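(* Let $k$ be an algebraically closed field and let $G$ be a finite group whose order is not divisible by the characteristic of $k$. Let $Q=(I,A)$ be a quiver with finite vertex set $I$ and set of arrows $A$. Suppose $G$ acts on the right on the path algebra $kQ$ by $k$-algebra automorphisms, permuting the set of primitive idempotents $\{e_i \mid i\in I\}$ and stabilizing the vector space spanned by the arrows. Let $Q_G$ be the quiver associated with this action (defined in the context) and let $(kQ)G$ be the skew group algebra. Then there is an equivalence of categories $$\operatorname{mod} k(Q_G)\;\simeq\;\operatorname{mod}\,(kQ)G .$$
   Context: Conventions. The right action of $G$ is written exponentially, $a\mapsto a^g$. For a $k$-algebra $\Lambda$ with a right action of $G$ by algebra automorphisms, the skew group algebra $\Lambda G$ is the vector space $\Lambda\otimes_k k[G]$ with multiplication determined by $(a\otimes g)(a'\otimes g')=a\,a'^{\,g^{-1}}\otimes gg'$ for $a,a'\in\Lambda$, $g,g'\in G$. Equivalently, it is generated by $\Lambda$ and $k[G]$ with relations $g^{-1}ag=a^g$. In a path algebra $kQ$, $e_i$ is the idempotent of the vertex $i$, and paths are composed so that an arrow from $i$ to $j$ lies in $e_j\,kQ\,e_i$. For an algebra $B$, $\operatorname{mod} B$ denotes the category of left $B$-modules. Representations of subgroups of $G$ are regarded as right modules over the group algebras. Definition of $Q_G$. The action of $G$ on $I$ is given by $e_i^g=e_{i^g}$. Let $\tilde I\subset I$ be a set of representatives of the $G$-orbits on $I$. For $i\in I$, let $G_i$ be the stabilizer of $e_i$ in $G$, let $i_\circ\in\tilde I$ be the representative of the orbit of $i$, and fix $\kappa_i\in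 G$ with $i_\circ^{\kappa_i}=i$. For $(i,j)\in\tilde I^2$, let $O_i,O_j$ be the orbits of $i$ and $j$, and let $F_{ij}$ be a set of representatives of the orbits of the diagonal action of $G$ on $O_i\times O_j$. For $i,j\in I$, let $M_{ij}\subset kQ$ be the vector space spanned by the arrows from $i$ to $j$, viewed as a right $k[G_i\cap G_j]$-module by restricting the action of $G$. For a finite group $H$, $\operatorname{irr}(H)$ is a set of representatives of the isomorphism classes of irreducible representations of $H$ over $k$. For $i\in\tilde I$, $i'\in O_i$ and a representation $\rho$ of $G_i$, let $\rho\cdot\kappa_{i'}$ be the representation of $G_{i'}=\kappa_{i'}^{-1}G_i\kappa_{i'}$ with the same underlying vector space as $\rho$ and $(\rho\cdot\kappa_{i'})_g=\rho_{\kappa_{i'}g\kappa_{i'}^{-1}}$ for $g\in G_{i'}$. The quiver $Q_G$ has vertex set $I_G=\bigcup_{i\in\tilde I}\{i\}\times\operatorname{irr}(G_i)$, and the set of arrows from $(i,\rho)$ to $(j,\sigma)$ is a basis of $$\bigoplus_{(i',j')\in F_{ij}}\operatorname{Hom}_{k[G_{i'}\cap G_{j'}]}\Big((\rho\cdot\kappa_{i'})|_{G_{i'}\cap G_{j'}},\ (\sigma\cdot\kappa_{j'})|_{G_{i'}\cap G_{j'}}\otimes_k M_{i'j'}\Big),$$ where $\otimes_k$ carries the diagonal group action. *)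

theory Defs
  imports
    "HOL-Algebra.Group_Action"
    "HOL-Computational_Algebra.Polynomial"
    "Graph_Theory.Arc_Walk"
    "Jordan_Normal_Form.VS_Connect"
begin

section \<open>Categories and equivalences\<close>

text \<open>
  Hom-sets are indexed by pairs of objects and need not be disjoint; for this reason
  composition and the action of functors on morphisms take the objects as arguments.
\<close>

record ('o, 'a) category =
  Ob :: "'o set"
  Hom :: "'o \<Rightarrow> 'o \<Rightarrow> 'a set"
  Ident :: "'o \<Rightarrow> 'a"
  Comp :: "'o \<Rightarrow> 'o \<Rightarrow> 'o \<Rightarrow> 'a \<Rightarrow> 'a \<Rightarrow> 'a"  \<comment> \<open>\<open>Comp C X Y Z g f\<close> is \<open>g \<circ> f\<close> for \<open>f : X \<rightarrow> Y\<close>, \<open>g : Y \<rightarrow> Z\<close>\<close>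

locale category =
  fixes C :: "('o, 'a, 'm) category_scheme"
  assumes Ident_in_Hom: "X \<in> Ob C \<Longrightarrow> Ident C X \<in> Hom C X X"
    and Comp_in_Hom: "\<lbrakk>X \<in> Ob C; Y \<in> Ob C; Z \<in> Ob C; f \<in> Hom C X Y; g \<in> Hom C Y Z\<rbrakk>
        \<Longrightarrow> Comp C X Y Z g f \<in> Hom C X Z"
    and Comp_Ident: "\<lbrakk>X \<in> Ob C; Y \<in> Ob C; f \<in> Hom C X Y\<rbrakk> \<Longrightarrow> Comp C X X Y f (Ident C X) = f"
    and Ident_Comp: "\<lbrakk>X \<in> Ob C; Y \<in> Ob C; f \<in> Hom C X Y\<rbrakk> \<Longrightarrow> Comp C X Y Y (Ident C Y) f = f"
    and Comp_assoc: "\<lbrakk>W \<in> Ob C; X \<in> Ob C; Y \<in> Ob C; Z \<in> Ob C;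
          f \<in> Hom C W X; g \<in> Hom C X Y; h \<in> Hom C Y Z\<rbrakk>
        \<Longrightarrow> Comp C W X Z (Comp C X Y Z h g) f = Comp C W Y Z h (Comp C W X Y g f)"

record ('o, 'a, 'p, 'b) cat_functor =
  on_ob :: "'o \<Rightarrow> 'p"
  on_hom :: "'o \<Rightarrow> 'o \<Rightarrow> 'a \<Rightarrow> 'b"

locale cat_functor =
  C: category C + D: category D
  for C :: "('o, 'a, 'm) category_scheme" and D :: "('p, 'b, 'n) category_scheme"
    and F :: "('o, 'a, 'p, 'b, 'l) cat_functor_scheme" +
  assumes ob: "X \<in> Ob C \<Longrightarrow> on_ob F X \<in> Ob D"
    and hom: "\<lbrakk>X \<in> Ob C; Y \<in> Ob C; f \<in> Hom C X Y\<rbrakk>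
        \<Longrightarrow> on_hom F X Y f \<in> Hom D (on_ob F X) (on_ob F Y)"
    and preserves_Ident: "X \<in> Ob C \<Longrightarrow> on_hom F X X (Ident C X) = Ident D (on_ob F X)"
    and preserves_Comp: "\<lbrakk>X \<in> Ob C; Y \<in> Ob C; Z \<in> Ob C; f \<in> Hom C X Y; g \<in> Hom C Y Z\<rbrakk>
        \<Longrightarrow> on_hom F X Z (Comp C X Y Z g f) =
            Comp D (on_ob F X) (on_ob F Y) (on_ob F Z) (on_hom F Y Z g) (on_hom F X Y f)"

definition id_functor :: "('o, 'a, 'o, 'a) cat_functor" where
  "id_functor = \<lparr>on_ob = (\<lambda>X. X), on_hom = (\<lambda>X Y f. f)\<rparr>"

definition comp_functor ::
  "('p, 'b, 'q, 'c) cat_functor \<Rightarrow> ('o, 'a, 'p, 'b) cat_functor \<Rightarrow> ('o, 'a, 'q, 'c) cat_functor" where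
  "comp_functor G F =
    \<lparr>on_ob = (\<lambda>X. on_ob G (on_ob F X)),
     on_hom = (\<lambda>X Y f. on_hom G (on_ob F X) (on_ob F Y) (on_hom F X Y f))\<rparr>"

definition iso_in :: "('o, 'a, 'm) category_scheme \<Rightarrow> 'o \<Rightarrow> 'o \<Rightarrow> 'a set" where
  "iso_in C X Y =
    {f \<in> Hom C X Y. \<exists>g \<in> Hom C Y X. Comp C X Y X g f = Ident C X \<and> Comp C Y X Y f g = Ident C Y}"

definition natural_isomorphism ::
  "('o, 'a, 'm) category_scheme \<Rightarrow> ('p, 'b, 'n) category_scheme \<Rightarrow>
   ('o, 'a, 'p, 'b) cat_functor \<Rightarrow> ('o, 'a, 'p, 'b) cat_functor \<Rightarrow> ('o \<Rightarrow> 'b) \<Rightarrow> bool" where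
  "natural_isomorphism C D F G \<eta> \<longleftrightarrow>
    cat_functor C D F \<and> cat_functor C D G \<and>
    (\<forall>X \<in> Ob C. \<eta> X \<in> iso_in D (on_ob F X) (on_ob G X)) \<and>
    (\<forall>X \<in> Ob C. \<forall>Y \<in> Ob C. \<forall>f \<in> Hom C X Y.
       Comp D (on_ob F X) (on_ob F Y) (on_ob G Y) (\<eta> Y) (on_hom F X Y f) =
       Comp D (on_ob F X) (on_ob G X) (on_ob G Y) (on_hom G X Y f) (\<eta> X))"

definition equivalent_categories ::
  "('o, 'a, 'm) category_scheme \<Rightarrow> ('p, 'b, 'n) category_scheme \<Rightarrow> bool" where
  "equivalent_categories C D \<longleftrightarrow>
    (\<exists>F G \<eta> \<epsilon>. cat_functor C D F \<and> cat_functor D C G \<and>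
       natural_isomorphism C C id_functor (comp_functor G F) \<eta> \<and>
       natural_isomorphism D D (comp_functor F G) id_functor \<epsilon>)"


section \<open>Left modules\<close>

text \<open>The library locale \<^locale>\<open>module\<close> requires the ring of scalars to be commutative.\<close>

locale left_module = R?: ring R + M?: abelian_group M
  for R :: "('a, 'n) ring_scheme" (structure) and M :: "('a, 'm, 'l) module_scheme" (structure) +
  assumes smult_closed: "\<lbrakk>a \<in> carrier R; x \<in> carrier M\<rbrakk> \<Longrightarrow> a \<odot>\<^bsub>M\<^esub> x \<in> carrier M"
    and smult_l_distr: "\<lbrakk>a \<in> carrier R; b \<in> carrier R; x \<in> carrier M\<rbrakk>
        \<Longrightarrow> (a \<oplus>\<^bsub>R\<^esub> b) \<odot>\<^bsub>M\<^esub> x = a \<odot>\<^bsub>M\<^esub> x \<oplus>\<^bsub>M\<^esub> b \<odot>\<^bsub>M\<^esub> x"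
    and smult_r_distr: "\<lbrakk>a \<in> carrier R; x \<in> carrier M; y \<in> carrier M\<rbrakk>
        \<Longrightarrow> a \<odot>\<^bsub>M\<^esub> (x \<oplus>\<^bsub>M\<^esub> y) = a \<odot>\<^bsub>M\<^esub> x \<oplus>\<^bsub>M\<^esub> a \<odot>\<^bsub>M\<^esub> y"
    and smult_assoc: "\<lbrakk>a \<in> carrier R; b \<in> carrier R; x \<in> carrier M\<rbrakk>
        \<Longrightarrow> (a \<otimes>\<^bsub>R\<^esub> b) \<odot>\<^bsub>M\<^esub> x = a \<odot>\<^bsub>M\<^esub> (b \<odot>\<^bsub>M\<^esub> x)"
    and smult_one: "x \<in> carrier M \<Longrightarrow> \<one>\<^bsub>R\<^esub> \<odot>\<^bsub>M\<^esub> x = x"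

text \<open>
  The objects are the left \<open>R\<close>-modules whose underlying set is contained in the type \<open>'m\<close>,
  which thus plays the role of the universe.  Morphisms are made extensional, so that they are
  determined by their values on the underlying set.
\<close>

definition module_category :: "('a, 'n) ring_scheme \<Rightarrow> (('a, 'm) module, 'm \<Rightarrow> 'm) category" where
  "module_category R =
    \<lparr>Ob = {M. left_module R M},
     Hom = (\<lambda>M N. module_hom R M N \<inter> extensional (carrier M)),
     Ident = (\<lambda>M. \<lambda>x \<in> carrier M. x),
     Comp = (\<lambda>L M N g f. compose (carrier L) g f)\<rparr>"

lemma category_module_category: "category (module_category R)"
  by unfold_locales
    (auto simp: module_category_def module_hom_def compose_def Pi_def extensional_def fun_eq_iff
        restrict_def left_module.axioms abelian_group.axioms abelian_monoid.a_closed
        left_module.smult_closed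
        intro!: abelian_monoid.a_closed)


section \<open>Path algebras\<close>

text \<open>
  A path is recorded as the triple of its source, the list of its arrows in the order in
  which they are traversed, and its target.
\<close>

type_synonym ('v, 'e) path = "'v \<times> 'e list \<times> 'v"

definition paths :: "('v, 'e) pre_digraph \<Rightarrow> ('v, 'e) path set" where
  "paths Q = {(u, p, v). pre_digraph.awalk Q u p v}"

definition unit_fun :: "'x \<Rightarrow> 'x \<Rightarrow> 'k::zero_neq_one" where
  "unit_fun x = (\<lambda>y. if y = x then 1 else 0)"

text \<open>
  The product of a path from \<open>v\<close> to \<open>w\<close> with a path from \<open>u\<close> to \<open>v\<close>, in this order, is the
  concatenated path from \<open>u\<close> to \<open>w\<close>.
\<close>

definition path_algebra ::
  "('v, 'e) pre_digraph \<Rightarrow> ('k::field, ('v, 'e) path \<Rightarrow> 'k) module" where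
  "path_algebra Q =
    \<lparr>carrier = {f. finite {x. f x \<noteq> 0} \<and> {x. f x \<noteq> 0} \<subseteq> paths Q},
     monoid.mult = (\<lambda>f g (u, r, w).
        \<Sum>(p, v, q) \<in> {(p, v, q). (u, p, v) \<in> paths Q \<and> (v, q, w) \<in> paths Q \<and> p @ q = r}.
          f (v, q, w) * g (u, p, v)),
     one = (\<lambda>(u, p, v). if u \<in> verts Q \<and> p = [] \<and> v = u then 1 else 0),
     zero = (\<lambda>_. 0),
     add = (\<lambda>f g x. f x + g x),
     smult = (\<lambda>c f x. c * f x)\<rparr>"

definition vertex_idem :: "'v \<Rightarrow> ('v, 'e) path \<Rightarrow> 'k::field" where
  "vertex_idem i = unit_fun (i, [], i)"

definition arrow_elt :: "('v, 'e) pre_digraph \<Rightarrow> 'e \<Rightarrow> ('v, 'e) path \<Rightarrow> 'k::field" where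
  "arrow_elt Q a = unit_fun (tail Q a, [a], head Q a)"

definition arrow_span :: "('v, 'e) pre_digraph \<Rightarrow> 'e set \<Rightarrow> (('v, 'e) path \<Rightarrow> 'k::field) set" where
  "arrow_span Q A = LinearCombinations.module.span class_ring (path_algebra Q) (arrow_elt Q ` A)"


lemma cring_class_ring: "cring (class_ring :: 'k::field ring)"
  by unfold_locales
lemma field_class_ring: "field (class_ring :: 'k::field ring)"
  by unfold_locales

lemma vectorspace_path_algebra:
  "vectorspace class_ring (path_algebra Q :: ('k::field, ('v, 'e) path \<Rightarrow> 'k) module)"
proof -
  let ?P = "path_algebra Q :: ('k, ('v, 'e) path \<Rightarrow> 'k) module"
  have add: "(\<lambda>x. f x + g x) \<in> carrier ?P" if "f \<in> carrier ?P" "g \<in> carrier ?P" for f g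
  proof -
    have "{x. f x + g x \<noteq> 0} \<subseteq> {x. f x \<noteq> 0} \<union> {x. g x \<noteq> 0}" by auto
    with that show ?thesis
      by (auto simp: path_algebra_def intro: finite_subset)
  qed
  have scal: "(\<lambda>x. c * f x) \<in> carrier ?P" if "f \<in> carrier ?P" for c f
  proof -
    have "{x. c * f x \<noteq> 0} \<subseteq> {x. f x \<noteq> 0}" by auto
    with that show ?thesis
      by (auto simp: path_algebra_def intro: finite_subset)
  qed
  have ag: "abelian_group ?P"
  proof (rule abelian_groupI)
    fix x assume "x \<in> carrier ?P"
    with scal[of x "-1"] show "\<exists>y\<in>carrier ?P. y \<oplus>\<^bsub>?P\<^esub> x = \<zero>\<^bsub>?P\<^esub>"
      by (intro bexI[of _ "\<lambda>z. -1 * x z"]) (auto simp: path_algebra_def)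
  qed (use add in \<open>auto simp: path_algebra_def algebra_simps\<close>)
  have "module class_ring ?P"
    by (rule moduleI)
      (use ag scal cring_class_ring in \<open>auto simp: path_algebra_def algebra_simps\<close>)
  with field_class_ring show ?thesis by (simp add: vectorspace_def)
qed

lemma arrow_span_eq:
  fixes Q :: "('v, 'e) pre_digraph"
  assumes "wf_digraph Q" "A \<subseteq> arcs Q"
  shows "(arrow_span Q A :: (('v, 'e) path \<Rightarrow> 'k::field) set) =
    {f. finite {x. f x \<noteq> 0} \<and> {x. f x \<noteq> 0} \<subseteq> (\<lambda>a. (tail Q a, [a], head Q a)) ` A}"
    (is "_ = ?S")
proof -
  let ?P = "path_algebra Q :: ('k, ('v, 'e) path \<Rightarrow> 'k) module"
  interpret wf_digraph Q by fact
  interpret P: vectorspace "class_ring :: 'k ring" ?P by (rule vectorspace_path_algebra)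
  have paths: "(\<lambda>a. (tail Q a, [a], head Q a)) ` A \<subseteq> paths Q"
    using assms by (auto simp: paths_def arc_implies_awalk)
  have elts: "arrow_elt Q ` A \<subseteq> ?S" by (auto simp: arrow_elt_def unit_fun_def split: if_splits)
  have SP: "?S \<subseteq> carrier ?P" using paths by (auto simp: path_algebra_def)
  have "f \<oplus>\<^bsub>?P\<^esub> g \<in> ?S" if "f \<in> ?S" "g \<in> ?S" for f g
  proof -
    have "{x. f x + g x \<noteq> 0} \<subseteq> {x. f x \<noteq> 0} \<union> {x. g x \<noteq> 0}" by auto
    with that show ?thesis
      by (auto simp: path_algebra_def intro: finite_subset)
  qed
  moreover have "c \<odot>\<^bsub>?P\<^esub> f \<in> ?S" if "f \<in> ?S" for c f
  proof -
    have "{x. c * f x \<noteq> 0} \<subseteq> {x. f x \<noteq> 0}" by auto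
    with that show ?thesis
      by (auto simp: path_algebra_def intro: finite_subset)
  qed
  ultimately have "submodule class_ring ?S ?P"
    using SP P.module_axioms by (auto simp: submodule_def path_algebra_def)
  then have 1: "arrow_span Q A \<subseteq> ?S"
    unfolding arrow_span_def using elts by (rule P.span_is_subset[rotated])
  have sm: "submodule class_ring (arrow_span Q A) ?P"
    unfolding arrow_span_def using elts SP by (intro P.span_is_submodule) auto
  have own: "arrow_elt Q ` A \<subseteq> (arrow_span Q A :: (('v, 'e) path \<Rightarrow> 'k) set)"
    unfolding arrow_span_def using P.in_own_span[OF subset_trans[OF elts SP]] by simp
  have "f \<in> arrow_span Q A" if "finite T" "f \<in> ?S" "{x. f x \<noteq> 0} \<subseteq> T" for f :: "('v, 'e) path \<Rightarrow> 'k" and T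
    using that
  proof (induction T arbitrary: f rule: finite_induct)
    case empty
    then have "f = \<zero>\<^bsub>?P\<^esub>" by (auto simp: path_algebra_def)
    then show ?case using submodule.zero_closed[OF sm] by simp
  next
    case (insert y T)
    let ?g = "f(y := 0)"
    have g: "?g \<in> arrow_span Q A"
    proof (rule insert.IH)
      have "{x. ?g x \<noteq> 0} \<subseteq> {x. f x \<noteq> 0}" by auto
      then show "?g \<in> ?S" using insert.prems(1) by (auto intro: finite_subset)
    qed (use insert.prems(2) in auto)
    show ?case
    proof (cases "f y = 0")
      case True
      then have "?g = f" by auto
      with g show ?thesis by simp
    next
      case False
      then obtain a where a: "a \<in> A" "y = (tail Q a, [a], head Q a)"
        using insert.prems(1) by auto
      then have "arrow_elt Q a \<in> (arrow_span Q A :: (('v, 'e) path \<Rightarrow> 'k) set)"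
        using own by auto
      then have "?g \<oplus>\<^bsub>?P\<^esub> (f y \<odot>\<^bsub>?P\<^esub> arrow_elt Q a) \<in> arrow_span Q A"
        using g sm by (auto intro!: submodule.m_closed submodule.smult_closed)
      moreover have "?g \<oplus>\<^bsub>?P\<^esub> (f y \<odot>\<^bsub>?P\<^esub> arrow_elt Q a) = f"
        using a by (auto simp: path_algebra_def arrow_elt_def unit_fun_def)
      ultimately show ?thesis by simp
    qed
  qed
  with 1 show ?thesis by blast
qed


section \<open>Right actions and skew group algebras\<close>

text \<open>
  An action is given by a function \<open>\<phi>\<close> such that \<open>\<phi> g x\<close> is \<open>x\<^sup>g\<close>.  It is a right action, so
  \<open>\<phi> (g \<otimes> h)\<close> is \<open>\<phi> g\<close> followed by \<open>\<phi> h\<close>.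
\<close>

locale right_algebra_action = group G
  for G :: "('g, 'n) monoid_scheme" (structure)
    and \<Lambda> :: "('k::field, 'x, 'l) module_scheme"
    and \<phi> :: "'g \<Rightarrow> 'x \<Rightarrow> 'x" +
  assumes automorphism: "g \<in> carrier G \<Longrightarrow>
      \<phi> g \<in> Ring.ring_hom \<Lambda> \<Lambda> \<inter> module_hom class_ring \<Lambda> \<Lambda> \<and> bij_betw (\<phi> g) (carrier \<Lambda>) (carrier \<Lambda>)"
    and act_one: "x \<in> carrier \<Lambda> \<Longrightarrow> \<phi> \<one> x = x"
    and act_mult: "\<lbrakk>g \<in> carrier G; h \<in> carrier G; x \<in> carrier \<Lambda>\<rbrakk> \<Longrightarrow> \<phi> (g \<otimes> h) x = \<phi> h (\<phi> g x)"

text \<open>For a finite group \<open>G\<close>, the element \<open>\<Sum>\<^sub>g a\<^sub>g \<otimes> g\<close> of \<open>\<Lambda> \<otimes> k[G]\<close> is recorded as \<open>g \<mapsto> a\<^sub>g\<close>.\<close>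

definition skew_group_algebra ::
  "('g, 'n) monoid_scheme \<Rightarrow> ('k, 'x, 'l) module_scheme \<Rightarrow> ('g \<Rightarrow> 'x \<Rightarrow> 'x)
    \<Rightarrow> ('k, 'g \<Rightarrow> 'x) module" where
  "skew_group_algebra G \<Lambda> \<phi> =
    \<lparr>carrier = {x. (\<forall>g \<in> carrier G. x g \<in> carrier \<Lambda>) \<and> (\<forall>g. g \<notin> carrier G \<longrightarrow> x g = \<zero>\<^bsub>\<Lambda>\<^esub>)},
     monoid.mult = (\<lambda>x y h.
        \<Oplus>\<^bsub>\<Lambda>\<^esub>p \<in> {p \<in> carrier G \<times> carrier G. fst p \<otimes>\<^bsub>G\<^esub> snd p = h}.
          x (fst p) \<otimes>\<^bsub>\<Lambda>\<^esub> \<phi> (inv\<^bsub>G\<^esub> (fst p)) (y (snd p))),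
     one = (\<lambda>g. if g = \<one>\<^bsub>G\<^esub> then \<one>\<^bsub>\<Lambda>\<^esub> else \<zero>\<^bsub>\<Lambda>\<^esub>),
     zero = (\<lambda>_. \<zero>\<^bsub>\<Lambda>\<^esub>),
     add = (\<lambda>x y g. x g \<oplus>\<^bsub>\<Lambda>\<^esub> y g),
     smult = (\<lambda>c x g. c \<odot>\<^bsub>\<Lambda>\<^esub> x g)\<rparr>"

definition orbit_representatives ::
  "('g, 'n) monoid_scheme \<Rightarrow> ('g \<Rightarrow> 'x \<Rightarrow> 'x) \<Rightarrow> 'x set \<Rightarrow> 'x set \<Rightarrow> bool" where
  "orbit_representatives G \<phi> X R \<longleftrightarrow> R \<subseteq> X \<and> (\<forall>x \<in> X. \<exists>!r. r \<in> R \<and> r \<in> orbit G \<phi> x)"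


section \<open>Representations as right modules\<close>

record ('g, 'k, 'r) rep = "('k, 'r) module" +
  act :: "'g \<Rightarrow> 'r \<Rightarrow> 'r"

locale representation = vectorspace class_ring V + group H
  for H :: "('g, 'n) monoid_scheme" and V :: "('g, 'k::field, 'r, 'l) rep_scheme" +
  assumes act_linear: "g \<in> carrier H \<Longrightarrow> act V g \<in> module_hom class_ring V V"
    and act_one: "v \<in> carrier V \<Longrightarrow> act V \<one>\<^bsub>H\<^esub> v = v"
    and act_mult: "\<lbrakk>g \<in> carrier H; h \<in> carrier H; v \<in> carrier V\<rbrakk>
        \<Longrightarrow> act V (g \<otimes>\<^bsub>H\<^esub> h) v = act V h (act V g v)"

definition irreducible_rep ::
  "('g, 'n) monoid_scheme \<Rightarrow> ('g, 'k::field, 'r) rep \<Rightarrow> bool" where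
  "irreducible_rep H V \<longleftrightarrow> representation H V \<and> carrier V \<noteq> {\<zero>\<^bsub>V\<^esub>} \<and>
    (\<forall>W. subspace class_ring W V \<and> (\<forall>g \<in> carrier H. act V g ` W \<subseteq> W)
       \<longrightarrow> W = {\<zero>\<^bsub>V\<^esub>} \<or> W = carrier V)"

definition rep_hom ::
  "('g, 'n) monoid_scheme \<Rightarrow> ('g, 'k::field, 'r) rep \<Rightarrow> ('g, 'k, 's) rep \<Rightarrow> ('r \<Rightarrow> 's) set" where
  "rep_hom H V W =
    {f \<in> module_hom class_ring V W \<inter> extensional (carrier V).
       \<forall>g \<in> carrier H. \<forall>v \<in> carrier V. f (act V g v) = act W g (f v)}"

definition rep_isomorphic ::
  "('g, 'n) monoid_scheme \<Rightarrow> ('g, 'k::field, 'r) rep \<Rightarrow> ('g, 'k, 's) rep \<Rightarrow> bool" where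
  "rep_isomorphic H V W \<longleftrightarrow> (\<exists>f \<in> rep_hom H V W. bij_betw f (carrier V) (carrier W))"

text \<open>
  An irreducible representation of a finite group \<open>H\<close> is spanned by the orbit of any nonzero
  vector, so its dimension is at most the order of \<open>H\<close>, and it is isomorphic to one whose
  underlying set is contained in the type \<open>'g \<Rightarrow> 'k\<close>.  Hence it suffices to require that \<open>S\<close>
  contains an isomorphic copy of each irreducible representation of this kind; the elements
  of \<open>S\<close> themselves may live on any type \<open>'r\<close>.
\<close>

definition irr_representatives ::
  "('g, 'n) monoid_scheme \<Rightarrow> ('g, 'k::field, 'r) rep set \<Rightarrow> bool" where
  "irr_representatives H S \<longleftrightarrow>
    (\<forall>\<rho> \<in> S. irreducible_rep H \<rho>) \<and>
    (\<forall>\<rho> \<in> S. \<forall>\<sigma> \<in> S. rep_isomorphic H \<rho> \<sigma> \<longrightarrow> \<rho> = \<sigma>) \<and>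
    (\<forall>\<tau> :: ('g, 'k, 'g \<Rightarrow> 'k) rep. irreducible_rep H \<tau> \<longrightarrow> (\<exists>\<rho> \<in> S. rep_isomorphic H \<tau> \<rho>))"

definition twist ::
  "('g, 'n) monoid_scheme \<Rightarrow> ('g, 'k, 'r) rep \<Rightarrow> 'g \<Rightarrow> ('g, 'k, 'r) rep" where
  "twist G \<rho> \<kappa> = \<rho>\<lparr>act := (\<lambda>g. act \<rho> (\<kappa> \<otimes>\<^bsub>G\<^esub> g \<otimes>\<^bsub>G\<^esub> inv\<^bsub>G\<^esub> \<kappa>))\<rparr>"

text \<open>The multiplication and the unit in the following records carry no information.\<close>

definition hom_space ::
  "('g, 'n) monoid_scheme \<Rightarrow> ('g, 'k::field, 'r) rep \<Rightarrow> ('g, 'k, 's) rep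
    \<Rightarrow> ('k, 'r \<Rightarrow> 's) module" where
  "hom_space H V W =
    \<lparr>carrier = rep_hom H V W,
     monoid.mult = (\<lambda>f g. \<lambda>v \<in> carrier V. \<zero>\<^bsub>W\<^esub>),
     one = (\<lambda>v \<in> carrier V. \<zero>\<^bsub>W\<^esub>),
     zero = (\<lambda>v \<in> carrier V. \<zero>\<^bsub>W\<^esub>),
     add = (\<lambda>f g. \<lambda>v \<in> carrier V. f v \<oplus>\<^bsub>W\<^esub> g v),
     smult = (\<lambda>c f. \<lambda>v \<in> carrier V. c \<odot>\<^bsub>W\<^esub> f v)\<rparr>"

definition direct_sum_family :: "'p set \<Rightarrow> ('p \<Rightarrow> ('k, 'x) module) \<Rightarrow> ('k, 'p \<Rightarrow> 'x) module" where
  "direct_sum_family P V =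
    \<lparr>carrier = {x \<in> \<Pi>\<^sub>E p \<in> P. carrier (V p). finite {p \<in> P. x p \<noteq> \<zero>\<^bsub>V p\<^esub>}},
     monoid.mult = (\<lambda>x y. \<lambda>p \<in> P. \<zero>\<^bsub>V p\<^esub>),
     one = (\<lambda>p \<in> P. \<zero>\<^bsub>V p\<^esub>),
     zero = (\<lambda>p \<in> P. \<zero>\<^bsub>V p\<^esub>),
     add = (\<lambda>x y. \<lambda>p \<in> P. x p \<oplus>\<^bsub>V p\<^esub> y p),
     smult = (\<lambda>c x. \<lambda>p \<in> P. c \<odot>\<^bsub>V p\<^esub> x p)\<rparr>"

text \<open>
  The tensor product of \<open>V\<close> with the space \<open>W\<close> of all finitely supported functions from a set
  \<open>B\<close> to the field is the space of finitely supported functions from \<open>B\<close> to \<open>V\<close>, where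
  \<open>v \<otimes> w\<close> is the function \<open>b \<mapsto> w b \<odot> v\<close>.  Every element \<open>t\<close> is
  \<open>\<Sum>\<^sub>b t b \<otimes> unit_fun b\<close>, which gives the formula for the diagonal action.
  The universal property and the action on pure tensors are proved below.
\<close>

definition tensor_rep ::
  "('g, 'k::field, 'r) rep \<Rightarrow> ('g, 'k, 'b \<Rightarrow> 'k) rep \<Rightarrow> ('g, 'k, 'b \<Rightarrow> 'r) rep" where
  "tensor_rep V W =
    \<lparr>carrier = {t. (\<forall>b. t b \<in> carrier V) \<and> finite {b. t b \<noteq> \<zero>\<^bsub>V\<^esub>} \<and>
                  (\<forall>b. t b \<noteq> \<zero>\<^bsub>V\<^esub> \<longrightarrow> unit_fun b \<in> carrier W)},
     monoid.mult = (\<lambda>s t b. \<zero>\<^bsub>V\<^esub>),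
     one = (\<lambda>b. \<zero>\<^bsub>V\<^esub>),
     zero = (\<lambda>b. \<zero>\<^bsub>V\<^esub>),
     add = (\<lambda>s t b. s b \<oplus>\<^bsub>V\<^esub> t b),
     smult = (\<lambda>c t b. c \<odot>\<^bsub>V\<^esub> t b),
     act = (\<lambda>g t c. \<Oplus>\<^bsub>V\<^esub>b \<in> {b. t b \<noteq> \<zero>\<^bsub>V\<^esub>}. act W g (unit_fun b) c \<odot>\<^bsub>V\<^esub> act V g (t b))\<rparr>"

definition pure_tensor ::
  "('g, 'k, 'r) rep \<Rightarrow> 'r \<Rightarrow> ('b \<Rightarrow> 'k) \<Rightarrow> 'b \<Rightarrow> 'r" where
  "pure_tensor V v w = (\<lambda>b. w b \<odot>\<^bsub>V\<^esub> v)"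


locale tensor_product_model =
  V: vectorspace class_ring V + U: vectorspace class_ring U
  for V :: "('g, 'k::field, 'r) rep" and U :: "('k, 'u) module" +
  fixes W :: "('g, 'k, 'b \<Rightarrow> 'k) rep" and B :: "'b set"
  assumes carrier_W: "carrier W = {w. finite {b. w b \<noteq> 0} \<and> {b. w b \<noteq> 0} \<subseteq> B}"
    and add_W: "add W = (\<lambda>v w b. v b + w b)"
    and smult_W: "smult W = (\<lambda>c w b. c * w b)"
begin

lemma carrier_tensor:
  "carrier (tensor_rep V W) =
    {t. (\<forall>b. t b \<in> carrier V) \<and> finite {b. t b \<noteq> \<zero>\<^bsub>V\<^esub>} \<and> {b. t b \<noteq> \<zero>\<^bsub>V\<^esub>} \<subseteq> B}"
  by (auto simp: tensor_rep_def carrier_W unit_fun_def)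

lemma pure_tensor_closed:
  assumes "v \<in> carrier V" "w \<in> carrier W"
  shows "pure_tensor V v w \<in> carrier (tensor_rep V W)"
proof -
  have "{b. w b \<odot>\<^bsub>V\<^esub> v \<noteq> \<zero>\<^bsub>V\<^esub>} \<subseteq> {b. w b \<noteq> 0}"
    using assms V.smult_l_null[of v] by auto
  with assms show ?thesis
    by (auto simp: carrier_tensor pure_tensor_def carrier_W intro: finite_subset)
qed

lemma hom_expand:
  assumes h: "h \<in> module_hom class_ring W U" and "finite T" "w \<in> carrier W" "{b. w b \<noteq> 0} \<subseteq> T" "T \<subseteq> B"
  shows "h w = (\<Oplus>\<^bsub>U\<^esub>b \<in> T. w b \<odot>\<^bsub>U\<^esub> h (unit_fun b))"
  using assms(2-)
proof (induction T arbitrary: w rule: finite_induct)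
  case empty
  then have w: "w = (\<lambda>b. 0)" by auto
  have "h (0 \<odot>\<^bsub>W\<^esub> w) = 0 \<odot>\<^bsub>U\<^esub> h w" by (rule module_hom_smult[OF h _ empty.prems(1)]) simp
  moreover have "0 \<odot>\<^bsub>W\<^esub> w = w" using w by (auto simp: smult_W)
  moreover have "h w \<in> carrier U" using h empty.prems(1) by (auto simp: module_hom_def)
  ultimately show ?case using U.smult_l_null by simp
next
  case (insert y T)
  let ?g = "w(y := 0)"
  have s: "unit_fun b \<in> carrier W" if "b \<in> B" for b
    using that by (auto simp: carrier_W unit_fun_def)
  have hs: "h (unit_fun b) \<in> carrier U" if "b \<in> B" for b
    using s[OF that] h by (auto simp: module_hom_def)
  have "{b. ?g b \<noteq> 0} \<subseteq> {b. w b \<noteq> 0}" by auto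
  then have g: "?g \<in> carrier W"
    using insert.prems(1) by (auto simp: carrier_W intro: finite_subset)
  have "h ?g = (\<Oplus>\<^bsub>U\<^esub>b \<in> T. ?g b \<odot>\<^bsub>U\<^esub> h (unit_fun b))"
    using insert.prems by (intro insert.IH g) auto
  also have "\<dots> = (\<Oplus>\<^bsub>U\<^esub>b \<in> T. w b \<odot>\<^bsub>U\<^esub> h (unit_fun b))"
    using insert.hyps insert.prems hs by (intro U.finsum_cong') auto
  finally have hg: "h ?g = (\<Oplus>\<^bsub>U\<^esub>b \<in> T. w b \<odot>\<^bsub>U\<^esub> h (unit_fun b))" .
  have sy: "w y \<odot>\<^bsub>W\<^esub> unit_fun y \<in> carrier W"
    using insert.prems by (auto simp: carrier_W smult_W unit_fun_def)
  have "w = (w y \<odot>\<^bsub>W\<^esub> unit_fun y) \<oplus>\<^bsub>W\<^esub> ?g"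
    by (auto simp: add_W smult_W unit_fun_def)
  then have "h w = h (w y \<odot>\<^bsub>W\<^esub> unit_fun y) \<oplus>\<^bsub>U\<^esub> h ?g"
    using h sy g module_hom_add by metis
  also have "h (w y \<odot>\<^bsub>W\<^esub> unit_fun y) = w y \<odot>\<^bsub>U\<^esub> h (unit_fun y)"
    using h s insert.prems by (auto simp: module_hom_def)
  finally show ?case
    unfolding hg using insert.hyps insert.prems hs by (subst U.finsum_insert) auto
qed

lemma tensor_hom_eqI:
  assumes f: "f \<in> module_hom class_ring (tensor_rep V W) U" and g: "g \<in> module_hom class_ring (tensor_rep V W) U"
    and eq: "\<And>v w. v \<in> carrier V \<Longrightarrow> w \<in> carrier W \<Longrightarrow> f (pure_tensor V v w) = g (pure_tensor V v w)"
    and "t \<in> carrier (tensor_rep V W)"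
  shows "f t = g t"
proof -
  have "f t = g t" if "finite T" "{b. t b \<noteq> \<zero>\<^bsub>V\<^esub>} \<subseteq> T" "T \<subseteq> B" "t \<in> carrier (tensor_rep V W)" for T t
    using that
  proof (induction T arbitrary: t rule: finite_induct)
    case empty
    then have "t = pure_tensor V \<zero>\<^bsub>V\<^esub> (\<lambda>_. 0)" by (auto simp: pure_tensor_def)
    then show ?case by (auto simp: carrier_W intro!: eq)
  next
    case (insert y T)
    let ?t = "t(y := \<zero>\<^bsub>V\<^esub>)"
    have ty: "t y \<in> carrier V" using insert.prems by (auto simp: carrier_tensor)
    have sy: "unit_fun y \<in> carrier W" using insert.prems by (auto simp: carrier_W unit_fun_def)
    have "finite {b. ?t b \<noteq> \<zero>\<^bsub>V\<^esub>}"
      using insert.prems by (auto simp: carrier_tensor intro: finite_subset[of _ "{b. t b \<noteq> \<zero>\<^bsub>V\<^esub>}"])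
    then have t: "?t \<in> carrier (tensor_rep V W)"
      using insert.prems by (auto simp: carrier_tensor)
    moreover have "{b. ?t b \<noteq> \<zero>\<^bsub>V\<^esub>} \<subseteq> T" using insert.prems by auto
    ultimately have "f ?t = g ?t" using insert.prems insert.IH[of ?t] by blast
    moreover have "t = ?t \<oplus>\<^bsub>tensor_rep V W\<^esub> pure_tensor V (t y) (unit_fun y)"
      using insert.prems ty by (auto simp: tensor_rep_def pure_tensor_def unit_fun_def fun_eq_iff
          V.smult_l_null[simplified] V.smult_one[simplified])
    ultimately show ?case
      using module_hom_add[OF f t pure_tensor_closed[OF ty sy]]
        module_hom_add[OF g t pure_tensor_closed[OF ty sy]] eq[OF ty sy] by simp
  qed
  from this[of "{b. t b \<noteq> \<zero>\<^bsub>V\<^esub>}"] show ?thesis using assms(4) by (auto simp: carrier_tensor)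
qed

theorem tensor_universal:
  assumes \<beta>1: "\<And>v. v \<in> carrier V \<Longrightarrow> \<beta> v \<in> module_hom class_ring W U"
    and \<beta>2: "\<And>w. w \<in> carrier W \<Longrightarrow> (\<lambda>v. \<beta> v w) \<in> module_hom class_ring V U"
  shows "\<exists>!f. f \<in> module_hom class_ring (tensor_rep V W) U \<inter> extensional (carrier (tensor_rep V W)) \<and>
    (\<forall>v \<in> carrier V. \<forall>w \<in> carrier W. f (pure_tensor V v w) = \<beta> v w)"
proof (rule ex_ex1I)
  let ?T = "tensor_rep V W"
  define f where "f = (\<lambda>t \<in> carrier ?T. \<Oplus>\<^bsub>U\<^esub>b \<in> {b. t b \<noteq> \<zero>\<^bsub>V\<^esub>}. \<beta> (t b) (unit_fun b))"
  have s: "unit_fun b \<in> carrier W" if "b \<in> B" for b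
    using that by (auto simp: carrier_W unit_fun_def)
  have \<beta>c: "\<beta> v w \<in> carrier U" if "v \<in> carrier V" "w \<in> carrier W" for v w
    using \<beta>1[OF that(1)] that(2) by (auto simp: module_hom_def)
  have \<beta>0: "\<beta> \<zero>\<^bsub>V\<^esub> w = \<zero>\<^bsub>U\<^esub>" if "w \<in> carrier W" for w
  proof -
    have "\<beta> (0 \<odot>\<^bsub>V\<^esub> \<zero>\<^bsub>V\<^esub>) w = 0 \<odot>\<^bsub>U\<^esub> \<beta> \<zero>\<^bsub>V\<^esub> w"
      by (rule module_hom_smult[OF \<beta>2[OF that]]) auto
    then show ?thesis using V.smult_l_null[of "\<zero>\<^bsub>V\<^esub>"] U.smult_l_null[OF \<beta>c[OF _ that]] by simp
  qed
  have f_eq: "f t = (\<Oplus>\<^bsub>U\<^esub>b \<in> S. \<beta> (t b) (unit_fun b))"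
    if "t \<in> carrier ?T" "finite S" "{b. t b \<noteq> \<zero>\<^bsub>V\<^esub>} \<subseteq> S" "S \<subseteq> B" for t S
    unfolding f_def using that s
    by (auto intro!: U.add.finprod_mono_neutral_cong_left \<beta>0 \<beta>c simp: carrier_tensor subset_iff)
  have "f \<in> module_hom class_ring ?T U"
    unfolding module_hom_def mem_Collect_eq
  proof (intro conjI allI impI)
    show "f \<in> carrier ?T \<rightarrow> carrier U"
      using s by (auto simp: f_def carrier_tensor intro!: U.finsum_closed \<beta>c)
  next
    fix m1 m2 assume m: "m1 \<in> carrier ?T \<and> m2 \<in> carrier ?T"
    let ?S = "{b. m1 b \<noteq> \<zero>\<^bsub>V\<^esub>} \<union> {b. m2 b \<noteq> \<zero>\<^bsub>V\<^esub>}"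
    have S: "finite ?S" "?S \<subseteq> B" using m by (auto simp: carrier_tensor)
    have sub: "{b. (m1 \<oplus>\<^bsub>?T\<^esub> m2) b \<noteq> \<zero>\<^bsub>V\<^esub>} \<subseteq> ?S" by (auto simp: tensor_rep_def)
    have mm: "m1 \<oplus>\<^bsub>?T\<^esub> m2 \<in> carrier ?T"
      using m S finite_subset[OF sub] sub by (auto simp: carrier_tensor) (auto simp: tensor_rep_def)
    have "f (m1 \<oplus>\<^bsub>?T\<^esub> m2) = (\<Oplus>\<^bsub>U\<^esub>b \<in> ?S. \<beta> (m1 b \<oplus>\<^bsub>V\<^esub> m2 b) (unit_fun b))"
      using f_eq[OF mm S(1) sub S(2)] by (simp add: tensor_rep_def)
    also have "\<dots> = (\<Oplus>\<^bsub>U\<^esub>b \<in> ?S. \<beta> (m1 b) (unit_fun b) \<oplus>\<^bsub>U\<^esub> \<beta> (m2 b) (unit_fun b))"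
      using S m s \<beta>2[OF s] by (intro U.finsum_cong') (auto intro!: \<beta>c U.a_closed simp: carrier_tensor module_hom_def)
    also have "\<dots> = f m1 \<oplus>\<^bsub>U\<^esub> f m2"
      using S m s by (subst (1 2) f_eq[of _ ?S]) (auto intro!: \<beta>c U.finsum_addf simp: carrier_tensor)
    finally show "f (m1 \<oplus>\<^bsub>?T\<^esub> m2) = f m1 \<oplus>\<^bsub>U\<^esub> f m2" .
  next
    fix r :: 'k and m assume "r \<in> carrier class_ring \<and> m \<in> carrier ?T"
    then have m: "m \<in> carrier ?T" by simp
    let ?S = "{b. m b \<noteq> \<zero>\<^bsub>V\<^esub>}"
    have S: "finite ?S" "?S \<subseteq> B" using m by (auto simp: carrier_tensor)
    have sub: "{b. (r \<odot>\<^bsub>?T\<^esub> m) b \<noteq> \<zero>\<^bsub>V\<^esub>} \<subseteq> ?S"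
      using V.smult_r_null[of r] by (auto simp: tensor_rep_def)
    have mm: "r \<odot>\<^bsub>?T\<^esub> m \<in> carrier ?T"
      using m S finite_subset[OF sub] sub by (auto simp: carrier_tensor) (auto simp: tensor_rep_def)
    have "f (r \<odot>\<^bsub>?T\<^esub> m) = (\<Oplus>\<^bsub>U\<^esub>b \<in> ?S. \<beta> (r \<odot>\<^bsub>V\<^esub> m b) (unit_fun b))"
      using f_eq[OF mm S(1) sub S(2)] by (simp add: tensor_rep_def)
    also have "\<dots> = (\<Oplus>\<^bsub>U\<^esub>b \<in> ?S. r \<odot>\<^bsub>U\<^esub> \<beta> (m b) (unit_fun b))"
      using S m s \<beta>2[OF s] by (intro U.finsum_cong') (auto intro!: \<beta>c U.smult_closed[simplified] simp: carrier_tensor module_hom_def)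
    also have "\<dots> = r \<odot>\<^bsub>U\<^esub> f m"
      using S m s by (subst f_eq[of _ ?S]) (auto intro!: \<beta>c U.finsum_smult[symmetric] simp: carrier_tensor)
    finally show "f (r \<odot>\<^bsub>?T\<^esub> m) = r \<odot>\<^bsub>U\<^esub> f m" .
  qed
  moreover have "f (pure_tensor V v w) = \<beta> v w" if v: "v \<in> carrier V" and w: "w \<in> carrier W" for v w
  proof -
    let ?S = "{b. w b \<noteq> 0}"
    have S: "finite ?S" "?S \<subseteq> B" using w by (auto simp: carrier_W)
    have sub: "{b. pure_tensor V v w b \<noteq> \<zero>\<^bsub>V\<^esub>} \<subseteq> ?S"
      using V.smult_l_null[OF v] by (auto simp: pure_tensor_def)
    have "f (pure_tensor V v w) = (\<Oplus>\<^bsub>U\<^esub>b \<in> ?S. \<beta> (w b \<odot>\<^bsub>V\<^esub> v) (unit_fun b))"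
      using f_eq[OF pure_tensor_closed[OF v w] S(1) sub S(2)] by (simp add: pure_tensor_def)
    also have "\<dots> = (\<Oplus>\<^bsub>U\<^esub>b \<in> ?S. w b \<odot>\<^bsub>U\<^esub> \<beta> v (unit_fun b))"
      using S v s \<beta>2[OF s] by (intro U.finsum_cong') (auto intro!: U.smult_closed[simplified] \<beta>c simp: module_hom_def)
    also have "\<dots> = \<beta> v w" using hom_expand[OF \<beta>1[OF v] S(1) w _ S(2)] by simp
    finally show ?thesis .
  qed
  moreover have "f \<in> extensional (carrier ?T)" by (simp add: f_def)
  ultimately show "\<exists>f. f \<in> module_hom class_ring ?T U \<inter> extensional (carrier ?T) \<and>
    (\<forall>v \<in> carrier V. \<forall>w \<in> carrier W. f (pure_tensor V v w) = \<beta> v w)"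
    by blast
next
  let ?T = "tensor_rep V W"
  fix f g assume
    f: "f \<in> module_hom class_ring ?T U \<inter> extensional (carrier ?T) \<and>
      (\<forall>v \<in> carrier V. \<forall>w \<in> carrier W. f (pure_tensor V v w) = \<beta> v w)" and
    g: "g \<in> module_hom class_ring ?T U \<inter> extensional (carrier ?T) \<and>
      (\<forall>v \<in> carrier V. \<forall>w \<in> carrier W. g (pure_tensor V v w) = \<beta> v w)"
  show "f = g"
  proof (rule extensionalityI[of _ "carrier ?T"])
    show "f t = g t" if "t \<in> carrier ?T" for t
      using f g that by (intro tensor_hom_eqI[of f g t]) simp_all
  qed (use f g in simp_all)
qed

lemma act_expand:
  assumes h: "h \<in> module_hom class_ring W W"
    and "finite T" "w \<in> carrier W" "{b. w b \<noteq> 0} \<subseteq> T" "T \<subseteq> B"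
  shows "h w c = (\<Sum>b \<in> T. w b * h (unit_fun b) c)"
  using assms(2-)
proof (induction T arbitrary: w rule: finite_induct)
  case empty
  then have "w = (\<lambda>b. 0)" by auto
  moreover have "h (0 \<odot>\<^bsub>W\<^esub> w) = 0 \<odot>\<^bsub>W\<^esub> h w"
    by (rule module_hom_smult[OF h _ empty.prems(1)]) simp
  ultimately show ?case by (simp add: smult_W)
next
  case (insert y T)
  let ?g = "w(y := 0)"
  have "finite {b. ?g b \<noteq> 0}"
    using insert.prems by (auto simp: carrier_W intro: finite_subset[of _ "{b. w b \<noteq> 0}"])
  then have g: "?g \<in> carrier W" using insert.prems by (auto simp: carrier_W)
  have "h ?g c = (\<Sum>b \<in> T. ?g b * h (unit_fun b) c)"
    using insert.prems by (intro insert.IH g) auto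
  also have "\<dots> = (\<Sum>b \<in> T. w b * h (unit_fun b) c)"
    using insert.hyps by (intro sum.cong) auto
  finally have hg: "h ?g c = (\<Sum>b \<in> T. w b * h (unit_fun b) c)" .
  have s: "unit_fun y \<in> carrier W" and sy: "w y \<odot>\<^bsub>W\<^esub> unit_fun y \<in> carrier W"
    using insert.prems by (auto simp: carrier_W smult_W unit_fun_def)
  have "w = (w y \<odot>\<^bsub>W\<^esub> unit_fun y) \<oplus>\<^bsub>W\<^esub> ?g"
    by (auto simp: add_W smult_W unit_fun_def)
  then have "h w = h (w y \<odot>\<^bsub>W\<^esub> unit_fun y) \<oplus>\<^bsub>W\<^esub> h ?g"
    using h sy g module_hom_add by metis
  also have "h (w y \<odot>\<^bsub>W\<^esub> unit_fun y) = w y \<odot>\<^bsub>W\<^esub> h (unit_fun y)"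
    using s by (intro module_hom_smult[OF h]) auto
  finally show ?case
    using insert.hyps by (simp add: add_W smult_W hg del: fun_upd_apply)
qed

theorem act_pure_tensor:
  assumes gV: "act V g \<in> module_hom class_ring V V" and gW: "act W g \<in> module_hom class_ring W W"
    and v: "v \<in> carrier V" and w: "w \<in> carrier W"
  shows "act (tensor_rep V W) g (pure_tensor V v w) = pure_tensor V (act V g v) (act W g w)"
proof
  fix c
  let ?t = "pure_tensor V v w" and ?S = "{b. w b \<noteq> 0}"
  let ?a = "\<lambda>b. act W g (unit_fun b) c"
  have S: "finite ?S" "?S \<subseteq> B" using w by (auto simp: carrier_W)
  have t: "?t b \<in> carrier V" for b using v by (auto simp: pure_tensor_def)
  have gc: "act V g x \<in> carrier V" if "x \<in> carrier V" for x
    using that gV by (auto simp: module_hom_def)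
  have "act V g (0 \<odot>\<^bsub>V\<^esub> v) = 0 \<odot>\<^bsub>V\<^esub> act V g v"
    using v by (intro module_hom_smult[OF gV]) auto
  then have g0: "act V g \<zero>\<^bsub>V\<^esub> = \<zero>\<^bsub>V\<^esub>"
    using V.smult_l_null[OF v] V.smult_l_null[OF gc[OF v]] by simp
  have r0: "r \<odot>\<^bsub>V\<^esub> \<zero>\<^bsub>V\<^esub> = \<zero>\<^bsub>V\<^esub>" for r using V.smult_r_null[of r] by simp
  have sub: "{b. ?t b \<noteq> \<zero>\<^bsub>V\<^esub>} \<subseteq> ?S"
    using V.smult_l_null[OF v] by (auto simp: pure_tensor_def)
  have "act (tensor_rep V W) g ?t c = (\<Oplus>\<^bsub>V\<^esub>b \<in> {b. ?t b \<noteq> \<zero>\<^bsub>V\<^esub>}. ?a b \<odot>\<^bsub>V\<^esub> act V g (?t b))"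
    by (simp add: tensor_rep_def)
  also have "\<dots> = (\<Oplus>\<^bsub>V\<^esub>b \<in> ?S. ?a b \<odot>\<^bsub>V\<^esub> act V g (?t b))"
    using sub S t gc by (intro V.add.finprod_mono_neutral_cong_left) (auto simp: g0 r0)
  also have "\<dots> = (\<Oplus>\<^bsub>V\<^esub>b \<in> ?S. (w b * ?a b) \<odot>\<^bsub>V\<^esub> act V g v)"
  proof (intro V.finsum_cong')
    fix b
    have "act V g (w b \<odot>\<^bsub>V\<^esub> v) = w b \<odot>\<^bsub>V\<^esub> act V g v"
      using v by (intro module_hom_smult[OF gV]) auto
    then show "?a b \<odot>\<^bsub>V\<^esub> act V g (?t b) = (w b * ?a b) \<odot>\<^bsub>V\<^esub> act V g v"
      using V.smult_assoc1[OF _ _ gc[OF v], of "?a b" "w b"] by (simp add: pure_tensor_def mult.commute)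
  qed (use gc v in auto)
  also have "\<dots> = (\<Sum>b \<in> ?S. w b * ?a b) \<odot>\<^bsub>V\<^esub> act V g v"
    using S(1)
  proof (induction rule: finite_induct)
    case empty
    then show ?case using V.smult_l_null[OF gc[OF v]] by simp
  next
    case (insert x F)
    then show ?case using gc[OF v] V.smult_l_distr[OF _ _ gc[OF v]] by (subst V.finsum_insert) auto
  qed
  also have "\<dots> = pure_tensor V (act V g v) (act W g w) c"
    using act_expand[OF gW S(1) w _ S(2)] by (simp add: pure_tensor_def)
  finally show "act (tensor_rep V W) g ?t c = pure_tensor V (act V g v) (act W g w) c" .
qed

end


section \<open>The quiver associated with an action on a path algebra\<close>

text \<open>\<open>vertex_act Q \<phi> g i\<close> is the vertex \<open>j = i\<^sup>g\<close> for which \<open>\<phi> g\<close> maps the idempotent of \<open>i\<close> to that of \<open>j\<close>.\<close>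

definition vertex_act ::
  "('v, 'e) pre_digraph \<Rightarrow> ('g \<Rightarrow> (('v, 'e) path \<Rightarrow> 'k::field) \<Rightarrow> ('v, 'e) path \<Rightarrow> 'k)
    \<Rightarrow> 'g \<Rightarrow> 'v \<Rightarrow> 'v" where
  "vertex_act Q \<phi> g i = (THE j. j \<in> verts Q \<and> \<phi> g (vertex_idem i) = vertex_idem j)"

definition vertex_stabilizer ::
  "('g, 'n) monoid_scheme \<Rightarrow> ('g \<Rightarrow> (('v, 'e) path \<Rightarrow> 'k::field) \<Rightarrow> ('v, 'e) path \<Rightarrow> 'k)
    \<Rightarrow> 'v \<Rightarrow> 'g set" where
  "vertex_stabilizer G \<phi> i = stabilizer G \<phi> (vertex_idem i)"

definition arrow_rep ::
  "('v, 'e) pre_digraph \<Rightarrow> ('g \<Rightarrow> (('v, 'e) path \<Rightarrow> 'k::field) \<Rightarrow> ('v, 'e) path \<Rightarrow> 'k)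
    \<Rightarrow> 'v \<Rightarrow> 'v \<Rightarrow> ('g, 'k, ('v, 'e) path \<Rightarrow> 'k) rep" where
  "arrow_rep Q \<phi> i j =
    module.extend ((path_algebra Q)
        \<lparr>carrier := arrow_span Q {a \<in> arcs Q. tail Q a = i \<and> head Q a = j}\<rparr>)
      \<lparr>act = \<phi>\<rparr>"

lemma arrow_rep_tensor_product_model:
  fixes Q :: "('v, 'e) pre_digraph"
    and V :: "('g, 'k::field, 'r) rep" and U :: "('k, 'u) module"
    and \<phi> :: "'g \<Rightarrow> (('v, 'e) path \<Rightarrow> 'k) \<Rightarrow> ('v, 'e) path \<Rightarrow> 'k"
  assumes "wf_digraph Q" "vectorspace class_ring V" "vectorspace class_ring U"
  shows "tensor_product_model V U (arrow_rep Q \<phi> i j)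
    ((\<lambda>a. (i, [a], j)) ` {a \<in> arcs Q. tail Q a = i \<and> head Q a = j})"
proof -
  let ?A = "{a \<in> arcs Q. tail Q a = i \<and> head Q a = j}"
  have "(\<lambda>a. (tail Q a, [a], head Q a)) ` ?A = (\<lambda>a. (i, [a], j)) ` ?A"
    by (intro image_cong) auto
  moreover have "carrier (arrow_rep Q \<phi> i j) = arrow_span Q ?A"
    by (simp add: arrow_rep_def module.defs)
  ultimately have "carrier (arrow_rep Q \<phi> i j) =
      {f. finite {x. f x \<noteq> 0} \<and> {x. f x \<noteq> 0} \<subseteq> (\<lambda>a. (i, [a], j)) ` ?A}"
    using arrow_span_eq[OF assms(1), of ?A] by auto
  with assms(2,3) show ?thesis
    by (simp add: tensor_product_model_def tensor_product_model_axioms_def arrow_rep_def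
        module.defs path_algebra_def)
qed

definition arrow_space ::
  "('g, 'n) monoid_scheme \<Rightarrow> ('v, 'e) pre_digraph
    \<Rightarrow> ('g \<Rightarrow> (('v, 'e) path \<Rightarrow> 'k::field) \<Rightarrow> ('v, 'e) path \<Rightarrow> 'k)
    \<Rightarrow> ('v \<Rightarrow> 'g) \<Rightarrow> ('v \<Rightarrow> 'v \<Rightarrow> ('v \<times> 'v) set)
    \<Rightarrow> 'v \<times> ('g, 'k, 'r) rep \<Rightarrow> 'v \<times> ('g, 'k, 'r) rep
    \<Rightarrow> ('k, 'v \<times> 'v \<Rightarrow> 'r \<Rightarrow> ('v, 'e) path \<Rightarrow> 'r) module" where
  "arrow_space G Q \<phi> \<kappa> F = (\<lambda>(i, \<rho>) (j, \<sigma>).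
     direct_sum_family (F i j) (\<lambda>(i', j').
       hom_space (G\<lparr>carrier := vertex_stabilizer G \<phi> i' \<inter> vertex_stabilizer G \<phi> j'\<rparr>)
         (twist G \<rho> (\<kappa> i'))
         (tensor_rep (twist G \<sigma> (\<kappa> j')) (arrow_rep Q \<phi> i' j'))))"

definition assoc_verts ::
  "('g, 'n) monoid_scheme \<Rightarrow> ('g \<Rightarrow> (('v, 'e) path \<Rightarrow> 'k::field) \<Rightarrow> ('v, 'e) path \<Rightarrow> 'k)
    \<Rightarrow> 'v set \<Rightarrow> ('g set \<Rightarrow> ('g, 'k, 'r) rep set) \<Rightarrow> ('v \<times> ('g, 'k, 'r) rep) set" where
  "assoc_verts G \<phi> R irr = (SIGMA i : R. irr (vertex_stabilizer G \<phi> i))"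

text \<open>
  The quiver depends on the following choices: representatives \<open>R\<close> of the orbits of vertices,
  group elements \<open>\<kappa> i'\<close> moving the representative of the orbit of \<open>i'\<close> to \<open>i'\<close>, representatives
  \<open>F i j\<close> of the orbits of pairs of vertices, representatives \<open>irr H\<close> of the irreducible
  representations of \<open>H\<close>, and a basis \<open>bas x y\<close> of the space of arrows from \<open>x\<close> to \<open>y\<close>.
\<close>

definition assoc_quiver_choices ::
  "('g, 'n) monoid_scheme \<Rightarrow> ('v, 'e) pre_digraph
    \<Rightarrow> ('g \<Rightarrow> (('v, 'e) path \<Rightarrow> 'k::field) \<Rightarrow> ('v, 'e) path \<Rightarrow> 'k)
    \<Rightarrow> 'v set \<Rightarrow> ('v \<Rightarrow> 'g) \<Rightarrow> ('v \<Rightarrow> 'v \<Rightarrow> ('v \<times> 'v) set) \<Rightarrow> ('g set \<Rightarrow> ('g, 'k, 'r) rep set)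
    \<Rightarrow> ('v \<times> ('g, 'k, 'r) rep \<Rightarrow> 'v \<times> ('g, 'k, 'r) rep
         \<Rightarrow> ('v \<times> 'v \<Rightarrow> 'r \<Rightarrow> ('v, 'e) path \<Rightarrow> 'r) set)
    \<Rightarrow> bool" where
  "assoc_quiver_choices G Q \<phi> R \<kappa> F irr bas \<longleftrightarrow>
    orbit_representatives G (vertex_act Q \<phi>) (verts Q) R \<and>
    (\<forall>i \<in> R. \<forall>i' \<in> orbit G (vertex_act Q \<phi>) i. \<kappa> i' \<in> carrier G \<and> vertex_act Q \<phi> (\<kappa> i') i = i') \<and>
    (\<forall>i \<in> R. \<forall>j \<in> R.
       orbit_representatives G (\<lambda>g. map_prod (vertex_act Q \<phi> g) (vertex_act Q \<phi> g))
         (orbit G (vertex_act Q \<phi>) i \<times> orbit G (vertex_act Q \<phi>) j) (F i j)) \<and>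
    (\<forall>i \<in> R. irr_representatives (G\<lparr>carrier := vertex_stabilizer G \<phi> i\<rparr>)
       (irr (vertex_stabilizer G \<phi> i))) \<and>
    (\<forall>x \<in> assoc_verts G \<phi> R irr. \<forall>y \<in> assoc_verts G \<phi> R irr.
       vectorspace.basis class_ring (arrow_space G Q \<phi> \<kappa> F x y) (bas x y))"

text \<open>Basis elements are tagged with their source and target to keep the sets of arrows disjoint.\<close>

definition assoc_quiver ::
  "'x set \<Rightarrow> ('x \<Rightarrow> 'x \<Rightarrow> 'b set) \<Rightarrow> ('x, 'x \<times> 'b \<times> 'x) pre_digraph" where
  "assoc_quiver X bas =
    \<lparr>verts = X,
     arcs = {(x, b, y). x \<in> X \<and> y \<in> X \<and> b \<in> bas x y},
     tail = (\<lambda>(x, b, y). x),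
     head = (\<lambda>(x, b, y). y)\<rparr>"

end

(*
  Realise (kQ)G as a space AA of operators, and let A0 and A1 be its parts of path length 0 and 1.
  Since |G| is invertible in k, A0 is Morita equivalent to a product of copies of k, one for each
  pair x = (i, rho) of an orbit representative i and an irreducible representation rho of G_i: each
  pair yields an idempotent eps x in k[G_i] e_i such that eps x * k[G_i] e_i realises rho, these
  idempotents are pairwise orthogonal (Schur), and together they generate the unit ideal.
  Frobenius reciprocity and a Mackey decomposition over the orbits of pairs of vertices identify
  eps y * A1 * eps x with the space of which the arrows x -> y of Q_G form a basis.  As (kQ)G is
  freely generated by A1 over A0, sending the arrows of Q_G to these elements is an isomorphism of
  k(Q_G) onto the corner e * (kQ)G * e, where e is the sum of the eps x.  The idempotent e is full,
  so restriction to the corner is an equivalence.  In Isabelle the objects are confined to one type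
  of elements, so essential surjectivity needs a module over (kQ)G inside the given type 'm: this
  works because nonzero modules over an algebra over an infinite field are infinite, hence large
  enough to carry a copy of their own finite powers.
*)
theory Submission
  imports Defs "HOL-Library.Function_Algebras"
begin

section \<open>Fully faithful and essentially surjective functors\<close>

text \<open>\<open>Q\<close> may have infinitely many arrows, so no comparison of dimensions shows
  that the new arrows satisfy no relations; this has to come from freeness itself. Freeness is first
  read off from coefficients of paths of \<open>Q\<close>. It passes to the new arrows through maps
  D on \<open>A1\<close> that are linear over \<open>A0\<close> and detect a single new arrow; they
  exist because Schur's lemma turns each \<epsilon> y a \<epsilon> y with a in \<open>A0\<close>
  into a scalar multiple of \<epsilon> y. A second obstacle: an element of \<open>A1\<close> is a
  sum of terms w a with w in \<open>A0\<close>, and the group elements inside w hide the head of a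
  from multiplication on the left. The Mackey pieces are therefore cut out by the operator
  \<open>comp\<close>, which inspects the unique coefficients, and not by an idempotent. Summing
  over a full stabilizer instead of over cosets counts each piece once for every element of the
  common stabilizer of two vertices; dividing by that order is a second use of the hypothesis on the
  characteristic, next to Maschke's averaging. The unit \<gamma> 1 of \<open>AA\<close> need not be
  the unit of the ring of operators, since the operators first project onto the regular
  module.\<close>

lemma (in category) iso_inE:
  assumes "f \<in> iso_in C X Y"
  obtains g where "f \<in> Hom C X Y" "g \<in> Hom C Y X"
    "Comp C X Y X g f = Ident C X" "Comp C Y X Y f g = Ident C Y"
  using assms by (auto simp: iso_in_def)

lemma id_functor_cat_functor: "category C \<Longrightarrow> cat_functor C C id_functor"
  by (simp add: cat_functor_def cat_functor_axioms_def id_functor_def)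

lemma comp_functor_cat_functor:
  fixes F :: "('o, 'a, 'p, 'b) cat_functor" and G :: "('p, 'b, 'q, 'c) cat_functor"
  assumes "cat_functor C D F" "cat_functor D E G"
  shows "cat_functor C E (comp_functor G F)"
proof -
  interpret F: cat_functor C D F by fact
  interpret G: cat_functor D E G by fact
  show ?thesis
    by unfold_locales
      (simp_all add: comp_functor_def F.ob G.ob F.hom G.hom F.preserves_Ident G.preserves_Ident
        F.preserves_Comp G.preserves_Comp)
qed

text \<open>Choose for each \<open>Y\<close> an object \<open>GO Y\<close> and mutually inverse
  \<open>u Y\<close>, \<open>v Y\<close> between its image and \<open>Y\<close>. The quasi-inverse
  sends f to the preimage of the composite of \<open>u X\<close>, f and \<open>v Y\<close>; as
  \<open>F\<close> is faithful, every law may be checked after applying \<open>F\<close>. The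
  quasi-inverse is the first functor of the equivalence, so the conclusion goes from
  \<open>D\<close> to \<open>C\<close>.\<close>

theorem equivalent_categories_if_fully_faithful:
  fixes F :: "('o, 'a, 'p, 'b) cat_functor"
  assumes F: "cat_functor C D F"
    and full: "\<And>X Y g. \<lbrakk>X \<in> Ob C; Y \<in> Ob C; g \<in> Hom D (on_ob F X) (on_ob F Y)\<rbrakk>
      \<Longrightarrow> \<exists>f \<in> Hom C X Y. on_hom F X Y f = g"
    and faithful: "\<And>X Y f f'. \<lbrakk>X \<in> Ob C; Y \<in> Ob C; f \<in> Hom C X Y; f' \<in> Hom C X Y;
      on_hom F X Y f = on_hom F X Y f'\<rbrakk> \<Longrightarrow> f = f'"
    and surj: "\<And>Y. Y \<in> Ob D \<Longrightarrow> \<exists>X \<in> Ob C. iso_in D (on_ob F X) Y \<noteq> {}"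
  shows "equivalent_categories D C"
proof -
  interpret F: cat_functor C D F by fact
  have "\<exists>X u v. X \<in> Ob C \<and> u \<in> Hom D (on_ob F X) Y \<and> v \<in> Hom D Y (on_ob F X) \<and>
      Comp D (on_ob F X) Y (on_ob F X) v u = Ident D (on_ob F X) \<and>
      Comp D Y (on_ob F X) Y u v = Ident D Y" if "Y \<in> Ob D" for Y
    using surj[OF that] by (auto elim!: F.D.iso_inE)
  then obtain GO u v where
    GO: "\<And>Y. Y \<in> Ob D \<Longrightarrow> GO Y \<in> Ob C" and
    u: "\<And>Y. Y \<in> Ob D \<Longrightarrow> u Y \<in> Hom D (on_ob F (GO Y)) Y" and
    v: "\<And>Y. Y \<in> Ob D \<Longrightarrow> v Y \<in> Hom D Y (on_ob F (GO Y))" and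
    vu: "\<And>Y. Y \<in> Ob D \<Longrightarrow> Comp D (on_ob F (GO Y)) Y (on_ob F (GO Y)) (v Y) (u Y) = Ident D (on_ob F (GO Y))" and
    uv: "\<And>Y. Y \<in> Ob D \<Longrightarrow> Comp D Y (on_ob F (GO Y)) Y (u Y) (v Y) = Ident D Y"
    by metis
  define FG where "FG Y = on_ob F (GO Y)" for Y
  define pre where "pre X Y g = (SOME f. f \<in> Hom C X Y \<and> on_hom F X Y f = g)" for X Y g
  have pre: "pre X Y g \<in> Hom C X Y" "on_hom F X Y (pre X Y g) = g"
    if "X \<in> Ob C" "Y \<in> Ob C" "g \<in> Hom D (on_ob F X) (on_ob F Y)" for X Y g
    using someI_ex[of "\<lambda>f. f \<in> Hom C X Y \<and> on_hom F X Y f = g"] full[OF that]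
    unfolding pre_def by blast+
  note ob = GO F.ob FG_def[symmetric]
  have FG: "FG Y \<in> Ob D" if "Y \<in> Ob D" for Y using that by (simp add: FG_def GO F.ob)
  note u' = u[folded FG_def] and v' = v[folded FG_def] and uv' = uv[folded FG_def] and vu' = vu[folded FG_def]
  define conj where "conj X Y f = Comp D (FG X) Y (FG Y) (v Y) (Comp D (FG X) X Y f (u X))" for X Y f
  have conj: "conj X Y f \<in> Hom D (FG X) (FG Y)" if "X \<in> Ob D" "Y \<in> Ob D" "f \<in> Hom D X Y" for X Y f
    unfolding conj_def using that u' v' FG by (blast intro: F.D.Comp_in_Hom)
  define G where "G = \<lparr>on_ob = GO, on_hom = (\<lambda>X Y f. pre (GO X) (GO Y) (conj X Y f))\<rparr>"
  have conj': "conj X Y f \<in> Hom D (on_ob F (GO X)) (on_ob F (GO Y))"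
    if "X \<in> Ob D" "Y \<in> Ob D" "f \<in> Hom D X Y" for X Y f
    using conj[OF that] by (simp add: FG_def)
  have FGh: "on_hom F (GO X) (GO Y) (on_hom G X Y f) = conj X Y f" and
      Gh: "on_hom G X Y f \<in> Hom C (GO X) (GO Y)"
    if "X \<in> Ob D" "Y \<in> Ob D" "f \<in> Hom D X Y" for X Y f
    using pre[OF _ _ conj'[OF that]] that GO by (simp_all add: G_def)
  have G_ob: "on_ob G = GO" by (simp add: G_def)
  \<comment> \<open>This square and the next one express naturality of \<open>u\<close> and
    \<open>v\<close>; functoriality and both natural isomorphisms reduce to them.\<close>
  have uconj: "Comp D (FG X) (FG Y) Y (u Y) (conj X Y f) = Comp D (FG X) X Y f (u X)"
    if "X \<in> Ob D" "Y \<in> Ob D" "f \<in> Hom D X Y" for X Y f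
  proof -
    have fu: "Comp D (FG X) X Y f (u X) \<in> Hom D (FG X) Y"
      using that u' FG by (blast intro: F.D.Comp_in_Hom)
    have "Comp D (FG X) (FG Y) Y (u Y) (conj X Y f) =
        Comp D (FG X) Y Y (Comp D Y (FG Y) Y (u Y) (v Y)) (Comp D (FG X) X Y f (u X))"
      unfolding conj_def using that u' v' FG fu by (intro F.D.Comp_assoc[symmetric]) auto
    then show ?thesis using that uv' fu FG by (simp add: F.D.Ident_Comp)
  qed
  have conjv: "Comp D X (FG X) (FG Y) (conj X Y f) (v X) = Comp D X Y (FG Y) (v Y) f"
    if "X \<in> Ob D" "Y \<in> Ob D" "f \<in> Hom D X Y" for X Y f
  proof -
    have fu: "Comp D (FG X) X Y f (u X) \<in> Hom D (FG X) Y"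
      using that u' FG by (blast intro: F.D.Comp_in_Hom)
    have "Comp D X (FG X) (FG Y) (conj X Y f) (v X)
      = Comp D X Y (FG Y) (v Y) (Comp D X (FG X) Y (Comp D (FG X) X Y f (u X)) (v X))"
      unfolding conj_def using that u' v' FG fu by (intro F.D.Comp_assoc) auto
    also have "Comp D X (FG X) Y (Comp D (FG X) X Y f (u X)) (v X)
      = Comp D X X Y f (Comp D X (FG X) X (u X) (v X))"
      using that u' v' FG by (intro F.D.Comp_assoc) auto
    finally show ?thesis using that uv' by (simp add: F.D.Comp_Ident)
  qed
  have Gfun: "cat_functor D C G"
  proof (unfold_locales, unfold G_ob)
    show "GO X \<in> Ob C" if "X \<in> Ob D" for X using that GO by simp
    show "on_hom G X Y f \<in> Hom C (GO X) (GO Y)" if "X \<in> Ob D" "Y \<in> Ob D" "f \<in> Hom D X Y" for X Y f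
      using Gh that by simp
    show "on_hom G X X (Ident D X) = Ident C (GO X)" if X: "X \<in> Ob D" for X
    proof (rule faithful[of "GO X" "GO X"])
      have "conj X X (Ident D X) = Ident D (FG X)"
        unfolding conj_def using X u' vu' FG by (simp add: F.D.Ident_Comp)
      then show "on_hom F (GO X) (GO X) (on_hom G X X (Ident D X)) = on_hom F (GO X) (GO X) (Ident C (GO X))"
        using X GO F.D.Ident_in_Hom by (simp add: FGh F.preserves_Ident FG_def)
    qed (use X in \<open>auto intro!: F.C.Ident_in_Hom F.D.Ident_in_Hom GO Gh\<close>)
    show "on_hom G X Z (Comp D X Y Z g f) = Comp C (GO X) (GO Y) (GO Z) (on_hom G Y Z g) (on_hom G X Y f)"
      if X: "X \<in> Ob D" and Y: "Y \<in> Ob D" and Z: "Z \<in> Ob D" and f: "f \<in> Hom D X Y" and g: "g \<in> Hom D Y Z" for X Y Z f g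
    proof (rule faithful[of "GO X" "GO Z"])
      have gf: "Comp D X Y Z g f \<in> Hom D X Z" using that by (blast intro: F.D.Comp_in_Hom)
      note h = X Y Z f g gf u' v' FG conj
      have fu: "Comp D (FG X) X Y f (u X) \<in> Hom D (FG X) Y"
        using h by (blast intro: F.D.Comp_in_Hom)
      have gu: "Comp D (FG Y) Y Z g (u Y) \<in> Hom D (FG Y) Z"
        using h by (blast intro: F.D.Comp_in_Hom)
      have "Comp D (FG X) (FG Y) (FG Z) (conj Y Z g) (conj X Y f)
        = Comp D (FG X) Z (FG Z) (v Z) (Comp D (FG X) (FG Y) Z (Comp D (FG Y) Y Z g (u Y)) (conj X Y f))"
        unfolding conj_def[of Y Z g] using h gu by (intro F.D.Comp_assoc) auto
      also have "Comp D (FG X) (FG Y) Z (Comp D (FG Y) Y Z g (u Y)) (conj X Y f)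
         = Comp D (FG X) Y Z g (Comp D (FG X) (FG Y) Y (u Y) (conj X Y f))"
        using h by (intro F.D.Comp_assoc) auto
      also have "\<dots> = Comp D (FG X) Y Z g (Comp D (FG X) X Y f (u X))" by (simp add: uconj h)
      also have "\<dots> = Comp D (FG X) X Z (Comp D X Y Z g f) (u X)"
        using h by (intro F.D.Comp_assoc[symmetric]) auto
      finally have c: "Comp D (FG X) (FG Y) (FG Z) (conj Y Z g) (conj X Y f) = conj X Z (Comp D X Y Z g f)"
        by (simp add: conj_def)
      show "on_hom F (GO X) (GO Z) (on_hom G X Z (Comp D X Y Z g f)) =
         on_hom F (GO X) (GO Z) (Comp C (GO X) (GO Y) (GO Z) (on_hom G Y Z g) (on_hom G X Y f))"
        using h GO Gh c by (simp add: FGh F.preserves_Comp FG_def)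
    qed (use that in \<open>auto intro!: F.C.Comp_in_Hom F.D.Comp_in_Hom GO Gh\<close>)
  qed
  have \<eta>: "natural_isomorphism D D id_functor (comp_functor F G) v"
    unfolding natural_isomorphism_def
  proof (intro conjI ballI)
    show "cat_functor D D id_functor" by (rule id_functor_cat_functor) unfold_locales
    show "cat_functor D D (comp_functor F G)" using Gfun F by (rule comp_functor_cat_functor)
    show "v X \<in> iso_in D (on_ob id_functor X) (on_ob (comp_functor F G) X)" if "X \<in> Ob D" for X
      using that u' v' uv' vu' by (auto simp: iso_in_def id_functor_def comp_functor_def G_ob FG_def[symmetric] intro!: bexI[of _ "u X"])
    show "Comp D (on_ob id_functor X) (on_ob id_functor Y) (on_ob (comp_functor F G) Y) (v Y) (on_hom id_functor X Y f)
     = Comp D (on_ob id_functor X) (on_ob (comp_functor F G) X) (on_ob (comp_functor F G) Y)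
         (on_hom (comp_functor F G) X Y f) (v X)" if "X \<in> Ob D" "Y \<in> Ob D" "f \<in> Hom D X Y" for X Y f
      using conjv[OF that] that by (simp add: id_functor_def comp_functor_def G_ob FGh FG_def)
  qed
  \<comment> \<open>The natural isomorphism on the side of \<open>C\<close> consists of the
    preimages of \<open>u\<close> at image objects; that \<open>w\<close> and \<open>w'\<close> are
    mutually inverse is again detected by \<open>F\<close>.\<close>
  define w where "w X = pre (GO (on_ob F X)) X (u (on_ob F X))" for X
  define w' where "w' X = pre X (GO (on_ob F X)) (v (on_ob F X))" for X
  have w: "w X \<in> Hom C (GO (on_ob F X)) X" "on_hom F (GO (on_ob F X)) X (w X) = u (on_ob F X)"
    if "X \<in> Ob C" for X
    unfolding w_def using that GO F.ob u by (auto intro!: pre)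
  have w': "w' X \<in> Hom C X (GO (on_ob F X))" "on_hom F X (GO (on_ob F X)) (w' X) = v (on_ob F X)"
    if "X \<in> Ob C" for X
    unfolding w'_def using that GO F.ob v by (auto intro!: pre)
  have ww': "Comp C (GO (on_ob F X)) X (GO (on_ob F X)) (w' X) (w X) = Ident C (GO (on_ob F X))"
    if X: "X \<in> Ob C" for X
    by (rule faithful[of "GO (on_ob F X)" "GO (on_ob F X)"])
      (use X w w' GO F.ob vu in \<open>auto intro!: F.C.Comp_in_Hom F.C.Ident_in_Hom simp: F.preserves_Comp F.preserves_Ident\<close>)
  have w'w: "Comp C X (GO (on_ob F X)) X (w X) (w' X) = Ident C X"
    if X: "X \<in> Ob C" for X
    by (rule faithful[of X X])
      (use X w w' GO F.ob uv in \<open>auto intro!: F.C.Comp_in_Hom F.C.Ident_in_Hom simp: F.preserves_Comp F.preserves_Ident\<close>)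
  have \<epsilon>: "natural_isomorphism C C (comp_functor G F) id_functor w"
    unfolding natural_isomorphism_def
  proof (intro conjI ballI)
    show "cat_functor C C id_functor" by (rule id_functor_cat_functor) unfold_locales
    show "cat_functor C C (comp_functor G F)" using F Gfun by (rule comp_functor_cat_functor)
    show "w X \<in> iso_in C (on_ob (comp_functor G F) X) (on_ob id_functor X)" if "X \<in> Ob C" for X
      using w w' ww' w'w that by (auto simp: iso_in_def id_functor_def comp_functor_def G_ob intro!: bexI[of _ "w' X"])
    show "Comp C (on_ob (comp_functor G F) X) (on_ob (comp_functor G F) Y) (on_ob id_functor Y) (w Y)
          (on_hom (comp_functor G F) X Y f) =
        Comp C (on_ob (comp_functor G F) X) (on_ob id_functor X) (on_ob id_functor Y)
          (on_hom id_functor X Y f) (w X)" if X: "X \<in> Ob C" and Y: "Y \<in> Ob C" and f: "f \<in> Hom C X Y" for X Y f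
    proof -
      let ?g = "on_hom F X Y f"
      have g: "?g \<in> Hom D (on_ob F X) (on_ob F Y)" using that by (simp add: F.hom)
      have Gg: "on_hom G (on_ob F X) (on_ob F Y) ?g \<in> Hom C (GO (on_ob F X)) (GO (on_ob F Y))"
        using that F.ob F.hom by (intro Gh) auto
      have "Comp C (GO (on_ob F X)) (GO (on_ob F Y)) Y (w Y) (on_hom G (on_ob F X) (on_ob F Y) ?g)
        = Comp C (GO (on_ob F X)) X Y f (w X)"
      proof (rule faithful[of "GO (on_ob F X)" Y])
        show "on_hom F (GO (on_ob F X)) Y (Comp C (GO (on_ob F X)) (GO (on_ob F Y)) Y (w Y) (on_hom G (on_ob F X) (on_ob F Y) ?g))
          = on_hom F (GO (on_ob F X)) Y (Comp C (GO (on_ob F X)) X Y f (w X))"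
          using that GO F.ob F.hom w Gg uconj[of "on_ob F X" "on_ob F Y" ?g]
          by (simp add: F.preserves_Comp FGh FG_def)
      qed (use that GO F.ob w Gg in \<open>auto intro!: F.C.Comp_in_Hom\<close>)
      then show ?thesis by (simp add: comp_functor_def id_functor_def G_ob)
    qed
  qed
  show ?thesis unfolding equivalent_categories_def
    using Gfun F \<eta> \<epsilon> by blast
qed

section \<open>Morita equivalence for a full idempotent\<close>

lemma finsum_hom:
  assumes "abelian_group M" "abelian_group N" and h: "h \<in> carrier M \<rightarrow> carrier N"
    and add: "\<And>x y. \<lbrakk>x \<in> carrier M; y \<in> carrier M\<rbrakk> \<Longrightarrow> h (x \<oplus>\<^bsub>M\<^esub> y) = h x \<oplus>\<^bsub>N\<^esub> h y"
    and "finite I" and "f \<in> I \<rightarrow> carrier M"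
  shows "h (finsum M f I) = finsum N (\<lambda>i. h (f i)) I"
proof -
  interpret M: abelian_group M by fact
  interpret N: abelian_group N by fact
  have "h \<zero>\<^bsub>M\<^esub> \<oplus>\<^bsub>N\<^esub> h \<zero>\<^bsub>M\<^esub> = h \<zero>\<^bsub>M\<^esub>" using add[of "\<zero>\<^bsub>M\<^esub>" "\<zero>\<^bsub>M\<^esub>"] by simp
  then have h0: "h \<zero>\<^bsub>M\<^esub> = \<zero>\<^bsub>N\<^esub>"
    using h by (metis M.zero_closed N.add.r_cancel_one PiE)
  show ?thesis using \<open>finite I\<close> \<open>f \<in> I \<rightarrow> carrier M\<close>
  proof (induction rule: finite_induct)
    case (insert x F)
    then have "finsum M f F \<in> carrier M" "f x \<in> carrier M" "\<forall>i\<in>F. f i \<in> carrier M" by auto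
    with insert h show ?case by (simp add: Pi_iff add)
  qed (simp add: h0)
qed

context left_module
begin

lemma smult_finsum:
  assumes "a \<in> carrier R" "finite I" "f \<in> I \<rightarrow> carrier M"
  shows "a \<odot>\<^bsub>M\<^esub> finsum M f I = finsum M (\<lambda>i. a \<odot>\<^bsub>M\<^esub> f i) I"
  using assms by (intro finsum_hom[of M M]) (auto simp: smult_closed smult_r_distr M.abelian_group_axioms)

lemma finsum_smult:
  assumes "x \<in> carrier M" "finite I" "f \<in> I \<rightarrow> carrier R"
  shows "finsum R f I \<odot>\<^bsub>M\<^esub> x = finsum M (\<lambda>i. f i \<odot>\<^bsub>M\<^esub> x) I"
  using assms finsum_hom[of R M "\<lambda>a. a \<odot>\<^bsub>M\<^esub> x" I f]
  by (auto simp: smult_closed smult_l_distr M.abelian_group_axioms R.abelian_group_axioms)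

lemma smult_zero: "a \<in> carrier R \<Longrightarrow> a \<odot>\<^bsub>M\<^esub> \<zero>\<^bsub>M\<^esub> = \<zero>\<^bsub>M\<^esub>"
  using smult_finsum[of a "{}" "\<lambda>_. \<zero>\<^bsub>M\<^esub>"] by simp

lemma zero_smult: "x \<in> carrier M \<Longrightarrow> \<zero>\<^bsub>R\<^esub> \<odot>\<^bsub>M\<^esub> x = \<zero>\<^bsub>M\<^esub>"
  using finsum_smult[of x "{}" "\<lambda>_. \<zero>\<^bsub>R\<^esub>"] by simp

lemma smult_minus: "\<lbrakk>a \<in> carrier R; x \<in> carrier M\<rbrakk> \<Longrightarrow> a \<odot>\<^bsub>M\<^esub> (\<ominus>\<^bsub>M\<^esub> x) = \<ominus>\<^bsub>M\<^esub> (a \<odot>\<^bsub>M\<^esub> x)"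
  by (rule M.minus_equality[symmetric])
    (simp_all add: smult_closed smult_r_distr[symmetric] M.l_neg smult_zero)

end

lemma left_moduleI:
  assumes "ring R" "abelian_group M"
    "\<And>a x. \<lbrakk>a \<in> carrier R; x \<in> carrier M\<rbrakk> \<Longrightarrow> a \<odot>\<^bsub>M\<^esub> x \<in> carrier M"
    "\<And>a b x. \<lbrakk>a \<in> carrier R; b \<in> carrier R; x \<in> carrier M\<rbrakk>
        \<Longrightarrow> (a \<oplus>\<^bsub>R\<^esub> b) \<odot>\<^bsub>M\<^esub> x = a \<odot>\<^bsub>M\<^esub> x \<oplus>\<^bsub>M\<^esub> b \<odot>\<^bsub>M\<^esub> x"
    "\<And>a x y. \<lbrakk>a \<in> carrier R; x \<in> carrier M; y \<in> carrier M\<rbrakk>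
        \<Longrightarrow> a \<odot>\<^bsub>M\<^esub> (x \<oplus>\<^bsub>M\<^esub> y) = a \<odot>\<^bsub>M\<^esub> x \<oplus>\<^bsub>M\<^esub> a \<odot>\<^bsub>M\<^esub> y"
    "\<And>a b x. \<lbrakk>a \<in> carrier R; b \<in> carrier R; x \<in> carrier M\<rbrakk>
        \<Longrightarrow> (a \<otimes>\<^bsub>R\<^esub> b) \<odot>\<^bsub>M\<^esub> x = a \<odot>\<^bsub>M\<^esub> (b \<odot>\<^bsub>M\<^esub> x)"
    "\<And>x. x \<in> carrier M \<Longrightarrow> \<one>\<^bsub>R\<^esub> \<odot>\<^bsub>M\<^esub> x = x"
  shows "left_module R M"
  using assms by (simp add: left_module_def left_module_axioms_def)

text \<open>An additive bijection onto \<open>X\<close> is used to carry a module over to another type.\<close>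

definition transport_module :: "('x \<Rightarrow> 'm) \<Rightarrow> ('a, 'x) module \<Rightarrow> ('a, 'm) module" where
  "transport_module j M = (let i = inv_into (carrier M) j in
    \<lparr>carrier = j ` carrier M, monoid.mult = (\<lambda>x y. x), one = j \<zero>\<^bsub>M\<^esub>, zero = j \<zero>\<^bsub>M\<^esub>,
     add = (\<lambda>x y. j (i x \<oplus>\<^bsub>M\<^esub> i y)), smult = (\<lambda>a x. j (a \<odot>\<^bsub>M\<^esub> i x))\<rparr>)"

lemma left_module_transport:
  assumes "left_module R M" and j: "inj_on j (carrier M)"
  shows "left_module R (transport_module j M)" "j \<in> module_hom R M (transport_module j M)"
proof -
  interpret left_module R M by fact
  let ?i = "inv_into (carrier M) j"
  have [simp]: "?i (j x) = x" if "x \<in> carrier M" for x using j that by simp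
  note [simp] = transport_module_def Let_def
  have "abelian_group (transport_module j M)"
  proof (rule abelian_groupI)
    fix x assume "x \<in> carrier (transport_module j M)"
    then obtain y where "y \<in> carrier M" "x = j y" by auto
    then show "\<exists>y\<in>carrier (transport_module j M). y \<oplus>\<^bsub>transport_module j M\<^esub> x = \<zero>\<^bsub>transport_module j M\<^esub>"
      by (intro bexI[of _ "j (\<ominus>\<^bsub>M\<^esub> y)"]) (auto simp: M.l_neg)
  qed (auto simp: M.a_ac)
  then show "left_module R (transport_module j M)"
    by (intro left_moduleI)
      (auto simp: smult_closed smult_l_distr smult_r_distr smult_assoc smult_one R.ring_axioms)
  show "j \<in> module_hom R M (transport_module j M)"
    by (auto simp: module_hom_def)
qed

text \<open>An infinite set is equipotent with its square, so the last coordinate and a code of the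
  others merge into one element. This makes room for coinduced modules inside the given
  universe.\<close>

lemma infinite_power_inj:
  fixes N :: "'m set"
  assumes "infinite N"
  shows "\<exists>\<iota>. inj_on \<iota> ({..<n::nat} \<rightarrow>\<^sub>E N) \<and> \<iota> ` ({..<n} \<rightarrow>\<^sub>E N) \<subseteq> N"
proof (induction n)
  case 0
  obtain c where "c \<in> N" using assms by fastforce
  then show ?case by (intro exI[of _ "\<lambda>_. c"]) auto
next
  case (Suc n)
  then obtain \<iota> where \<iota>: "inj_on \<iota> ({..<n} \<rightarrow>\<^sub>E N)" "\<iota> ` ({..<n} \<rightarrow>\<^sub>E N) \<subseteq> N" by blast
  obtain p where p: "bij_betw p (N \<times> N) N"
    using card_of_Times_same_infinite[OF assms] card_of_ordIso by blast
  let ?j = "\<lambda>v. p (v n, \<iota> (restrict v {..<n}))"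
  have r: "restrict v {..<n} \<in> {..<n} \<rightarrow>\<^sub>E N" "v n \<in> N" if "v \<in> {..<Suc n} \<rightarrow>\<^sub>E N" for v
    using that PiE_mem[OF that] by (simp_all add: restrict_PiE_iff)
  have m: "(v n, \<iota> (restrict v {..<n})) \<in> N \<times> N" if "v \<in> {..<Suc n} \<rightarrow>\<^sub>E N" for v
    using r[OF that] \<iota>(2) by auto
  have "inj_on ?j ({..<Suc n} \<rightarrow>\<^sub>E N)"
  proof (rule inj_onI)
    fix v w assume v: "v \<in> {..<Suc n} \<rightarrow>\<^sub>E N" and w: "w \<in> {..<Suc n} \<rightarrow>\<^sub>E N" and "?j v = ?j w"
    then have "(v n, \<iota> (restrict v {..<n})) = (w n, \<iota> (restrict w {..<n}))"
      using m[OF v] m[OF w] p by (auto simp: bij_betw_def dest: inj_onD)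
    then have "v n = w n" "restrict v {..<n} = restrict w {..<n}"
      using inj_onD[OF \<iota>(1) _ r(1)[OF v] r(1)[OF w]] by auto
    then have "v k = w k" if "k < Suc n" for k
      using that by (metis less_SucE lessThan_iff restrict_apply')
    then show "v = w" using v w by (intro PiE_ext[OF v w]) auto
  qed
  moreover have "?j ` ({..<Suc n} \<rightarrow>\<^sub>E N) \<subseteq> N"
    using m p by (auto simp: bij_betw_def)
  ultimately show ?case by blast
qed

text \<open>Fullness AeA = A is recorded by a witness: finitely many \<open>p i\<close> in Ae and
  \<open>q i\<close> in eA whose products sum to 1. All inverse constructions below are explicit
  formulas in these elements. The corner eAe enters only through the bijection \<Phi>, so that it
  may be a ring on another type.\<close>

locale full_idempotent =
  A: ring A + B: ring B for A :: "('a, 'x) ring_scheme" and B :: "('b, 'y) ring_scheme" +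
  fixes e :: 'a and \<Phi> :: "'b \<Rightarrow> 'a" and n :: nat and p q :: "nat \<Rightarrow> 'a"
  assumes e_closed: "e \<in> carrier A" and e_idem: "e \<otimes>\<^bsub>A\<^esub> e = e"
    and \<Phi>_bij: "bij_betw \<Phi> (carrier B) {a \<in> carrier A. e \<otimes>\<^bsub>A\<^esub> a = a \<and> a \<otimes>\<^bsub>A\<^esub> e = a}"
    and \<Phi>_add: "\<lbrakk>b \<in> carrier B; c \<in> carrier B\<rbrakk> \<Longrightarrow> \<Phi> (b \<oplus>\<^bsub>B\<^esub> c) = \<Phi> b \<oplus>\<^bsub>A\<^esub> \<Phi> c"
    and \<Phi>_mult: "\<lbrakk>b \<in> carrier B; c \<in> carrier B\<rbrakk> \<Longrightarrow> \<Phi> (b \<otimes>\<^bsub>B\<^esub> c) = \<Phi> b \<otimes>\<^bsub>A\<^esub> \<Phi> c"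
    and \<Phi>_one: "\<Phi> \<one>\<^bsub>B\<^esub> = e"
    and p_closed: "p \<in> {..<n} \<rightarrow> carrier A" and q_closed: "q \<in> {..<n} \<rightarrow> carrier A"
    and p_e: "i < n \<Longrightarrow> p i \<otimes>\<^bsub>A\<^esub> e = p i" and e_q: "i < n \<Longrightarrow> e \<otimes>\<^bsub>A\<^esub> q i = q i"
    and full: "finsum A (\<lambda>i. p i \<otimes>\<^bsub>A\<^esub> q i) {..<n} = \<one>\<^bsub>A\<^esub>"
begin

lemma p_in [simp]: "i < n \<Longrightarrow> p i \<in> carrier A" and q_in [simp]: "i < n \<Longrightarrow> q i \<in> carrier A"
  using p_closed q_closed by auto

lemma \<Phi>_closed: "b \<in> carrier B \<Longrightarrow> \<Phi> b \<in> carrier A"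
  and e_\<Phi>: "b \<in> carrier B \<Longrightarrow> e \<otimes>\<^bsub>A\<^esub> \<Phi> b = \<Phi> b"
  and \<Phi>_e: "b \<in> carrier B \<Longrightarrow> \<Phi> b \<otimes>\<^bsub>A\<^esub> e = \<Phi> b"
  using bij_betwE[OF \<Phi>_bij] by auto

lemma \<Phi>_surj:
  assumes "a \<in> carrier A" "e \<otimes>\<^bsub>A\<^esub> a = a" "a \<otimes>\<^bsub>A\<^esub> e = a"
  obtains b where "b \<in> carrier B" "a = \<Phi> b"
  using assms \<Phi>_bij by (auto simp: bij_betw_def)

lemma \<Phi>_inj: "\<lbrakk>b \<in> carrier B; c \<in> carrier B; \<Phi> b = \<Phi> c\<rbrakk> \<Longrightarrow> b = c"
  using \<Phi>_bij by (auto simp: bij_betw_def dest: inj_onD)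

section \<open>Restriction of modules to the corner\<close>

definition corner :: "('a, 'm) module \<Rightarrow> ('b, 'm) module" where
  "corner M = \<lparr>carrier = {m \<in> carrier M. e \<odot>\<^bsub>M\<^esub> m = m}, monoid.mult = monoid.mult M,
    one = monoid.one M, zero = \<zero>\<^bsub>M\<^esub>, add = add M, smult = (\<lambda>b m. \<Phi> b \<odot>\<^bsub>M\<^esub> m)\<rparr>"

lemma corner_simps [simp]:
  "carrier (corner M) = {m \<in> carrier M. e \<odot>\<^bsub>M\<^esub> m = m}"
  "\<zero>\<^bsub>corner M\<^esub> = \<zero>\<^bsub>M\<^esub>" "x \<oplus>\<^bsub>corner M\<^esub> y = x \<oplus>\<^bsub>M\<^esub> y" "b \<odot>\<^bsub>corner M\<^esub> x = \<Phi> b \<odot>\<^bsub>M\<^esub> x"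
  by (simp_all add: corner_def)

lemma left_module_corner:
  assumes "left_module A M" shows "left_module B (corner M)"
proof -
  interpret left_module A M by fact
  have "abelian_group (corner M)"
  proof (rule abelian_groupI)
    fix x assume "x \<in> carrier (corner M)"
    then show "\<exists>y\<in>carrier (corner M). y \<oplus>\<^bsub>corner M\<^esub> x = \<zero>\<^bsub>corner M\<^esub>"
      by (intro bexI[of _ "\<ominus>\<^bsub>M\<^esub> x"]) (auto simp: M.l_neg smult_minus e_closed)
  qed (auto simp: M.a_ac smult_r_distr e_closed smult_zero)
  then show ?thesis
    by (intro left_moduleI)
      (auto simp: \<Phi>_closed e_closed smult_closed smult_l_distr smult_r_distr smult_assoc[symmetric]
        \<Phi>_add \<Phi>_mult \<Phi>_one e_\<Phi> B.ring_axioms)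
qed

text \<open>The components \<open>q i\<close> m lie in eM, so m is expressed through the corner;
  morphisms and their equality can be recovered from there.\<close>

lemma decompose:
  assumes "left_module A M" "m \<in> carrier M"
  shows "finsum M (\<lambda>i. p i \<odot>\<^bsub>M\<^esub> (q i \<odot>\<^bsub>M\<^esub> m)) {..<n} = m"
proof -
  interpret left_module A M by fact
  have "finsum M (\<lambda>i. p i \<odot>\<^bsub>M\<^esub> (q i \<odot>\<^bsub>M\<^esub> m)) {..<n} = finsum M (\<lambda>i. (p i \<otimes>\<^bsub>A\<^esub> q i) \<odot>\<^bsub>M\<^esub> m) {..<n}"
    using assms by (intro M.finsum_cong') (auto simp: smult_assoc smult_closed)
  also have "\<dots> = m"
    using assms by (subst finsum_smult[symmetric]) (auto simp: full smult_one)
  finally show ?thesis .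
qed

definition corner_functor :: "(('a, 'm) module, 'm \<Rightarrow> 'm, ('b, 'm) module, 'm \<Rightarrow> 'm) cat_functor" where
  "corner_functor = \<lparr>on_ob = corner, on_hom = (\<lambda>M N f. restrict f (carrier (corner M)))\<rparr>"

lemma corner_functor_cat_functor:
  "cat_functor (module_category A) (module_category B) corner_functor"
proof -
  interpret CA: category "module_category A" by (rule category_module_category)
  interpret CB: category "module_category B" by (rule category_module_category)
  show ?thesis
  proof (unfold_locales, goal_cases)
    case (1 X)
    then show ?case by (simp add: module_category_def corner_functor_def left_module_corner)
  next
    case (2 X Y f)
    interpret X: left_module A X using 2 by (simp add: module_category_def)
    interpret Y: left_module A Y using 2 by (simp add: module_category_def)
    have f: "f \<in> module_hom A X Y" using 2 by (simp add: module_category_def)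
    show ?case
      using f by (auto simp: module_category_def corner_functor_def module_hom_def \<Phi>_closed X.smult_assoc[symmetric]
          e_closed X.smult_closed X.smult_r_distr e_\<Phi> Pi_iff) (metis e_closed)
  next
    case (3 X)
    show ?case by (auto simp: module_category_def corner_functor_def restrict_def fun_eq_iff)
  next
    case (4 X Y Z f g)
    have f: "f \<in> module_hom A X Y" using 4 by (simp add: module_category_def)
    have "e \<odot>\<^bsub>Y\<^esub> f x = f x" "f x \<in> carrier Y" if "x \<in> carrier X" "e \<odot>\<^bsub>X\<^esub> x = x" for x
      using f that e_closed by (auto simp: module_hom_def) metis
    then show ?case
      by (auto simp: module_category_def corner_functor_def compose_def restrict_def fun_eq_iff)
  qed
qed

text \<open>The only possible extension of g is m \<mapsto> sum of \<open>p i\<close>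
  g(\<open>q i\<close> m). It is linear over \<open>A\<close> because every \<open>q i\<close> a
  \<open>p s\<close> lies in eAe, over which g is linear.\<close>

lemma corner_full:
  assumes "left_module A M" "left_module A N"
    and g: "g \<in> module_hom B (corner M) (corner N)" "g \<in> extensional (carrier (corner M))"
  shows "\<exists>f \<in> module_hom A M N \<inter> extensional (carrier M). restrict f (carrier (corner M)) = g"
proof -
  interpret M: left_module A M by fact
  interpret N: left_module A N by fact
  have gc: "g m \<in> carrier N" "e \<odot>\<^bsub>N\<^esub> g m = g m" if "m \<in> carrier M" "e \<odot>\<^bsub>M\<^esub> m = m" for m
    using g that by (auto simp: module_hom_def)
  have ga: "g (m \<oplus>\<^bsub>M\<^esub> m') = g m \<oplus>\<^bsub>N\<^esub> g m'"
    if "m \<in> carrier M" "e \<odot>\<^bsub>M\<^esub> m = m" "m' \<in> carrier M" "e \<odot>\<^bsub>M\<^esub> m' = m'" for m m'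
    using g that by (auto simp: module_hom_def)
  have gs: "g (a \<odot>\<^bsub>M\<^esub> m) = a \<odot>\<^bsub>N\<^esub> g m"
    if a: "a \<in> carrier A" "e \<otimes>\<^bsub>A\<^esub> a = a" "a \<otimes>\<^bsub>A\<^esub> e = a" and m: "m \<in> carrier M" "e \<odot>\<^bsub>M\<^esub> m = m" for a m
  proof -
    obtain b where "b \<in> carrier B" "a = \<Phi> b" by (rule \<Phi>_surj[OF a])
    then show ?thesis using g m by (auto simp: module_hom_def)
  qed
  define f where "f = (\<lambda>m \<in> carrier M. finsum N (\<lambda>i. p i \<odot>\<^bsub>N\<^esub> g (q i \<odot>\<^bsub>M\<^esub> m)) {..<n})"
  have qm: "q i \<odot>\<^bsub>M\<^esub> m \<in> carrier M" "e \<odot>\<^bsub>M\<^esub> (q i \<odot>\<^bsub>M\<^esub> m) = q i \<odot>\<^bsub>M\<^esub> m" if "i < n" "m \<in> carrier M" for i m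
    using that by (auto simp: M.smult_closed M.smult_assoc[symmetric] e_closed e_q)
  have fc: "f m \<in> carrier N" if "m \<in> carrier M" for m
    using that qm gc by (auto simp: f_def intro!: N.M.finsum_closed N.smult_closed)
  have fadd: "f (m \<oplus>\<^bsub>M\<^esub> m') = f m \<oplus>\<^bsub>N\<^esub> f m'" if "m \<in> carrier M" "m' \<in> carrier M" for m m'
  proof -
    have "f (m \<oplus>\<^bsub>M\<^esub> m') = finsum N (\<lambda>i. p i \<odot>\<^bsub>N\<^esub> g (q i \<odot>\<^bsub>M\<^esub> m) \<oplus>\<^bsub>N\<^esub> p i \<odot>\<^bsub>N\<^esub> g (q i \<odot>\<^bsub>M\<^esub> m')) {..<n}"
      using that qm gc by (auto simp: f_def M.smult_r_distr ga N.smult_r_distr intro!: N.M.finsum_cong' N.smult_closed)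
    also have "\<dots> = f m \<oplus>\<^bsub>N\<^esub> f m'"
      using that qm gc by (subst N.M.finsum_addf) (auto simp: f_def intro!: N.smult_closed)
    finally show ?thesis .
  qed
  have fsm: "f (a \<odot>\<^bsub>M\<^esub> m) = a \<odot>\<^bsub>N\<^esub> f m" if a: "a \<in> carrier A" and m: "m \<in> carrier M" for a m
  proof -
    \<comment> \<open>Expanding m by \<open>decompose\<close> lets \<open>q i\<close> a meet every
      \<open>p s\<close>; the product \<open>?c s\<close> belongs to eAe and may be pulled out of
      g.\<close>
    have *: "g (q i \<odot>\<^bsub>M\<^esub> (a \<odot>\<^bsub>M\<^esub> m)) = q i \<odot>\<^bsub>N\<^esub> (a \<odot>\<^bsub>N\<^esub> f m)" if i: "i < n" for i
    proof -
      let ?c = "\<lambda>s. q i \<otimes>\<^bsub>A\<^esub> (a \<otimes>\<^bsub>A\<^esub> p s)"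
      have c: "?c s \<in> carrier A" "e \<otimes>\<^bsub>A\<^esub> ?c s = ?c s" "?c s \<otimes>\<^bsub>A\<^esub> e = ?c s" if "s < n" for s
        using i that a e_closed
        by (simp_all add: A.m_assoc p_e) (simp add: A.m_assoc[symmetric] e_q)
      have cm: "?c s \<odot>\<^bsub>M\<^esub> (q s \<odot>\<^bsub>M\<^esub> m) \<in> carrier M"
        "e \<odot>\<^bsub>M\<^esub> (?c s \<odot>\<^bsub>M\<^esub> (q s \<odot>\<^bsub>M\<^esub> m)) = ?c s \<odot>\<^bsub>M\<^esub> (q s \<odot>\<^bsub>M\<^esub> m)" if "s < n" for s
        using c[OF that] qm[OF that m] e_closed
        by (simp_all add: M.smult_closed M.smult_assoc[symmetric, of e])
      have "q i \<odot>\<^bsub>M\<^esub> (a \<odot>\<^bsub>M\<^esub> m) = (q i \<otimes>\<^bsub>A\<^esub> a) \<odot>\<^bsub>M\<^esub> finsum M (\<lambda>s. p s \<odot>\<^bsub>M\<^esub> (q s \<odot>\<^bsub>M\<^esub> m)) {..<n}"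
        using i a m by (simp add: decompose assms M.smult_assoc)
      also have "\<dots> = finsum M (\<lambda>s. ?c s \<odot>\<^bsub>M\<^esub> (q s \<odot>\<^bsub>M\<^esub> m)) {..<n}"
        using i a m qm c
        by (subst M.smult_finsum) (auto intro!: M.M.finsum_cong' simp: M.smult_closed M.smult_assoc A.m_assoc)
      finally have "g (q i \<odot>\<^bsub>M\<^esub> (a \<odot>\<^bsub>M\<^esub> m)) = g (finsum M (\<lambda>s. ?c s \<odot>\<^bsub>M\<^esub> (q s \<odot>\<^bsub>M\<^esub> m)) {..<n})" by simp
      also have "\<dots> = finsum N (\<lambda>s. g (?c s \<odot>\<^bsub>M\<^esub> (q s \<odot>\<^bsub>M\<^esub> m))) {..<n}"
      proof -
        \<comment> \<open>Additivity of g is available only on the corner, so the induction also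
          records that the partial sums stay there.\<close>
        have "g (finsum M (\<lambda>s. ?c s \<odot>\<^bsub>M\<^esub> (q s \<odot>\<^bsub>M\<^esub> m)) S) = finsum N (\<lambda>s. g (?c s \<odot>\<^bsub>M\<^esub> (q s \<odot>\<^bsub>M\<^esub> m))) S
            \<and> finsum M (\<lambda>s. ?c s \<odot>\<^bsub>M\<^esub> (q s \<odot>\<^bsub>M\<^esub> m)) S \<in> carrier (corner M)"
          if "finite S" "S \<subseteq> {..<n}" for S using that
        proof (induction rule: finite_induct)
          case empty
          have "g (\<zero>\<^bsub>A\<^esub> \<odot>\<^bsub>M\<^esub> \<zero>\<^bsub>M\<^esub>) = \<zero>\<^bsub>A\<^esub> \<odot>\<^bsub>N\<^esub> g \<zero>\<^bsub>M\<^esub>"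
            by (rule gs) (auto simp: e_closed M.smult_zero)
          then show ?case by (simp add: M.smult_zero N.zero_smult gc e_closed)
        next
          case (insert x F)
          then have "?c x \<odot>\<^bsub>M\<^esub> (q x \<odot>\<^bsub>M\<^esub> m) \<in> carrier M" "g (?c x \<odot>\<^bsub>M\<^esub> (q x \<odot>\<^bsub>M\<^esub> m)) \<in> carrier N"
              "\<forall>s\<in>F. ?c s \<odot>\<^bsub>M\<^esub> (q s \<odot>\<^bsub>M\<^esub> m) \<in> carrier M"  "\<forall>s\<in>F. g (?c s \<odot>\<^bsub>M\<^esub> (q s \<odot>\<^bsub>M\<^esub> m)) \<in> carrier N"
            using cm gc by auto
          then show ?case using insert cm
            by (simp add: Pi_iff ga M.smult_r_distr e_closed)
        qed
        then show ?thesis by blast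
      qed
      also have "\<dots> = finsum N (\<lambda>s. (q i \<otimes>\<^bsub>A\<^esub> a) \<odot>\<^bsub>N\<^esub> (p s \<odot>\<^bsub>N\<^esub> g (q s \<odot>\<^bsub>M\<^esub> m))) {..<n}"
        using i a m qm c gc gs by (intro N.M.finsum_cong') (auto simp: N.smult_closed N.smult_assoc)
      also have "\<dots> = (q i \<otimes>\<^bsub>A\<^esub> a) \<odot>\<^bsub>N\<^esub> f m"
        using i a m qm gc by (subst N.smult_finsum[symmetric]) (auto simp: f_def N.smult_closed)
      finally show ?thesis using i a fc[OF m] by (simp add: N.smult_assoc)
    qed
    have "f (a \<odot>\<^bsub>M\<^esub> m) = finsum N (\<lambda>i. p i \<odot>\<^bsub>N\<^esub> (q i \<odot>\<^bsub>N\<^esub> (a \<odot>\<^bsub>N\<^esub> f m))) {..<n}"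
      using a m * fc by (auto simp: f_def M.smult_closed N.smult_closed intro!: N.M.finsum_cong')
    then show ?thesis using a fc[OF m] by (simp add: decompose assms N.smult_closed)
  qed
  have "restrict f (carrier (corner M)) m = g m" for m
  proof (cases "m \<in> carrier (corner M)")
    case True
    then have m: "m \<in> carrier M" "e \<odot>\<^bsub>M\<^esub> m = m" by auto
    have "g (q i \<odot>\<^bsub>M\<^esub> m) = q i \<odot>\<^bsub>N\<^esub> g m" if i: "i < n" for i
    proof -
      \<comment> \<open>\<open>q i\<close> need not be fixed by e on the right. Since m = e m, it
        may be replaced by \<open>q i\<close> e, which lies in eAe.\<close>
      have "e \<otimes>\<^bsub>A\<^esub> (q i \<otimes>\<^bsub>A\<^esub> e) = q i \<otimes>\<^bsub>A\<^esub> e"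
        using i e_closed by (simp add: A.m_assoc[symmetric] e_q)
      then have "g ((q i \<otimes>\<^bsub>A\<^esub> e) \<odot>\<^bsub>M\<^esub> m) = (q i \<otimes>\<^bsub>A\<^esub> e) \<odot>\<^bsub>N\<^esub> g m"
        using i m e_closed by (intro gs) (auto simp: A.m_assoc e_idem)
      then show ?thesis using i m e_closed gc by (simp add: M.smult_assoc N.smult_assoc)
    qed
    then have "f m = finsum N (\<lambda>i. p i \<odot>\<^bsub>N\<^esub> (q i \<odot>\<^bsub>N\<^esub> g m)) {..<n}"
      using m gc[OF m] by (auto simp: f_def N.smult_closed intro!: N.M.finsum_cong')
    then show ?thesis using True gc[OF m] by (simp add: decompose assms)
  qed (use g in \<open>auto simp: extensional_def\<close>)
  then show ?thesis using fc fadd fsm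
    by (intro bexI[of _ f]) (auto simp: module_hom_def fun_eq_iff f_def extensional_def)
qed

text \<open>Applying a morphism to \<open>decompose\<close> leaves only its values at the elements
  \<open>q i\<close> m of the corner.\<close>

lemma corner_faithful:
  assumes "left_module A M" "left_module A N"
    and f: "f \<in> module_hom A M N \<inter> extensional (carrier M)"
    and g: "g \<in> module_hom A M N \<inter> extensional (carrier M)"
    and eq: "restrict f (carrier (corner M)) = restrict g (carrier (corner M))"
  shows "f = g"
proof (rule extensionalityI)
  interpret M: left_module A M by fact
  interpret N: left_module A N by fact
  fix m assume m: "m \<in> carrier M"
  have *: "h m = finsum N (\<lambda>i. p i \<odot>\<^bsub>N\<^esub> h (q i \<odot>\<^bsub>M\<^esub> m)) {..<n}"
    if h: "h \<in> module_hom A M N" for h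
  proof -
    have "h m = h (finsum M (\<lambda>i. p i \<odot>\<^bsub>M\<^esub> (q i \<odot>\<^bsub>M\<^esub> m)) {..<n})"
      using m by (simp add: decompose assms)
    also have "\<dots> = finsum N (\<lambda>i. h (p i \<odot>\<^bsub>M\<^esub> (q i \<odot>\<^bsub>M\<^esub> m))) {..<n}"
      using h m by (intro finsum_hom) (auto simp: module_hom_def M.smult_closed M.M.abelian_group_axioms N.M.abelian_group_axioms)
    also have "\<dots> = finsum N (\<lambda>i. p i \<odot>\<^bsub>N\<^esub> h (q i \<odot>\<^bsub>M\<^esub> m)) {..<n}"
      using h m by (intro N.M.finsum_cong') (auto simp: module_hom_def M.smult_closed N.smult_closed Pi_iff)
    finally show ?thesis .
  qed
  have "q i \<odot>\<^bsub>M\<^esub> m \<in> carrier (corner M)" if "i < n" for i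
    using that m e_closed by (simp add: M.smult_closed M.smult_assoc[symmetric] e_q)
  then have "f (q i \<odot>\<^bsub>M\<^esub> m) = g (q i \<odot>\<^bsub>M\<^esub> m)" if "i < n" for i
    using that eq by (metis restrict_apply')
  then show "f m = g m" using *[of f] *[of g] f g m
    by (auto simp: module_hom_def M.smult_closed N.smult_closed Pi_iff intro!: N.M.finsum_cong')
qed (use f g in auto)

text \<open>The quasi-inverse on objects is coinduction, \<open>N \<mapsto> Hom\<^sub>B(eA, N)\<close>.\<close>

definition coind :: "('b, 'm) module \<Rightarrow> ('a, 'a \<Rightarrow> 'm) module" where
  "coind N = (let E = {z \<in> carrier A. e \<otimes>\<^bsub>A\<^esub> z = z} in
    \<lparr>carrier = {h \<in> E \<rightarrow>\<^sub>E carrier N. (\<forall>z \<in> E. \<forall>w \<in> E. h (z \<oplus>\<^bsub>A\<^esub> w) = h z \<oplus>\<^bsub>N\<^esub> h w) \<and>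
       (\<forall>b \<in> carrier B. \<forall>z \<in> E. h (\<Phi> b \<otimes>\<^bsub>A\<^esub> z) = b \<odot>\<^bsub>N\<^esub> h z)},
     monoid.mult = (\<lambda>h k. h), one = (\<lambda>z \<in> E. \<zero>\<^bsub>N\<^esub>), zero = (\<lambda>z \<in> E. \<zero>\<^bsub>N\<^esub>),
     add = (\<lambda>h k. \<lambda>z \<in> E. h z \<oplus>\<^bsub>N\<^esub> k z), smult = (\<lambda>a h. \<lambda>z \<in> E. h (z \<otimes>\<^bsub>A\<^esub> a))\<rparr>)"

text \<open>Multiplying the argument on the right by a commutes with the action of \<open>B\<close>
  on eA from the left, so linearity over \<open>B\<close> survives. Precomposition reverses the
  order of products, which makes this a left action.\<close>

lemma left_module_coind:
  assumes "left_module B N" shows "left_module A (coind N)"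
proof -
  interpret N: left_module B N by fact
  define E where "E = {z \<in> carrier A. e \<otimes>\<^bsub>A\<^esub> z = z}"
  have EA: "z \<in> carrier A" if "z \<in> E" for z using that by (simp add: E_def)
  have r: "z \<otimes>\<^bsub>A\<^esub> a \<in> E" if "z \<in> E" "a \<in> carrier A" for z a
    using that e_closed by (simp add: E_def A.m_assoc[symmetric])
  have l: "\<Phi> b \<otimes>\<^bsub>A\<^esub> z \<in> E" if "z \<in> E" "b \<in> carrier B" for z b
    using that e_closed \<Phi>_closed e_\<Phi> by (simp add: E_def A.m_assoc[symmetric])
  have s: "z \<oplus>\<^bsub>A\<^esub> w \<in> E" if "z \<in> E" "w \<in> E" for z w
    using that e_closed by (simp add: E_def A.r_distr)
  have [simp]: "\<zero>\<^bsub>coind N\<^esub> = (\<lambda>z \<in> E. \<zero>\<^bsub>N\<^esub>)" "h \<oplus>\<^bsub>coind N\<^esub> k = (\<lambda>z \<in> E. h z \<oplus>\<^bsub>N\<^esub> k z)"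
    "a \<odot>\<^bsub>coind N\<^esub> h = (\<lambda>z \<in> E. h (z \<otimes>\<^bsub>A\<^esub> a))" for a h k
    by (simp_all add: coind_def Let_def E_def)
  have mem: "h \<in> carrier (coind N) \<longleftrightarrow> h \<in> extensional E \<and> (\<forall>z \<in> E. h z \<in> carrier N) \<and>
     (\<forall>z \<in> E. \<forall>w \<in> E. h (z \<oplus>\<^bsub>A\<^esub> w) = h z \<oplus>\<^bsub>N\<^esub> h w) \<and>
     (\<forall>b \<in> carrier B. \<forall>z \<in> E. h (\<Phi> b \<otimes>\<^bsub>A\<^esub> z) = b \<odot>\<^bsub>N\<^esub> h z)" for h
    by (auto simp: coind_def Let_def E_def[symmetric] PiE_iff)
  have eqI: "h = k" if "h \<in> extensional E" "k \<in> extensional E" "\<And>z. z \<in> E \<Longrightarrow> h z = k z" for h k :: "'a \<Rightarrow> 'm"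
    using that by (rule extensionalityI)
  have ab: "abelian_group (coind N)"
  proof (rule abelian_groupI)
    fix h assume h: "h \<in> carrier (coind N)"
    show "\<exists>k\<in>carrier (coind N). k \<oplus>\<^bsub>coind N\<^esub> h = \<zero>\<^bsub>coind N\<^esub>"
    proof (intro bexI[of _ "\<lambda>z \<in> E. \<ominus>\<^bsub>N\<^esub> h z"])
      show "(\<lambda>z \<in> E. \<ominus>\<^bsub>N\<^esub> h z) \<in> carrier (coind N)"
        using h by (simp add: mem s l N.M.minus_add N.smult_minus N.M.a_comm)
      show "(\<lambda>z \<in> E. \<ominus>\<^bsub>N\<^esub> h z) \<oplus>\<^bsub>coind N\<^esub> h = \<zero>\<^bsub>coind N\<^esub>"
        using h by (intro eqI) (simp_all add: mem N.M.l_neg)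
    qed
    show "\<zero>\<^bsub>coind N\<^esub> \<oplus>\<^bsub>coind N\<^esub> h = h"
      using h by (intro eqI) (simp_all add: mem)
  next
    fix h k assume h: "h \<in> carrier (coind N)" and k: "k \<in> carrier (coind N)"
    show "h \<oplus>\<^bsub>coind N\<^esub> k \<in> carrier (coind N)"
      using h k by (simp add: mem s l N.smult_r_distr N.M.a_ac)
    show "h \<oplus>\<^bsub>coind N\<^esub> k = k \<oplus>\<^bsub>coind N\<^esub> h"
      using h k by (intro eqI) (simp_all add: mem N.M.a_comm)
  next
    fix h k m assume "h \<in> carrier (coind N)" "k \<in> carrier (coind N)" "m \<in> carrier (coind N)"
    then show "h \<oplus>\<^bsub>coind N\<^esub> k \<oplus>\<^bsub>coind N\<^esub> m = h \<oplus>\<^bsub>coind N\<^esub> (k \<oplus>\<^bsub>coind N\<^esub> m)"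
      by (intro eqI) (simp_all add: mem N.M.a_assoc)
  next
    show "\<zero>\<^bsub>coind N\<^esub> \<in> carrier (coind N)"
      by (simp add: mem s l N.smult_zero)
  qed
  show ?thesis
  proof (rule left_moduleI)
    show "ring A" by (rule A.ring_axioms)
    show "abelian_group (coind N)" by (rule ab)
  next
    fix a h assume a: "a \<in> carrier A" and h: "h \<in> carrier (coind N)"
    show "a \<odot>\<^bsub>coind N\<^esub> h \<in> carrier (coind N)"
      using a h by (simp add: mem s l r EA A.l_distr A.m_assoc \<Phi>_closed)
  next
    fix a b h assume "a \<in> carrier A" "b \<in> carrier A" and h: "h \<in> carrier (coind N)"
    then show "(a \<oplus>\<^bsub>A\<^esub> b) \<odot>\<^bsub>coind N\<^esub> h = a \<odot>\<^bsub>coind N\<^esub> h \<oplus>\<^bsub>coind N\<^esub> b \<odot>\<^bsub>coind N\<^esub> h"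
      by (intro eqI) (simp_all add: mem r EA A.r_distr)
  next
    fix a h k assume "a \<in> carrier A" "h \<in> carrier (coind N)" "k \<in> carrier (coind N)"
    then show "a \<odot>\<^bsub>coind N\<^esub> (h \<oplus>\<^bsub>coind N\<^esub> k) = a \<odot>\<^bsub>coind N\<^esub> h \<oplus>\<^bsub>coind N\<^esub> a \<odot>\<^bsub>coind N\<^esub> k"
      by (intro eqI) (simp_all add: r)
  next
    fix a b h assume "a \<in> carrier A" "b \<in> carrier A" and h: "h \<in> carrier (coind N)"
    then show "(a \<otimes>\<^bsub>A\<^esub> b) \<odot>\<^bsub>coind N\<^esub> h = a \<odot>\<^bsub>coind N\<^esub> (b \<odot>\<^bsub>coind N\<^esub> h)"
      by (intro eqI) (simp_all add: r EA A.m_assoc)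
  next
    fix h assume "h \<in> carrier (coind N)"
    then show "\<one>\<^bsub>A\<^esub> \<odot>\<^bsub>coind N\<^esub> h = h"
      by (intro eqI) (simp_all add: mem EA)
  qed
qed

text \<open>Evaluation at e identifies e Hom(eA, \<open>N\<close>) with \<open>N\<close>. The
  coinduced module consists of functions on \<open>'a\<close>, but such a function is determined by
  its values at the finitely many \<open>q i\<close>. So it embeds into a finite power of
  \<open>N\<close>, for which there is room in an infinite \<open>N\<close>; a finite
  \<open>N\<close> is zero, and then one point suffices.\<close>

lemma corner_surj:
  fixes N :: "('b, 'm) module"
  assumes N: "left_module B N" and fin: "finite (carrier N) \<Longrightarrow> carrier N = {\<zero>\<^bsub>N\<^esub>}"
  shows "\<exists>M :: ('a, 'm) module. left_module A M \<and> iso_in (module_category B) (corner M) N \<noteq> {}"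
proof -
  interpret N: left_module B N by fact
  let ?E = "{z \<in> carrier A. e \<otimes>\<^bsub>A\<^esub> z = z}"
  let ?C = "coind N"
  interpret C: left_module A ?C by (rule left_module_coind[OF N])
  have hadd: "h (z \<oplus>\<^bsub>A\<^esub> w) = h z \<oplus>\<^bsub>N\<^esub> h w" if "h \<in> carrier ?C" "z \<in> ?E" "w \<in> ?E" for h z w
    using that by (simp add: coind_def Let_def)
  have h\<Phi>: "h (\<Phi> b \<otimes>\<^bsub>A\<^esub> z) = b \<odot>\<^bsub>N\<^esub> h z" if "h \<in> carrier ?C" "z \<in> ?E" "b \<in> carrier B" for h z b
    using that by (simp add: coind_def Let_def)
  have hc: "h z \<in> carrier N" if "h \<in> carrier ?C" "z \<in> ?E" for h z
    using that by (auto simp: coind_def Let_def)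
  have hext: "h \<in> extensional ?E" if "h \<in> carrier ?C" for h
    using that by (auto simp: coind_def Let_def PiE_iff)
  obtain \<iota> :: "(nat \<Rightarrow> 'm) \<Rightarrow> 'm" where \<iota>: "inj_on \<iota> ({..<n} \<rightarrow>\<^sub>E carrier N)"
  proof (cases "finite (carrier N)")
    case True
    have "inj_on (\<lambda>_. \<zero>\<^bsub>N\<^esub>) ({..<n} \<rightarrow>\<^sub>E carrier N)"
      using fin[OF True] by (auto simp: inj_on_def intro: PiE_ext)
    then show ?thesis by (rule that)
  next
    case False
    then show ?thesis using infinite_power_inj that by blast
  qed
  define j where "j h = \<iota> (\<lambda>i \<in> {..<n}. h (q i))" for h
  \<comment> \<open>z is the sum of the (z \<open>p i\<close>) \<open>q i\<close>, and z
    \<open>p i\<close> lies in eAe; linearity over \<open>B\<close> thus expresses h z through the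
    values h (\<open>q i\<close>).\<close>
  have det: "h z = k z" if h: "h \<in> carrier ?C" and k: "k \<in> carrier ?C" and eq: "\<And>i. i < n \<Longrightarrow> h (q i) = k (q i)"
    and z: "z \<in> ?E" for h k z
  proof -
    have t: "(z \<otimes>\<^bsub>A\<^esub> p i) \<otimes>\<^bsub>A\<^esub> q i \<in> ?E" "h ((z \<otimes>\<^bsub>A\<^esub> p i) \<otimes>\<^bsub>A\<^esub> q i) = k ((z \<otimes>\<^bsub>A\<^esub> p i) \<otimes>\<^bsub>A\<^esub> q i)" if i: "i < n" for i
    proof -
      have "z \<otimes>\<^bsub>A\<^esub> p i \<in> carrier A" "e \<otimes>\<^bsub>A\<^esub> (z \<otimes>\<^bsub>A\<^esub> p i) = z \<otimes>\<^bsub>A\<^esub> p i" "(z \<otimes>\<^bsub>A\<^esub> p i) \<otimes>\<^bsub>A\<^esub> e = z \<otimes>\<^bsub>A\<^esub> p i"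
        using i z e_closed by (auto simp: A.m_assoc p_e) (simp add: A.m_assoc[symmetric])
      then obtain b where b: "b \<in> carrier B" "z \<otimes>\<^bsub>A\<^esub> p i = \<Phi> b" by (rule \<Phi>_surj)
      then show "(z \<otimes>\<^bsub>A\<^esub> p i) \<otimes>\<^bsub>A\<^esub> q i \<in> ?E" "h ((z \<otimes>\<^bsub>A\<^esub> p i) \<otimes>\<^bsub>A\<^esub> q i) = k ((z \<otimes>\<^bsub>A\<^esub> p i) \<otimes>\<^bsub>A\<^esub> q i)"
        using i h k eq by (auto simp: h\<Phi> e_q \<Phi>_closed e_closed e_\<Phi> A.m_assoc[symmetric])
    qed
    have "h (finsum A (\<lambda>i. (z \<otimes>\<^bsub>A\<^esub> p i) \<otimes>\<^bsub>A\<^esub> q i) S) = k (finsum A (\<lambda>i. (z \<otimes>\<^bsub>A\<^esub> p i) \<otimes>\<^bsub>A\<^esub> q i) S)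
       \<and> finsum A (\<lambda>i. (z \<otimes>\<^bsub>A\<^esub> p i) \<otimes>\<^bsub>A\<^esub> q i) S \<in> ?E" if "finite S" "S \<subseteq> {..<n}" for S using that
    proof (induction rule: finite_induct)
      case empty
      have "h (\<Phi> \<zero>\<^bsub>B\<^esub> \<otimes>\<^bsub>A\<^esub> \<zero>\<^bsub>A\<^esub>) = k (\<Phi> \<zero>\<^bsub>B\<^esub> \<otimes>\<^bsub>A\<^esub> \<zero>\<^bsub>A\<^esub>)"
        using hc h k e_closed by (simp add: h\<Phi> N.zero_smult)
      then show ?case using e_closed \<Phi>_closed by simp
    next
      case (insert x F)
      then have "(z \<otimes>\<^bsub>A\<^esub> p x) \<otimes>\<^bsub>A\<^esub> q x \<in> carrier A" "\<forall>s\<in>F. (z \<otimes>\<^bsub>A\<^esub> p s) \<otimes>\<^bsub>A\<^esub> q s \<in> carrier A" using t by auto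
      then show ?case using insert t h k by (simp add: Pi_iff hadd A.r_distr e_closed)
    qed
    from this[of "{..<n}"] have "h (finsum A (\<lambda>i. (z \<otimes>\<^bsub>A\<^esub> p i) \<otimes>\<^bsub>A\<^esub> q i) {..<n}) = k (finsum A (\<lambda>i. (z \<otimes>\<^bsub>A\<^esub> p i) \<otimes>\<^bsub>A\<^esub> q i) {..<n})"
      by simp
    also have "finsum A (\<lambda>i. (z \<otimes>\<^bsub>A\<^esub> p i) \<otimes>\<^bsub>A\<^esub> q i) {..<n} = z \<otimes>\<^bsub>A\<^esub> finsum A (\<lambda>i. p i \<otimes>\<^bsub>A\<^esub> q i) {..<n}"
      using z by (subst A.finsum_rdistr) (auto intro!: A.finsum_cong' simp: A.m_assoc)
    finally show ?thesis using z by (simp add: full)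
  qed
  have qE: "q i \<in> ?E" if "i < n" for i using that by (simp add: e_q)
  have j: "inj_on j (carrier ?C)"
  proof (rule inj_onI)
    fix h k assume h: "h \<in> carrier ?C" and k: "k \<in> carrier ?C" and "j h = j k"
    then have "(\<lambda>i \<in> {..<n}. h (q i)) = (\<lambda>i \<in> {..<n}. k (q i))"
      unfolding j_def using hc qE by (intro inj_onD[OF \<iota>]) auto
    then have "h (q i) = k (q i)" if "i < n" for i using that by (metis lessThan_iff restrict_apply')
    then show "h = k" using det[OF h k] h k by (intro extensionalityI[OF hext hext]) auto
  qed
  let ?M = "transport_module j ?C" and ?i = "inv_into (carrier ?C) j"
  interpret M: left_module A ?M by (rule left_module_transport[OF C.left_module_axioms j])
  have ij: "?i (j h) = h" if "h \<in> carrier ?C" for h using j that by simp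
  have eE: "e \<in> ?E" using e_closed e_idem by simp
  define f where "f = (\<lambda>m \<in> carrier (corner ?M). ?i m e)"
  \<comment> \<open>The inverse of evaluation at e: v goes to the function that sends z to the
    \<Phi>-preimage of ze applied to v. The preimage is unique because ze lies in eAe.\<close>
  define g where "g = (\<lambda>v \<in> carrier N. j (\<lambda>z \<in> ?E. (THE b. b \<in> carrier B \<and> \<Phi> b = z \<otimes>\<^bsub>A\<^esub> e) \<odot>\<^bsub>N\<^esub> v))"
  have cornerM: "m \<in> carrier (corner ?M) \<longleftrightarrow> (\<exists>h \<in> carrier ?C. m = j h \<and> (\<forall>z \<in> ?E. h (z \<otimes>\<^bsub>A\<^esub> e) = h z))" for m
  proof -
    have "m \<in> carrier (corner ?M) \<longleftrightarrow> (\<exists>h \<in> carrier ?C. m = j h \<and> e \<odot>\<^bsub>?C\<^esub> h = h)"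
      using ij inj_onD[OF j] C.smult_closed[OF e_closed]
      by (auto simp: transport_module_def Let_def)
    also have "e \<odot>\<^bsub>?C\<^esub> h = h \<longleftrightarrow> (\<forall>z \<in> ?E. h (z \<otimes>\<^bsub>A\<^esub> e) = h z)" if "h \<in> carrier ?C" for h
      using hext[OF that] by (auto simp: coind_def Let_def fun_eq_iff extensional_def)
    then have "(\<exists>h \<in> carrier ?C. m = j h \<and> e \<odot>\<^bsub>?C\<^esub> h = h) \<longleftrightarrow> (\<exists>h \<in> carrier ?C. m = j h \<and> (\<forall>z \<in> ?E. h (z \<otimes>\<^bsub>A\<^esub> e) = h z))"
      by blast
    finally show ?thesis .
  qed
  have eAe: "\<exists>!b. b \<in> carrier B \<and> \<Phi> b = z \<otimes>\<^bsub>A\<^esub> e" if "z \<in> ?E" for z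
  proof -
    have "e \<otimes>\<^bsub>A\<^esub> (z \<otimes>\<^bsub>A\<^esub> e) = z \<otimes>\<^bsub>A\<^esub> e" "(z \<otimes>\<^bsub>A\<^esub> e) \<otimes>\<^bsub>A\<^esub> e = z \<otimes>\<^bsub>A\<^esub> e" "z \<otimes>\<^bsub>A\<^esub> e \<in> carrier A"
      using that e_closed by (auto simp: A.m_assoc e_idem) (simp add: A.m_assoc[symmetric])
    then show ?thesis by (metis \<Phi>_surj \<Phi>_inj)
  qed
  define \<Psi> where "\<Psi> z = (THE b. b \<in> carrier B \<and> \<Phi> b = z \<otimes>\<^bsub>A\<^esub> e)" for z
  have \<Psi>: "\<Psi> z \<in> carrier B" "\<Phi> (\<Psi> z) = z \<otimes>\<^bsub>A\<^esub> e" if "z \<in> ?E" for z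
    using theI'[OF eAe[OF that]] by (auto simp: \<Psi>_def)
  have \<Psi>I: "\<Psi> z = b" if "b \<in> carrier B" "\<Phi> b = z \<otimes>\<^bsub>A\<^esub> e" "z \<in> ?E" for z b
    using eAe[OF that(3)] that \<Psi>[OF that(3)] by blast
  have \<Psi>add: "\<Psi> (z \<oplus>\<^bsub>A\<^esub> w) = \<Psi> z \<oplus>\<^bsub>B\<^esub> \<Psi> w" if "z \<in> ?E" "w \<in> ?E" for z w
    using that \<Psi>[OF that(1)] \<Psi>[OF that(2)] e_closed by (intro \<Psi>I) (auto simp: \<Phi>_add A.l_distr A.r_distr)
  have \<Psi>mult: "\<Psi> (\<Phi> b \<otimes>\<^bsub>A\<^esub> z) = b \<otimes>\<^bsub>B\<^esub> \<Psi> z" if "z \<in> ?E" "b \<in> carrier B" for z b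
    using that \<Psi>[OF that(1)] e_closed \<Phi>_closed e_\<Phi>
    by (intro \<Psi>I) (auto simp: \<Phi>_mult A.m_assoc, simp add: A.m_assoc[symmetric])
  have \<Psi>e: "\<Psi> (z \<otimes>\<^bsub>A\<^esub> e) = \<Psi> z" if "z \<in> ?E" for z
    using that \<Psi>[OF that] e_closed by (intro \<Psi>I) (auto simp: A.m_assoc e_idem, simp add: A.m_assoc[symmetric])
  have \<Psi>1: "\<Psi> e = \<one>\<^bsub>B\<^esub>" using eE by (intro \<Psi>I) (auto simp: \<Phi>_one e_idem)
  define k where "k v = (\<lambda>z \<in> ?E. \<Psi> z \<odot>\<^bsub>N\<^esub> v)" for v
  have g_eq: "g v = j (k v)" if "v \<in> carrier N" for v using that by (simp add: g_def k_def \<Psi>_def)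
  have kC: "k v \<in> carrier ?C" if "v \<in> carrier N" for v
    using that \<Psi> e_\<Phi> \<Phi>_closed e_closed
    by (auto simp: coind_def Let_def k_def N.smult_closed \<Psi>add \<Psi>mult N.smult_l_distr N.smult_assoc A.r_distr
        A.m_assoc[symmetric])
  have kcorner: "k v (z \<otimes>\<^bsub>A\<^esub> e) = k v z" if "v \<in> carrier N" "z \<in> ?E" for v z
    using that \<Psi>e[OF that(2)] e_closed by (auto simp: k_def A.m_assoc[symmetric])
  \<comment> \<open>A function fixed by e satisfies h z = h (ze). As ze = (ze)e with ze in eAe, its
    values are determined by h e.\<close>
  have h_eq: "h z = \<Psi> z \<odot>\<^bsub>N\<^esub> h e" if "h \<in> carrier ?C" "\<forall>z \<in> ?E. h (z \<otimes>\<^bsub>A\<^esub> e) = h z" "z \<in> ?E" for h z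
    using h\<Phi>[OF that(1) eE \<Psi>(1)[OF that(3)]] \<Psi>(2)[OF that(3)] that e_closed by (simp add: A.m_assoc e_idem)
  have "f \<in> module_hom B (corner ?M) N"
    unfolding module_hom_def mem_Collect_eq
  proof (intro conjI allI impI)
    show "f \<in> carrier (corner ?M) \<rightarrow> carrier N"
      by (auto simp: f_def cornerM ij hc[OF _ eE] simp del: corner_simps)
  next
    fix m m' assume m: "m \<in> carrier (corner ?M) \<and> m' \<in> carrier (corner ?M)"
    then obtain h h' where h: "h \<in> carrier ?C" "m = j h" and h': "h' \<in> carrier ?C" "m' = j h'"
      by (auto simp: cornerM simp del: corner_simps)
    interpret cM: left_module B "corner ?M" by (rule left_module_corner) unfold_locales
    have s: "m \<oplus>\<^bsub>corner ?M\<^esub> m' \<in> carrier (corner ?M)" using m by blast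
    have "m \<oplus>\<^bsub>corner ?M\<^esub> m' = j (h \<oplus>\<^bsub>?C\<^esub> h')" using h h' by (simp add: transport_module_def Let_def ij)
    then have "f (m \<oplus>\<^bsub>corner ?M\<^esub> m') = (h \<oplus>\<^bsub>?C\<^esub> h') e"
      using s h h' by (simp add: f_def ij del: corner_simps)
    also have "\<dots> = h e \<oplus>\<^bsub>N\<^esub> h' e" using eE by (simp add: coind_def Let_def)
    also have "\<dots> = f m \<oplus>\<^bsub>N\<^esub> f m'" using m h h' by (simp add: f_def ij del: corner_simps)
    finally show "f (m \<oplus>\<^bsub>corner ?M\<^esub> m') = f m \<oplus>\<^bsub>N\<^esub> f m'" .
  next
    fix b m assume m: "b \<in> carrier B \<and> m \<in> carrier (corner ?M)"
    then obtain h where h: "h \<in> carrier ?C" "m = j h"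
      by (auto simp: cornerM simp del: corner_simps)
    interpret cM: left_module B "corner ?M" by (rule left_module_corner) unfold_locales
    have s: "b \<odot>\<^bsub>corner ?M\<^esub> m \<in> carrier (corner ?M)" using m cM.smult_closed by blast
    have b: "\<Phi> b \<in> carrier A" using m \<Phi>_closed by blast
    have "b \<odot>\<^bsub>corner ?M\<^esub> m = j (\<Phi> b \<odot>\<^bsub>?C\<^esub> h)" using h by (simp add: transport_module_def Let_def ij)
    then have "f (b \<odot>\<^bsub>corner ?M\<^esub> m) = (\<Phi> b \<odot>\<^bsub>?C\<^esub> h) e"
      using s h b C.smult_closed by (simp add: f_def ij del: corner_simps)
    also have "\<dots> = h (\<Phi> b \<otimes>\<^bsub>A\<^esub> e)" using eE m by (simp add: coind_def Let_def e_\<Phi> \<Phi>_e)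
    also have "\<dots> = b \<odot>\<^bsub>N\<^esub> f m" using m h h\<Phi>[OF h(1) eE] by (simp add: f_def ij del: corner_simps)
    finally show "f (b \<odot>\<^bsub>corner ?M\<^esub> m) = b \<odot>\<^bsub>N\<^esub> f m" .
  qed
  then have f: "f \<in> Hom (module_category B) (corner ?M) N"
    by (simp add: module_category_def f_def)
  have gin: "g v \<in> carrier (corner ?M)" if "v \<in> carrier N" for v
    unfolding cornerM using that kC kcorner g_eq by blast
  have fg: "f (g v) = v" if v: "v \<in> carrier N" for v
    using gin[OF v] kC[OF v] eE v by (simp add: f_def g_eq ij k_def \<Psi>1 N.smult_one del: corner_simps)
  have gf: "g (f m) = m" if m: "m \<in> carrier (corner ?M)" for m
  proof -
    obtain h where h: "h \<in> carrier ?C" "m = j h" "\<forall>z \<in> ?E. h (z \<otimes>\<^bsub>A\<^esub> e) = h z"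
      using m unfolding cornerM by blast
    have "k (h e) = h"
    proof (rule extensionalityI[of _ ?E])
      show "k (h e) z = h z" if "z \<in> ?E" for z using h_eq[OF h(1,3) that] that by (simp add: k_def)
    qed (use hext h in \<open>auto simp: k_def\<close>)
    moreover have "f m = h e" using m h by (simp add: f_def ij del: corner_simps)
    ultimately show ?thesis using h hc[OF h(1) eE] by (simp add: g_eq)
  qed
  \<comment> \<open>Linearity is inherited from f: both sides of each law agree after applying f,
    which is injective.\<close>
  have "g \<in> module_hom B N (corner ?M)"
  proof -
    interpret cM: left_module B "corner ?M" by (rule left_module_corner) unfold_locales
    have fh: "f \<in> module_hom B (corner ?M) N" using f by (simp add: module_category_def)
    have finj: "m = m'" if "f m = f m'" "m \<in> carrier (corner ?M)" "m' \<in> carrier (corner ?M)" for m m'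
      using that gf by metis
    have fadd: "f (m \<oplus>\<^bsub>corner ?M\<^esub> m') = f m \<oplus>\<^bsub>N\<^esub> f m'"
      if "m \<in> carrier (corner ?M)" "m' \<in> carrier (corner ?M)" for m m'
      using fh that unfolding module_hom_def by blast
    have fsmult: "f (b \<odot>\<^bsub>corner ?M\<^esub> m) = b \<odot>\<^bsub>N\<^esub> f m"
      if "b \<in> carrier B" "m \<in> carrier (corner ?M)" for b m
      using fh that unfolding module_hom_def by blast
    have "g (v \<oplus>\<^bsub>N\<^esub> w) = g v \<oplus>\<^bsub>corner ?M\<^esub> g w" if v: "v \<in> carrier N" and w: "w \<in> carrier N" for v w
    proof (rule finj)
      show "f (g (v \<oplus>\<^bsub>N\<^esub> w)) = f (g v \<oplus>\<^bsub>corner ?M\<^esub> g w)"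
        unfolding fadd[OF gin[OF v] gin[OF w]] fg[OF v] fg[OF w] by (rule fg) (simp add: v w)
    qed (use gin v w in blast)+
    moreover have "g (b \<odot>\<^bsub>N\<^esub> v) = b \<odot>\<^bsub>corner ?M\<^esub> g v" if b: "b \<in> carrier B" and v: "v \<in> carrier N" for v b
    proof (rule finj)
      show "f (g (b \<odot>\<^bsub>N\<^esub> v)) = f (b \<odot>\<^bsub>corner ?M\<^esub> g v)"
        unfolding fsmult[OF b gin[OF v]] fg[OF v] by (rule fg) (simp add: v b N.smult_closed)
    qed (use gin v b N.smult_closed cM.smult_closed in blast)+
    ultimately show ?thesis using gin unfolding module_hom_def by blast
  qed
  then have g: "g \<in> Hom (module_category B) N (corner ?M)"
    by (simp add: module_category_def g_def)
  have "compose (carrier (corner ?M)) g f = (\<lambda>m \<in> carrier (corner ?M). m)"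
    unfolding compose_def using gf by (rule restrict_ext)
  moreover have "compose (carrier N) f g = (\<lambda>v \<in> carrier N. v)"
    unfolding compose_def using fg by (rule restrict_ext)
  ultimately have "f \<in> iso_in (module_category B) (corner ?M) N"
    using f g unfolding iso_in_def by (auto simp: module_category_def simp del: corner_simps)
  then show ?thesis using M.left_module_axioms by blast
qed

text \<open>Modules have to be constructed only over \<open>A\<close>, from given ones over
  \<open>B\<close>; the size condition is therefore one on \<open>B\<close>-modules.\<close>

theorem morita_equivalence:
  assumes "\<And>N :: ('b, 'm) module. \<lbrakk>left_module B N; finite (carrier N)\<rbrakk> \<Longrightarrow> carrier N = {\<zero>\<^bsub>N\<^esub>}"
  shows "equivalent_categories (module_category B :: (_, 'm \<Rightarrow> 'm) category)
    (module_category A :: (_, 'm \<Rightarrow> 'm) category)"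
proof (rule equivalent_categories_if_fully_faithful[OF corner_functor_cat_functor])
  show "\<exists>f\<in>Hom (module_category A) X Y. on_hom corner_functor X Y f = g"
    if "X \<in> Ob (module_category A)" "Y \<in> Ob (module_category A)"
      "g \<in> Hom (module_category B) (on_ob corner_functor X) (on_ob corner_functor Y)" for X Y and g :: "'m \<Rightarrow> 'm"
    using that corner_full[of X Y g] by (simp add: module_category_def corner_functor_def)
  show "f = f'"
    if "X \<in> Ob (module_category A)" "Y \<in> Ob (module_category A)" "f \<in> Hom (module_category A) X Y"
      "f' \<in> Hom (module_category A) X Y" "on_hom corner_functor X Y f = on_hom corner_functor X Y f'" for X Y and f f' :: "'m \<Rightarrow> 'm"
    using that corner_faithful[of X Y f f'] by (simp add: module_category_def corner_functor_def)
  show "\<exists>X\<in>Ob (module_category A). iso_in (module_category B) (on_ob corner_functor X) Y \<noteq> {}"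
    if "Y \<in> Ob (module_category B)" for Y :: "('b, 'm) module"
    using that corner_surj[of Y] assms[of Y] by (auto simp: module_category_def corner_functor_def)
qed

end

section \<open>Algebras with central scalars\<close>

text \<open>Scalars are central elements of a type-class ring. Products keep the simplification
  rules of \<open>ring_1\<close>, while \<open>vs\<close> supplies spans, bases and
  dimensions.\<close>

locale central_algebra =
  fixes sc :: "'k::field \<Rightarrow> 'a::ring_1"
  assumes sc_add: "sc (a + b) = sc a + sc b"
    and sc_mult: "sc (a * b) = sc a * sc b"
    and sc_one: "sc 1 = 1"
    and sc_commute: "sc a * x = x * sc a"
begin

sublocale vs: vector_space "\<lambda>c x. sc c * x"
  by unfold_locales (simp_all add: sc_add sc_mult sc_one algebra_simps)

sublocale vs_pair: vector_space_pair "\<lambda>c x. sc c * x" "\<lambda>c x. sc c * x"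
  by unfold_locales

lemma sc_zero [simp]: "sc 0 = 0"
  using sc_add[of 0 0] by simp

lemma mult_sc: "x * (sc c * y) = sc c * (x * y)"
  by (metis mult.assoc sc_commute)

lemma sc_uminus: "sc (- a) = - sc a"
  using sc_add[of a "- a"] by (simp add: eq_neg_iff_add_eq_0 add.commute)

lemma sc_diff: "sc (a - b) = sc a - sc b"
  using sc_add[of a "- b"] by (simp add: sc_uminus)

lemma sc_sum: "sc (\<Sum>i\<in>I. f i) = (\<Sum>i\<in>I. sc (f i))"
  by (induction I rule: infinite_finite_induct) (simp_all add: sc_add)

lemma sc_eq_0_iff [simp]: "sc c = 0 \<longleftrightarrow> c = 0"
  using vs.scale_eq_0_iff[of c 1] by simp

text \<open>The identity on a basis of \<open>N\<close> extends to a linear map whose range is the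
  span of that basis. Such projections are the raw material for the averaging in
  \<open>maschke\<close>.\<close>

lemma projection_exists:
  assumes "vs.subspace N"
  obtains P where "\<And>x y. P (x + y) = P x + P y" "\<And>c x. P (sc c * x) = sc c * P x"
    "\<And>x. P x \<in> N" "\<And>x. x \<in> N \<Longrightarrow> P x = x"
proof -
  obtain B where B: "B \<subseteq> N" "vs.independent B" "N \<subseteq> vs.span B" by (rule vs.maximal_independent_subset)
  have NB: "vs.span B = N" using B assms by (simp add: vs.span_subspace)
  obtain P where P: "Vector_Spaces.linear (\<lambda>c x. sc c * x) (\<lambda>c x. sc c * x) P"
      "\<forall>x\<in>B. P x = x" "range P = vs.span ((\<lambda>x. x) ` B)"
    using vs_pair.linear_independent_extend_subspace[OF B(2), of "\<lambda>x. x"] by blast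
  interpret P: Vector_Spaces.linear "\<lambda>c x. sc c * x" "\<lambda>c x. sc c * x" P by (rule P(1))
  have "P x = x" if "x \<in> N" for x
    using that unfolding NB[symmetric]
    by (induction rule: vs.span_induct_alt) (simp_all add: P.add P.scale P(2) P.zero)
  then show ?thesis using that[of P] P.add P.scale P(3) NB by auto
qed

lemma span_mult:
  assumes "x \<in> vs.span S" "y \<in> vs.span T" and "\<And>s t. \<lbrakk>s \<in> S; t \<in> T\<rbrakk> \<Longrightarrow> s * t \<in> U" and U: "vs.subspace U"
  shows "x * y \<in> U"
proof -
  have *: "s * y \<in> U" if "s \<in> S" for s
    using assms(2)
  proof (induction rule: vs.span_induct_alt)
    case (step c t z)
    have "s * (sc c * t + z) = sc c * (s * t) + s * z" by (simp add: distrib_left mult_sc)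
    then show ?case using step assms(3)[OF that] U by (simp add: vs.subspace_add vs.subspace_scale)
  qed (simp add: vs.subspace_0[OF U])
  show ?thesis using assms(1)
  proof (induction rule: vs.span_induct_alt)
    case (step c s z)
    have "(sc c * s + z) * y = sc c * (s * y) + z * y" by (simp add: distrib_right mult.assoc)
    then show ?case using step * U by (simp add: vs.subspace_add vs.subspace_scale)
  qed (simp add: vs.subspace_0[OF U])
qed

end

section \<open>Group algebras and irreducible representations\<close>

text \<open>A copy of k[H] inside a larger ring. The image of the neutral element is only an
  idempotent, not the unit of \<open>'a\<close>; this is what allows k[G_i] e_i as an
  instance.\<close>

locale group_algebra = central_algebra sc + H: group H
  for sc :: "'k::alg_closed_field \<Rightarrow> 'a::ring_1" and H :: "('g, 'n) monoid_scheme" (structure) +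
  fixes \<eta> :: "'g \<Rightarrow> 'a"
  assumes finite_H: "finite (carrier H)"
    and card_H: "of_nat (card (carrier H)) \<noteq> (0 :: 'k)"
    and \<eta>_mult: "\<lbrakk>g \<in> carrier H; h \<in> carrier H\<rbrakk> \<Longrightarrow> \<eta> (g \<otimes> h) = \<eta> g * \<eta> h"
    and \<eta>_indep: "\<lbrakk>(\<Sum>h \<in> carrier H. sc (c h) * \<eta> h) = 0; h \<in> carrier H\<rbrakk> \<Longrightarrow> c h = 0"
begin

definition e0 :: 'a where "e0 = \<eta> \<one>"

definition K :: "'a set" where "K = vs.span (\<eta> ` carrier H)"

definition comb :: "('g \<Rightarrow> 'k) \<Rightarrow> 'a" where "comb c = (\<Sum>h \<in> carrier H. sc (c h) * \<eta> h)"

text \<open>The value 0 off the group makes the coefficient function unique. Its type is the one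
  over which \<open>irr_representatives\<close> tests completeness.\<close>

definition cf :: "'a \<Rightarrow> 'g \<Rightarrow> 'k" where
  "cf x = (THE c. comb c = x \<and> (\<forall>h. h \<notin> carrier H \<longrightarrow> c h = 0))"

lemma subspace_K: "vs.subspace K" by (simp add: K_def)

lemma \<eta>_K: "h \<in> carrier H \<Longrightarrow> \<eta> h \<in> K" by (simp add: K_def vs.span_base)

lemma e0_K: "e0 \<in> K" by (simp add: e0_def \<eta>_K)

lemma comb_add: "comb (\<lambda>h. c h + d h) = comb c + comb d"
  by (simp add: comb_def sc_add distrib_right sum.distrib)

lemma comb_scale: "comb (\<lambda>h. a * c h) = sc a * comb c"
  unfolding comb_def sc_mult mult.assoc sum_distrib_left ..

lemma comb_K: "comb c \<in> K"
  unfolding comb_def by (intro vs.subspace_sum[OF subspace_K] vs.subspace_scale[OF subspace_K] \<eta>_K)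

lemma comb_eqD: assumes "comb c = comb d" "h \<in> carrier H" shows "c h = d h"
proof -
  have "(\<Sum>h \<in> carrier H. sc (c h - d h) * \<eta> h) = comb c - comb d"
    by (simp add: comb_def sc_diff left_diff_distrib sum_subtractf)
  then show ?thesis using \<eta>_indep[of "\<lambda>h. c h - d h" h] assms by simp
qed

lemma comb_unit: "g \<in> carrier H \<Longrightarrow> comb (\<lambda>h. if h = g then 1 else 0) = \<eta> g"
proof -
  assume "g \<in> carrier H"
  have "comb (\<lambda>h. if h = g then 1 else 0) = (\<Sum>h \<in> carrier H. if h = g then \<eta> g else 0)"
    unfolding comb_def by (intro sum.cong) (auto simp: sc_one)
  then show ?thesis using \<open>g \<in> carrier H\<close> finite_H by simp
qed

lemma K_comb: assumes "x \<in> K" obtains c where "x = comb c" "\<And>h. h \<notin> carrier H \<Longrightarrow> c h = 0"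
proof -
  have "\<exists>c. x = comb c" using assms unfolding K_def
  proof (induction rule: vs.span_induct_alt)
    case base
    then show ?case by (intro exI[of _ "\<lambda>_. 0"]) (simp add: comb_def)
  next
    case (step a s z)
    then obtain g c where g: "g \<in> carrier H" "s = \<eta> g" and z: "z = comb c" by blast
    have "sc a * s + z = comb (\<lambda>h. a * (if h = g then 1 else 0) + c h)"
      unfolding comb_add comb_scale comb_unit[OF g(1)] g(2) z ..
    then show ?case by blast
  qed
  then obtain c where "x = comb c" by blast
  then have "x = comb (\<lambda>h. if h \<in> carrier H then c h else 0)"
    by (simp add: comb_def cong: sum.cong)
  then show ?thesis by (rule that) simp
qed

lemma cf: assumes "x \<in> K" shows "comb (cf x) = x" "h \<notin> carrier H \<Longrightarrow> cf x h = 0"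
proof -
  have "\<exists>!c. comb c = x \<and> (\<forall>h. h \<notin> carrier H \<longrightarrow> c h = 0)"
  proof -
    obtain c where c: "x = comb c" "\<And>h. h \<notin> carrier H \<Longrightarrow> c h = 0" using K_comb[OF assms] by blast
    show ?thesis
    proof (intro ex1I[of _ c])
      fix d assume "comb d = x \<and> (\<forall>h. h \<notin> carrier H \<longrightarrow> d h = 0)"
      then show "d = c" using c comb_eqD[of d c] by (metis ext)
    qed (use c in auto)
  qed
  from theI'[OF this] show "comb (cf x) = x" "h \<notin> carrier H \<Longrightarrow> cf x h = 0"
    by (simp_all add: cf_def)
qed

lemma cf_comb:
  assumes "\<And>h. h \<notin> carrier H \<Longrightarrow> c h = 0"
  shows "cf (comb c) = c"
proof
  fix h
  have "comb (cf (comb c)) = comb c" by (rule cf(1)) (rule comb_K)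
  then show "cf (comb c) h = c h"
    using comb_eqD cf(2)[OF comb_K] assms by (cases "h \<in> carrier H") auto
qed

lemma cf_add: "\<lbrakk>x \<in> K; y \<in> K\<rbrakk> \<Longrightarrow> cf (x + y) = (\<lambda>h. cf x h + cf y h)"
  using cf_comb[of "\<lambda>h. cf x h + cf y h"] cf by (simp add: comb_add)

lemma cf_scale: "x \<in> K \<Longrightarrow> cf (sc a * x) = (\<lambda>h. a * cf x h)"
  using cf_comb[of "\<lambda>h. a * cf x h"] cf by (simp add: comb_scale)

lemma cf_zero: "cf 0 = (\<lambda>_. 0)"
  using cf_comb[of "\<lambda>_. 0"] by (simp add: comb_def)

lemma comb_\<eta>: "g \<in> carrier H \<Longrightarrow> comb c * \<eta> g = comb (\<lambda>h. c (h \<otimes> inv g))"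
proof -
  assume g: "g \<in> carrier H"
  have "comb c * \<eta> g = (\<Sum>h \<in> carrier H. sc (c h) * \<eta> (h \<otimes> g))"
    unfolding comb_def sum_distrib_right by (intro sum.cong) (auto simp: \<eta>_mult g mult.assoc)
  also have "\<dots> = (\<Sum>h \<in> carrier H. sc (c (h \<otimes> inv g)) * \<eta> h)"
    by (rule sum.reindex_bij_witness[of _ "\<lambda>h. h \<otimes> inv g" "\<lambda>h. h \<otimes> g"])
      (auto simp: g H.m_assoc)
  finally show ?thesis by (simp add: comb_def)
qed

lemma cf_\<eta>: assumes "x \<in> K" "g \<in> carrier H" shows "cf (x * \<eta> g) = (\<lambda>h. if h \<in> carrier H then cf x (h \<otimes> inv g) else 0)"
proof -
  have "x * \<eta> g = comb (\<lambda>h. cf x (h \<otimes> inv g))" using assms cf(1)[of x] comb_\<eta>[of g "cf x"] by simp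
  also have "\<dots> = comb (\<lambda>h. if h \<in> carrier H then cf x (h \<otimes> inv g) else 0)"
    by (simp add: comb_def cong: sum.cong)
  finally show ?thesis using cf_comb by simp
qed

lemma K_mult: "\<lbrakk>x \<in> K; y \<in> K\<rbrakk> \<Longrightarrow> x * y \<in> K"
  unfolding K_def by (erule (1) span_mult) (auto simp: \<eta>_mult[symmetric] intro: vs.span_base)

lemma e0_left: "x \<in> K \<Longrightarrow> e0 * x = x"
  unfolding K_def
  by (induction rule: vs.span_induct_alt) (auto simp: distrib_left mult_sc e0_def \<eta>_mult[symmetric])

lemma e0_right: "x \<in> K \<Longrightarrow> x * e0 = x"
  unfolding K_def
  by (induction rule: vs.span_induct_alt) (auto simp: distrib_right mult.assoc e0_def \<eta>_mult[symmetric])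

definition right_ideal :: "'a set \<Rightarrow> bool" where
  "right_ideal N \<longleftrightarrow> vs.subspace N \<and> N \<subseteq> K \<and> (\<forall>x \<in> N. \<forall>h \<in> carrier H. x * \<eta> h \<in> N)"

text \<open>The group elements span \<open>K\<close>, so compatibility with them extends linearly.
  Both claims are proved together because the laws of \<open>G\<close> are assumed only on
  \<open>N\<close>.\<close>

lemma equivariant_mult:
  assumes N: "vs.subspace N" "\<And>x h. \<lbrakk>x \<in> N; h \<in> carrier H\<rbrakk> \<Longrightarrow> x * \<eta> h \<in> N"
    and G: "\<And>x y. \<lbrakk>x \<in> N; y \<in> N\<rbrakk> \<Longrightarrow> G (x + y) = G x + G y" "\<And>c x. x \<in> N \<Longrightarrow> G (sc c * x) = sc c * G x"
      "\<And>x h. \<lbrakk>x \<in> N; h \<in> carrier H\<rbrakk> \<Longrightarrow> G (x * \<eta> h) = G x * \<eta> h"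
    and x: "x \<in> N" and y: "y \<in> K"
  shows "x * y \<in> N \<and> G (x * y) = G x * y"
  using y unfolding K_def
proof (induction rule: vs.span_induct_alt)
  case base
  show ?case using G(2)[OF x, of 0] vs.subspace_0[OF N(1)] by simp
next
  case (step c s z)
  then obtain h where h: "h \<in> carrier H" "s = \<eta> h" by blast
  have "x * (sc c * s + z) = sc c * (x * s) + x * z" by (simp add: distrib_left mult_sc)
  then show ?case using step h x N G
    by (simp add: vs.subspace_add vs.subspace_scale distrib_left mult_sc)
qed

lemma right_ideal_mult: assumes "right_ideal N" "x \<in> N" "y \<in> K" shows "x * y \<in> N"
  using assms equivariant_mult[of N "\<lambda>x. x" x y] by (auto simp: right_ideal_def)

lemma right_ideal_image:
  assumes N: "right_ideal N" and z: "z \<in> K" shows "right_ideal ((\<lambda>x. z * x) ` N)"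
  unfolding right_ideal_def
proof (intro conjI ballI)
  show "vs.subspace ((\<lambda>x. z * x) ` N)"
  proof (rule vs.subspaceI)
    show "0 \<in> (*) z ` N" using N vs.subspace_0 by (force simp: right_ideal_def)
    show "x + y \<in> (*) z ` N" if "x \<in> (*) z ` N" "y \<in> (*) z ` N" for x y
      using that N vs.subspace_add by (auto simp: right_ideal_def distrib_left[symmetric])
    show "sc c * x \<in> (*) z ` N" if "x \<in> (*) z ` N" for c x
      using that N vs.subspace_scale by (auto simp: right_ideal_def mult_sc[symmetric])
  qed
  show "(*) z ` N \<subseteq> K" using N z K_mult by (auto simp: right_ideal_def)
  show "x * \<eta> h \<in> (*) z ` N" if "x \<in> (*) z ` N" "h \<in> carrier H" for x h
    using that N by (auto simp: right_ideal_def mult.assoc)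
qed

lemma right_ideal_kernel:
  assumes N: "right_ideal N" shows "right_ideal {x \<in> N. z * x = 0}"
  unfolding right_ideal_def
proof (intro conjI ballI)
  show "vs.subspace {x \<in> N. z * x = 0}"
    using N by (auto intro!: vs.subspaceI simp: right_ideal_def distrib_left mult_sc vs.subspace_0 vs.subspace_add vs.subspace_scale)
qed (use N in \<open>auto simp: right_ideal_def mult.assoc[symmetric]\<close>)

text \<open>Averaging a linear projection onto \<open>N\<close> over the group gives an equivariant
  projection \<open>R\<close>. An equivariant map on \<open>K\<close> is left multiplication by its
  value at the unit \<open>e0\<close>, and this value is c.\<close>

lemma maschke:
  assumes N: "right_ideal N" obtains c where "c \<in> N" "\<And>n. n \<in> N \<Longrightarrow> c * n = n"
proof -
  have Ns: "vs.subspace N" and NK: "N \<subseteq> K" and N\<eta>: "\<And>x h. \<lbrakk>x \<in> N; h \<in> carrier H\<rbrakk> \<Longrightarrow> x * \<eta> h \<in> N"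
    using N by (auto simp: right_ideal_def)
  obtain P where P: "\<And>x y. P (x + y) = P x + P y" "\<And>c x. P (sc c * x) = sc c * P x"
    "\<And>x. P x \<in> N" "\<And>x. x \<in> N \<Longrightarrow> P x = x" using projection_exists[OF Ns] by blast
  define R where "R x = sc (1 / of_nat (card (carrier H))) * (\<Sum>h \<in> carrier H. P (x * \<eta> h) * \<eta> (inv h))" for x
  have RN: "R x \<in> N" for x
    unfolding R_def by (intro vs.subspace_scale[OF Ns] vs.subspace_sum[OF Ns] N\<eta> P) auto
  have R\<eta>: "R (x * \<eta> g) = R x * \<eta> g" if "x \<in> K" "g \<in> carrier H" for x g
  proof -
    have "(\<Sum>h \<in> carrier H. P (x * \<eta> g * \<eta> h) * \<eta> (inv h)) = (\<Sum>h \<in> carrier H. P (x * \<eta> (g \<otimes> h)) * \<eta> (inv h))"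
      using that by (intro sum.cong) (auto simp: \<eta>_mult mult.assoc)
    also have "\<dots> = (\<Sum>h \<in> carrier H. P (x * \<eta> h) * \<eta> (inv (inv g \<otimes> h)))"
      by (rule sum.reindex_bij_witness[of _ "\<lambda>h. inv g \<otimes> h" "\<lambda>h. g \<otimes> h"])
        (auto simp: that H.m_assoc[symmetric])
    also have "\<dots> = (\<Sum>h \<in> carrier H. P (x * \<eta> h) * \<eta> (inv h)) * \<eta> g"
      unfolding sum_distrib_right
      by (intro sum.cong) (auto simp: that \<eta>_mult[symmetric] mult.assoc H.inv_mult_group)
    finally show ?thesis by (simp add: R_def mult.assoc)
  qed
  have Radd: "R (x + y) = R x + R y" for x y
    by (simp add: R_def distrib_right P sum.distrib distrib_left)
  have Rsc: "R (sc c * x) = sc c * R x" for c x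
    unfolding R_def mult.assoc P(2) sum_distrib_left[symmetric] by (rule mult_sc)
  have Rid: "R n = n" if n: "n \<in> N" for n
  proof -
    \<comment> \<open>Every summand equals n, because n \<eta> h stays in \<open>N\<close>, where P
      is the identity. The normalizing factor cancels the number of summands; here
      \<open>card_H\<close> enters.\<close>
    have "(\<Sum>h \<in> carrier H. P (n * \<eta> h) * \<eta> (inv h)) = (\<Sum>h \<in> carrier H. n)"
    proof (intro sum.cong refl)
      fix h assume h: "h \<in> carrier H"
      have "\<eta> h * \<eta> (inv h) = e0" using h \<eta>_mult[of h "inv h"] by (simp add: e0_def)
      then show "P (n * \<eta> h) * \<eta> (inv h) = n"
        using h n NK e0_right[of n] by (auto simp: P N\<eta> mult.assoc)
    qed
    also have "\<dots> = sc (of_nat (card (carrier H))) * n" by (rule vs.sum_constant_scale)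
    finally show ?thesis using card_H by (simp add: R_def mult.assoc[symmetric] sc_mult[symmetric] sc_one)
  qed
  have "R e0 * n = n" if n: "n \<in> N" for n
  proof -
    have "R (e0 * n) = R e0 * n"
      using equivariant_mult[of K R e0 n] Radd Rsc R\<eta> subspace_K K_mult \<eta>_K e0_K n NK by blast
    then show ?thesis using n NK Rid e0_left[of n] by auto
  qed
  then show ?thesis using that RN by blast
qed

section \<open>Simple right ideals and Schur's lemma\<close>

definition simple_ideal :: "'a set \<Rightarrow> bool" where
  "simple_ideal T \<longleftrightarrow> right_ideal T \<and> T \<noteq> {0} \<and> (\<forall>U. right_ideal U \<and> U \<subseteq> T \<longrightarrow> U = {0} \<or> U = T)"

lemma independent_K: assumes "vs.independent B" "B \<subseteq> K" shows "finite B" "card B \<le> card (carrier H)"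
proof -
  have "finite B \<and> card B \<le> card (\<eta> ` carrier H)"
    using assms finite_H by (intro vs.independent_span_bound) (auto simp: K_def)
  then show "finite B" "card B \<le> card (carrier H)"
    using card_image_le[OF finite_H, of \<eta>] by auto
qed

text \<open>A nonzero subideal of least dimension is simple, since a proper subspace of a
  finite-dimensional space has smaller dimension.\<close>

lemma simple_ideal_exists:
  assumes C: "right_ideal C" "C \<noteq> {0}" obtains T where "T \<subseteq> C" "simple_ideal T"
proof -
  let ?P = "\<lambda>T. right_ideal T \<and> T \<noteq> {0} \<and> T \<subseteq> C"
  obtain T where T: "?P T" and min: "\<And>U. ?P U \<Longrightarrow> vs.dim T \<le> vs.dim U"
    using ex_has_least_nat[of ?P C vs.dim] C by blast
  have "U = T" if U: "right_ideal U" "U \<subseteq> T" "U \<noteq> {0}" for U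
  proof (rule ccontr)
    assume "U \<noteq> T"
    then obtain x where x: "x \<in> T" "x \<notin> U" using U by blast
    obtain BU where BU: "BU \<subseteq> U" "vs.independent BU" "U \<subseteq> vs.span BU" "card BU = vs.dim U"
      by (rule vs.basis_exists)
    obtain BT where BT: "BT \<subseteq> T" "vs.independent BT" "T \<subseteq> vs.span BT" "card BT = vs.dim T"
      by (rule vs.basis_exists)
    have TK: "T \<subseteq> K" using T by (simp add: right_ideal_def)
    have UC: "U \<subseteq> C" using U T by blast
    have "BU \<subseteq> K" "BT \<subseteq> K" using BU(1) BT(1) TK U(2) by blast+
    then have fin: "finite BU" "finite BT" using independent_K(1) BU(2) BT(2) by blast+
    \<comment> \<open>A basis of \<open>U\<close> enlarged by x is independent and lies in the span
      of a basis of \<open>T\<close>; hence the dimension of \<open>U\<close> is strictly smaller,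
      against minimality.\<close>
    have "x \<notin> vs.span BU" using BU U x vs.span_minimal[of BU U] by (auto simp: right_ideal_def)
    then have "vs.independent (insert x BU)" "x \<notin> BU"
      using BU vs.independent_insertI vs.span_base by blast+
    then have "card (insert x BU) \<le> card BT"
      using fin BT BU U x by (intro conjunct2[OF vs.independent_span_bound]) auto
    then show False using fin \<open>x \<notin> BU\<close> BU(4) BT(4) min[of U] U UC by simp
  qed
  then have "simple_ideal T" using T by (auto simp: simple_ideal_def)
  then show ?thesis using that T by blast
qed

text \<open>Left multiplication by y is an endomorphism of \<open>W\<close>. Take a nonzero
  polynomial p of least degree whose value at y kills \<epsilon>, a root z of p, and p = (X - z) q.
  The value of q is a nonzero element of \<open>W\<close> annihilated by y - z. What y - z
  annihilates in \<open>W\<close> is a subideal, hence all of \<open>W\<close>.\<close>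

lemma schur_simple:
  assumes W: "simple_ideal W" and \<epsilon>: "\<epsilon> \<in> W" "\<And>w. w \<in> W \<Longrightarrow> \<epsilon> * w = w" and y: "y \<in> W" "y * \<epsilon> = y"
  shows "\<exists>c. y = sc c * \<epsilon>"
proof -
  have WK: "W \<subseteq> K" and Ws: "vs.subspace W" and Wr: "right_ideal W" and W0: "W \<noteq> {0}"
    using W by (auto simp: simple_ideal_def right_ideal_def)
  have \<epsilon>0: "\<epsilon> \<noteq> 0"
  proof
    assume "\<epsilon> = 0"
    then have "W \<subseteq> {0}" using \<epsilon>(2) by force
    then show False using W0 \<epsilon>(1) by auto
  qed
  \<comment> \<open>Polynomials are evaluated with \<epsilon> in place of 1: constants go to
    multiples of \<epsilon>, and all values stay in \<open>W\<close>.\<close>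
  define f where "f i = y ^ i * \<epsilon>" for i
  have fW: "f i \<in> W" for i
  proof (induction i)
    case (Suc i)
    have "f (Suc i) = y * f i" by (simp add: f_def mult.assoc)
    then show ?case using right_ideal_mult[OF Wr y(1), of "f i"] Suc WK by auto
  qed (simp add: f_def \<epsilon>)
  define ev where "ev p = (\<Sum>i\<le>degree p. sc (poly.coeff p i) * f i)" for p
  have ev: "ev p = (\<Sum>i\<le>N. sc (poly.coeff p i) * f i)" if "degree p \<le> N" for p N
    unfolding ev_def using that by (intro sum.mono_neutral_left) (auto simp: coeff_eq_0)
  have ev_add: "ev (p + q) = ev p + ev q" for p q
  proof -
    let ?N = "max (degree p) (degree q)"
    show ?thesis using degree_add_le_max[of p q]
      by (simp add: ev[of _ ?N] sc_add distrib_right sum.distrib)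
  qed
  have ev_smult: "ev (Polynomial.smult a p) = sc a * ev p" for a p
  proof -
    have "ev (Polynomial.smult a p) = (\<Sum>i\<le>degree p. sc (poly.coeff (Polynomial.smult a p) i) * f i)"
      by (rule ev) (rule degree_smult_le)
    also have "\<dots> = sc a * ev p"
      unfolding coeff_smult sc_mult mult.assoc ev_def sum_distrib_left ..
    finally show ?thesis .
  qed
  have ev_pCons: "ev (pCons a p) = sc a * \<epsilon> + y * ev p" for a p
  proof -
    have "ev (pCons a p) = (\<Sum>i\<le>Suc (degree p). sc (poly.coeff (pCons a p) i) * f i)"
      by (rule ev) (rule degree_pCons_le)
    also have "\<dots> = sc a * \<epsilon> + (\<Sum>i\<le>degree p. sc (poly.coeff p i) * (y * f i))"
      by (simp only: sum.atMost_Suc_shift) (simp add: f_def mult.assoc)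
    also have "(\<Sum>i\<le>degree p. sc (poly.coeff p i) * (y * f i)) = y * ev p"
      unfolding ev_def sum_distrib_left mult_sc ..
    finally show ?thesis .
  qed
  have evW: "ev p \<in> W" for p
    unfolding ev_def by (intro vs.subspace_sum[OF Ws] vs.subspace_scale[OF Ws] fW)
  have "\<exists>p. p \<noteq> 0 \<and> ev p = 0"
  proof (rule ccontr)
    assume no: "\<not> (\<exists>p. p \<noteq> 0 \<and> ev p = 0)"
    \<comment> \<open>The elements f 0, ..., f \<open>?n\<close> are one more than an independent
      subset of \<open>K\<close> can have.\<close>
    let ?n = "card (carrier H)"
    have zero: "u i = 0" if "(\<Sum>i\<le>?n. sc (u i) * f i) = 0" "i \<le> ?n" for u i
    proof -
      let ?p = "\<Sum>i\<le>?n. monom (u i) i"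
      have c: "poly.coeff ?p j = (if j \<le> ?n then u j else 0)" for j
        by (simp add: coeff_sum)
      have "degree ?p \<le> ?n" by (rule degree_le) (simp add: c)
      then have "ev ?p = (\<Sum>i\<le>?n. sc (poly.coeff ?p i) * f i)" by (rule ev)
      also have "\<dots> = 0" using that(1) by (simp only: c) simp
      finally have "?p = 0" using no by blast
      then show ?thesis using c[of i] that(2) by simp
    qed
    \<comment> \<open>Coinciding powers must be excluded first, since they would make the set of
      powers smaller than its index set. A coincidence is itself a relation, given by X^i -
      X^j.\<close>
    have inj: "inj_on f {..?n}"
    proof (rule inj_onI, rule ccontr)
      fix i j assume ij: "i \<in> {..?n}" "j \<in> {..?n}" "f i = f j" "i \<noteq> j"
      let ?u = "\<lambda>l. if l = i then 1 else if l = j then - 1 else (0::'k)"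
      have "(\<Sum>l\<le>?n. sc (?u l) * f l) = (\<Sum>l\<in>{i, j}. sc (?u l) * f l)"
        using ij by (intro sum.mono_neutral_right) auto
      also have "\<dots> = 0" using ij by (simp add: sc_one sc_uminus)
      finally show False using zero[of ?u i] ij by simp
    qed
    have "vs.independent (f ` {..?n})"
    proof (rule vs.independent_if_scalars_zero)
      fix u x assume "(\<Sum>x\<in>f ` {..?n}. sc (u x) * x) = 0" and x: "x \<in> f ` {..?n}"
      then have "(\<Sum>i\<le>?n. sc (u (f i)) * f i) = 0" by (simp add: sum.reindex[OF inj])
      moreover obtain i where "i \<le> ?n" "x = f i" using x by auto
      ultimately show "u x = 0" using zero[of "\<lambda>i. u (f i)" i] by blast
    qed simp
    then have "card (f ` {..?n}) \<le> ?n" using fW WK by (intro independent_K) auto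
    then show False by (simp add: card_image[OF inj])
  qed
  then obtain p where p: "p \<noteq> 0" "ev p = 0" and min: "\<And>q. q \<noteq> 0 \<Longrightarrow> ev q = 0 \<Longrightarrow> degree p \<le> degree q"
    using ex_has_least_nat[of "\<lambda>p. p \<noteq> 0 \<and> ev p = 0" _ degree] by blast
  have "degree p \<noteq> 0"
  proof
    assume "degree p = 0"
    then obtain a where "p = [:a:]" by (metis degree_eq_zeroE)
    then show False using p ev_pCons[of a 0] \<epsilon>0 by (auto simp: ev_def[of 0])
  qed
  then obtain z where "poly p z = 0" using alg_closed_imp_poly_has_root[of p] by auto
  then obtain q where q: "p = [:-z, 1:] * q" by (auto simp: poly_eq_0_iff_dvd)
  have q0: "q \<noteq> 0" using p q by auto
  have "degree p = Suc (degree q)" unfolding q using q0 by (subst degree_mult_eq) auto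
  then have evq: "ev q \<noteq> 0" using min[OF q0] by linarith
  have "ev p = y * ev q - sc z * ev q"
  proof -
    have "p = pCons 0 q + Polynomial.smult (- z) q" unfolding q by simp
    then show ?thesis by (simp only: ev_add ev_smult ev_pCons sc_uminus) simp
  qed
  then have "(y - sc z) * ev q = 0" using p by (simp add: left_diff_distrib)
  then have evU: "ev q \<in> {w \<in> W. (y - sc z) * w = 0}" using evW by blast
  have "\<forall>U. right_ideal U \<and> U \<subseteq> W \<longrightarrow> U = {0} \<or> U = W" using W unfolding simple_ideal_def by blast
  from this[rule_format, OF conjI[OF right_ideal_kernel[OF Wr]], of "y - sc z"]
  have "{w \<in> W. (y - sc z) * w = 0} = {0} \<or> {w \<in> W. (y - sc z) * w = 0} = W" by blast
  then have "\<epsilon> \<in> {w \<in> W. (y - sc z) * w = 0}" using evU evq \<epsilon>(1) by blast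
  then have "y * \<epsilon> = sc z * \<epsilon>" by (simp add: left_diff_distrib)
  then show ?thesis unfolding y(2) by (rule exI)
qed

end

section \<open>Irreducible representations as right ideals of the group algebra\<close>

context group_algebra
begin

lemma simple_idealD:
  assumes "simple_ideal T"
  shows "right_ideal T" "T \<noteq> {0}" "\<lbrakk>right_ideal U; U \<subseteq> T\<rbrakk> \<Longrightarrow> U = {0} \<or> U = T"
  using assms by (auto simp: simple_ideal_def)

text \<open>\<open>\<theta>\<close> is an isomorphism from \<open>\<rho>\<close> to the right ideal \<open>\<epsilon>K\<close>.\<close>

definition realizes :: "('g, 'k, 'r) rep \<Rightarrow> ('r \<Rightarrow> 'a) \<Rightarrow> 'a \<Rightarrow> bool" where
  "realizes \<rho> \<theta> \<epsilon> \<longleftrightarrow>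
    (\<forall>v \<in> carrier \<rho>. \<theta> v \<in> K) \<and>
    (\<forall>v \<in> carrier \<rho>. \<forall>w \<in> carrier \<rho>. \<theta> (v \<oplus>\<^bsub>\<rho>\<^esub> w) = \<theta> v + \<theta> w) \<and>
    (\<forall>c. \<forall>v \<in> carrier \<rho>. \<theta> (c \<odot>\<^bsub>\<rho>\<^esub> v) = sc c * \<theta> v) \<and>
    inj_on \<theta> (carrier \<rho>) \<and>
    (\<forall>h \<in> carrier H. \<forall>v \<in> carrier \<rho>. \<theta> (act \<rho> h v) = \<theta> v * \<eta> h) \<and>
    \<epsilon> \<in> \<theta> ` carrier \<rho> \<and> (\<forall>v \<in> carrier \<rho>. \<epsilon> * \<theta> v = \<theta> v) \<and> \<epsilon> \<noteq> 0"

lemma realizesD: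
  assumes "realizes \<rho> \<theta> \<epsilon>"
  shows "v \<in> carrier \<rho> \<Longrightarrow> \<theta> v \<in> K"
    "\<lbrakk>v \<in> carrier \<rho>; w \<in> carrier \<rho>\<rbrakk> \<Longrightarrow> \<theta> (v \<oplus>\<^bsub>\<rho>\<^esub> w) = \<theta> v + \<theta> w"
    "v \<in> carrier \<rho> \<Longrightarrow> \<theta> (c \<odot>\<^bsub>\<rho>\<^esub> v) = sc c * \<theta> v"
    "inj_on \<theta> (carrier \<rho>)"
    "\<lbrakk>h \<in> carrier H; v \<in> carrier \<rho>\<rbrakk> \<Longrightarrow> \<theta> (act \<rho> h v) = \<theta> v * \<eta> h"
    "\<epsilon> \<in> \<theta> ` carrier \<rho>" "v \<in> carrier \<rho> \<Longrightarrow> \<epsilon> * \<theta> v = \<theta> v" "\<epsilon> \<noteq> 0" "\<epsilon> \<in> K" "\<epsilon> * \<epsilon> = \<epsilon>"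
  using assms unfolding realizes_def by auto

text \<open>A nonzero vector defines an equivariant map \<pi> from \<open>K\<close> to \<rho>, which
  is surjective by irreducibility. By Maschke its kernel is cK for an element c that is a left unit
  of it; then \<epsilon> = \<open>e0\<close> - c generates a complement, which \<pi> maps
  isomorphically onto \<rho>.\<close>

lemma realization_exists:
  assumes irr: "irreducible_rep H \<rho>" shows "\<exists>\<theta> \<epsilon>. realizes \<rho> \<theta> \<epsilon>"
proof -
  interpret \<rho>: representation H \<rho> using irr by (simp add: irreducible_rep_def)
  have act_c: "act \<rho> h v \<in> carrier \<rho>"
    and act_add: "w \<in> carrier \<rho> \<Longrightarrow> act \<rho> h (v \<oplus>\<^bsub>\<rho>\<^esub> w) = act \<rho> h v \<oplus>\<^bsub>\<rho>\<^esub> act \<rho> h w"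
    and act_smult: "act \<rho> h (c \<odot>\<^bsub>\<rho>\<^esub> v) = c \<odot>\<^bsub>\<rho>\<^esub> act \<rho> h v"
    if "h \<in> carrier H" "v \<in> carrier \<rho>" for h v w c
    using \<rho>.act_linear[OF that(1)] that by (auto simp: module_hom_def)
  have ag: "abelian_group \<rho>" by unfold_locales
  obtain v0 where v0: "v0 \<in> carrier \<rho>" "v0 \<noteq> \<zero>\<^bsub>\<rho>\<^esub>"
    using irr \<rho>.zero_closed unfolding irreducible_rep_def by blast
  define \<pi> where "\<pi> x = finsum \<rho> (\<lambda>h. cf x h \<odot>\<^bsub>\<rho>\<^esub> act \<rho> h v0) (carrier H)" for x
  have t: "c \<odot>\<^bsub>\<rho>\<^esub> act \<rho> h v0 \<in> carrier \<rho>" if "h \<in> carrier H" for c h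
    using act_c[OF that v0(1)] by simp
  have \<pi>c: "\<pi> x \<in> carrier \<rho>" for x unfolding \<pi>_def using t by (intro \<rho>.finsum_closed) auto
  have \<pi>add: "\<pi> (x + y) = \<pi> x \<oplus>\<^bsub>\<rho>\<^esub> \<pi> y" if "x \<in> K" "y \<in> K" for x y
  proof -
    have "\<pi> (x + y) = finsum \<rho> (\<lambda>h. cf x h \<odot>\<^bsub>\<rho>\<^esub> act \<rho> h v0 \<oplus>\<^bsub>\<rho>\<^esub> cf y h \<odot>\<^bsub>\<rho>\<^esub> act \<rho> h v0) (carrier H)"
      unfolding \<pi>_def cf_add[OF that] using t act_c v0
      by (intro \<rho>.finsum_cong') (auto simp: \<rho>.smult_l_distr[simplified])
    also have "\<dots> = \<pi> x \<oplus>\<^bsub>\<rho>\<^esub> \<pi> y"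
      unfolding \<pi>_def using t by (intro \<rho>.finsum_addf) auto
    finally show ?thesis .
  qed
  have \<pi>sc: "\<pi> (sc c * x) = c \<odot>\<^bsub>\<rho>\<^esub> \<pi> x" if "x \<in> K" for c x
  proof -
    have "\<pi> (sc c * x) = finsum \<rho> (\<lambda>h. c \<odot>\<^bsub>\<rho>\<^esub> (cf x h \<odot>\<^bsub>\<rho>\<^esub> act \<rho> h v0)) (carrier H)"
      unfolding \<pi>_def cf_scale[OF that] using t act_c v0
      by (intro \<rho>.finsum_cong') (auto simp: \<rho>.smult_assoc1[simplified])
    also have "\<dots> = c \<odot>\<^bsub>\<rho>\<^esub> \<pi> x"
      unfolding \<pi>_def
      by (rule finsum_hom[symmetric, OF ag ag, of "\<lambda>v. c \<odot>\<^bsub>\<rho>\<^esub> v"])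
        (use t finite_H in \<open>auto simp: \<rho>.smult_r_distr[simplified]\<close>)
    finally show ?thesis .
  qed
  have \<pi>\<eta>: "\<pi> (x * \<eta> g) = act \<rho> g (\<pi> x)" if x: "x \<in> K" and g: "g \<in> carrier H" for x g
  proof -
    have "\<pi> (x * \<eta> g) = finsum \<rho> (\<lambda>h. cf x (h \<otimes> inv g) \<odot>\<^bsub>\<rho>\<^esub> act \<rho> h v0) (carrier H)"
      unfolding \<pi>_def cf_\<eta>[OF x g] using t by (intro \<rho>.finsum_cong') auto
    \<comment> \<open>Right multiplication by g permutes the group; after this reindexing the shift
      of the coefficients has become the action of g.\<close>
    also have "carrier H = (\<lambda>h. h \<otimes> g) ` carrier H"
    proof (intro equalityI subsetI)
      fix x assume "x \<in> carrier H"
      then show "x \<in> (\<lambda>h. h \<otimes> g) ` carrier H"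
        using g by (intro image_eqI[of _ _ "x \<otimes> inv g"]) (auto simp: H.m_assoc)
    qed (use g in auto)
    also have "finsum \<rho> (\<lambda>h. cf x (h \<otimes> inv g) \<odot>\<^bsub>\<rho>\<^esub> act \<rho> h v0) ((\<lambda>h. h \<otimes> g) ` carrier H) =
      finsum \<rho> (\<lambda>h. cf x (h \<otimes> g \<otimes> inv g) \<odot>\<^bsub>\<rho>\<^esub> act \<rho> (h \<otimes> g) v0) (carrier H)"
      using t g by (intro \<rho>.finsum_reindex) (auto simp: inj_on_def)
    also have "\<dots> = finsum \<rho> (\<lambda>h. act \<rho> g (cf x h \<odot>\<^bsub>\<rho>\<^esub> act \<rho> h v0)) (carrier H)"
    proof (rule \<rho>.finsum_cong')
      show "(\<lambda>h. act \<rho> g (cf x h \<odot>\<^bsub>\<rho>\<^esub> act \<rho> h v0)) \<in> carrier H \<rightarrow> carrier \<rho>"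
        using t g act_c by auto
      show "cf x (h \<otimes> g \<otimes> inv g) \<odot>\<^bsub>\<rho>\<^esub> act \<rho> (h \<otimes> g) v0 = act \<rho> g (cf x h \<odot>\<^bsub>\<rho>\<^esub> act \<rho> h v0)"
        if "h \<in> carrier H" for h
        using that g v0 act_c by (simp add: act_smult \<rho>.act_mult H.m_assoc)
    qed simp
    also have "\<dots> = act \<rho> g (\<pi> x)"
      unfolding \<pi>_def
      by (rule finsum_hom[symmetric, OF ag ag, of "act \<rho> g"])
        (use t finite_H g act_c act_add in auto)
    finally show ?thesis .
  qed
  have \<pi>e: "\<pi> e0 = v0"
  proof -
    have "cf e0 = (\<lambda>h. if h = \<one> then 1 else 0)"
    proof -
      have "(if h = \<one> then 1 else 0) = (0 :: 'k)" if "h \<notin> carrier H" for h using that by auto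
      from cf_comb[of "\<lambda>h. if h = \<one> then 1 else 0", OF this] show ?thesis
        by (simp add: comb_unit e0_def)
    qed
    then have "\<pi> e0 = finsum \<rho> (\<lambda>h. if \<one> = h then v0 else \<zero>\<^bsub>\<rho>\<^esub>) (carrier H)"
      unfolding \<pi>_def using v0 act_c[OF _ v0(1)]
      by (intro \<rho>.finsum_cong') (auto simp: \<rho>.act_one \<rho>.smult_l_null[simplified] \<rho>.smult_one[simplified])
    also have "\<dots> = v0" using finite_H v0 by (intro \<rho>.add.finprod_singleton) auto
    finally show ?thesis .
  qed
  have \<pi>0: "\<pi> 0 = \<zero>\<^bsub>\<rho>\<^esub>"
    using \<pi>sc[OF e0_K, of 0] v0 by (simp add: \<pi>e \<rho>.smult_l_null[simplified])
  have \<pi>minus: "\<pi> (x - y) = \<zero>\<^bsub>\<rho>\<^esub> \<longleftrightarrow> \<pi> x = \<pi> y" if "x \<in> K" "y \<in> K" for x y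
  proof -
    have xy: "x - y \<in> K" using that vs.subspace_diff[OF subspace_K] by blast
    have "\<pi> x = \<pi> (x - y) \<oplus>\<^bsub>\<rho>\<^esub> \<pi> y" using \<pi>add[OF xy that(2)] by simp
    then show ?thesis using \<pi>c by (metis \<rho>.l_zero \<rho>.add.r_cancel_one')
  qed
  define N where "N = {x \<in> K. \<pi> x = \<zero>\<^bsub>\<rho>\<^esub>}"
  have act0: "act \<rho> h \<zero>\<^bsub>\<rho>\<^esub> = \<zero>\<^bsub>\<rho>\<^esub>" if "h \<in> carrier H" for h
    using act_smult[OF that v0(1), of 0] act_c[OF that v0(1)] v0 by (simp add: \<rho>.smult_l_null[simplified])
  have Nr: "right_ideal N"
    unfolding right_ideal_def
  proof (intro conjI ballI)
    show "vs.subspace N"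
    proof (rule vs.subspaceI)
      show "0 \<in> N" using \<pi>0 vs.subspace_0[OF subspace_K] by (simp add: N_def)
      show "x + y \<in> N" if "x \<in> N" "y \<in> N" for x y
        using that \<pi>add vs.subspace_add[OF subspace_K] by (simp add: N_def)
      show "sc c * x \<in> N" if "x \<in> N" for c x
        using that \<pi>sc vs.subspace_scale[OF subspace_K] \<rho>.smult_r_null[of c] by (simp add: N_def)
    qed
    show "N \<subseteq> K" by (auto simp: N_def)
    show "x * \<eta> h \<in> N" if "x \<in> N" "h \<in> carrier H" for x h
      using that \<pi>\<eta> act0 K_mult \<eta>_K by (simp add: N_def)
  qed
  obtain c where c: "c \<in> N" "\<And>n. n \<in> N \<Longrightarrow> c * n = n" using maschke[OF Nr] by blast
  define \<epsilon> where "\<epsilon> = e0 - c"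
  have cK: "c \<in> K" using c(1) by (simp add: N_def)
  have \<epsilon>K: "\<epsilon> \<in> K" unfolding \<epsilon>_def using vs.subspace_diff[OF subspace_K e0_K cK] .
  have \<epsilon>x: "\<epsilon> * x = x - c * x" if "x \<in> K" for x
    using e0_left[OF that] by (simp add: \<epsilon>_def left_diff_distrib)
  have cx: "c * x \<in> N" if "x \<in> K" for x using right_ideal_mult[OF Nr c(1) that] .
  have \<pi>\<epsilon>: "\<pi> (\<epsilon> * x) = \<pi> x" if "x \<in> K" for x
  proof -
    have "x - \<epsilon> * x = c * x" using \<epsilon>x[OF that] by simp
    then show ?thesis using \<pi>minus[OF that K_mult[OF \<epsilon>K that]] cx[OF that] by (simp add: N_def)
  qed
  have c\<epsilon>: "c * (\<epsilon> * x) = 0" if "x \<in> K" for x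
    using c(2)[OF cx[OF that]] \<epsilon>x[OF that] by (simp add: right_diff_distrib)
  have \<epsilon>\<epsilon>: "\<epsilon> * (\<epsilon> * x) = \<epsilon> * x" if "x \<in> K" for x
    using \<epsilon>x[OF K_mult[OF \<epsilon>K that]] c\<epsilon>[OF that] by simp
  have \<epsilon>inj: "\<epsilon> * x = \<epsilon> * y" if "x \<in> K" "y \<in> K" "\<pi> x = \<pi> y" for x y
  proof -
    have "x - y \<in> N" using that \<pi>minus vs.subspace_diff[OF subspace_K] by (simp add: N_def)
    then have "c * (x - y) = x - y" "x - y \<in> K" using c(2) by (auto simp: N_def)
    then have "\<epsilon> * (x - y) = 0" using \<epsilon>x by simp
    then show ?thesis by (simp add: right_diff_distrib)
  qed
  have surj: "carrier \<rho> = \<pi> ` K"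
  proof -
    have sub: "subspace class_ring (\<pi> ` K) \<rho>"
      unfolding subspace_def submodule_def
    proof (intro conjI allI impI)
      show "vectorspace class_ring \<rho>" "module class_ring \<rho>" by unfold_locales
      show "\<pi> ` K \<subseteq> carrier \<rho>" using \<pi>c by blast
      show "\<zero>\<^bsub>\<rho>\<^esub> \<in> \<pi> ` K" using \<pi>0 vs.subspace_0[OF subspace_K] by (metis image_eqI)
      show "v \<oplus>\<^bsub>\<rho>\<^esub> w \<in> \<pi> ` K" if "v \<in> \<pi> ` K" "w \<in> \<pi> ` K" for v w
        using that \<pi>add[symmetric] vs.subspace_add[OF subspace_K] by auto
      show "a \<odot>\<^bsub>\<rho>\<^esub> v \<in> \<pi> ` K" if "a \<in> carrier class_ring" "v \<in> \<pi> ` K" for a v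
        using that \<pi>sc[symmetric] vs.subspace_scale[OF subspace_K] by auto
    qed
    have inv: "\<forall>g \<in> carrier H. act \<rho> g ` (\<pi> ` K) \<subseteq> \<pi> ` K"
      using \<pi>\<eta>[symmetric] K_mult \<eta>_K by auto
    have "v0 \<in> \<pi> ` K" using \<pi>e e0_K by (metis image_eqI)
    then have "\<pi> ` K \<noteq> {\<zero>\<^bsub>\<rho>\<^esub>}" using v0 by blast
    then show ?thesis using irr sub inv unfolding irreducible_rep_def by blast
  qed
  \<comment> \<open>Left multiplication by \<epsilon> kills the kernel of \<pi>, so the choice of a
    preimage does not matter (\<open>\<epsilon>inj\<close>).\<close>
  define \<theta> where "\<theta> v = \<epsilon> * (SOME x. x \<in> K \<and> \<pi> x = v)" for v
  have \<theta>\<pi>: "\<theta> (\<pi> x) = \<epsilon> * x" if "x \<in> K" for x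
  proof -
    have "(SOME y. y \<in> K \<and> \<pi> y = \<pi> x) \<in> K \<and> \<pi> (SOME y. y \<in> K \<and> \<pi> y = \<pi> x) = \<pi> x"
      by (rule someI[of _ x]) (simp add: that)
    then show ?thesis unfolding \<theta>_def using that by (intro \<epsilon>inj) auto
  qed
  have "\<epsilon> \<noteq> 0"
  proof
    assume "\<epsilon> = 0"
    then have "e0 = c" by (simp add: \<epsilon>_def)
    then show False using c(1) \<pi>e v0 by (simp add: N_def)
  qed
  moreover have "\<epsilon> \<in> \<theta> ` carrier \<rho>"
    using \<theta>\<pi>[OF e0_K] e0_right[OF \<epsilon>K] \<pi>c by (metis image_eqI)
  moreover have "inj_on \<theta> (carrier \<rho>)"
  proof (rule inj_onI)
    fix v w assume "v \<in> carrier \<rho>" "w \<in> carrier \<rho>" and eq: "\<theta> v = \<theta> w"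
    then obtain x y where x: "x \<in> K" "v = \<pi> x" and y: "y \<in> K" "w = \<pi> y" unfolding surj by blast
    then have "\<epsilon> * x = \<epsilon> * y" using eq \<theta>\<pi> by simp
    then show "v = w" using \<pi>\<epsilon>[OF x(1)] \<pi>\<epsilon>[OF y(1)] x y by simp
  qed
  moreover have "\<theta> (\<pi> x \<oplus>\<^bsub>\<rho>\<^esub> \<pi> y) = \<theta> (\<pi> x) + \<theta> (\<pi> y)" if "x \<in> K" "y \<in> K" for x y
    using that vs.subspace_add[OF subspace_K that] by (simp add: \<pi>add[symmetric] \<theta>\<pi> distrib_left)
  moreover have "\<theta> (a \<odot>\<^bsub>\<rho>\<^esub> \<pi> x) = sc a * \<theta> (\<pi> x)" if "x \<in> K" for a x
    using that vs.subspace_scale[OF subspace_K that] by (simp add: \<pi>sc[symmetric] \<theta>\<pi> mult_sc)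
  moreover have "\<theta> (act \<rho> h (\<pi> x)) = \<theta> (\<pi> x) * \<eta> h" if "x \<in> K" "h \<in> carrier H" for h x
    using that K_mult[OF that(1) \<eta>_K[OF that(2)]] by (simp add: \<pi>\<eta>[symmetric] \<theta>\<pi> mult.assoc)
  ultimately have "realizes \<rho> \<theta> \<epsilon>"
    unfolding realizes_def surj using K_mult[OF \<epsilon>K] \<epsilon>\<epsilon> by (auto simp: \<theta>\<pi>)
  then show ?thesis by blast
qed

text \<open>Subideals of the image pull back along \<theta> to invariant subspaces, so
  irreducibility becomes simplicity. The second description holds because \<epsilon> lies in the
  image and is a left unit of it.\<close>

lemma realizes_image:
  assumes irr: "irreducible_rep H \<rho>" and R: "realizes \<rho> \<theta> \<epsilon>"
  shows "simple_ideal (\<theta> ` carrier \<rho>)" "\<theta> ` carrier \<rho> = (\<lambda>x. \<epsilon> * x) ` K"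
proof -
  interpret \<rho>: representation H \<rho> using irr by (simp add: irreducible_rep_def)
  note D = realizesD[OF R]
  let ?W = "\<theta> ` carrier \<rho>"
  have act_c: "act \<rho> h v \<in> carrier \<rho>" if "h \<in> carrier H" "v \<in> carrier \<rho>" for h v
    using \<rho>.act_linear[OF that(1)] that by (auto simp: module_hom_def)
  have \<theta>0: "\<theta> \<zero>\<^bsub>\<rho>\<^esub> = 0" using D(2)[of "\<zero>\<^bsub>\<rho>\<^esub>" "\<zero>\<^bsub>\<rho>\<^esub>"] by simp
  have W: "right_ideal ?W"
    unfolding right_ideal_def
  proof (intro conjI ballI)
    show "vs.subspace ?W"
    proof (rule vs.subspaceI)
      show "0 \<in> ?W" using \<theta>0 \<rho>.zero_closed by (metis image_eqI)
      show "x + y \<in> ?W" if "x \<in> ?W" "y \<in> ?W" for x y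
        using that by (auto simp: D(2)[symmetric])
      show "sc c * x \<in> ?W" if "x \<in> ?W" for c x
        using that by (auto simp: D(3)[symmetric])
    qed
    show "?W \<subseteq> K" using D(1) by blast
    show "x * \<eta> h \<in> ?W" if "x \<in> ?W" "h \<in> carrier H" for x h
      using that act_c by (auto simp: D(5)[symmetric])
  qed
  have "U = {0} \<or> U = ?W" if U: "right_ideal U" "U \<subseteq> ?W" for U
  proof -
    let ?V = "{v \<in> carrier \<rho>. \<theta> v \<in> U}"
    have Us: "vs.subspace U" and U\<eta>: "\<And>x h. \<lbrakk>x \<in> U; h \<in> carrier H\<rbrakk> \<Longrightarrow> x * \<eta> h \<in> U"
      using U(1) by (auto simp: right_ideal_def)
    have sub: "subspace class_ring ?V \<rho>"
      unfolding subspace_def submodule_def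
    proof (intro conjI allI impI)
      show "vectorspace class_ring \<rho>" "module class_ring \<rho>" by unfold_locales
      show "\<zero>\<^bsub>\<rho>\<^esub> \<in> ?V" using \<theta>0 vs.subspace_0[OF Us] by simp
      show "v \<oplus>\<^bsub>\<rho>\<^esub> w \<in> ?V" if "v \<in> ?V" "w \<in> ?V" for v w
        using that vs.subspace_add[OF Us] by (simp add: D(2))
      show "a \<odot>\<^bsub>\<rho>\<^esub> v \<in> ?V" if "a \<in> carrier class_ring" "v \<in> ?V" for a v
        using that vs.subspace_scale[OF Us] by (simp add: D(3))
    qed blast
    have inv: "\<forall>g \<in> carrier H. act \<rho> g ` ?V \<subseteq> ?V"
      using act_c U\<eta> by (auto simp: D(5))
    from irr have "subspace class_ring ?V \<rho> \<and> (\<forall>g\<in>carrier H. act \<rho> g ` ?V \<subseteq> ?V) \<longrightarrow> ?V = {\<zero>\<^bsub>\<rho>\<^esub>} \<or> ?V = carrier \<rho>"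
      unfolding irreducible_rep_def by blast
    then have "?V = {\<zero>\<^bsub>\<rho>\<^esub>} \<or> ?V = carrier \<rho>" using sub inv by blast
    moreover have "U = \<theta> ` ?V" using U(2) by blast
    ultimately show ?thesis using \<theta>0 by force
  qed
  moreover have "?W \<noteq> {0}" using D(6,8) by blast
  ultimately show "simple_ideal ?W" using W by (simp add: simple_ideal_def)
  show "?W = (\<lambda>x. \<epsilon> * x) ` K"
  proof
    show "?W \<subseteq> (\<lambda>x. \<epsilon> * x) ` K" using D(1) D(7)[symmetric] by blast
    show "(\<lambda>x. \<epsilon> * x) ` K \<subseteq> ?W" using right_ideal_mult[OF W D(6)] by blast
  qed
qed

lemma realizes_schur:
  assumes irr: "irreducible_rep H \<rho>" and R: "realizes \<rho> \<theta> \<epsilon>" and x: "x \<in> K"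
  shows "\<exists>c. \<epsilon> * x * \<epsilon> = sc c * \<epsilon>"
proof (rule schur_simple[OF realizes_image(1)[OF irr R]])
  note D = realizesD[OF R]
  show "\<epsilon> \<in> \<theta> ` carrier \<rho>" by (rule D(6))
  show "\<And>w. w \<in> \<theta> ` carrier \<rho> \<Longrightarrow> \<epsilon> * w = w" using D(7) by blast
  have "\<epsilon> * (x * \<epsilon>) \<in> (\<lambda>x. \<epsilon> * x) ` K" using K_mult[OF x D(9)] by blast
  then show "\<epsilon> * x * \<epsilon> \<in> \<theta> ` carrier \<rho>" unfolding realizes_image(2)[OF irr R] by (simp add: mult.assoc)
  show "\<epsilon> * x * \<epsilon> * \<epsilon> = \<epsilon> * x * \<epsilon>" using D(10) by (simp add: mult.assoc)
qed

text \<open>If \<delta> x \<epsilon> were nonzero, left multiplication by it would be a nonzero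
  equivariant map between simple ideals, hence bijective, and \<rho> and \<sigma> would be
  isomorphic.\<close>

lemma realizes_orthogonal:
  assumes irr: "irreducible_rep H \<rho>" "irreducible_rep H \<sigma>" and no: "\<not> rep_isomorphic H \<rho> \<sigma>"
    and R: "realizes \<rho> \<theta> \<epsilon>" and S: "realizes \<sigma> \<psi> \<delta>" and x: "x \<in> K"
  shows "\<delta> * x * \<epsilon> = 0"
proof (rule ccontr)
  assume nz: "\<delta> * x * \<epsilon> \<noteq> 0"
  let ?z = "\<delta> * x * \<epsilon>" and ?W = "\<theta> ` carrier \<rho>" and ?V = "\<psi> ` carrier \<sigma>"
  note D = realizesD[OF R] and E = realizesD[OF S]
  have zK: "?z \<in> K" by (intro K_mult x D E)
  have W: "simple_ideal ?W" by (rule realizes_image(1)[OF irr(1) R])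
  have V: "simple_ideal ?V" by (rule realizes_image(1)[OF irr(2) S])
  note Wr = simple_idealD(1)[OF W]
  have z\<epsilon>: "?z * \<epsilon> = ?z" using D(10) by (simp add: mult.assoc)
  have ker: "{w \<in> ?W. ?z * w = 0} = {0}"
  proof -
    have "{w \<in> ?W. ?z * w = 0} = {0} \<or> {w \<in> ?W. ?z * w = 0} = ?W"
      by (rule simple_idealD(3)[OF W right_ideal_kernel[OF Wr]]) blast
    moreover have "\<epsilon> \<notin> {w \<in> ?W. ?z * w = 0}" using z\<epsilon> nz by simp
    ultimately show ?thesis using D(6) by blast
  qed
  have zW: "?z * w \<in> ?V" if "w \<in> ?W" for w
  proof -
    have "w \<in> K" using that D(1) by blast
    then have "x * \<epsilon> * w \<in> K" by (intro K_mult x D)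
    then show ?thesis unfolding realizes_image(2)[OF irr(2) S] by (auto simp: mult.assoc)
  qed
  have im: "(\<lambda>w. ?z * w) ` ?W = ?V"
  proof -
    have "(\<lambda>w. ?z * w) ` ?W = {0} \<or> (\<lambda>w. ?z * w) ` ?W = ?V"
      by (rule simple_idealD(3)[OF V right_ideal_image[OF Wr zK]]) (use zW in blast)
    moreover have "?z \<in> (\<lambda>w. ?z * w) ` ?W" using z\<epsilon> D(6) by (metis image_eqI)
    ultimately show ?thesis using nz by blast
  qed
  define f where "f = (\<lambda>v \<in> carrier \<rho>. inv_into (carrier \<sigma>) \<psi> (?z * \<theta> v))"
  interpret \<rho>: representation H \<rho> using irr by (simp add: irreducible_rep_def)
  interpret \<sigma>: representation H \<sigma> using irr by (simp add: irreducible_rep_def)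
  have act_c: "act \<rho> h v \<in> carrier \<rho>" if "h \<in> carrier H" "v \<in> carrier \<rho>" for h v
    using \<rho>.act_linear[OF that(1)] that by (auto simp: module_hom_def)
  have act_c': "act \<sigma> h v \<in> carrier \<sigma>" if "h \<in> carrier H" "v \<in> carrier \<sigma>" for h v
    using \<sigma>.act_linear[OF that(1)] that by (auto simp: module_hom_def)
  have f: "f v \<in> carrier \<sigma>" "\<psi> (f v) = ?z * \<theta> v" if "v \<in> carrier \<rho>" for v
    using zW[of "\<theta> v"] that by (auto simp: f_def intro: inv_into_into f_inv_into_f)
  have eqI: "a = b" if "a \<in> carrier \<sigma>" "b \<in> carrier \<sigma>" "\<psi> a = \<psi> b" for a b
    using E(4) that by (auto dest: inj_onD)
  have "f \<in> rep_hom H \<rho> \<sigma>"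
    unfolding rep_hom_def module_hom_def
  proof (intro CollectI conjI IntI allI impI ballI)
    show "f \<in> carrier \<rho> \<rightarrow> carrier \<sigma>" using f by blast
    show "f (v \<oplus>\<^bsub>\<rho>\<^esub> w) = f v \<oplus>\<^bsub>\<sigma>\<^esub> f w" if "v \<in> carrier \<rho> \<and> w \<in> carrier \<rho>" for v w
      using that f by (intro eqI) (simp_all add: D(2) E(2) distrib_left)
    show "f (a \<odot>\<^bsub>\<rho>\<^esub> v) = a \<odot>\<^bsub>\<sigma>\<^esub> f v" if "a \<in> carrier class_ring \<and> v \<in> carrier \<rho>" for a v
      using that f by (intro eqI) (simp_all add: D(3) E(3) mult_sc[of ?z])
    show "f \<in> extensional (carrier \<rho>)" by (simp add: f_def)
    show "f (act \<rho> g v) = act \<sigma> g (f v)" if "g \<in> carrier H" "v \<in> carrier \<rho>" for g v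
      using that f act_c act_c' by (intro eqI) (simp_all add: D(5) E(5) mult.assoc)
  qed
  moreover have "bij_betw f (carrier \<rho>) (carrier \<sigma>)"
  proof (rule bij_betwI')
    fix v w assume v: "v \<in> carrier \<rho>" and w: "w \<in> carrier \<rho>"
    show "(f v = f w) = (v = w)"
    proof
      assume "f v = f w"
      then have "?z * (\<theta> v - \<theta> w) = 0" using f(2)[OF v] f(2)[OF w] by (simp add: right_diff_distrib)
      moreover have "\<theta> v - \<theta> w \<in> ?W"
        using Wr v w by (intro vs.subspace_diff) (auto simp: right_ideal_def)
      ultimately have "\<theta> v - \<theta> w \<in> {w \<in> ?W. ?z * w = 0}" by blast
      then have "\<theta> v = \<theta> w" unfolding ker by simp
      then show "v = w" using D(4) v w by (auto dest: inj_onD)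
    qed simp
  next
    fix v assume "v \<in> carrier \<rho>" then show "f v \<in> carrier \<sigma>" by (rule f)
  next
    fix u assume u: "u \<in> carrier \<sigma>"
    then have "\<psi> u \<in> (\<lambda>w. ?z * w) ` ?W" unfolding im by blast
    then obtain v where v: "v \<in> carrier \<rho>" "\<psi> u = ?z * \<theta> v" by blast
    then have "u = f v" using f u by (intro eqI) auto
    then show "\<exists>v\<in>carrier \<rho>. u = f v" using v by blast
  qed
  ultimately show False using no unfolding rep_isomorphic_def by blast
qed

text \<open>Vectors are coefficient functions and not ring elements, because
  \<open>irr_representatives\<close> quantifies over representations whose vectors are functions
  from the group to the field.\<close>

definition ideal_rep :: "'a set \<Rightarrow> ('g, 'k, 'g \<Rightarrow> 'k) rep" where
  "ideal_rep T = \<lparr>carrier = cf ` T, monoid.mult = (\<lambda>c d. c), one = (\<lambda>_. 0), zero = (\<lambda>_. 0),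
     add = (\<lambda>c d h. c h + d h), smult = (\<lambda>a c h. a * c h),
     act = (\<lambda>g c h. if h \<in> carrier H then c (h \<otimes> inv g) else 0)\<rparr>"

text \<open>Under \<open>cf\<close>, invariant subspaces correspond to right ideals contained in
  \<open>T\<close>.\<close>

lemma irreducible_ideal_rep:
  assumes T: "simple_ideal T" shows "irreducible_rep H (ideal_rep T)"
proof -
  let ?T = "ideal_rep T"
  have Ts: "vs.subspace T" and TK: "T \<subseteq> K" and T\<eta>: "\<And>x h. \<lbrakk>x \<in> T; h \<in> carrier H\<rbrakk> \<Longrightarrow> x * \<eta> h \<in> T" and T0: "T \<noteq> {0}"
    using T by (auto simp: simple_ideal_def right_ideal_def)
  have car: "carrier ?T = cf ` T" by (simp add: ideal_rep_def)
  have add: "cf x \<oplus>\<^bsub>?T\<^esub> cf y = cf (x + y)" if "x \<in> T" "y \<in> T" for x y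
    using that by (simp add: ideal_rep_def cf_add[OF subsetD[OF TK] subsetD[OF TK]])
  have smult: "a \<odot>\<^bsub>?T\<^esub> cf x = cf (sc a * x)" if "x \<in> T" for a x
    using that by (simp add: ideal_rep_def cf_scale[OF subsetD[OF TK]])
  have act: "act ?T g (cf x) = cf (x * \<eta> g)" if "x \<in> T" "g \<in> carrier H" for g x
    using that by (simp add: ideal_rep_def cf_\<eta>[OF subsetD[OF TK]])
  have zero: "\<zero>\<^bsub>?T\<^esub> = cf 0" by (simp add: ideal_rep_def cf_zero)
  have cf_inj: "x = y" if "cf x = cf y" "x \<in> T" "y \<in> T" for x y
    using that cf(1)[of x] cf(1)[of y] TK by auto
  note Tcl = vs.subspace_0[OF Ts] vs.subspace_add[OF Ts] vs.subspace_scale[OF Ts]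
  have ag: "abelian_group ?T"
  proof (rule abelian_groupI)
    fix x assume "x \<in> carrier ?T"
    then obtain t where t: "t \<in> T" "x = cf t" by (auto simp: car)
    have mt: "- t \<in> T" using vs.subspace_neg[OF Ts t(1)] .
    show "\<exists>y\<in>carrier ?T. y \<oplus>\<^bsub>?T\<^esub> x = \<zero>\<^bsub>?T\<^esub>"
      unfolding car t(2) zero by (rule bexI[OF _ imageI[OF mt]]) (simp add: add[OF mt t(1)])
  qed (auto simp: car add zero Tcl add_ac)
  have "module class_ring ?T"
  proof (rule moduleI)
    fix a b :: 'k and x y assume "x \<in> carrier ?T" "y \<in> carrier ?T"
    then obtain t u where t: "t \<in> T" "x = cf t" and u: "u \<in> T" "y = cf u" unfolding car by blast
    show "a \<odot>\<^bsub>?T\<^esub> (x \<oplus>\<^bsub>?T\<^esub> y) = a \<odot>\<^bsub>?T\<^esub> x \<oplus>\<^bsub>?T\<^esub> a \<odot>\<^bsub>?T\<^esub> y"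
      using t u Tcl by (simp add: add smult distrib_left)
  next
    fix a b :: 'k and x assume "x \<in> carrier ?T"
    then obtain t where t: "t \<in> T" "x = cf t" unfolding car by blast
    show "a \<odot>\<^bsub>?T\<^esub> x \<in> carrier ?T" using t Tcl(3) by (simp add: smult car)
    show "(a \<oplus>\<^bsub>class_ring\<^esub> b) \<odot>\<^bsub>?T\<^esub> x = a \<odot>\<^bsub>?T\<^esub> x \<oplus>\<^bsub>?T\<^esub> b \<odot>\<^bsub>?T\<^esub> x"
      using t Tcl by (simp add: add smult sc_add distrib_right)
    show "(a \<otimes>\<^bsub>class_ring\<^esub> b) \<odot>\<^bsub>?T\<^esub> x = a \<odot>\<^bsub>?T\<^esub> (b \<odot>\<^bsub>?T\<^esub> x)"
      using t Tcl by (simp add: smult)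
    show "\<one>\<^bsub>class_ring\<^esub> \<odot>\<^bsub>?T\<^esub> x = x" using t by (simp add: smult sc_one)
  qed (rule cring_class_ring, rule ag)
  then have vsT: "vectorspace class_ring ?T"
    by (simp add: vectorspace_def field_class_ring)
  have rep: "representation H ?T"
    unfolding representation_def representation_axioms_def
  proof (intro conjI allI impI)
    show "vectorspace class_ring ?T" by (rule vsT)
    show "group H" by (rule H.group_axioms)
    show "act ?T g \<in> module_hom class_ring ?T ?T" if g: "g \<in> carrier H" for g
      unfolding module_hom_def
    proof (intro CollectI conjI allI impI)
      show "act ?T g \<in> carrier ?T \<rightarrow> carrier ?T" using T\<eta>[OF _ g] by (auto simp: car act g)
      fix v w assume "v \<in> carrier ?T \<and> w \<in> carrier ?T"
      then obtain t u where t: "t \<in> T" "v = cf t" and u: "u \<in> T" "w = cf u" unfolding car by blast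
      show "act ?T g (v \<oplus>\<^bsub>?T\<^esub> w) = act ?T g v \<oplus>\<^bsub>?T\<^esub> act ?T g w"
        using t u g Tcl T\<eta>[OF _ g] by (simp add: add act distrib_right)
    next
      fix r :: 'k and v assume "r \<in> carrier class_ring \<and> v \<in> carrier ?T"
      then obtain t where t: "t \<in> T" "v = cf t" unfolding car by blast
      show "act ?T g (r \<odot>\<^bsub>?T\<^esub> v) = r \<odot>\<^bsub>?T\<^esub> act ?T g v"
        using t g Tcl T\<eta>[OF _ g] by (simp add: smult act mult.assoc)
    qed
    show "act ?T \<one> v = v" if "v \<in> carrier ?T" for v
      using that TK e0_right by (auto simp: car act e0_def[symmetric])
    show "act ?T (g \<otimes> h) v = act ?T h (act ?T g v)" if "g \<in> carrier H" "h \<in> carrier H" "v \<in> carrier ?T" for g h v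
      using that T\<eta> by (auto simp: car act \<eta>_mult mult.assoc)
  qed
  have "W = {\<zero>\<^bsub>?T\<^esub>} \<or> W = carrier ?T"
    if W: "subspace class_ring W ?T" "\<forall>g \<in> carrier H. act ?T g ` W \<subseteq> W" for W
  proof -
    let ?U = "{x \<in> T. cf x \<in> W}"
    have sW: "submodule class_ring W ?T" using W(1) by (simp add: subspace_def)
    have "right_ideal ?U"
      unfolding right_ideal_def
    proof (intro conjI ballI)
      show "vs.subspace ?U"
      proof (rule vs.subspaceI)
        show "0 \<in> ?U" using Tcl submodule.zero_closed[OF sW] by (simp add: zero)
        show "x + y \<in> ?U" if "x \<in> ?U" "y \<in> ?U" for x y
          using that Tcl submodule.m_closed[OF sW, of "cf x" "cf y"] by (simp add: add)
        show "sc a * x \<in> ?U" if "x \<in> ?U" for a x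
          using that Tcl submodule.smult_closed[OF sW, of a "cf x"] by (simp add: smult)
      qed
      show "?U \<subseteq> K" using TK by blast
      show "x * \<eta> h \<in> ?U" if "x \<in> ?U" "h \<in> carrier H" for x h
      proof -
        have "act ?T h (cf x) \<in> W" using that W(2) by blast
        then show ?thesis using that T\<eta> by (simp add: act)
      qed
    qed
    then have "?U = {0} \<or> ?U = T" by (rule simple_idealD(3)[OF T]) blast
    moreover have "W = cf ` ?U" using submodule.subset[OF sW] by (auto simp: car)
    ultimately show ?thesis by (auto simp: zero car)
  qed
  moreover have "carrier ?T \<noteq> {\<zero>\<^bsub>?T\<^esub>}"
  proof
    assume "carrier ?T = {\<zero>\<^bsub>?T\<^esub>}"
    then have "\<And>x. x \<in> T \<Longrightarrow> cf x = cf 0" by (auto simp: car zero)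
    then have "T \<subseteq> {0}" using cf_inj Tcl(1) by blast
    then show False using T0 Tcl(1) by blast
  qed
  ultimately show ?thesis using rep unfolding irreducible_rep_def by blast
qed

section \<open>Completeness of a system of irreducible representations\<close>

context
  fixes S :: "('g, 'k, 'r) rep set" and \<theta> :: "('g, 'k, 'r) rep \<Rightarrow> 'r \<Rightarrow> 'a" and \<epsilon> :: "('g, 'k, 'r) rep \<Rightarrow> 'a"
  assumes S: "irr_representatives H S" and R: "\<And>\<rho>. \<rho> \<in> S \<Longrightarrow> realizes \<rho> (\<theta> \<rho>) (\<epsilon> \<rho>)"
begin

lemma S_irr: "\<rho> \<in> S \<Longrightarrow> irreducible_rep H \<rho>"
  using S unfolding irr_representatives_def by blast

lemma S_orthogonal:
  assumes "\<rho> \<in> S" "\<sigma> \<in> S" "\<rho> \<noteq> \<sigma>" "x \<in> K" shows "\<epsilon> \<sigma> * x * \<epsilon> \<rho> = 0"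
proof (rule realizes_orthogonal[OF S_irr S_irr _ R R])
  show "\<not> rep_isomorphic H \<rho> \<sigma>" using S assms unfolding irr_representatives_def by blast
qed (use assms in auto)

text \<open>Let I be the two-sided ideal generated by all \<epsilon> \<rho>. If it is proper,
  Maschke's lemma gives a nonzero complement, which contains a simple right ideal \<open>T\<close>
  with T I = 0. By completeness \<open>T\<close> is isomorphic to some \<rho> in \<open>S\<close>;
  but \<epsilon> \<rho> does not annihilate \<rho> from the right.\<close>

lemma e0_in_span: "e0 \<in> vs.span {x * \<epsilon> \<rho> * y | \<rho> x y. \<rho> \<in> S \<and> x \<in> K \<and> y \<in> K}" (is "_ \<in> vs.span ?J")
proof (rule ccontr)
  assume e0: "e0 \<notin> vs.span ?J"
  let ?I = "vs.span ?J"
  have \<epsilon>K: "\<epsilon> \<rho> \<in> K" if "\<rho> \<in> S" for \<rho> using realizesD(9)[OF R[OF that]] .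
  have JK: "?J \<subseteq> K" using \<epsilon>K K_mult by blast
  then have IK: "?I \<subseteq> K" using vs.span_minimal subspace_K by blast
  have left: "x * y \<in> ?I" if "x \<in> K" "y \<in> ?I" for x y
  proof -
    have "x \<in> vs.span K" using that(1) by (rule vs.span_base)
    then show ?thesis using that(2)
    proof (rule span_mult)
      fix s t assume s: "s \<in> K" and "t \<in> ?J"
      then obtain \<rho> x y where "t = x * \<epsilon> \<rho> * y" "\<rho> \<in> S" "x \<in> K" "y \<in> K" by blast
      then have "s * t = (s * x) * \<epsilon> \<rho> * y" "s * x \<in> K" using s K_mult by (auto simp: mult.assoc)
      then have "s * t \<in> ?J" using \<open>\<rho> \<in> S\<close> \<open>y \<in> K\<close> by blast
      then show "s * t \<in> ?I" by (rule vs.span_base)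
    qed simp
  qed
  have Ir: "right_ideal ?I"
    unfolding right_ideal_def
  proof (intro conjI ballI)
    fix x h assume x: "x \<in> ?I" and h: "h \<in> carrier H"
    have "\<eta> h \<in> vs.span K" using \<eta>_K[OF h] by (rule vs.span_base)
    with x show "x * \<eta> h \<in> ?I"
    proof (rule span_mult)
      fix t s assume s: "s \<in> K" and "t \<in> ?J"
      then obtain \<rho> x y where "t = x * \<epsilon> \<rho> * y" "\<rho> \<in> S" "x \<in> K" "y \<in> K" by blast
      then have "t * s = x * \<epsilon> \<rho> * (y * s)" "y * s \<in> K" using s K_mult by (auto simp: mult.assoc)
      then have "t * s \<in> ?J" using \<open>\<rho> \<in> S\<close> \<open>x \<in> K\<close> by blast
      then show "t * s \<in> ?I" by (rule vs.span_base)
    qed simp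
  qed (use IK in auto)
  obtain c where c: "c \<in> ?I" "\<And>n. n \<in> ?I \<Longrightarrow> c * n = n" using maschke[OF Ir] by blast
  have cK: "c \<in> K" using c(1) IK by blast
  let ?C = "(\<lambda>x. (e0 - c) * x) ` K"
  have dK: "e0 - c \<in> K" using vs.subspace_diff[OF subspace_K e0_K cK] .
  have KK: "right_ideal K" unfolding right_ideal_def using subspace_K K_mult \<eta>_K by blast
  have Cr: "right_ideal ?C" using right_ideal_image[OF KK dK] .
  have "e0 - c \<in> ?C" using e0_right[OF dK] e0_K by (metis image_eqI)
  moreover have "e0 - c \<noteq> 0" using c(1) e0 by auto
  ultimately have "?C \<noteq> {0}" by blast
  then obtain T where T: "T \<subseteq> ?C" "simple_ideal T" using simple_ideal_exists[OF Cr] by blast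
  have Tr: "right_ideal T" and TK: "T \<subseteq> K" and Ts: "vs.subspace T"
    using T(2) by (auto simp: simple_ideal_def right_ideal_def)
  \<comment> \<open>t = (\<open>e0\<close> - c) x, and x n is again in the ideal, on which both
    \<open>e0\<close> and c are left units.\<close>
  have TI: "t * n = 0" if "t \<in> T" "n \<in> ?I" for t n
  proof -
    have "t \<in> ?C" using that(1) T(1) by (rule subsetD[rotated])
    then obtain x where x: "x \<in> K" "t = (e0 - c) * x" by (rule imageE)
    have xn: "x * n \<in> ?I" using left x(1) that(2) .
    have "t * n = e0 * (x * n) - c * (x * n)" using x(2) by (simp add: left_diff_distrib mult.assoc)
    then show ?thesis using c(2)[OF xn] e0_left[of "x * n"] xn IK by auto
  qed
  obtain \<rho> where \<rho>: "\<rho> \<in> S" "rep_isomorphic H (ideal_rep T) \<rho>"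
    using S irreducible_ideal_rep[OF T(2)] unfolding irr_representatives_def by blast
  then obtain f where f: "f \<in> rep_hom H (ideal_rep T) \<rho>" "bij_betw f (carrier (ideal_rep T)) (carrier \<rho>)"
    unfolding rep_isomorphic_def by blast
  note D = realizesD[OF R[OF \<rho>(1)]]
  define G where "G t = \<theta> \<rho> (f (cf t))" for t
  have car: "carrier (ideal_rep T) = cf ` T" by (simp add: ideal_rep_def)
  have fc: "f (cf t) \<in> carrier \<rho>" if "t \<in> T" for t using f(2) that by (auto simp: bij_betw_def car)
  have Gadd: "G (x + y) = G x + G y" if "x \<in> T" "y \<in> T" for x y
  proof -
    have "cf (x + y) = cf x \<oplus>\<^bsub>ideal_rep T\<^esub> cf y" using that by (simp add: ideal_rep_def cf_add[OF subsetD[OF TK] subsetD[OF TK]])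
    moreover have "f (cf x \<oplus>\<^bsub>ideal_rep T\<^esub> cf y) = f (cf x) \<oplus>\<^bsub>\<rho>\<^esub> f (cf y)"
      using f(1) that unfolding rep_hom_def module_hom_def car by blast
    ultimately show ?thesis unfolding G_def using D(2) fc that by simp
  qed
  have Gsc: "G (sc a * x) = sc a * G x" if "x \<in> T" for a x
  proof -
    have "cf (sc a * x) = a \<odot>\<^bsub>ideal_rep T\<^esub> cf x" using that by (simp add: ideal_rep_def cf_scale[OF subsetD[OF TK]])
    moreover have "f (a \<odot>\<^bsub>ideal_rep T\<^esub> cf x) = a \<odot>\<^bsub>\<rho>\<^esub> f (cf x)"
      using f(1) that unfolding rep_hom_def module_hom_def car by simp
    ultimately show ?thesis unfolding G_def using D(3) fc that by simp
  qed
  have G\<eta>: "G (x * \<eta> h) = G x * \<eta> h" if "x \<in> T" "h \<in> carrier H" for x h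
  proof -
    have "cf (x * \<eta> h) = act (ideal_rep T) h (cf x)" using that by (simp add: ideal_rep_def cf_\<eta>[OF subsetD[OF TK]])
    moreover have "f (act (ideal_rep T) h (cf x)) = act \<rho> h (f (cf x))"
      using f(1) that unfolding rep_hom_def car by blast
    ultimately show ?thesis unfolding G_def using D(5) fc that by simp
  qed
  have "f ` cf ` T = carrier \<rho>" using f(2) unfolding bij_betw_def car by (rule conjunct2)
  moreover obtain v where v: "v \<in> carrier \<rho>" "\<epsilon> \<rho> = \<theta> \<rho> v" using D(6) by (rule imageE)
  ultimately have "v \<in> f ` cf ` T" by simp
  then obtain t where "t \<in> T" "v = f (cf t)" by (auto elim!: imageE)
  \<comment> \<open>This t corresponds to \<epsilon> \<rho> under the isomorphism. Equivariance
    gives G (t \<epsilon> \<rho>) = \<epsilon> \<rho>, although t \<epsilon> \<rho> = 0.\<close>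
  then have t: "t \<in> T" "G t = \<epsilon> \<rho>" using v(2) by (simp_all add: G_def)
  have T\<eta>: "x * \<eta> h \<in> T" if "x \<in> T" "h \<in> carrier H" for x h
    using Tr that by (simp add: right_ideal_def)
  have "G (t * \<epsilon> \<rho>) = G t * \<epsilon> \<rho>"
    by (rule conjunct2[OF equivariant_mult[of T G t "\<epsilon> \<rho>", OF Ts T\<eta> Gadd Gsc G\<eta> t(1) D(9)]])
  also have "t * \<epsilon> \<rho> = 0"
  proof (rule TI[OF t(1)])
    have "\<epsilon> \<rho> = e0 * \<epsilon> \<rho> * e0" using e0_left e0_right D(9) by simp
    then have "\<epsilon> \<rho> \<in> ?J" using \<rho>(1) e0_K by blast
    then show "\<epsilon> \<rho> \<in> ?I" by (rule vs.span_base)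
  qed
  also have "G 0 = 0" using Gadd[of 0 0] vs.subspace_0[OF Ts] by simp
  finally show False using D(8,10) t(2) by simp
qed

text \<open>The unit \<open>e0\<close> already lies in the span of the terms of a finite part
  \<open>S0\<close>. For \<rho> outside \<open>S0\<close>, orthogonality would give \<epsilon>
  \<rho> = \<epsilon> \<rho> e0 = 0.\<close>

lemma S_finite: "finite S"
proof -
  let ?J = "\<lambda>S0. {x * \<epsilon> \<rho> * y | \<rho> x y. \<rho> \<in> S0 \<and> x \<in> K \<and> y \<in> K}"
  have "\<exists>S0. finite S0 \<and> S0 \<subseteq> S \<and> z \<in> vs.span (?J S0)" if "z \<in> vs.span (?J S)" for z
    using that
  proof (induction rule: vs.span_induct_alt)
    case base
    then show ?case by (intro exI[of _ "{}"]) (simp add: vs.span_zero)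
  next
    case (step c s z)
    then obtain S0 where S0: "finite S0" "S0 \<subseteq> S" "z \<in> vs.span (?J S0)" by blast
    from step(1) obtain \<rho> where \<rho>: "\<rho> \<in> S" "s \<in> ?J {\<rho>}" by blast
    have "?J {\<rho>} \<subseteq> ?J (insert \<rho> S0)" "?J S0 \<subseteq> ?J (insert \<rho> S0)" by blast+
    then have "s \<in> vs.span (?J (insert \<rho> S0))" "z \<in> vs.span (?J (insert \<rho> S0))"
      using vs.span_base[OF subsetD[OF _ \<rho>(2)]] subsetD[OF vs.span_mono S0(3)] by simp_all
    then have "sc c * s + z \<in> vs.span (?J (insert \<rho> S0))" by (intro vs.span_add vs.span_scale)
    then show ?case using S0 \<rho>(1) by (intro exI[of _ "insert \<rho> S0"]) auto
  qed
  then obtain S0 where S0: "finite S0" "S0 \<subseteq> S" "e0 \<in> vs.span (?J S0)" using e0_in_span by blast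
  have "S \<subseteq> S0"
  proof (rule subsetI, rule ccontr)
    fix \<rho> assume \<rho>: "\<rho> \<in> S" "\<rho> \<notin> S0"
    note D = realizesD[OF R[OF \<rho>(1)]]
    have "\<epsilon> \<rho> * z = 0" if "z \<in> vs.span (?J S0)" for z
      using that
    proof (induction rule: vs.span_induct_alt)
      case (step c s z)
      from step(1) obtain \<sigma> x y where s: "s = x * \<epsilon> \<sigma> * y" "\<sigma> \<in> S0" "x \<in> K" by blast
      have "\<epsilon> \<rho> * x * \<epsilon> \<sigma> = 0" using s \<rho> S0(2) by (intro S_orthogonal) auto
      then have "\<epsilon> \<rho> * s = 0" by (simp add: s(1) mult.assoc[symmetric])
      then show ?case using step by (simp add: distrib_left mult_sc)
    qed simp
    from this[OF S0(3)] show False using e0_right[OF D(9)] D(8) by simp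
  qed
  then show ?thesis using S0(1) finite_subset by blast
qed

end

end

section \<open>Linear endomorphisms as an algebra\<close>

text \<open>Path algebras and skew group algebras live on carriers of records, whereas the linear
  algebra above lives in a ring of class \<open>ring_1\<close>. Linear operators on functions form
  such a ring that is large enough to contain them.\<close>

typedef (overloaded) ('b, 'k) linend = "{T :: ('b \<Rightarrow> 'k::field) \<Rightarrow> 'b \<Rightarrow> 'k.
    (\<forall>f g. T (\<lambda>x. f x + g x) = (\<lambda>x. T f x + T g x)) \<and> (\<forall>c f. T (\<lambda>x. c * f x) = (\<lambda>x. c * T f x))}"
  morphisms app Linend
  by (rule exI[of _ "\<lambda>f. f"]) simp

setup_lifting type_definition_linend

instantiation linend :: (type, field) ring_1
begin

lift_definition zero_linend :: "('a, 'b) linend" is "\<lambda>f x. 0" by simp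
lift_definition one_linend :: "('a, 'b) linend" is "\<lambda>f. f" by simp
lift_definition plus_linend :: "('a, 'b) linend \<Rightarrow> ('a, 'b) linend \<Rightarrow> ('a, 'b) linend"
  is "\<lambda>S T f x. S f x + T f x" by (simp add: algebra_simps)
lift_definition minus_linend :: "('a, 'b) linend \<Rightarrow> ('a, 'b) linend \<Rightarrow> ('a, 'b) linend"
  is "\<lambda>S T f x. S f x - T f x" by (simp add: algebra_simps)
lift_definition uminus_linend :: "('a, 'b) linend \<Rightarrow> ('a, 'b) linend"
  is "\<lambda>T f x. - T f x" by (simp add: algebra_simps)
lift_definition times_linend :: "('a, 'b) linend \<Rightarrow> ('a, 'b) linend \<Rightarrow> ('a, 'b) linend"
  is "\<lambda>S T f. S (T f)" by simp

instance
proof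
  show "(0 :: ('a, 'b) linend) \<noteq> 1"
    by transfer (metis zero_neq_one)
qed (transfer; simp add: algebra_simps)+

end

lift_definition lscale :: "'k \<Rightarrow> ('b, 'k::field) linend" is "\<lambda>c f x. c * f x"
  by (simp add: algebra_simps)

lemma central_algebra_lscale: "central_algebra (lscale :: 'k::field \<Rightarrow> ('b, 'k) linend)"
proof
  fix a b :: 'k and T :: "('b, 'k) linend"
  show "lscale (a + b) = (lscale a + lscale b :: ('b, 'k) linend)"
    by transfer (simp add: distrib_right)
  show "lscale (a * b) = (lscale a * lscale b :: ('b, 'k) linend)"
    by transfer (simp add: mult.assoc)
  show "lscale 1 = (1 :: ('b, 'k) linend)" by transfer simp
  show "lscale a * T = T * lscale a" by transfer simp
qed

lemma app_sum: "app (\<Sum>i\<in>I. T i) f x = (\<Sum>i\<in>I. app (T i) f x)"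
  by (induction I rule: infinite_finite_induct) (simp_all add: zero_linend.rep_eq plus_linend.rep_eq)

text \<open>Pointwise multiplication makes the functions a ring in which the constants are central
  scalars, so \<open>projection_exists\<close> applies.\<close>

lemma function_projection_exists:
  fixes N :: "('b \<Rightarrow> 'k::field) set"
  assumes "(\<lambda>_. 0) \<in> N" "\<And>f g. \<lbrakk>f \<in> N; g \<in> N\<rbrakk> \<Longrightarrow> (\<lambda>x. f x + g x) \<in> N"
    "\<And>c f. f \<in> N \<Longrightarrow> (\<lambda>x. c * f x) \<in> N"
  obtains P where "\<And>f g. P (\<lambda>x. f x + g x) = (\<lambda>x. P f x + P g x)" "\<And>c f. P (\<lambda>x. c * f x) = (\<lambda>x. c * P f x)"
    "\<And>f. P f \<in> N" "\<And>f. f \<in> N \<Longrightarrow> P f = f"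
proof -
  interpret central_algebra "\<lambda>c :: 'k. (\<lambda>_ :: 'b. c)"
  proof
    fix a b :: 'k and x :: "'b \<Rightarrow> 'k"
    show "(\<lambda>_ :: 'b. a + b) = (\<lambda>_. a) + (\<lambda>_. b)" "(\<lambda>_ :: 'b. a * b) = (\<lambda>_. a) * (\<lambda>_. b)"
      "(\<lambda>_ :: 'b. 1 :: 'k) = 1" by (simp_all add: plus_fun_def times_fun_def one_fun_def)
    show "(\<lambda>_. a) * x = x * (\<lambda>_. a)" by (simp add: times_fun_def mult.commute)
  qed
  have N: "vs.subspace N"
  proof (rule vs.subspaceI)
    show "0 \<in> N" unfolding zero_fun_def by (rule assms(1))
    show "f + g \<in> N" if "f \<in> N" "g \<in> N" for f g unfolding plus_fun_def by (rule assms(2)[OF that])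
    show "(\<lambda>_. c) * f \<in> N" if "f \<in> N" for c f unfolding times_fun_def by (rule assms(3)[OF that])
  qed
  obtain P where P: "\<And>x y. P (x + y) = P x + P y" "\<And>c x. P ((\<lambda>_. c) * x) = (\<lambda>_. c) * P x"
    "\<And>x. P x \<in> N" "\<And>x. x \<in> N \<Longrightarrow> P x = x" by (rule projection_exists[OF N]) (rule that)
  show ?thesis
  proof (rule that[of P])
    show "P (\<lambda>x. f x + g x) = (\<lambda>x. P f x + P g x)" for f g using P(1)[of f g] unfolding plus_fun_def .
    show "P (\<lambda>x. c * f x) = (\<lambda>x. c * P f x)" for c f using P(2)[of c f] unfolding times_fun_def .
  qed (rule P(3), rule P(4))
qed

section \<open>Path algebras\<close>

lemma path_algebra_simps [simp]:
  "\<zero>\<^bsub>path_algebra Q\<^esub> = (\<lambda>_. 0)" "f \<oplus>\<^bsub>path_algebra Q\<^esub> g = (\<lambda>x. f x + g x)"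
  "c \<odot>\<^bsub>path_algebra Q\<^esub> f = (\<lambda>x. c * f x)"
  by (simp_all add: path_algebra_def)

lemma carrier_path_algebra: "carrier (path_algebra Q) = {f. finite {x. f x \<noteq> 0} \<and> {x. f x \<noteq> 0} \<subseteq> paths Q}"
  by (simp add: path_algebra_def)

lemma path_algebra_mult:
  "(f \<otimes>\<^bsub>path_algebra Q\<^esub> g) (u, r, w) =
    (\<Sum>(p, v, q) \<in> {(p, v, q). (u, p, v) \<in> paths Q \<and> (v, q, w) \<in> paths Q \<and> p @ q = r}. f (v, q, w) * g (u, p, v))"
  by (simp add: path_algebra_def)

lemma path_algebra_closed:
  "(\<lambda>_. 0) \<in> carrier (path_algebra Q)"
  "\<lbrakk>f \<in> carrier (path_algebra Q); g \<in> carrier (path_algebra Q)\<rbrakk> \<Longrightarrow> (\<lambda>x. f x + g x) \<in> carrier (path_algebra Q)"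
  "f \<in> carrier (path_algebra Q) \<Longrightarrow> (\<lambda>x. c * f x) \<in> carrier (path_algebra Q)"
  "p \<in> paths Q \<Longrightarrow> unit_fun p \<in> carrier (path_algebra Q)"
proof -
  show "(\<lambda>_. 0) \<in> carrier (path_algebra Q)" by (simp add: carrier_path_algebra)
  show "(\<lambda>x. f x + g x) \<in> carrier (path_algebra Q)"
    if "f \<in> carrier (path_algebra Q)" "g \<in> carrier (path_algebra Q)"
  proof -
    have "{x. f x + g x \<noteq> 0} \<subseteq> {x. f x \<noteq> 0} \<union> {x. g x \<noteq> 0}" by auto
    then show ?thesis using that by (auto simp: carrier_path_algebra intro: finite_subset)
  qed
  show "(\<lambda>x. c * f x) \<in> carrier (path_algebra Q)" if "f \<in> carrier (path_algebra Q)"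
  proof -
    have "{x. c * f x \<noteq> 0} \<subseteq> {x. f x \<noteq> 0}" by auto
    then show ?thesis using that by (auto simp: carrier_path_algebra intro: finite_subset)
  qed
  show "unit_fun p \<in> carrier (path_algebra Q)" if "p \<in> paths Q"
    using that by (auto simp: carrier_path_algebra unit_fun_def)
qed

lemma path_algebra_induct [consumes 1, case_names zero step]:
  assumes f: "f \<in> carrier (path_algebra Q)" and zero: "P (\<lambda>_. 0)"
    and step: "\<And>c p f. \<lbrakk>p \<in> paths Q; f \<in> carrier (path_algebra Q); P f\<rbrakk> \<Longrightarrow> P (\<lambda>x. c * unit_fun p x + f x)"
  shows "P f"
proof -
  have "P f" if "finite T" "f \<in> carrier (path_algebra Q)" "{x. f x \<noteq> 0} \<subseteq> T" for T f
    using that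
  proof (induction T arbitrary: f rule: finite_induct)
    case empty
    then have "f = (\<lambda>_. 0)" by auto
    then show ?case using zero by simp
  next
    case (insert y T)
    let ?g = "f(y := 0)"
    have "{x. ?g x \<noteq> 0} \<subseteq> {x. f x \<noteq> 0}" by auto
    then have g: "?g \<in> carrier (path_algebra Q)"
      using insert.prems(1) by (auto simp: carrier_path_algebra intro: finite_subset)
    have Pg: "P ?g" using insert.prems(2) by (intro insert.IH g) auto
    show ?case
    proof (cases "f y = 0")
      case True
      then have "?g = f" by auto
      then show ?thesis using Pg by simp
    next
      case False
      then have "y \<in> paths Q" using insert.prems(1) by (auto simp: carrier_path_algebra)
      moreover have "(\<lambda>x. f y * unit_fun y x + ?g x) = f" by (simp add: fun_eq_iff unit_fun_def)
      ultimately show ?thesis using step[OF _ g Pg, of y "f y"] by simp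
    qed
  qed
  from this[of "{x. f x \<noteq> 0}"] show ?thesis using f by (auto simp: carrier_path_algebra)
qed

lemma path_algebra_mult_linear:
  "(\<lambda>x. f x + f' x) \<otimes>\<^bsub>path_algebra Q\<^esub> g = (\<lambda>x. (f \<otimes>\<^bsub>path_algebra Q\<^esub> g) x + (f' \<otimes>\<^bsub>path_algebra Q\<^esub> g) x)"
  "f \<otimes>\<^bsub>path_algebra Q\<^esub> (\<lambda>x. g x + g' x) = (\<lambda>x. (f \<otimes>\<^bsub>path_algebra Q\<^esub> g) x + (f \<otimes>\<^bsub>path_algebra Q\<^esub> g') x)"
  "(\<lambda>x. c * f x) \<otimes>\<^bsub>path_algebra Q\<^esub> g = (\<lambda>x. c * (f \<otimes>\<^bsub>path_algebra Q\<^esub> g) x)"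
  "f \<otimes>\<^bsub>path_algebra Q\<^esub> (\<lambda>x. c * g x) = (\<lambda>x. c * (f \<otimes>\<^bsub>path_algebra Q\<^esub> g) x)"
  "(\<lambda>x. 0) \<otimes>\<^bsub>path_algebra Q\<^esub> g = (\<lambda>x. 0)"
  "f \<otimes>\<^bsub>path_algebra Q\<^esub> (\<lambda>x. 0) = (\<lambda>x. 0)"
proof -
  show "(\<lambda>x. f x + f' x) \<otimes>\<^bsub>path_algebra Q\<^esub> g = (\<lambda>x. (f \<otimes>\<^bsub>path_algebra Q\<^esub> g) x + (f' \<otimes>\<^bsub>path_algebra Q\<^esub> g) x)"
    by (auto simp: fun_eq_iff path_algebra_mult case_prod_unfold distrib_right sum.distrib)
  show "f \<otimes>\<^bsub>path_algebra Q\<^esub> (\<lambda>x. g x + g' x) = (\<lambda>x. (f \<otimes>\<^bsub>path_algebra Q\<^esub> g) x + (f \<otimes>\<^bsub>path_algebra Q\<^esub> g') x)"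
    by (auto simp: fun_eq_iff path_algebra_mult case_prod_unfold distrib_left sum.distrib)
  show "(\<lambda>x. c * f x) \<otimes>\<^bsub>path_algebra Q\<^esub> g = (\<lambda>x. c * (f \<otimes>\<^bsub>path_algebra Q\<^esub> g) x)"
    by (auto simp: fun_eq_iff path_algebra_mult case_prod_unfold sum_distrib_left mult.assoc)
  show "f \<otimes>\<^bsub>path_algebra Q\<^esub> (\<lambda>x. c * g x) = (\<lambda>x. c * (f \<otimes>\<^bsub>path_algebra Q\<^esub> g) x)"
    by (auto simp: fun_eq_iff path_algebra_mult case_prod_unfold sum_distrib_left mult.left_commute)
  show "(\<lambda>x. 0) \<otimes>\<^bsub>path_algebra Q\<^esub> g = (\<lambda>x. 0)" "f \<otimes>\<^bsub>path_algebra Q\<^esub> (\<lambda>x. 0) = (\<lambda>x. 0)"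
    by (auto simp: fun_eq_iff path_algebra_mult)
qed

context wf_digraph
begin

text \<open>A splitting is determined by the length of its first part.\<close>

lemma finite_splittings:
  "finite {(p, v, q). (u, p, v) \<in> paths G \<and> (v, q, w) \<in> paths G \<and> p @ q = r}" (is "finite ?S")
proof (rule finite_subset)
  show "?S \<subseteq> (\<lambda>n. (take n r, awlast u (take n r), drop n r)) ` {..length r}"
  proof (rule subsetI)
    fix t assume "t \<in> ?S"
    then obtain p v q where t: "t = (p, v, q)" "(u, p, v) \<in> paths G" "p @ q = r" by auto
    then have "awlast u p = v" by (auto simp: paths_def)
    then show "t \<in> (\<lambda>n. (take n r, awlast u (take n r), drop n r)) ` {..length r}"
      using t(1) t(3)[symmetric] by (intro image_eqI[of _ _ "length p"]) auto
  qed
qed simp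

text \<open>The right factor is traversed first, so only the splitting with prefix \<open>p0\<close>
  contributes, and f is evaluated at the remainder.\<close>

lemma path_algebra_mult_unit:
  assumes f: "f \<in> carrier (path_algebra G)" and p: "(u0, p0, v0) \<in> paths G"
  shows "(f \<otimes>\<^bsub>path_algebra G\<^esub> unit_fun (u0, p0, v0)) (u, r, w) =
    (if u = u0 \<and> (\<exists>q. r = p0 @ q) then f (v0, drop (length p0) r, w) else 0)"
proof -
  let ?S = "{(p, v, q). (u, p, v) \<in> paths G \<and> (v, q, w) \<in> paths G \<and> p @ q = r}"
  let ?t = "(p0, v0, drop (length p0) r)"
  let ?F = "\<lambda>(p, v, q). f (v, q, w) * unit_fun (u0, p0, v0) (u, p, v)"
  have "(f \<otimes>\<^bsub>path_algebra G\<^esub> unit_fun (u0, p0, v0)) (u, r, w) = sum ?F ?S"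
    by (simp add: path_algebra_mult)
  also have "\<dots> = sum ?F (?S \<inter> {?t})"
    using finite_splittings by (intro sum.mono_neutral_right) (auto simp: unit_fun_def split: if_splits)
  also have "\<dots> = (if u = u0 \<and> (\<exists>q. r = p0 @ q) then f (v0, drop (length p0) r, w) else 0)"
  proof (cases "?t \<in> ?S")
    case True
    then have "?S \<inter> {?t} = {?t}" by (simp only: Int_insert_right_if1 Int_empty_right)
    moreover have "p0 @ drop (length p0) r = r" using True by simp
    ultimately show ?thesis by (auto simp: unit_fun_def) (metis)
  next
    case False
    have e: "?S \<inter> {?t} = {}" using Int_insert_right_if0[OF False, of "{}"] by (simp only: Int_empty_right)
    \<comment> \<open>When this splitting is inadmissible, the claimed value must vanish as well. It
      does: f is supported on paths, and a path following \<open>p0\<close> would make the splitting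
      admissible.\<close>
    have "f (v0, drop (length p0) r, w) = 0" if "u = u0" "r = p0 @ q" for q
    proof (rule ccontr)
      assume "f (v0, drop (length p0) r, w) \<noteq> 0"
      then have "(v0, drop (length p0) r, w) \<in> paths G" using f by (auto simp: carrier_path_algebra)
      then show False using False that p by auto
    qed
    then show ?thesis unfolding e by auto
  qed
  finally show ?thesis .
qed

lemma unit_mult_unit:
  assumes "(v', q, w) \<in> paths G" "(u, p, v) \<in> paths G"
  shows "(unit_fun (v', q, w) :: _ \<Rightarrow> 'k::field) \<otimes>\<^bsub>path_algebra G\<^esub> unit_fun (u, p, v) = (if v = v' then unit_fun (u, p @ q, w) else (\<lambda>_. 0))"
proof
  fix x :: "'a \<times> 'b list \<times> 'a"
  obtain a r b where x: "x = (a, r, b)" by (cases x)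
  have "((unit_fun (v', q, w) :: _ \<Rightarrow> 'k) \<otimes>\<^bsub>path_algebra G\<^esub> unit_fun (u, p, v)) (a, r, b)
    = (if a = u \<and> (\<exists>s. r = p @ s) then unit_fun (v', q, w) (v, drop (length p) r, b) else 0)"
    by (rule path_algebra_mult_unit[OF path_algebra_closed(4)[OF assms(1)] assms(2)])
  also have "\<dots> = (if v = v' then unit_fun (u, p @ q, w) else (\<lambda>_. 0)) (a, r, b)"
    by (auto simp: unit_fun_def)
  finally show "((unit_fun (v', q, w) :: _ \<Rightarrow> 'k) \<otimes>\<^bsub>path_algebra G\<^esub> unit_fun (u, p, v)) x
    = (if v = v' then unit_fun (u, p @ q, w) else (\<lambda>_. 0)) x"
    by (simp only: x)
qed

lemma paths_append: "\<lbrakk>(u, p, v) \<in> paths G; (v, q, w) \<in> paths G\<rbrakk> \<Longrightarrow> (u, p @ q, w) \<in> paths G"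
  by (auto simp: paths_def intro: awalk_appendI)

lemma path_algebra_mult_closed:
  assumes f: "(f :: _ \<Rightarrow> 'k::field) \<in> carrier (path_algebra G)" and g: "g \<in> carrier (path_algebra G)"
  shows "f \<otimes>\<^bsub>path_algebra G\<^esub> g \<in> carrier (path_algebra G)"
  using f
proof (induction rule: path_algebra_induct)
  case zero
  then show ?case by (simp add: path_algebra_mult_linear path_algebra_closed)
next
  case (step c p f)
  have "unit_fun p \<otimes>\<^bsub>path_algebra G\<^esub> g \<in> carrier (path_algebra G)"
    using g
  proof (induction rule: path_algebra_induct)
    case zero
    then show ?case by (simp add: path_algebra_mult_linear path_algebra_closed)
  next
    case (step d q g)
    have "(unit_fun p :: _ \<Rightarrow> 'k) \<otimes>\<^bsub>path_algebra G\<^esub> unit_fun q \<in> carrier (path_algebra G)"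
      using \<open>p \<in> paths G\<close> step(1) by (cases p; cases q) (auto simp: unit_mult_unit paths_append intro!: path_algebra_closed)
    then show ?case using step by (simp add: path_algebra_mult_linear path_algebra_closed)
  qed
  then show ?case using step by (simp add: path_algebra_mult_linear path_algebra_closed)
qed

lemma path_algebra_assoc:
  assumes f: "(f :: _ \<Rightarrow> 'k::field) \<in> carrier (path_algebra G)" and g: "g \<in> carrier (path_algebra G)"
    and h: "h \<in> carrier (path_algebra G)"
  shows "(f \<otimes>\<^bsub>path_algebra G\<^esub> g) \<otimes>\<^bsub>path_algebra G\<^esub> h = f \<otimes>\<^bsub>path_algebra G\<^esub> (g \<otimes>\<^bsub>path_algebra G\<^esub> h)"
  using f
proof (induction rule: path_algebra_induct)
  case (step c p f)
  have "(unit_fun p \<otimes>\<^bsub>path_algebra G\<^esub> g) \<otimes>\<^bsub>path_algebra G\<^esub> h = unit_fun p \<otimes>\<^bsub>path_algebra G\<^esub> (g \<otimes>\<^bsub>path_algebra G\<^esub> h)"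
    using g
  proof (induction rule: path_algebra_induct)
    case (step d q g)
    have "(unit_fun p \<otimes>\<^bsub>path_algebra G\<^esub> unit_fun q) \<otimes>\<^bsub>path_algebra G\<^esub> h = unit_fun p \<otimes>\<^bsub>path_algebra G\<^esub> (unit_fun q \<otimes>\<^bsub>path_algebra G\<^esub> h)"
      using h
    proof (induction rule: path_algebra_induct)
      case (step a r h)
      have "((unit_fun p :: _ \<Rightarrow> 'k) \<otimes>\<^bsub>path_algebra G\<^esub> unit_fun q) \<otimes>\<^bsub>path_algebra G\<^esub> unit_fun r = unit_fun p \<otimes>\<^bsub>path_algebra G\<^esub> (unit_fun q \<otimes>\<^bsub>path_algebra G\<^esub> unit_fun r)"
        using \<open>p \<in> paths G\<close> \<open>q \<in> paths G\<close> step(1)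
        by (cases p; cases q; cases r) (auto simp: unit_mult_unit paths_append path_algebra_mult_linear)
      then show ?case using step by (simp add: path_algebra_mult_linear)
    qed (simp add: path_algebra_mult_linear)
    then show ?case using step by (simp add: path_algebra_mult_linear)
  qed (simp add: path_algebra_mult_linear)
  then show ?case using step by (simp add: path_algebra_mult_linear)
qed (simp add: path_algebra_mult_linear)

lemma one_path_algebra:
  assumes "finite (verts G)"
  shows "\<one>\<^bsub>path_algebra G\<^esub> = (\<lambda>x. \<Sum>i\<in>verts G. vertex_idem i x)" "\<one>\<^bsub>path_algebra G\<^esub> \<in> carrier (path_algebra G)"
proof -
  show "\<one>\<^bsub>path_algebra G\<^esub> = (\<lambda>x. \<Sum>i\<in>verts G. vertex_idem i x)"
  proof
    fix x :: "'a \<times> 'b list \<times> 'a"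
    obtain u p v where x: "x = (u, p, v)" by (cases x)
    have "(\<Sum>i\<in>verts G. vertex_idem i x) = (\<Sum>i\<in>verts G. if u = i then (if p = [] \<and> v = u then 1 else 0) else (0 :: 'k::field))"
      by (intro sum.cong) (auto simp: x vertex_idem_def unit_fun_def)
    also have "\<dots> = (if u \<in> verts G \<and> p = [] \<and> v = u then 1 else 0)"
      using assms by auto
    also have "\<dots> = \<one>\<^bsub>path_algebra G\<^esub> x" by (simp add: x path_algebra_def)
    finally show "\<one>\<^bsub>path_algebra G\<^esub> x = (\<Sum>i\<in>verts G. vertex_idem i x)" by (rule sym)
  qed
  have "{x. \<one>\<^bsub>path_algebra G\<^esub> x \<noteq> (0::'k::field)} \<subseteq> (\<lambda>i. (i, [], i)) ` verts G"
    by (auto simp: path_algebra_def split: if_splits)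
  moreover have "(\<lambda>i. (i, [], i)) ` verts G \<subseteq> paths G" by (auto simp: paths_def awalk_Nil_iff)
  ultimately show "\<one>\<^bsub>path_algebra G\<^esub> \<in> carrier (path_algebra G)"
    using assms finite_subset by (fastforce simp: carrier_path_algebra)
qed

lemma vertex_path: "i \<in> verts G \<Longrightarrow> (i, [], i) \<in> paths G"
  by (auto simp: paths_def awalk_Nil_iff)

lemma arrow_path: "a \<in> arcs G \<Longrightarrow> (tail G a, [a], head G a) \<in> paths G"
  by (auto simp: paths_def arc_implies_awalk)

lemma vertex_idem_closed: "i \<in> verts G \<Longrightarrow> vertex_idem i \<in> carrier (path_algebra G)"
  by (simp add: vertex_idem_def path_algebra_closed vertex_path)

lemma arrow_elt_closed: "a \<in> arcs G \<Longrightarrow> arrow_elt G a \<in> carrier (path_algebra G)"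
  by (simp add: arrow_elt_def path_algebra_closed arrow_path)

lemma ring_path_algebra:
  assumes "finite (verts G)" shows "ring (path_algebra G :: ('k::field, _) module)"
proof -
  let ?P = "path_algebra G :: ('k, _) module"
  interpret P: vectorspace class_ring ?P by (rule vectorspace_path_algebra)
  note one = one_path_algebra[OF assms]
  have left1: "\<one>\<^bsub>?P\<^esub> \<otimes>\<^bsub>?P\<^esub> f = f" if "f \<in> carrier ?P" for f
    using that
  proof (induction rule: path_algebra_induct)
    case (step c p f)
    obtain u r w where p: "p = (u, r, w)" by (cases p)
    have w: "w \<in> verts G" using step(1) by (auto simp: p paths_def)
    have "(\<one>\<^bsub>?P\<^esub> \<otimes>\<^bsub>?P\<^esub> unit_fun p) x = unit_fun p x" for x
    proof -
      obtain a b d where x: "x = (a, b, d)" by (cases x)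
      show ?thesis using path_algebra_mult_unit[OF one(2) step(1)[unfolded p], of a b d] w
        by (auto simp: x p path_algebra_def unit_fun_def)
    qed
    then have "\<one>\<^bsub>?P\<^esub> \<otimes>\<^bsub>?P\<^esub> unit_fun p = unit_fun p" by blast
    then show ?case using step by (simp add: path_algebra_mult_linear)
  qed (simp add: path_algebra_mult_linear)
  have sums: "(f \<otimes>\<^bsub>?P\<^esub> (\<lambda>x. \<Sum>i\<in>S. vertex_idem i x)) y = (\<Sum>i\<in>S. (f \<otimes>\<^bsub>?P\<^esub> vertex_idem i) y)" if "finite S" for f S y
    using that by (induction rule: finite_induct) (simp_all add: path_algebra_mult_linear)
  have right1: "f \<otimes>\<^bsub>?P\<^esub> \<one>\<^bsub>?P\<^esub> = f" if f: "f \<in> carrier ?P" for f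
  proof
    fix x :: "'a \<times> 'b list \<times> 'a"
    obtain u r w where x: "x = (u, r, w)" by (cases x)
    have "(f \<otimes>\<^bsub>?P\<^esub> \<one>\<^bsub>?P\<^esub>) x = (\<Sum>i\<in>verts G. (f \<otimes>\<^bsub>?P\<^esub> vertex_idem i) x)"
      unfolding one(1) by (rule sums[OF assms])
    also have "\<dots> = (\<Sum>i\<in>verts G. if u = i then f x else 0)"
      using f by (intro sum.cong) (auto simp: vertex_idem_def x path_algebra_mult_unit vertex_path)
    also have "\<dots> = f x"
    proof (cases "u \<in> verts G")
      case False
      then have "f x = 0" using f by (auto simp: x carrier_path_algebra paths_def)
      then show ?thesis by simp
    qed (use assms in simp)
    finally show "(f \<otimes>\<^bsub>?P\<^esub> \<one>\<^bsub>?P\<^esub>) x = f x" .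
  qed
  show ?thesis
  proof (rule ringI)
    show "abelian_group ?P" by unfold_locales
    show "Group.monoid ?P"
      by (rule monoidI) (simp_all add: one(2) path_algebra_mult_closed path_algebra_assoc left1 right1)
  qed (simp_all add: path_algebra_mult_linear)
qed

end

section \<open>A model of the skew group algebra\<close>

text \<open>
  The skew group algebra is realised inside a type-class ring \<open>'a\<close>, by \<open>\<iota>\<close> on the path algebra
  and \<open>\<gamma>\<close> on the group.
\<close>

locale skew_model = central_algebra sc + right_algebra_action G "path_algebra Q" \<phi> + quiver: wf_digraph Q
  for sc :: "'k::field \<Rightarrow> 'a::ring_1" and G :: "('g, 'n) monoid_scheme" (structure)
    and Q :: "('v, 'e) pre_digraph"
    and \<phi> :: "'g \<Rightarrow> (('v, 'e) path \<Rightarrow> 'k) \<Rightarrow> ('v, 'e) path \<Rightarrow> 'k" +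
  fixes \<iota> :: "(('v, 'e) path \<Rightarrow> 'k) \<Rightarrow> 'a" and \<gamma> :: "'g \<Rightarrow> 'a"
  assumes finite_G: "finite (carrier G)" and finite_verts: "finite (verts Q)"
    and \<iota>_add: "\<lbrakk>x \<in> carrier (path_algebra Q); y \<in> carrier (path_algebra Q)\<rbrakk> \<Longrightarrow> \<iota> (\<lambda>p. x p + y p) = \<iota> x + \<iota> y"
    and \<iota>_scale: "x \<in> carrier (path_algebra Q) \<Longrightarrow> \<iota> (\<lambda>p. c * x p) = sc c * \<iota> x"
    and \<iota>_mult: "\<lbrakk>x \<in> carrier (path_algebra Q); y \<in> carrier (path_algebra Q)\<rbrakk>
      \<Longrightarrow> \<iota> (x \<otimes>\<^bsub>path_algebra Q\<^esub> y) = \<iota> x * \<iota> y"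
    and \<gamma>_mult: "\<lbrakk>g \<in> carrier G; h \<in> carrier G\<rbrakk> \<Longrightarrow> \<gamma> (g \<otimes> h) = \<gamma> g * \<gamma> h"
    and \<gamma>_one: "\<gamma> \<one> = \<iota> \<one>\<^bsub>path_algebra Q\<^esub>"
    and \<iota>_\<gamma>: "\<lbrakk>x \<in> carrier (path_algebra Q); g \<in> carrier G\<rbrakk> \<Longrightarrow> \<iota> x * \<gamma> g = \<gamma> g * \<iota> (\<phi> g x)"
    and \<gamma>_indep: "\<lbrakk>\<And>g. g \<in> carrier G \<Longrightarrow> z g \<in> carrier (path_algebra Q);
      (\<Sum>g \<in> carrier G. \<gamma> g * \<iota> (z g)) = 0; h \<in> carrier G\<rbrakk> \<Longrightarrow> z h = (\<lambda>_. 0)"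

context right_algebra_action
begin

lemma \<phi>_closed: "\<lbrakk>g \<in> carrier G; x \<in> carrier \<Lambda>\<rbrakk> \<Longrightarrow> \<phi> g x \<in> carrier \<Lambda>"
  and \<phi>_add: "\<lbrakk>g \<in> carrier G; x \<in> carrier \<Lambda>; y \<in> carrier \<Lambda>\<rbrakk> \<Longrightarrow> \<phi> g (x \<oplus>\<^bsub>\<Lambda>\<^esub> y) = \<phi> g x \<oplus>\<^bsub>\<Lambda>\<^esub> \<phi> g y"
  and \<phi>_mult: "\<lbrakk>g \<in> carrier G; x \<in> carrier \<Lambda>; y \<in> carrier \<Lambda>\<rbrakk> \<Longrightarrow> \<phi> g (x \<otimes>\<^bsub>\<Lambda>\<^esub> y) = \<phi> g x \<otimes>\<^bsub>\<Lambda>\<^esub> \<phi> g y"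
  and \<phi>_smult: "\<lbrakk>g \<in> carrier G; x \<in> carrier \<Lambda>\<rbrakk> \<Longrightarrow> \<phi> g (c \<odot>\<^bsub>\<Lambda>\<^esub> x) = c \<odot>\<^bsub>\<Lambda>\<^esub> \<phi> g x"
  and \<phi>_one: "g \<in> carrier G \<Longrightarrow> \<phi> g \<one>\<^bsub>\<Lambda>\<^esub> = \<one>\<^bsub>\<Lambda>\<^esub>"
  using automorphism[of g] by (auto simp: Ring.ring_hom_def module_hom_def)

lemma \<phi>_inv: "\<lbrakk>g \<in> carrier G; x \<in> carrier \<Lambda>\<rbrakk> \<Longrightarrow> \<phi> g (\<phi> (inv g) x) = x"
  "\<lbrakk>g \<in> carrier G; x \<in> carrier \<Lambda>\<rbrakk> \<Longrightarrow> \<phi> (inv g) (\<phi> g x) = x"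
  using act_mult[of "inv g" g x] act_mult[of g "inv g" x] act_one[of x] by auto

end

lemma path_algebra_closed_minus:
  "f \<in> carrier (path_algebra Q) \<Longrightarrow> (\<lambda>x. - f x) \<in> carrier (path_algebra Q)"
  "\<lbrakk>f \<in> carrier (path_algebra Q); g \<in> carrier (path_algebra Q)\<rbrakk> \<Longrightarrow> (\<lambda>x. f x - g x) \<in> carrier (path_algebra Q)"
  using path_algebra_closed(3)[of f Q "- 1"] path_algebra_closed(2)[of f Q "\<lambda>x. - g x"]
    path_algebra_closed(3)[of g Q "- 1"] by simp_all

lemma app_Linend:
  assumes "\<And>f g. T (\<lambda>x. f x + g x) = (\<lambda>x. T f x + T g x)" "\<And>c f. T (\<lambda>x. c * f x) = (\<lambda>x. c * T f x)"
  shows "app (Linend T) = T"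
  using assms by (intro Linend_inverse) blast

lemma linend_eqI: "(\<And>f x. app S f x = app T f x) \<Longrightarrow> S = T"
  by (metis app_inject ext)

text \<open>The left regular representation. A formal sum of terms a_h \<otimes> h is stored as the
  function (h, p) \<mapsto> a_h p; \<open>I a\<close> multiplies every a_h by a, and
  \<open>C g\<close> implements g (b \<otimes> h) = \<open>\<phi> (inv g) b\<close> \<otimes> gh.
  Operators have to be defined on all functions, so they are preceded by a projection P onto this
  module; consequently \<gamma> 1 equals P and is only an idempotent.\<close>

lemma skew_model_exists:
  fixes G :: "('g, 'n) monoid_scheme" (structure)
    and Q :: "('v, 'e) pre_digraph" and \<phi> :: "'g \<Rightarrow> (('v, 'e) path \<Rightarrow> 'k::field) \<Rightarrow> ('v, 'e) path \<Rightarrow> 'k"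
  assumes "right_algebra_action G (path_algebra Q) \<phi>" "wf_digraph Q" "finite (carrier G)" "finite (verts Q)"
  shows "\<exists>\<iota> \<gamma>. skew_model (lscale :: 'k \<Rightarrow> ('g \<times> ('v, 'e) path, 'k) linend) G Q \<phi> \<iota> \<gamma>"
proof -
  interpret right_algebra_action G "path_algebra Q" \<phi> by fact
  interpret quiver: wf_digraph Q by fact
  let ?P = "path_algebra Q :: ('k, ('v, 'e) path \<Rightarrow> 'k) module"
  interpret R: ring ?P by (rule quiver.ring_path_algebra) fact
  let ?X = "{f :: 'g \<times> ('v, 'e) path \<Rightarrow> 'k. (\<forall>h \<in> carrier G. (\<lambda>p. f (h, p)) \<in> carrier ?P) \<and> (\<forall>h p. h \<notin> carrier G \<longrightarrow> f (h, p) = 0)}"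
  obtain P where P: "\<And>f g. P (\<lambda>x. f x + g x) = (\<lambda>x. P f x + P g x)" "\<And>c f. P (\<lambda>x. c * f x) = (\<lambda>x. c * P f x)"
    "\<And>f. P f \<in> ?X" "\<And>f. f \<in> ?X \<Longrightarrow> P f = f"
    by (rule function_projection_exists[of ?X]) (auto simp: path_algebra_closed)
  define s where "s f h = (\<lambda>p. P f (h, p))" for f h
  have s: "s f h \<in> carrier ?P" if "h \<in> carrier G" for f h
    using P(3)[of f] that by (simp add: s_def)
  have s_add: "s (\<lambda>x. f x + g x) h = (\<lambda>p. s f h p + s g h p)" and s_scale: "s (\<lambda>x. c * f x) h = (\<lambda>p. c * s f h p)" for f g h c
    by (simp_all add: s_def P(1,2))
  have \<phi>0: "\<phi> g (\<lambda>_. 0) = (\<lambda>_. 0)" if "g \<in> carrier G" for g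
    using \<phi>_smult[OF that path_algebra_closed(1), of 0] by simp
  define I where "I a f = (\<lambda>(h, p). if h \<in> carrier G then (a \<otimes>\<^bsub>?P\<^esub> s f h) p else 0)" for a f
  define C where "C g f = (\<lambda>(h, p). if h \<in> carrier G then \<phi> (inv g) (s f (inv g \<otimes> h)) p else 0)" for g f
  have I: "app (Linend (I a)) = I a" for a
    by (rule app_Linend) (auto simp: I_def s_add s_scale path_algebra_mult_linear fun_eq_iff)
  have C: "app (Linend (C g)) = C g" if "g \<in> carrier G" for g
  proof (rule app_Linend)
    show "C g (\<lambda>x. f x + f' x) = (\<lambda>x. C g f x + C g f' x)" for f f'
      using that s \<phi>_add[of "inv g"] by (auto simp: C_def s_add fun_eq_iff)
    show "C g (\<lambda>x. c * f x) = (\<lambda>x. c * C g f x)" for c f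
      using that s \<phi>_smult[of "inv g"] by (auto simp: C_def s_scale fun_eq_iff)
  qed
  have IX: "I a f \<in> ?X" if "a \<in> carrier ?P" for a f
    using that s by (auto simp: I_def)
  have CX: "C g f \<in> ?X" if "g \<in> carrier G" for g f
    using that s by (auto simp: C_def intro: \<phi>_closed)
  have sI: "s (I a f) h = a \<otimes>\<^bsub>?P\<^esub> s f h" if "a \<in> carrier ?P" "h \<in> carrier G" for a f h
    using that(2) unfolding s_def[of "I a f"] P(4)[OF IX[OF that(1)]] by (simp add: I_def)
  have sC: "s (C g f) h = \<phi> (inv g) (s f (inv g \<otimes> h))" if "g \<in> carrier G" "h \<in> carrier G" for g f h
    using that(2) unfolding s_def[of "C g f"] P(4)[OF CX[OF that(1)]] by (simp add: C_def)
  have I_cong: "I a f = (\<lambda>(h, p). if h \<in> carrier G then t h p else 0)" if "\<And>h. h \<in> carrier G \<Longrightarrow> a \<otimes>\<^bsub>?P\<^esub> s f h = t h" for a f t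
    using that by (auto simp: I_def)
  have C_cong: "C g f = (\<lambda>(h, p). if h \<in> carrier G then t h p else 0)" if "\<And>h. h \<in> carrier G \<Longrightarrow> \<phi> (inv g) (s f (inv g \<otimes> h)) = t h" for g f t
    using that by (auto simp: C_def)
  interpret L: central_algebra "lscale :: 'k \<Rightarrow> ('g \<times> ('v, 'e) path, 'k) linend" by (rule central_algebra_lscale)
  have "skew_model (lscale :: 'k \<Rightarrow> ('g \<times> ('v, 'e) path, 'k) linend) G Q \<phi> (\<lambda>a. Linend (I a)) (\<lambda>g. Linend (C g))"
  proof (unfold_locales)
    show "finite (carrier G)" "finite (verts Q)" by fact+
    fix x y assume x: "x \<in> carrier ?P" and y: "y \<in> carrier ?P"
    show "Linend (I (\<lambda>p. x p + y p)) = Linend (I x) + Linend (I y)"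
      by (rule linend_eqI) (auto simp: plus_linend.rep_eq I I_def path_algebra_mult_linear)
    show "Linend (I (x \<otimes>\<^bsub>?P\<^esub> y)) = Linend (I x) * Linend (I y)"
    proof (rule linend_eqI)
      fix f z
      have "I (x \<otimes>\<^bsub>?P\<^esub> y) f = I x (I y f)"
        unfolding I_def[of x "I y f"] using x y s by (intro I_cong) (simp add: sI quiver.path_algebra_assoc)
      then show "app (Linend (I (x \<otimes>\<^bsub>?P\<^esub> y))) f z = app (Linend (I x) * Linend (I y)) f z"
        by (simp add: times_linend.rep_eq I)
    qed
  next
    fix x c assume x: "x \<in> carrier ?P"
    show "Linend (I (\<lambda>p. c * x p)) = lscale c * Linend (I x)"
      by (rule linend_eqI) (auto simp: times_linend.rep_eq lscale.rep_eq I I_def path_algebra_mult_linear)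
    fix g assume g: "g \<in> carrier G"
    show "Linend (I x) * Linend (C g) = Linend (C g) * Linend (I (\<phi> g x))"
    proof (rule linend_eqI)
      fix f z
      have "I x (C g f) = C g (I (\<phi> g x) f)"
        unfolding C_def[of g "I (\<phi> g x) f"]
        using x g s by (intro I_cong) (simp add: sC sI \<phi>_closed \<phi>_mult \<phi>_inv)
      then show "app (Linend (I x) * Linend (C g)) f z = app (Linend (C g) * Linend (I (\<phi> g x))) f z"
        using g by (simp add: times_linend.rep_eq I C)
    qed
  next
    fix g k assume g: "g \<in> carrier G" and k: "k \<in> carrier G"
    show "Linend (C (g \<otimes> k)) = Linend (C g) * Linend (C k)"
    proof (rule linend_eqI)
      fix f z
      have "C (g \<otimes> k) f = C g (C k f)"
        unfolding C_def[of g "C k f"]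
        using g k s by (intro C_cong) (simp add: sC inv_mult_group act_mult m_assoc)
      then show "app (Linend (C (g \<otimes> k))) f z = app (Linend (C g) * Linend (C k)) f z"
        using g k by (simp add: times_linend.rep_eq C)
    qed
  next
    show "Linend (C \<one>) = Linend (I \<one>\<^bsub>?P\<^esub>)"
    proof (rule linend_eqI)
      fix f z
      have "C \<one> f = I \<one>\<^bsub>?P\<^esub> f"
        unfolding I_def[of "\<one>\<^bsub>?P\<^esub>"] using s by (intro C_cong) (simp add: act_one)
      then show "app (Linend (C \<one>)) f z = app (Linend (I \<one>\<^bsub>?P\<^esub>)) f z" by (simp add: C I)
    qed
  next
    fix y :: "'g \<Rightarrow> ('v, 'e) path \<Rightarrow> 'k" and h assume y: "\<And>g. g \<in> carrier G \<Longrightarrow> y g \<in> carrier ?P"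
      and sum0: "(\<Sum>g\<in>carrier G. Linend (C g) * Linend (I (y g))) = 0" and h: "h \<in> carrier G"
    \<comment> \<open>The element 1 \<otimes> 1 of the regular module. Applying an operator to it
      recovers the coefficients of the operator up to the automorphisms \<phi>.\<close>
    define \<delta> where "\<delta> = (\<lambda>(k, p). if k = \<one> then \<one>\<^bsub>?P\<^esub> p else (0 :: 'k))"
    have "(\<lambda>p. \<delta> (k, p)) = (if k = \<one> then \<one>\<^bsub>?P\<^esub> else (\<lambda>_. 0))" for k by (auto simp: \<delta>_def)
    then have "\<delta> \<in> ?X" using path_algebra_closed(1) by (auto simp: \<delta>_def)
    then have s\<delta>: "s \<delta> k = (if k = \<one> then \<one>\<^bsub>?P\<^esub> else (\<lambda>_. 0))" for k
      using P(4)[of \<delta>] by (auto simp: s_def \<delta>_def)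
    have *: "C g (I (y g) \<delta>) (h, p) = (if g = h then \<phi> (inv h) (y h) p else 0)" if g: "g \<in> carrier G" for g p
    proof (cases "g = h")
      case True
      then show ?thesis using h y[OF h] by (simp add: C_def sI s\<delta>)
    next
      case False
      then have "inv g \<otimes> h \<noteq> \<one>" using g h by (metis inv_equality inv_inv inv_closed)
      then show ?thesis using g h False y[OF g] by (simp add: C_def sI s\<delta> \<phi>0 path_algebra_mult_linear)
    qed
    have "\<phi> (inv h) (y h) p = 0" for p
    proof -
      have "(\<Sum>g\<in>carrier G. app (Linend (C g) * Linend (I (y g))) \<delta> (h, p)) = 0"
        unfolding app_sum[symmetric] sum0 by (simp add: zero_linend.rep_eq)
      moreover have "(\<Sum>g\<in>carrier G. app (Linend (C g) * Linend (I (y g))) \<delta> (h, p))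
          = (\<Sum>g\<in>carrier G. if g = h then \<phi> (inv h) (y h) p else 0)"
        by (intro sum.cong) (simp_all add: times_linend.rep_eq C I *)
      ultimately show ?thesis using h assms(3) by simp
    qed
    then have "\<phi> (inv h) (y h) = (\<lambda>_. 0)" by blast
    then have "\<phi> h (\<lambda>_. 0) = y h" using \<phi>_inv(1)[OF h y[OF h]] by simp
    then show "y h = (\<lambda>_. 0)" using \<phi>0[OF h] by simp
  qed
  then show ?thesis by blast
qed

context skew_model
begin

abbreviation "PA \<equiv> (path_algebra Q :: ('k, ('v, 'e) path \<Rightarrow> 'k) module)"
abbreviation "SA \<equiv> skew_group_algebra G PA \<phi>"

interpretation R: ring PA by (rule quiver.ring_path_algebra[OF finite_verts])

lemma \<iota>_zero: "\<iota> (\<lambda>_. 0) = 0"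
  using \<iota>_scale[OF path_algebra_closed(1), of 0] by simp

lemma \<iota>_finsum: "\<lbrakk>finite S; f \<in> S \<rightarrow> carrier PA\<rbrakk> \<Longrightarrow> \<iota> (finsum PA f S) = (\<Sum>s\<in>S. \<iota> (f s))"
  by (induction S rule: finite_induct) (simp_all add: \<iota>_zero \<iota>_add[simplified] R.finsum_closed[simplified] Pi_iff)

lemma \<gamma>_\<iota>_swap: "\<lbrakk>x \<in> carrier PA; g \<in> carrier G\<rbrakk> \<Longrightarrow> \<gamma> g * \<iota> x = \<iota> (\<phi> (inv g) x) * \<gamma> g"
  by (simp add: \<iota>_\<gamma> \<phi>_closed \<phi>_inv)

definition embed :: "('g \<Rightarrow> ('v, 'e) path \<Rightarrow> 'k) \<Rightarrow> 'a" where
  "embed x = (\<Sum>g\<in>carrier G. \<iota> (x g) * \<gamma> g)"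

lemma SA_simps [simp]:
  "carrier SA = {x. (\<forall>g \<in> carrier G. x g \<in> carrier PA) \<and> (\<forall>g. g \<notin> carrier G \<longrightarrow> x g = (\<lambda>_. 0))}"
  "\<zero>\<^bsub>SA\<^esub> = (\<lambda>_ _. 0)" "x \<oplus>\<^bsub>SA\<^esub> y = (\<lambda>g p. x g p + y g p)"
  "\<one>\<^bsub>SA\<^esub> = (\<lambda>g. if g = \<one> then \<one>\<^bsub>PA\<^esub> else (\<lambda>_. 0))"
  by (simp_all add: skew_group_algebra_def cong: if_cong)

lemma SA_mult: "(x \<otimes>\<^bsub>SA\<^esub> y) h = finsum PA (\<lambda>p. x (fst p) \<otimes>\<^bsub>PA\<^esub> \<phi> (inv (fst p)) (y (snd p)))
    {p \<in> carrier G \<times> carrier G. fst p \<otimes> snd p = h}"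
  by (simp add: skew_group_algebra_def)

lemma SA_mult_closed: assumes "x \<in> carrier SA" "y \<in> carrier SA" shows "x \<otimes>\<^bsub>SA\<^esub> y \<in> carrier SA"
proof -
  have "(x \<otimes>\<^bsub>SA\<^esub> y) h \<in> carrier PA" for h
    unfolding SA_mult using assms by (intro R.finsum_closed) (auto intro!: \<phi>_closed)
  moreover have "(x \<otimes>\<^bsub>SA\<^esub> y) h = (\<lambda>_. 0)" if "h \<notin> carrier G" for h
  proof -
    have e: "{p \<in> carrier G \<times> carrier G. fst p \<otimes> snd p = h} = {}" using that by auto
    show ?thesis unfolding SA_mult e by simp
  qed
  ultimately show ?thesis by simp
qed

lemma embed_add: "\<lbrakk>x \<in> carrier SA; y \<in> carrier SA\<rbrakk> \<Longrightarrow> embed (x \<oplus>\<^bsub>SA\<^esub> y) = embed x + embed y"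
  by (simp add: embed_def \<iota>_add distrib_right sum.distrib)

text \<open>Moving \<gamma> g to the right past \<iota> y applies \<open>\<phi> (inv g)\<close> to
  y, which is exactly the twist in the skew multiplication. The double sum is then regrouped by the
  product of the two group elements.\<close>

lemma embed_mult:
  assumes x: "x \<in> carrier SA" and y: "y \<in> carrier SA" shows "embed (x \<otimes>\<^bsub>SA\<^esub> y) = embed x * embed y"
proof -
  let ?f = "\<lambda>p. \<iota> (x (fst p)) * \<gamma> (fst p) * (\<iota> (y (snd p)) * \<gamma> (snd p))"
  have "embed (x \<otimes>\<^bsub>SA\<^esub> y) = (\<Sum>h\<in>carrier G. \<Sum>p\<in>{p \<in> carrier G \<times> carrier G. fst p \<otimes> snd p = h}. ?f p)"
    unfolding embed_def
  proof (intro sum.cong refl)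
    fix h assume h: "h \<in> carrier G"
    let ?S = "{p \<in> carrier G \<times> carrier G. fst p \<otimes> snd p = h}"
    have S: "finite ?S" by (rule finite_subset[of _ "carrier G \<times> carrier G"]) (auto simp: finite_G)
    have "\<iota> ((x \<otimes>\<^bsub>SA\<^esub> y) h) * \<gamma> h = (\<Sum>p\<in>?S. \<iota> (x (fst p) \<otimes>\<^bsub>PA\<^esub> \<phi> (inv (fst p)) (y (snd p))) * \<gamma> h)"
      unfolding SA_mult using S x y by (subst \<iota>_finsum) (auto simp: sum_distrib_right intro!: \<phi>_closed)
    also have "\<dots> = (\<Sum>p\<in>?S. ?f p)"
    proof (intro sum.cong refl)
      fix p assume p: "p \<in> ?S"
      then have g: "fst p \<in> carrier G" "snd p \<in> carrier G" "h = fst p \<otimes> snd p" by auto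
      have c: "x (fst p) \<in> carrier PA" "y (snd p) \<in> carrier PA" "\<phi> (inv (fst p)) (y (snd p)) \<in> carrier PA"
        using x y g by (auto intro: \<phi>_closed)
      have "\<iota> (x (fst p) \<otimes>\<^bsub>PA\<^esub> \<phi> (inv (fst p)) (y (snd p))) * \<gamma> h
        = \<iota> (x (fst p)) * (\<iota> (\<phi> (inv (fst p)) (y (snd p))) * \<gamma> (fst p)) * \<gamma> (snd p)"
        using c g by (simp add: \<iota>_mult \<gamma>_mult mult.assoc)
      also have "\<dots> = ?f p"
        unfolding \<gamma>_\<iota>_swap[OF c(2) g(1), symmetric] by (simp only: mult.assoc)
      finally show "\<iota> (x (fst p) \<otimes>\<^bsub>PA\<^esub> \<phi> (inv (fst p)) (y (snd p))) * \<gamma> h = ?f p" .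
    qed
    finally show "\<iota> ((x \<otimes>\<^bsub>SA\<^esub> y) h) * \<gamma> h = (\<Sum>p\<in>?S. ?f p)" .
  qed
  also have "\<dots> = sum ?f (carrier G \<times> carrier G)"
    by (rule sum.group) (auto simp: finite_G)
  also have "\<dots> = embed x * embed y"
    unfolding embed_def sum_product by (simp add: sum.cartesian_product case_prod_unfold)
  finally show ?thesis .
qed

lemma embed_\<gamma>_\<iota>: "x \<in> carrier SA \<Longrightarrow> embed x = (\<Sum>g\<in>carrier G. \<gamma> g * \<iota> (\<phi> g (x g)))"
  unfolding embed_def by (intro sum.cong refl \<iota>_\<gamma>) auto

text \<open>\<open>\<gamma>_indep\<close> expects the group elements on the left. Commuting them
  there turns the coefficients x g into \<phi> g (x g), and \<phi> g is invertible.\<close>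

lemma embed_inj: "inj_on embed (carrier SA)"
proof (rule inj_onI)
  fix x y assume x: "x \<in> carrier SA" and y: "y \<in> carrier SA" and eq: "embed x = embed y"
  let ?z = "\<lambda>g p. x g p + (- 1) * y g p"
  have my: "(\<lambda>g p. (- 1) * y g p) \<in> carrier SA" using y by (auto simp: path_algebra_closed_minus)
  have z: "?z \<in> carrier SA" using x y by (auto simp: path_algebra_closed_minus)
  have "embed ?z = embed x + embed (\<lambda>g p. (- 1) * y g p)" using embed_add[OF x my] by simp
  also have "embed (\<lambda>g p. (- 1) * y g p) = - embed y"
    unfolding embed_def sum_negf[symmetric]
    using y by (intro sum.cong refl, subst \<iota>_scale) (auto simp: sc_uminus sc_one)
  finally have "(\<Sum>g\<in>carrier G. \<gamma> g * \<iota> (\<phi> g (?z g))) = 0" using embed_\<gamma>_\<iota>[OF z] eq by simp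
  then have "\<phi> g (?z g) = (\<lambda>_. 0)" if "g \<in> carrier G" for g
    by (rule \<gamma>_indep[rotated]) (use z that \<phi>_closed in auto)
  then have "?z g = \<phi> (inv g) (\<lambda>_. 0)" if "g \<in> carrier G" for g
    using \<phi>_inv(2)[OF that, of "?z g"] z that by auto
  moreover have "\<phi> (inv g) (\<lambda>_. 0) = (\<lambda>_. 0)" if "g \<in> carrier G" for g
    using \<phi>_smult[OF inv_closed[OF that] path_algebra_closed(1), of 0] by simp
  ultimately have "x g p + (- 1) * y g p = 0" if "g \<in> carrier G" for g p using that by (metis (no_types, lifting))
  then have "x g = y g" if "g \<in> carrier G" for g using that by (auto simp: fun_eq_iff)
  moreover have "x g = y g" if "g \<notin> carrier G" for g using that x y by simp
  ultimately show "x = y" by blast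
qed

lemma \<iota>_one_left: "x \<in> carrier PA \<Longrightarrow> \<gamma> \<one> * \<iota> x = \<iota> x"
  and \<iota>_one_right: "x \<in> carrier PA \<Longrightarrow> \<iota> x * \<gamma> \<one> = \<iota> x"
  unfolding \<gamma>_one by (simp_all add: \<iota>_mult[symmetric])

lemma \<gamma>_one_mult: "g \<in> carrier G \<Longrightarrow> \<gamma> \<one> * \<gamma> g = \<gamma> g" "g \<in> carrier G \<Longrightarrow> \<gamma> g * \<gamma> \<one> = \<gamma> g"
  by (simp_all add: \<gamma>_mult[symmetric])

lemma embed_one: "embed \<one>\<^bsub>SA\<^esub> = \<gamma> \<one>"
proof -
  have "embed \<one>\<^bsub>SA\<^esub> = (\<Sum>g\<in>carrier G. if g = \<one> then \<gamma> \<one> * \<gamma> \<one> else 0)"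
    unfolding embed_def by (intro sum.cong) (auto simp: \<iota>_zero \<gamma>_one)
  then show ?thesis using finite_G \<gamma>_one_mult(1)[OF one_closed] by simp
qed

lemma embed_unit: "x \<in> carrier SA \<Longrightarrow> \<gamma> \<one> * embed x = embed x" "x \<in> carrier SA \<Longrightarrow> embed x * \<gamma> \<one> = embed x"
  by (simp_all add: embed_def sum_distrib_left sum_distrib_right mult.assoc \<gamma>_one_mult)
    (simp add: mult.assoc[symmetric] \<iota>_one_left)

text \<open>Associativity, the unit laws and distributivity are pulled back from \<open>'a\<close>
  along the injective map \<open>embed\<close>; no convolution sum is manipulated.\<close>

lemma ring_SA: "ring SA"
proof (rule ringI)
  show "abelian_group SA"
  proof (rule abelian_groupI)
    fix x assume "x \<in> carrier SA"
    then show "\<exists>y\<in>carrier SA. y \<oplus>\<^bsub>SA\<^esub> x = \<zero>\<^bsub>SA\<^esub>"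
      using path_algebra_closed(3)[of _ Q "- 1"] by (intro bexI[of _ "\<lambda>g p. (- 1) * x g p"]) auto
  qed (auto simp: path_algebra_closed add_ac)
  have one: "\<one>\<^bsub>SA\<^esub> \<in> carrier SA" by (auto simp: path_algebra_closed)
  show "Group.monoid SA"
  proof (rule monoidI)
    fix x y z assume x: "x \<in> carrier SA" and y: "y \<in> carrier SA" and z: "z \<in> carrier SA"
    show "x \<otimes>\<^bsub>SA\<^esub> y \<otimes>\<^bsub>SA\<^esub> z = x \<otimes>\<^bsub>SA\<^esub> (y \<otimes>\<^bsub>SA\<^esub> z)"
      using x y z SA_mult_closed by (intro inj_onD[OF embed_inj]) (simp_all add: embed_mult mult.assoc del: SA_simps)
  next
    fix x assume x: "x \<in> carrier SA"
    show "\<one>\<^bsub>SA\<^esub> \<otimes>\<^bsub>SA\<^esub> x = x"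
      using x one SA_mult_closed by (intro inj_onD[OF embed_inj]) (simp_all add: embed_mult embed_one embed_unit del: SA_simps)
    show "x \<otimes>\<^bsub>SA\<^esub> \<one>\<^bsub>SA\<^esub> = x"
      using x one SA_mult_closed by (intro inj_onD[OF embed_inj]) (simp_all add: embed_mult embed_one embed_unit del: SA_simps)
  qed (rule SA_mult_closed, assumption+, rule one)
  have add: "x \<oplus>\<^bsub>SA\<^esub> y \<in> carrier SA" if "x \<in> carrier SA" "y \<in> carrier SA" for x y
    using that by (auto simp: path_algebra_closed)
  fix x y z assume x: "x \<in> carrier SA" and y: "y \<in> carrier SA" and z: "z \<in> carrier SA"
  show "(x \<oplus>\<^bsub>SA\<^esub> y) \<otimes>\<^bsub>SA\<^esub> z = x \<otimes>\<^bsub>SA\<^esub> z \<oplus>\<^bsub>SA\<^esub> y \<otimes>\<^bsub>SA\<^esub> z"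
    using x y z SA_mult_closed add
    by (intro inj_onD[OF embed_inj]) (simp_all add: embed_mult embed_add distrib_right del: SA_simps)
  show "z \<otimes>\<^bsub>SA\<^esub> (x \<oplus>\<^bsub>SA\<^esub> y) = z \<otimes>\<^bsub>SA\<^esub> x \<oplus>\<^bsub>SA\<^esub> z \<otimes>\<^bsub>SA\<^esub> y"
    using x y z SA_mult_closed add
    by (intro inj_onD[OF embed_inj]) (simp_all add: embed_mult embed_add distrib_left del: SA_simps)
qed

end

section \<open>Group actions on quivers\<close>

locale equivariant_quiver = skew_model sc G Q \<phi> \<iota> \<gamma>
  for sc :: "'k::alg_closed_field \<Rightarrow> 'a::ring_1" and G :: "('g, 'n) monoid_scheme" (structure)
    and Q :: "('v, 'e) pre_digraph"
    and \<phi> :: "'g \<Rightarrow> (('v, 'e) path \<Rightarrow> 'k) \<Rightarrow> ('v, 'e) path \<Rightarrow> 'k"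
    and \<iota> :: "(('v, 'e) path \<Rightarrow> 'k) \<Rightarrow> 'a" and \<gamma> :: "'g \<Rightarrow> 'a" +
  assumes card_G: "of_nat (card (carrier G)) \<noteq> (0 :: 'k)"
    and permutes: "g \<in> carrier G \<Longrightarrow> \<phi> g ` vertex_idem ` verts Q = vertex_idem ` verts Q"
    and arrows: "g \<in> carrier G \<Longrightarrow> \<phi> g ` arrow_span Q (arcs Q) \<subseteq> arrow_span Q (arcs Q)"
begin

abbreviation "va \<equiv> vertex_act Q \<phi>"
abbreviation "Stab \<equiv> vertex_stabilizer G \<phi>"
abbreviation "VI \<equiv> (vertex_idem :: 'v \<Rightarrow> ('v, 'e) path \<Rightarrow> 'k)"
abbreviation "AE \<equiv> (arrow_elt Q :: 'e \<Rightarrow> ('v, 'e) path \<Rightarrow> 'k)"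

definition E :: "'v \<Rightarrow> 'a" where "E i = \<iota> (VI i)"

definition AR :: "'e \<Rightarrow> 'a" where "AR a = \<iota> (AE a)"

lemmas VI_closed = quiver.vertex_idem_closed and AE_closed = quiver.arrow_elt_closed

lemma VI_inj: "VI i = VI j \<Longrightarrow> i = j"
  unfolding vertex_idem_def unit_fun_def by (metis prod.inject zero_neq_one)

text \<open>Distinct vertices have distinct idempotents, so the definite description behind
  \<open>vertex_act\<close> has exactly one candidate.\<close>

lemma va: assumes "g \<in> carrier G" "i \<in> verts Q"
  shows "va g i \<in> verts Q" "\<phi> g (VI i) = VI (va g i)"
proof -
  have "\<phi> g (VI i) \<in> VI ` verts Q" using permutes[OF assms(1)] assms(2) by blast
  then obtain j where j: "j \<in> verts Q" "\<phi> g (VI i) = VI j" by blast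
  have "\<exists>!j. j \<in> verts Q \<and> \<phi> g (VI i) = VI j"
    using j VI_inj by (intro ex1I[of _ j]) auto
  from theI'[OF this] show "va g i \<in> verts Q" "\<phi> g (VI i) = VI (va g i)"
    by (auto simp: vertex_act_def)
qed

lemma va_one: "i \<in> verts Q \<Longrightarrow> va \<one> i = i"
  using va(2)[of \<one> i] act_one[OF VI_closed] VI_inj by auto

lemma va_mult: "\<lbrakk>g \<in> carrier G; h \<in> carrier G; i \<in> verts Q\<rbrakk> \<Longrightarrow> va (g \<otimes> h) i = va h (va g i)"
  using va(2)[of "g \<otimes> h" i] va(2)[of g i] va(2)[of h "va g i"] va(1)[of g i]
    act_mult[of g h "VI i"] VI_closed VI_inj by auto

lemma va_inv: "\<lbrakk>g \<in> carrier G; i \<in> verts Q\<rbrakk> \<Longrightarrow> va (inv g) (va g i) = i"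
  "\<lbrakk>g \<in> carrier G; i \<in> verts Q\<rbrakk> \<Longrightarrow> va g (va (inv g) i) = i"
  using va_mult[of g "inv g" i] va_mult[of "inv g" g i] va_one[of i] by auto

lemma va_eq_iff: "\<lbrakk>g \<in> carrier G; i \<in> verts Q; j \<in> verts Q\<rbrakk> \<Longrightarrow> va g i = va g j \<longleftrightarrow> i = j"
  using va_inv(1)[of g i] va_inv(1)[of g j] by metis

lemma Stab_iff: "i \<in> verts Q \<Longrightarrow> g \<in> Stab i \<longleftrightarrow> g \<in> carrier G \<and> va g i = i"
  using va(2)[of g i] VI_inj by (auto simp: vertex_stabilizer_def stabilizer_def)

lemma subgroup_Stab: assumes i: "i \<in> verts Q" shows "subgroup (Stab i) G"
proof (rule subgroupI)
  show "Stab i \<subseteq> carrier G" using Stab_iff[OF i] by blast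
  show "Stab i \<noteq> {}" using Stab_iff[OF i, of \<one>] va_one[OF i] by blast
  show "inv g \<in> Stab i" if "g \<in> Stab i" for g
    using that va_inv(1)[of g i] i by (simp add: Stab_iff)
  show "g \<otimes> h \<in> Stab i" if "g \<in> Stab i" "h \<in> Stab i" for g h
    using that i by (simp add: Stab_iff va_mult)
qed

text \<open>The order of a subgroup divides that of the group, so it is nonzero in the field as
  well.\<close>

lemma card_subgroup: assumes "subgroup H G" shows "of_nat (card H) \<noteq> (0 :: 'k)"
proof -
  have "card (carrier G) = card (rcosets H) * card H"
    using lagrange[OF assms] by (simp add: Coset.order_def)
  then show ?thesis using card_G by auto
qed

lemma vertex_arrow:
  "i \<in> verts Q \<Longrightarrow> j \<in> verts Q \<Longrightarrow> VI i \<otimes>\<^bsub>PA\<^esub> VI j = (if i = j then VI i else (\<lambda>_. 0))"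
  "a \<in> arcs Q \<Longrightarrow> i \<in> verts Q \<Longrightarrow> VI i \<otimes>\<^bsub>PA\<^esub> AE a = (if i = head Q a then AE a else (\<lambda>_. 0))"
  "a \<in> arcs Q \<Longrightarrow> i \<in> verts Q \<Longrightarrow> AE a \<otimes>\<^bsub>PA\<^esub> VI i = (if i = tail Q a then AE a else (\<lambda>_. 0))"
  by (auto simp: vertex_idem_def arrow_elt_def quiver.unit_mult_unit quiver.vertex_path quiver.arrow_path)

lemma E_mult: "\<lbrakk>i \<in> verts Q; j \<in> verts Q\<rbrakk> \<Longrightarrow> E i * E j = (if i = j then E i else 0)"
  by (simp add: E_def \<iota>_mult[symmetric] VI_closed vertex_arrow \<iota>_zero)

lemma E_idem: "i \<in> verts Q \<Longrightarrow> E i * E i = E i" by (simp add: E_mult)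

lemma E_AR: "\<lbrakk>a \<in> arcs Q; i \<in> verts Q\<rbrakk> \<Longrightarrow> E i * AR a = (if i = head Q a then AR a else 0)"
  and AR_E: "\<lbrakk>a \<in> arcs Q; i \<in> verts Q\<rbrakk> \<Longrightarrow> AR a * E i = (if i = tail Q a then AR a else 0)"
  by (simp_all add: E_def AR_def \<iota>_mult[symmetric] VI_closed AE_closed vertex_arrow \<iota>_zero)

lemma E_\<gamma>: "\<lbrakk>i \<in> verts Q; g \<in> carrier G\<rbrakk> \<Longrightarrow> E i * \<gamma> g = \<gamma> g * E (va g i)"
  by (simp add: E_def \<iota>_\<gamma> VI_closed va)

lemma \<gamma>_E: "\<lbrakk>i \<in> verts Q; g \<in> carrier G\<rbrakk> \<Longrightarrow> \<gamma> g * E i = E (va (inv g) i) * \<gamma> g"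
  using E_\<gamma>[of "va (inv g) i" g] va[of "inv g" i] va_inv(2)[of g i] by simp

lemma \<iota>_sum: "finite S \<Longrightarrow> (\<And>s. s \<in> S \<Longrightarrow> f s \<in> carrier PA) \<Longrightarrow>
    \<iota> (\<lambda>p. \<Sum>s\<in>S. f s p) = (\<Sum>s\<in>S. \<iota> (f s)) \<and> (\<lambda>p. \<Sum>s\<in>S. f s p) \<in> carrier PA"
  by (induction S rule: finite_induct) (simp_all add: \<iota>_zero \<iota>_add path_algebra_closed)

lemma sum_E: "(\<Sum>i\<in>verts Q. E i) = \<gamma> \<one>"
  unfolding \<gamma>_one E_def quiver.one_path_algebra(1)[OF finite_verts]
  by (rule conjunct1[OF \<iota>_sum[OF finite_verts VI_closed], symmetric])

lemma \<gamma>1_E: "i \<in> verts Q \<Longrightarrow> \<gamma> \<one> * E i = E i" "i \<in> verts Q \<Longrightarrow> E i * \<gamma> \<one> = E i"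
  by (simp_all add: E_def \<iota>_one_left \<iota>_one_right VI_closed)

lemma \<gamma>_inv_\<gamma>: "g \<in> carrier G \<Longrightarrow> \<gamma> (inv g) * \<gamma> g = \<gamma> \<one>" "g \<in> carrier G \<Longrightarrow> \<gamma> g * \<gamma> (inv g) = \<gamma> \<one>"
  by (simp_all add: \<gamma>_mult[symmetric])

section \<open>The image of the skew group algebra, its degree zero part, and freeness\<close>

definition AA :: "'a set" where
  "AA = {\<Sum>g\<in>carrier G. \<gamma> g * \<iota> (y g) | y. \<forall>g\<in>carrier G. y g \<in> carrier PA}"

definition A0 :: "'a set" where "A0 = vs.span {\<gamma> g * E i | g i. g \<in> carrier G \<and> i \<in> verts Q}"

lemma subspace_A0: "vs.subspace A0" by (simp add: A0_def)

lemma A0_base: "\<lbrakk>g \<in> carrier G; i \<in> verts Q\<rbrakk> \<Longrightarrow> \<gamma> g * E i \<in> A0"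
  unfolding A0_def by (rule vs.span_base) blast

lemma A0_base': "\<lbrakk>g \<in> carrier G; i \<in> verts Q\<rbrakk> \<Longrightarrow> E i * \<gamma> g \<in> A0"
  by (simp add: E_\<gamma> A0_base va)

lemma E_A0: "i \<in> verts Q \<Longrightarrow> E i \<in> A0"
  using A0_base[of \<one> i] by (simp add: \<gamma>1_E)

lemma \<gamma>_A0: assumes g: "g \<in> carrier G" shows "\<gamma> g \<in> A0"
proof -
  have "\<gamma> g = (\<Sum>i\<in>verts Q. \<gamma> g * E i)" using \<gamma>_one_mult(2)[OF g] by (simp add: sum_distrib_left[symmetric] sum_E)
  also have "\<dots> \<in> A0" using g by (intro vs.subspace_sum[OF subspace_A0] A0_base)
  finally show ?thesis .
qed

lemma A0_mult: "\<lbrakk>x \<in> A0; y \<in> A0\<rbrakk> \<Longrightarrow> x * y \<in> A0"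
  unfolding A0_def
proof (erule (1) span_mult)
  fix s t assume "s \<in> {\<gamma> g * E i |g i. g \<in> carrier G \<and> i \<in> verts Q}" "t \<in> {\<gamma> g * E i |g i. g \<in> carrier G \<and> i \<in> verts Q}"
  then obtain g i h j where s: "s = \<gamma> g * E i" "g \<in> carrier G" "i \<in> verts Q" and t: "t = \<gamma> h * E j" "h \<in> carrier G" "j \<in> verts Q"
    by blast
  have "s * t = \<gamma> g * (E i * \<gamma> h) * E j" by (simp add: s t mult.assoc)
  also have "\<dots> = \<gamma> (g \<otimes> h) * (E (va h i) * E j)" using s t by (simp add: E_\<gamma> \<gamma>_mult mult.assoc)
  also have "\<dots> \<in> A0" using s t va[OF t(2) s(3)] vs.subspace_0[OF subspace_A0]
    by (simp add: E_mult A0_base)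
  finally show "s * t \<in> vs.span {\<gamma> g * E i |g i. g \<in> carrier G \<and> i \<in> verts Q}" by (simp add: A0_def)
qed simp

lemma AA_eq_embed: "AA = embed ` carrier SA"
proof
  show "embed ` carrier SA \<subseteq> AA"
  proof (rule image_subsetI)
    fix x assume x: "x \<in> carrier SA"
    show "embed x \<in> AA" unfolding AA_def embed_\<gamma>_\<iota>[OF x]
      using x by (intro CollectI exI[of _ "\<lambda>g. \<phi> g (x g)"]) (auto simp: \<phi>_closed)
  qed
  show "AA \<subseteq> embed ` carrier SA"
  proof
    fix z assume "z \<in> AA"
    then obtain y where y: "\<And>g. g \<in> carrier G \<Longrightarrow> y g \<in> carrier PA" "z = (\<Sum>g\<in>carrier G. \<gamma> g * \<iota> (y g))"
      unfolding AA_def by blast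
    let ?x = "\<lambda>g. if g \<in> carrier G then \<phi> (inv g) (y g) else (\<lambda>_. 0)"
    have x: "?x \<in> carrier SA" using y \<phi>_closed by simp
    have "embed ?x = z" unfolding embed_\<gamma>_\<iota>[OF x] y(2) by (intro sum.cong) (simp_all add: \<phi>_inv y)
    then show "z \<in> embed ` carrier SA" using x by blast
  qed
qed

lemma AA_mult: "\<lbrakk>x \<in> AA; y \<in> AA\<rbrakk> \<Longrightarrow> x * y \<in> AA"
  unfolding AA_eq_embed using SA_mult_closed by (auto simp: embed_mult[symmetric] simp del: SA_simps)

lemma subspace_AA: "vs.subspace AA"
proof (rule vs.subspaceI)
  show "0 \<in> AA" unfolding AA_def
    by (intro CollectI exI[of _ "\<lambda>_ _. 0"]) (simp add: \<iota>_zero path_algebra_closed)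
  fix x y assume "x \<in> AA" "y \<in> AA"
  then obtain u v where u: "\<And>g. g \<in> carrier G \<Longrightarrow> u g \<in> carrier PA" "x = (\<Sum>g\<in>carrier G. \<gamma> g * \<iota> (u g))"
    and v: "\<And>g. g \<in> carrier G \<Longrightarrow> v g \<in> carrier PA" "y = (\<Sum>g\<in>carrier G. \<gamma> g * \<iota> (v g))"
    unfolding AA_def by blast
  show "x + y \<in> AA" unfolding AA_def
    using u v by (intro CollectI exI[of _ "\<lambda>g p. u g p + v g p"])
      (simp add: \<iota>_add distrib_left sum.distrib path_algebra_closed)
next
  fix c x assume "x \<in> AA"
  then obtain u where u: "\<And>g. g \<in> carrier G \<Longrightarrow> u g \<in> carrier PA" "x = (\<Sum>g\<in>carrier G. \<gamma> g * \<iota> (u g))"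
    unfolding AA_def by blast
  have "sc c * x = (\<Sum>g\<in>carrier G. \<gamma> g * \<iota> (\<lambda>p. c * u g p))"
    unfolding u(2) sum_distrib_left using u(1) by (intro sum.cong) (simp_all add: \<iota>_scale mult_sc)
  then show "sc c * x \<in> AA" unfolding AA_def
    using u(1) path_algebra_closed(3) by (intro CollectI exI[of _ "\<lambda>g p. c * u g p"]) auto
qed

lemma AA_base: assumes "g \<in> carrier G" "x \<in> carrier PA" shows "\<gamma> g * \<iota> x \<in> AA"
proof -
  have "(\<Sum>h\<in>carrier G. \<gamma> h * \<iota> (if h = g then x else (\<lambda>_. 0))) = (\<Sum>h\<in>carrier G. if h = g then \<gamma> g * \<iota> x else 0)"
    by (intro sum.cong) (auto simp: \<iota>_zero)
  also have "\<dots> = \<gamma> g * \<iota> x" using assms finite_G by simp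
  finally show ?thesis unfolding AA_def using assms
    by (intro CollectI exI[of _ "\<lambda>h. if h = g then x else (\<lambda>_. 0)"]) (simp add: path_algebra_closed)
qed

lemma \<iota>_AA: "x \<in> carrier PA \<Longrightarrow> \<iota> x \<in> AA"
  using AA_base[of \<one> x] by (simp add: \<iota>_one_left)

lemma AR_AA: "a \<in> arcs Q \<Longrightarrow> AR a \<in> AA" by (simp add: AR_def \<iota>_AA AE_closed)

lemma A0_AA: assumes "x \<in> A0" shows "x \<in> AA"
proof -
  have "{\<gamma> g * E i | g i. g \<in> carrier G \<and> i \<in> verts Q} \<subseteq> AA"
    using AA_base[OF _ VI_closed] by (auto simp: E_def)
  then show ?thesis using vs.span_minimal[OF _ subspace_AA] assms unfolding A0_def by blast
qed

lemma \<gamma>_AA: "g \<in> carrier G \<Longrightarrow> \<gamma> g \<in> AA" by (simp add: A0_AA \<gamma>_A0)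

text \<open>A path is a trivial path extended by arrows on the right of the product, so
  \<open>AA\<close> arises from \<open>A0\<close> by right multiplication with arrows and by linear
  combinations. Among the case names, \<open>zero\<close> refers to sums and \<open>step\<close> to
  scalar multiples.\<close>

lemma AA_induct [consumes 1, case_names base arrow zero step]:
  assumes x: "x \<in> AA"
    and A0: "\<And>z. z \<in> A0 \<Longrightarrow> P z"
    and arrow: "\<And>z a. \<lbrakk>z \<in> AA; a \<in> arcs Q; P z\<rbrakk> \<Longrightarrow> P (z * AR a)"
    and add: "\<And>y z. \<lbrakk>y \<in> AA; z \<in> AA; P y; P z\<rbrakk> \<Longrightarrow> P (y + z)"
    and scale: "\<And>c z. \<lbrakk>z \<in> AA; P z\<rbrakk> \<Longrightarrow> P (sc c * z)"
  shows "P x"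
proof -
  have word: "P (\<gamma> g * \<iota> (unit_fun (u, p, v)))" if g: "g \<in> carrier G" and "(u, p, v) \<in> paths Q" for g u p v
    using that(2)
  proof (induction p arbitrary: u)
    case Nil
    then have "u = v" "u \<in> verts Q" by (auto simp: paths_def quiver.awalk_Nil_iff)
    then show ?case using A0[OF A0_base[OF g, of u]] by (simp add: E_def vertex_idem_def)
  next
    case (Cons a p)
    then have a: "a \<in> arcs Q" "tail Q a = u" "(head Q a, p, v) \<in> paths Q"
      by (auto simp: paths_def quiver.awalk_Cons_iff)
    \<comment> \<open>The first arrow traversed is the rightmost factor, so induction on the list
      peels off factors on the right.\<close>
    then have "unit_fun (head Q a, p, v) \<otimes>\<^bsub>PA\<^esub> AE a = unit_fun (u, a # p, v)"
      using quiver.arrow_path[OF a(1)] by (simp add: arrow_elt_def quiver.unit_mult_unit)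
    then have "\<gamma> g * \<iota> (unit_fun (u, a # p, v)) = \<gamma> g * \<iota> (unit_fun (head Q a, p, v)) * AR a"
      using \<iota>_mult[OF path_algebra_closed(4)[OF a(3)] AE_closed[OF a(1)]] by (simp add: AR_def mult.assoc)
    then show ?case using arrow[OF AA_base[OF g path_algebra_closed(4)[OF a(3)]] a(1) Cons.IH[OF a(3)]] by simp
  qed
  have P0: "P 0" using A0[OF vs.subspace_0[OF subspace_A0]] .
  have Pterm: "P (\<gamma> g * \<iota> y)" if g: "g \<in> carrier G" and y: "y \<in> carrier PA" for g y
    using y
  proof (induction rule: path_algebra_induct)
    case zero
    then show ?case using P0 by (simp add: \<iota>_zero)
  next
    case (step c p f)
    have u: "unit_fun p \<in> carrier PA" using step(1) by (rule path_algebra_closed)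
    have "P (\<gamma> g * \<iota> (unit_fun p))" using word[OF g] step(1) by (cases p) auto
    then have "P (sc c * (\<gamma> g * \<iota> (unit_fun p)))" using AA_base[OF g u] by (intro scale)
    then have "P (sc c * (\<gamma> g * \<iota> (unit_fun p)) + \<gamma> g * \<iota> f)"
      using AA_base[OF g u] AA_base[OF g step(2)] step(3) vs.subspace_scale[OF subspace_AA] by (intro add)
    moreover have "\<gamma> g * \<iota> (\<lambda>x. c * unit_fun p x + f x) = sc c * (\<gamma> g * \<iota> (unit_fun p)) + \<gamma> g * \<iota> f"
      using u step(2) by (simp add: \<iota>_add path_algebra_closed \<iota>_scale distrib_left mult_sc)
    ultimately show ?case by simp
  qed
  obtain y where y: "\<And>g. g \<in> carrier G \<Longrightarrow> y g \<in> carrier PA" "x = (\<Sum>g\<in>carrier G. \<gamma> g * \<iota> (y g))"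
    using x unfolding AA_def by blast
  have "P (\<Sum>g\<in>S. \<gamma> g * \<iota> (y g)) \<and> (\<Sum>g\<in>S. \<gamma> g * \<iota> (y g)) \<in> AA" if "finite S" "S \<subseteq> carrier G" for S
    using that
  proof (induction rule: finite_induct)
    case empty
    then show ?case using P0 vs.subspace_0[OF subspace_AA] by simp
  next
    case (insert g S)
    then have g: "g \<in> carrier G" by simp
    have "P (\<gamma> g * \<iota> (y g))" "\<gamma> g * \<iota> (y g) \<in> AA"
      using Pterm[OF g y(1)[OF g]] AA_base[OF g y(1)[OF g]] by auto
    then show ?case using insert add vs.subspace_add[OF subspace_AA] by simp
  qed
  then show ?thesis unfolding y(2) using finite_G by blast
qed

text \<open>Elements of \<open>A0\<close> involve trivial paths only; this is what separates them
  from terms that end in an arrow.\<close>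

lemma A0_form:
  assumes "z \<in> A0"
  obtains y where "\<And>g. g \<in> carrier G \<Longrightarrow> y g \<in> carrier PA" "z = (\<Sum>g\<in>carrier G. \<gamma> g * \<iota> (y g))"
    "\<And>g u a p v. g \<in> carrier G \<Longrightarrow> y g (u, a # p, v) = 0"
proof -
  have "\<exists>y. (\<forall>g\<in>carrier G. y g \<in> carrier PA) \<and> z = (\<Sum>g\<in>carrier G. \<gamma> g * \<iota> (y g)) \<and> (\<forall>g\<in>carrier G. \<forall>u a p v. y g (u, a # p, v) = 0)"
    using assms unfolding A0_def
  proof (induction rule: vs.span_induct_alt)
    case base
    then show ?case by (intro exI[of _ "\<lambda>_ _. 0"]) (simp add: \<iota>_zero path_algebra_closed)
  next
    case (step c s z)
    then obtain h i where h: "h \<in> carrier G" "i \<in> verts Q" "s = \<gamma> h * E i" by blast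
    from step obtain y where y: "\<And>g. g \<in> carrier G \<Longrightarrow> y g \<in> carrier PA" "z = (\<Sum>g\<in>carrier G. \<gamma> g * \<iota> (y g))"
      "\<And>g u a p v. g \<in> carrier G \<Longrightarrow> y g (u, a # p, v) = 0" by blast
    let ?y = "\<lambda>g. if g = h then (\<lambda>p. c * VI i p + y g p) else y g"
    have c: "(\<lambda>p. c * VI i p) \<in> carrier PA" using VI_closed[OF h(2)] by (rule path_algebra_closed)
    have "(\<Sum>g\<in>carrier G. \<gamma> g * \<iota> (?y g)) = (\<Sum>g\<in>carrier G. (if g = h then sc c * s else 0) + \<gamma> g * \<iota> (y g))"
    proof (intro sum.cong refl)
      fix g assume g: "g \<in> carrier G"
      show "\<gamma> g * \<iota> (?y g) = (if g = h then sc c * s else 0) + \<gamma> g * \<iota> (y g)"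
        using \<iota>_add[OF c y(1)[OF g]] \<iota>_scale[OF VI_closed[OF h(2)], of c]
        by (cases "g = h") (simp_all add: h(3) E_def distrib_left mult_sc)
    qed
    also have "\<dots> = sc c * s + z" using finite_G h(1) by (simp add: sum.distrib y(2))
    finally show ?case
      using y(1,3) c path_algebra_closed(2)[OF c]
      by (intro exI[of _ ?y]) (auto simp: vertex_idem_def unit_fun_def)
  qed
  then show ?thesis using that by blast
qed

text \<open>Right multiplication by an arrow a shifts a path p that starts at its head to a # p. The
  coefficient of a # p in the sum thus comes from \<open>w a\<close> alone and not from u, so all
  coefficients of \<open>w a\<close> vanish.\<close>

lemma freeness:
  assumes u: "u \<in> A0" and S: "finite S" "S \<subseteq> arcs Q"
    and w: "\<And>a. a \<in> S \<Longrightarrow> w a \<in> AA" "\<And>a. a \<in> S \<Longrightarrow> w a * E (head Q a) = w a"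
    and sum: "u + (\<Sum>a\<in>S. w a * AR a) = 0"
  shows "u = 0" "\<And>a. a \<in> S \<Longrightarrow> w a = 0"
proof -
  obtain x where x: "\<And>g. g \<in> carrier G \<Longrightarrow> x g \<in> carrier PA" "u = (\<Sum>g\<in>carrier G. \<gamma> g * \<iota> (x g))"
    "\<And>g u a p v. g \<in> carrier G \<Longrightarrow> x g (u, a # p, v) = 0" using A0_form[OF u] by blast
  have "\<forall>a\<in>S. \<exists>y. (\<forall>g\<in>carrier G. y g \<in> carrier PA) \<and> w a = (\<Sum>g\<in>carrier G. \<gamma> g * \<iota> (y g))"
    using w(1) unfolding AA_def by blast
  from bchoice[OF this] obtain y
    where "\<forall>a\<in>S. (\<forall>g\<in>carrier G. y a g \<in> carrier PA) \<and> w a = (\<Sum>g\<in>carrier G. \<gamma> g * \<iota> (y a g))" ..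
  then have y: "\<And>a g. a \<in> S \<Longrightarrow> g \<in> carrier G \<Longrightarrow> y a g \<in> carrier PA"
    "\<And>a. a \<in> S \<Longrightarrow> w a = (\<Sum>g\<in>carrier G. \<gamma> g * \<iota> (y a g))" by simp_all
  have hd: "head Q a \<in> verts Q" if "a \<in> S" for a using that S by auto
  \<comment> \<open>Restricting the coefficients to paths that start at the head of a does not
    change \<open>w a\<close>, which is fixed by that idempotent, and makes the support condition
    explicit.\<close>
  define z where "z a g = y a g \<otimes>\<^bsub>PA\<^esub> VI (head Q a)" for a g
  have zc: "z a g \<in> carrier PA" if "a \<in> S" "g \<in> carrier G" for a g
    unfolding z_def by (rule quiver.path_algebra_mult_closed[OF y(1)[OF that] VI_closed[OF hd[OF that(1)]]])
  have wz: "w a = (\<Sum>g\<in>carrier G. \<gamma> g * \<iota> (z a g))" if "a \<in> S" for a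
  proof -
    have "w a = w a * E (head Q a)" using w(2)[OF that] by simp
    also have "\<dots> = (\<Sum>g\<in>carrier G. \<gamma> g * \<iota> (z a g))"
      unfolding y(2)[OF that] sum_distrib_right z_def
      by (intro sum.cong)
        (simp_all add: \<iota>_mult[OF y(1)[OF that] VI_closed[OF hd[OF that]]] E_def mult.assoc)
    finally show ?thesis .
  qed
  have zAc: "z a g \<otimes>\<^bsub>PA\<^esub> AE a \<in> carrier PA" if "a \<in> S" "g \<in> carrier G" for a g
    by (rule quiver.path_algebra_mult_closed[OF zc[OF that] AE_closed[OF subsetD[OF S(2) that(1)]]])
  define t where "t g = (\<lambda>p. x g p + (\<Sum>a\<in>S. (z a g \<otimes>\<^bsub>PA\<^esub> AE a) p))" for g
  have t: "t g \<in> carrier PA" "\<gamma> g * \<iota> (t g) = \<gamma> g * \<iota> (x g) + (\<Sum>a\<in>S. \<gamma> g * \<iota> (z a g) * AR a)" if g: "g \<in> carrier G" for g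
  proof -
    have *: "\<iota> (\<lambda>p. \<Sum>a\<in>S. (z a g \<otimes>\<^bsub>PA\<^esub> AE a) p) = (\<Sum>a\<in>S. \<iota> (z a g \<otimes>\<^bsub>PA\<^esub> AE a))"
      "(\<lambda>p. \<Sum>a\<in>S. (z a g \<otimes>\<^bsub>PA\<^esub> AE a) p) \<in> carrier PA"
      using \<iota>_sum[OF S(1), of "\<lambda>a. z a g \<otimes>\<^bsub>PA\<^esub> AE a"] zAc g by auto
    show "t g \<in> carrier PA" unfolding t_def using x(1)[OF g] *(2) by (rule path_algebra_closed)
    have "(\<Sum>a\<in>S. \<iota> (z a g \<otimes>\<^bsub>PA\<^esub> AE a)) = (\<Sum>a\<in>S. \<iota> (z a g) * AR a)"
      by (intro sum.cong) (simp_all add: \<iota>_mult[OF zc[OF _ g] AE_closed[OF subsetD[OF S(2)]]] AR_def)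
    then show "\<gamma> g * \<iota> (t g) = \<gamma> g * \<iota> (x g) + (\<Sum>a\<in>S. \<gamma> g * \<iota> (z a g) * AR a)"
      unfolding t_def using \<iota>_add[OF x(1)[OF g] *(2)] *(1) by (simp add: distrib_left sum_distrib_left mult.assoc)
  qed
  have "(\<Sum>g\<in>carrier G. \<gamma> g * \<iota> (t g)) = u + (\<Sum>g\<in>carrier G. \<Sum>a\<in>S. \<gamma> g * \<iota> (z a g) * AR a)"
    unfolding x(2) sum.distrib[symmetric] using t(2) by (intro sum.cong) auto
  also have "(\<Sum>g\<in>carrier G. \<Sum>a\<in>S. \<gamma> g * \<iota> (z a g) * AR a) = (\<Sum>a\<in>S. w a * AR a)"
    by (subst sum.swap) (intro sum.cong refl, simp only: wz sum_distrib_right)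
  finally have "(\<Sum>g\<in>carrier G. \<gamma> g * \<iota> (t g)) = 0" using sum by simp
  then have t0: "t g = (\<lambda>_. 0)" if "g \<in> carrier G" for g
    using \<gamma>_indep[of t g] t(1) that by blast
  have val: "(z a g \<otimes>\<^bsub>PA\<^esub> AE a) (u', p, v') = (if u' = tail Q a \<and> (\<exists>q. p = [a] @ q) then z a g (head Q a, drop (length [a]) p, v') else 0)"
    if "a \<in> S" "g \<in> carrier G" for a g u' p v'
    unfolding arrow_elt_def
    by (rule quiver.path_algebra_mult_unit[OF zc[OF that] quiver.arrow_path[OF subsetD[OF S(2) that(1)]]])
  have z0: "z a g q = 0" if a: "a \<in> S" and g: "g \<in> carrier G" for a g q
  proof -
    obtain u' p v' where q: "q = (u', p, v')" by (cases q)
    show ?thesis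
    proof (cases "u' = head Q a")
      case False
      then show ?thesis unfolding q z_def vertex_idem_def
        using quiver.path_algebra_mult_unit[OF y(1)[OF a g] quiver.vertex_path[OF hd[OF a]]] by simp
    next
      case True
      \<comment> \<open>A path has only one first arrow, so among the terms of the sum only b = a
        contributes.\<close>
      have "0 = t g (tail Q a, a # p, v')" using t0[OF g] by simp
      also have "\<dots> = (\<Sum>b\<in>S. if b = a then z a g (head Q a, p, v') else 0)"
        unfolding t_def x(3)[OF g] add_0 by (intro sum.cong) (auto simp: val[OF _ g])
      also have "\<dots> = z a g q" using S(1) a by (simp add: q True)
      finally show ?thesis by simp
    qed
  qed
  show w0: "w a = 0" if "a \<in> S" for a
  proof -
    have "z a g = (\<lambda>_. 0)" if "g \<in> carrier G" for g using z0[OF \<open>a \<in> S\<close> that] by blast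
    then show ?thesis unfolding wz[OF that] by (simp add: \<iota>_zero)
  qed
  then have "(\<Sum>a\<in>S. w a * AR a) = 0" by simp
  then show "u = 0" using sum by simp
qed

text \<open>Matrix entries of g on the span of the arrows. The value 0 for other b makes the support
  of each row a set of arrows.\<close>

definition coef :: "'g \<Rightarrow> 'e \<Rightarrow> 'e \<Rightarrow> 'k" where
  "coef g a b = (if b \<in> arcs Q then \<phi> g (AE a) (tail Q b, [b], head Q b) else 0)"

lemma AE_span: "a \<in> arcs Q \<Longrightarrow> AE a \<in> arrow_span Q (arcs Q)"
  unfolding arrow_span_eq[OF quiver.wf_digraph_axioms subset_refl]
  by (auto simp: arrow_elt_def unit_fun_def)

lemma \<phi>_AE:
  assumes g: "g \<in> carrier G" and a: "a \<in> arcs Q"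
  shows "finite {b. coef g a b \<noteq> 0}" "\<phi> g (AE a) = (\<lambda>p. \<Sum>b | coef g a b \<noteq> 0. coef g a b * AE b p)"
proof -
  have "\<phi> g (AE a) \<in> arrow_span Q (arcs Q)" using arrows[OF g] AE_span[OF a] by blast
  then have f: "finite {x. \<phi> g (AE a) x \<noteq> 0}" "{x. \<phi> g (AE a) x \<noteq> 0} \<subseteq> (\<lambda>a. (tail Q a, [a], head Q a)) ` arcs Q"
    unfolding arrow_span_eq[OF quiver.wf_digraph_axioms subset_refl] by auto
  have "(\<lambda>b. (tail Q b, [b], head Q b)) ` {b. coef g a b \<noteq> 0} \<subseteq> {x. \<phi> g (AE a) x \<noteq> 0}"
    by (auto simp: coef_def split: if_splits)
  then have "finite ((\<lambda>b. (tail Q b, [b], head Q b)) ` {b. coef g a b \<noteq> 0})" using f(1) finite_subset by blast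
  then show fin: "finite {b. coef g a b \<noteq> 0}" by (rule finite_imageD) (auto simp: inj_on_def)
  show "\<phi> g (AE a) = (\<lambda>p. \<Sum>b | coef g a b \<noteq> 0. coef g a b * AE b p)"
  proof
    fix p
    show "\<phi> g (AE a) p = (\<Sum>b | coef g a b \<noteq> 0. coef g a b * AE b p)"
    proof (cases "\<exists>c\<in>arcs Q. p = (tail Q c, [c], head Q c)")
      case True
      then obtain c where c: "c \<in> arcs Q" "p = (tail Q c, [c], head Q c)" by blast
      have "(\<Sum>b | coef g a b \<noteq> 0. coef g a b * AE b p) = (\<Sum>b | coef g a b \<noteq> 0. if b = c then coef g a c else 0)"
        by (intro sum.cong) (auto simp: c arrow_elt_def unit_fun_def)
      also have "\<dots> = coef g a c" using fin by simp
      finally show ?thesis using c by (simp add: coef_def)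
    next
      case False
      then have "\<phi> g (AE a) p = 0" using f(2) by blast
      moreover have "coef g a b * AE b p = 0" for b
        using False by (auto simp: coef_def arrow_elt_def unit_fun_def)
      ultimately show ?thesis by simp
    qed
  qed
qed

lemma AR_\<gamma>:
  assumes g: "g \<in> carrier G" and a: "a \<in> arcs Q"
  shows "AR a * \<gamma> g = (\<Sum>b | coef g a b \<noteq> 0. sc (coef g a b) * (\<gamma> g * AR b))"
proof -
  have b: "b \<in> arcs Q" if "coef g a b \<noteq> 0" for b using that by (auto simp: coef_def split: if_splits)
  have "\<iota> (\<phi> g (AE a)) = (\<Sum>b | coef g a b \<noteq> 0. \<iota> (\<lambda>p. coef g a b * AE b p))"
    unfolding \<phi>_AE(2)[OF assms]
    by (rule conjunct1[OF \<iota>_sum[OF \<phi>_AE(1)[OF assms]]], rule path_algebra_closed(3), rule AE_closed, rule b) simp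
  also have "\<dots> = (\<Sum>b | coef g a b \<noteq> 0. sc (coef g a b) * AR b)"
    by (intro sum.cong) (simp_all add: \<iota>_scale[OF AE_closed[OF b]] AR_def)
  finally show ?thesis
    using \<iota>_\<gamma>[OF AE_closed[OF a] g] by (simp add: AR_def sum_distrib_left mult_sc)
qed

text \<open>Apply the automorphism to e_j a = a = a e_i, for a from i to j: the image of a is fixed
  by the idempotents of the moved vertices, so only arrows between those occur in it.\<close>

lemma coef_nonzero:
  assumes g: "g \<in> carrier G" and a: "a \<in> arcs Q" and nz: "coef g a b \<noteq> 0"
  shows "b \<in> arcs Q" "head Q b = va g (head Q a)" "tail Q b = va g (tail Q a)"
proof -
  show b: "b \<in> arcs Q" using nz by (auto simp: coef_def split: if_splits)
  have ht: "head Q a \<in> verts Q" "tail Q a \<in> verts Q" using a by auto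
  have pc: "\<phi> g (AE a) \<in> carrier PA" using \<phi>_closed[OF g AE_closed[OF a]] .
  have val: "\<phi> g (AE a) (tail Q b, [b], head Q b) \<noteq> 0" using nz b by (simp add: coef_def)
  have "\<phi> g (AE a \<otimes>\<^bsub>PA\<^esub> VI (tail Q a)) = \<phi> g (AE a) \<otimes>\<^bsub>PA\<^esub> VI (va g (tail Q a))"
    using \<phi>_mult[OF g AE_closed[OF a] VI_closed[OF ht(2)]] va[OF g ht(2)] by simp
  then have "\<phi> g (AE a) = \<phi> g (AE a) \<otimes>\<^bsub>PA\<^esub> VI (va g (tail Q a))" using a ht by (simp add: vertex_arrow)
  then have "(\<phi> g (AE a) \<otimes>\<^bsub>PA\<^esub> VI (va g (tail Q a))) (tail Q b, [b], head Q b) \<noteq> 0" using val by simp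
  then show "tail Q b = va g (tail Q a)"
    unfolding vertex_idem_def using quiver.path_algebra_mult_unit[OF pc quiver.vertex_path[OF va(1)[OF g ht(2)]]]
    by (auto split: if_splits)
  have "\<phi> g (VI (head Q a) \<otimes>\<^bsub>PA\<^esub> AE a) = VI (va g (head Q a)) \<otimes>\<^bsub>PA\<^esub> \<phi> g (AE a)"
    using \<phi>_mult[OF g VI_closed[OF ht(1)] AE_closed[OF a]] va[OF g ht(1)] by simp
  then have "\<phi> g (AE a) = VI (va g (head Q a)) \<otimes>\<^bsub>PA\<^esub> \<phi> g (AE a)" using a ht by (simp add: vertex_arrow)
  then have "(VI (va g (head Q a)) \<otimes>\<^bsub>PA\<^esub> \<phi> g (AE a)) (tail Q b, [b], head Q b) \<noteq> 0" using val by simp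
  then obtain x where x: "x \<in> {(p, v, q). (tail Q b, p, v) \<in> paths Q \<and> (v, q, head Q b) \<in> paths Q \<and> p @ q = [b]}"
    "(\<lambda>(p, v, q). VI (va g (head Q a)) (v, q, head Q b) * \<phi> g (AE a) (tail Q b, p, v)) x \<noteq> 0"
    unfolding path_algebra_mult using sum.not_neutral_contains_not_neutral by blast
  then show "head Q b = va g (head Q a)"
    by (auto simp: vertex_idem_def unit_fun_def split: if_splits)
qed

end

section \<open>Idempotents attached to the vertices of the associated quiver\<close>

context equivariant_quiver
begin

abbreviation "HG i \<equiv> G\<lparr>carrier := Stab i\<rparr>"

text \<open>The stabilizer of i commutes with e_i. Cut down by e_i it spans a copy of its group
  algebra with unit e_i.\<close>

definition \<eta>S :: "'v \<Rightarrow> 'g \<Rightarrow> 'a" where "\<eta>S i h = E i * \<gamma> h"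

definition KK :: "'v \<Rightarrow> 'a set" where "KK i = vs.span (\<eta>S i ` Stab i)"

lemma E_\<gamma>_Stab: "\<lbrakk>i \<in> verts Q; h \<in> Stab i\<rbrakk> \<Longrightarrow> E i * \<gamma> h = \<gamma> h * E i"
  using E_\<gamma>[of i h] Stab_iff[of i h] by simp

lemma group_algebra_Stab:
  assumes i: "i \<in> verts Q" shows "group_algebra sc (HG i) (\<eta>S i)"
proof -
  have sub: "subgroup (Stab i) G" by (rule subgroup_Stab[OF i])
  have SG: "Stab i \<subseteq> carrier G" using subgroup.subset[OF sub] .
  interpret H: group "HG i" by (rule subgroup.subgroup_is_group[OF sub is_group])
  show ?thesis
  proof (unfold_locales)
    show "finite (carrier (HG i))" using finite_subset[OF SG finite_G] by simp
    show "of_nat (card (carrier (HG i))) \<noteq> (0 :: 'k)" using card_subgroup[OF sub] by simp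
    show "\<eta>S i (g \<otimes>\<^bsub>HG i\<^esub> h) = \<eta>S i g * \<eta>S i h" if "g \<in> carrier (HG i)" "h \<in> carrier (HG i)" for g h
    proof -
      have g: "g \<in> Stab i" "g \<in> carrier G" and h: "h \<in> carrier G" using that SG by auto
      have "\<eta>S i g * \<eta>S i h = E i * (\<gamma> g * E i) * \<gamma> h" by (simp add: \<eta>S_def mult.assoc)
      also have "\<dots> = E i * E i * (\<gamma> g * \<gamma> h)"
        unfolding E_\<gamma>_Stab[OF i g(1), symmetric] by (simp only: mult.assoc)
      also have "\<dots> = \<eta>S i (g \<otimes> h)" using g h i by (simp add: E_idem \<gamma>_mult \<eta>S_def)
      finally show ?thesis by simp
    qed
    show "c h = 0" if sum0: "(\<Sum>h\<in>carrier (HG i). sc (c h) * \<eta>S i h) = 0" and h: "h \<in> carrier (HG i)" for c h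
    proof -
      \<comment> \<open>The relation is rewritten as one over the whole group; its coefficients can
        then be read off at the trivial path of i.\<close>
      let ?y = "\<lambda>g. if g \<in> Stab i then (\<lambda>p. c g * VI i p) else (\<lambda>_. 0)"
      have y: "?y g \<in> carrier PA" for g
        using path_algebra_closed(3)[OF VI_closed[OF i], of "c g"] by (simp add: path_algebra_closed)
      have "(\<Sum>g\<in>carrier G. \<gamma> g * \<iota> (?y g)) = (\<Sum>g\<in>Stab i. \<gamma> g * \<iota> (?y g))"
        using SG finite_G by (intro sum.mono_neutral_right) (auto simp: \<iota>_zero)
      also have "\<dots> = (\<Sum>h\<in>Stab i. sc (c h) * \<eta>S i h)"
        by (intro sum.cong refl)
          (simp add: \<iota>_scale[OF VI_closed[OF i]] \<eta>S_def E_\<gamma>_Stab[OF i] mult_sc, simp add: E_def)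
      also have "\<dots> = 0" using sum0 by simp
      finally have "?y h = (\<lambda>_. 0)" using \<gamma>_indep[of ?y h] y h SG by auto
      then have "(if h \<in> Stab i then (\<lambda>p. c h * VI i p) else (\<lambda>_. 0)) (i, [], i) = 0" by (simp only:)
      then show ?thesis using h by (simp add: vertex_idem_def unit_fun_def)
    qed
  qed
qed

lemma K_eq_KK: "i \<in> verts Q \<Longrightarrow> group_algebra.K sc (HG i) (\<eta>S i) = KK i"
  using group_algebra.K_def[OF group_algebra_Stab] by (simp add: KK_def)

lemma e0_eq_E: "i \<in> verts Q \<Longrightarrow> group_algebra.e0 (HG i) (\<eta>S i) = E i"
  using group_algebra.e0_def[OF group_algebra_Stab] by (simp add: \<eta>S_def \<gamma>1_E)

lemma KK_A0: assumes i: "i \<in> verts Q" shows "KK i \<subseteq> A0"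
proof -
  have "\<eta>S i ` Stab i \<subseteq> A0" using A0_base'[OF _ i] Stab_iff[OF i] by (auto simp: \<eta>S_def)
  then show ?thesis unfolding KK_def using vs.span_minimal subspace_A0 by blast
qed

text \<open>Between e_j and e_j', a generator \<gamma> g e_i survives only if g maps j to i and i =
  j'. If no element maps j to j', nothing is left; if k does, the inverse of k moves all survivors
  into the stabilizer of j.\<close>

lemma A0_corner:
  assumes j: "j \<in> verts Q" and j': "j' \<in> verts Q" and z: "z \<in> A0"
  shows "(\<And>g. g \<in> carrier G \<Longrightarrow> va g j \<noteq> j') \<Longrightarrow> E j * z * E j' = 0"
    and "\<lbrakk>k \<in> carrier G; va k j = j'\<rbrakk> \<Longrightarrow> E j * z * E j' * \<gamma> (inv k) \<in> KK j"
proof -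
  have gen: "E j * (\<gamma> g * E i) * E j' = (if va g j = i \<and> i = j' then E j * \<gamma> g else 0)"
    if g: "g \<in> carrier G" and i: "i \<in> verts Q" for g i
  proof -
    have "E j * (\<gamma> g * E i) * E j' = \<gamma> g * (E (va g j) * E i) * E j'"
      using E_\<gamma>[OF j g] by (simp add: mult.assoc[symmetric])
    then show ?thesis using i j' va[OF g j] E_\<gamma>[OF j g] by (simp add: E_mult mult.assoc)
  qed
  {
    assume no: "\<And>g. g \<in> carrier G \<Longrightarrow> va g j \<noteq> j'"
    show "E j * z * E j' = 0"
      using z unfolding A0_def
    proof (induction rule: vs.span_induct_alt)
      case (step c s z)
      then obtain g i where s: "g \<in> carrier G" "i \<in> verts Q" "s = \<gamma> g * E i" by blast
      then have "E j * s * E j' = 0" using gen[OF s(1,2)] no[OF s(1)] by auto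
      moreover have "E j * (sc c * s + z) * E j' = sc c * (E j * s * E j') + E j * z * E j'"
        by (simp add: distrib_left distrib_right mult_sc mult.assoc)
      ultimately show ?case using step by simp
    qed simp
  next
    assume k: "k \<in> carrier G" "va k j = j'"
    have KKs: "vs.subspace (KK j)" by (simp add: KK_def)
    show "E j * z * E j' * \<gamma> (inv k) \<in> KK j"
      using z unfolding A0_def
    proof (induction rule: vs.span_induct_alt)
      case base
      then show ?case using vs.subspace_0[OF KKs] by simp
    next
      case (step c s z)
      then obtain g i where s: "g \<in> carrier G" "i \<in> verts Q" "s = \<gamma> g * E i" by blast
      have "E j * s * E j' * \<gamma> (inv k) \<in> KK j"
      proof (cases "va g j = i \<and> i = j'")
        case True
        then have "E j * s * E j' * \<gamma> (inv k) = \<eta>S j (g \<otimes> inv k)"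
          using gen[OF s(1,2)] s k by (simp add: \<eta>S_def \<gamma>_mult mult.assoc)
        moreover have "g \<otimes> inv k \<in> Stab j"
          using True s k j va_inv(1)[OF k(1) j] by (simp add: Stab_iff va_mult)
        ultimately show ?thesis unfolding KK_def by (simp add: vs.span_base)
      next
        case False
        then have "E j * s * E j' = 0" using gen[OF s(1,2)] s(3) by (simp only: if_False)
        then show ?thesis using vs.subspace_0[OF KKs] by simp
      qed
      moreover have "E j * (sc c * s + z) * E j' * \<gamma> (inv k) = sc c * (E j * s * E j' * \<gamma> (inv k)) + E j * z * E j' * \<gamma> (inv k)"
        by (simp add: distrib_left distrib_right mult_sc mult.assoc)
      ultimately show ?case using step vs.subspace_add[OF KKs] vs.subspace_scale[OF KKs] by simp
    qed
  }
qed

lemma A0_corner_Stab: assumes "i \<in> verts Q" "z \<in> A0" shows "E i * z * E i \<in> KK i"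
  using A0_corner(2)[OF assms(1,1,2), of \<one>] assms(1) va_one[OF assms(1)]
  by (simp add: mult.assoc \<gamma>1_E)

end

locale assoc_quiver_model = equivariant_quiver sc G Q \<phi> \<iota> \<gamma>
  for sc :: "'k::alg_closed_field \<Rightarrow> 'a::ring_1" and G :: "('g, 'n) monoid_scheme" (structure)
    and Q :: "('v, 'e) pre_digraph"
    and \<phi> :: "'g \<Rightarrow> (('v, 'e) path \<Rightarrow> 'k) \<Rightarrow> ('v, 'e) path \<Rightarrow> 'k"
    and \<iota> :: "(('v, 'e) path \<Rightarrow> 'k) \<Rightarrow> 'a" and \<gamma> :: "'g \<Rightarrow> 'a" +
  fixes R :: "'v set" and \<kappa> :: "'v \<Rightarrow> 'g" and F :: "'v \<Rightarrow> 'v \<Rightarrow> ('v \<times> 'v) set"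
    and irr :: "'g set \<Rightarrow> ('g, 'k, 'r) rep set"
    and bas :: "'v \<times> ('g, 'k, 'r) rep \<Rightarrow> 'v \<times> ('g, 'k, 'r) rep
                \<Rightarrow> ('v \<times> 'v \<Rightarrow> 'r \<Rightarrow> ('v, 'e) path \<Rightarrow> 'r) set"
  assumes choices: "assoc_quiver_choices G Q \<phi> R \<kappa> F irr bas"
begin

abbreviation "X \<equiv> assoc_verts G \<phi> R irr"

lemma R_verts: "i \<in> R \<Longrightarrow> i \<in> verts Q"
  using choices by (auto simp: assoc_quiver_choices_def orbit_representatives_def)

lemma R_rep: assumes "i \<in> verts Q" shows "\<exists>r\<in>R. \<kappa> i \<in> carrier G \<and> va (\<kappa> i) r = i"
proof -
  have "\<exists>!r. r \<in> R \<and> r \<in> orbit G va i"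
    using choices assms by (auto simp: assoc_quiver_choices_def orbit_representatives_def)
  then obtain r g where r: "r \<in> R" "g \<in> carrier G" "r = va g i" by (auto simp: orbit_def)
  then have "i = va (inv g) r" using va_inv(1) assms by simp
  then have "i \<in> orbit G va r" using r by (auto simp: orbit_def)
  then show ?thesis using choices r(1) by (auto simp: assoc_quiver_choices_def)
qed

lemma R_\<kappa>: "\<lbrakk>i \<in> R; g \<in> carrier G; va g i = i'\<rbrakk> \<Longrightarrow> \<kappa> i' \<in> carrier G \<and> va (\<kappa> i') i = i'"
  using choices by (auto simp: assoc_quiver_choices_def orbit_def)

lemma R_unique: assumes "i \<in> R" "j \<in> R" "g \<in> carrier G" "va g i = j" shows "i = j"
proof -
  have "\<exists>!r. r \<in> R \<and> r \<in> orbit G va i"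
    using choices R_verts[OF assms(1)] by (auto simp: assoc_quiver_choices_def orbit_representatives_def)
  moreover have "i \<in> orbit G va i" using va_one[OF R_verts[OF assms(1)]] one_closed unfolding orbit_def by force
  moreover have "j \<in> orbit G va i" using assms by (auto simp: orbit_def)
  ultimately show ?thesis using assms(1,2) by blast
qed

lemma irr_reps: "i \<in> R \<Longrightarrow> irr_representatives (HG i) (irr (Stab i))"
  using choices by (auto simp: assoc_quiver_choices_def)

lemma X_iff: "(i, \<rho>) \<in> X \<longleftrightarrow> i \<in> R \<and> \<rho> \<in> irr (Stab i)"
  by (auto simp: assoc_verts_def)

lemma X_irr: "(i, \<rho>) \<in> X \<Longrightarrow> irreducible_rep (HG i) \<rho>"
  using irr_reps by (auto simp: X_iff irr_representatives_def)

lemma X_verts: "(i, \<rho>) \<in> X \<Longrightarrow> i \<in> verts Q"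
  by (simp add: X_iff R_verts)

text \<open>Embedding and idempotent are chosen as one pair, since \<theta> and \<epsilon> have to
  belong to the same right ideal.\<close>

definition realization :: "'v \<times> ('g, 'k, 'r) rep \<Rightarrow> ('r \<Rightarrow> 'a) \<times> 'a" where
  "realization = (\<lambda>(i, \<rho>). SOME (\<theta>, \<epsilon>). group_algebra.realizes sc (HG i) (\<eta>S i) \<rho> \<theta> \<epsilon>)"

definition \<theta> :: "'v \<times> ('g, 'k, 'r) rep \<Rightarrow> 'r \<Rightarrow> 'a" where "\<theta> x = fst (realization x)"
definition \<epsilon> :: "'v \<times> ('g, 'k, 'r) rep \<Rightarrow> 'a" where "\<epsilon> x = snd (realization x)"

lemma realizes: assumes x: "(i, \<rho>) \<in> X"
  shows "group_algebra.realizes sc (HG i) (\<eta>S i) \<rho> (\<theta> (i, \<rho>)) (\<epsilon> (i, \<rho>))"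
proof -
  interpret K: group_algebra sc "HG i" "\<eta>S i" by (rule group_algebra_Stab[OF X_verts[OF x]])
  have "\<exists>t d. K.realizes \<rho> t d" by (rule K.realization_exists[OF X_irr[OF x]])
  then have "\<exists>p. K.realizes \<rho> (fst p) (snd p)" by simp
  from someI_ex[OF this] show ?thesis
    by (simp add: \<theta>_def \<epsilon>_def realization_def case_prod_unfold)
qed

text \<open>The facts about group algebras, restated so that later arguments use only products with
  e_i and \<gamma> h in the ring \<open>'a\<close>.\<close>

lemma \<theta>_facts: assumes x: "(i, \<rho>) \<in> X"
  shows "v \<in> carrier \<rho> \<Longrightarrow> \<theta> (i, \<rho>) v \<in> KK i"
    "\<lbrakk>v \<in> carrier \<rho>; w \<in> carrier \<rho>\<rbrakk> \<Longrightarrow> \<theta> (i, \<rho>) (v \<oplus>\<^bsub>\<rho>\<^esub> w) = \<theta> (i, \<rho>) v + \<theta> (i, \<rho>) w"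
    "v \<in> carrier \<rho> \<Longrightarrow> \<theta> (i, \<rho>) (c \<odot>\<^bsub>\<rho>\<^esub> v) = sc c * \<theta> (i, \<rho>) v"
    "inj_on (\<theta> (i, \<rho>)) (carrier \<rho>)"
    "\<epsilon> (i, \<rho>) \<in> \<theta> (i, \<rho>) ` carrier \<rho>" "v \<in> carrier \<rho> \<Longrightarrow> \<epsilon> (i, \<rho>) * \<theta> (i, \<rho>) v = \<theta> (i, \<rho>) v"
    "\<epsilon> (i, \<rho>) \<noteq> 0" "\<epsilon> (i, \<rho>) \<in> KK i" "\<epsilon> (i, \<rho>) * \<epsilon> (i, \<rho>) = \<epsilon> (i, \<rho>)"
    "\<theta> (i, \<rho>) ` carrier \<rho> = (\<lambda>z. \<epsilon> (i, \<rho>) * z) ` KK i"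
    "z \<in> KK i \<Longrightarrow> E i * z = z" "z \<in> KK i \<Longrightarrow> z * E i = z"
    "\<lbrakk>h \<in> Stab i; v \<in> carrier \<rho>\<rbrakk> \<Longrightarrow> \<theta> (i, \<rho>) (act \<rho> h v) = \<theta> (i, \<rho>) v * \<gamma> h"
proof -
  have i: "i \<in> verts Q" by (rule X_verts[OF x])
  interpret K: group_algebra sc "HG i" "\<eta>S i" by (rule group_algebra_Stab[OF i])
  note D = K.realizesD[OF realizes[OF x]] and KK = K_eq_KK[OF i] and e = e0_eq_E[OF i]
  show 1: "\<theta> (i, \<rho>) v \<in> KK i" if "v \<in> carrier \<rho>" for v using D(1)[OF that] by (simp add: KK)
  show "\<lbrakk>v \<in> carrier \<rho>; w \<in> carrier \<rho>\<rbrakk> \<Longrightarrow> \<theta> (i, \<rho>) (v \<oplus>\<^bsub>\<rho>\<^esub> w) = \<theta> (i, \<rho>) v + \<theta> (i, \<rho>) w" by (rule D(2))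
  show "v \<in> carrier \<rho> \<Longrightarrow> \<theta> (i, \<rho>) (c \<odot>\<^bsub>\<rho>\<^esub> v) = sc c * \<theta> (i, \<rho>) v" by (rule D(3))
  show "inj_on (\<theta> (i, \<rho>)) (carrier \<rho>)" by (rule D(4))
  show "\<epsilon> (i, \<rho>) \<in> \<theta> (i, \<rho>) ` carrier \<rho>" by (rule D(6))
  show "v \<in> carrier \<rho> \<Longrightarrow> \<epsilon> (i, \<rho>) * \<theta> (i, \<rho>) v = \<theta> (i, \<rho>) v" by (rule D(7))
  show "\<epsilon> (i, \<rho>) \<noteq> 0" by (rule D(8))
  show "\<epsilon> (i, \<rho>) \<in> KK i" using D(9) by (simp add: KK)
  show "\<epsilon> (i, \<rho>) * \<epsilon> (i, \<rho>) = \<epsilon> (i, \<rho>)" by (rule D(10))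
  show "\<theta> (i, \<rho>) ` carrier \<rho> = (\<lambda>z. \<epsilon> (i, \<rho>) * z) ` KK i"
    using K.realizes_image(2)[OF X_irr[OF x] realizes[OF x]] by (simp add: KK)
  show "z \<in> KK i \<Longrightarrow> E i * z = z" using K.e0_left[of z] by (simp add: KK e)
  show 2: "z * E i = z" if "z \<in> KK i" for z using K.e0_right[of z] that by (simp add: KK e)
  show "\<theta> (i, \<rho>) (act \<rho> h v) = \<theta> (i, \<rho>) v * \<gamma> h" if "h \<in> Stab i" "v \<in> carrier \<rho>"
    using D(5)[of h v] that 2[OF 1[OF that(2)]] by (simp add: \<eta>S_def mult.assoc[symmetric])
qed

lemma \<epsilon>_A0: "x \<in> X \<Longrightarrow> \<epsilon> x \<in> A0"
  using \<theta>_facts(8) KK_A0 X_verts by (cases x) blast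

lemma \<epsilon>_E: "(i, \<rho>) \<in> X \<Longrightarrow> E i * \<epsilon> (i, \<rho>) = \<epsilon> (i, \<rho>)" "(i, \<rho>) \<in> X \<Longrightarrow> \<epsilon> (i, \<rho>) * E i = \<epsilon> (i, \<rho>)"
  using \<theta>_facts(8,11,12) by blast+

lemma \<epsilon>_idem: "x \<in> X \<Longrightarrow> \<epsilon> x * \<epsilon> x = \<epsilon> x" and \<epsilon>_nonzero: "x \<in> X \<Longrightarrow> \<epsilon> x \<noteq> 0"
  using \<theta>_facts(7,9) by (cases x; blast)+

text \<open>\<epsilon> x absorbs e_i on both sides, so z may be replaced by e_i z e_i. This lies in
  k[G_i] e_i, where Schur's lemma is available.\<close>

lemma schur:
  assumes x: "x \<in> X" and z: "z \<in> A0" shows "\<exists>c. \<epsilon> x * z * \<epsilon> x = sc c * \<epsilon> x"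
proof -
  obtain i \<rho> where xi: "x = (i, \<rho>)" by (cases x)
  note x' = x[unfolded xi]
  have i: "i \<in> verts Q" by (rule X_verts[OF x'])
  interpret K: group_algebra sc "HG i" "\<eta>S i" by (rule group_algebra_Stab[OF i])
  have "E i * z * E i \<in> K.K" using A0_corner_Stab[OF i z] by (simp add: K_eq_KK[OF i])
  from K.realizes_schur[OF X_irr[OF x'] realizes[OF x'] this]
  obtain c where "\<epsilon> x * (E i * z * E i) * \<epsilon> x = sc c * \<epsilon> x" unfolding xi by blast
  moreover have "\<epsilon> x * (E i * z * E i) * \<epsilon> x = (\<epsilon> x * E i) * z * (E i * \<epsilon> x)" by (simp only: mult.assoc)
  ultimately have "\<epsilon> x * z * \<epsilon> x = sc c * \<epsilon> x" using \<epsilon>_E[OF x'] by (simp add: xi)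
  then show ?thesis by (rule exI)
qed

text \<open>Vertices of different orbits are not linked by \<open>A0\<close>. If the vertices agree,
  the representations are distinct members of a system of representatives, hence not
  isomorphic.\<close>

lemma orthogonal:
  assumes x: "x \<in> X" and y: "y \<in> X" and ne: "x \<noteq> y" and z: "z \<in> A0" shows "\<epsilon> y * z * \<epsilon> x = 0"
proof -
  obtain i \<rho> j \<sigma> where xi: "x = (i, \<rho>)" and yj: "y = (j, \<sigma>)" by (cases x; cases y)
  note x' = x[unfolded xi] and y' = y[unfolded yj]
  have i: "i \<in> verts Q" "i \<in> R" and j: "j \<in> verts Q" "j \<in> R" using X_verts x' y' X_iff by blast+
  have eq: "\<epsilon> y * z * \<epsilon> x = \<epsilon> y * (E j * z * E i) * \<epsilon> x"
  proof -
    have "\<epsilon> y * (E j * z * E i) * \<epsilon> x = (\<epsilon> y * E j) * z * (E i * \<epsilon> x)" by (simp only: mult.assoc)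
    then show ?thesis using \<epsilon>_E(1)[OF x'] \<epsilon>_E(2)[OF y'] by (simp add: xi yj)
  qed
  show ?thesis
  proof (cases "i = j")
    case False
    then have "va g j \<noteq> i" if "g \<in> carrier G" for g using R_unique[OF j(2) i(2) that] by auto
    then have "E j * z * E i = 0" by (rule A0_corner(1)[OF j(1) i(1) z])
    then show ?thesis unfolding eq by simp
  next
    case True
    interpret K: group_algebra sc "HG i" "\<eta>S i" by (rule group_algebra_Stab[OF i(1)])
    have "\<epsilon> (i, \<sigma>) * (E i * z * E i) * \<epsilon> (i, \<rho>) = 0"
    proof (rule K.realizes_orthogonal)
      show "irreducible_rep (HG i) \<rho>" "irreducible_rep (HG i) \<sigma>" using X_irr x' y' True by auto
      show "\<not> rep_isomorphic (HG i) \<rho> \<sigma>"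
        using irr_reps[OF i(2)] x' y' ne True xi yj by (auto simp: X_iff irr_representatives_def)
      show "K.realizes \<rho> (\<theta> (i, \<rho>)) (\<epsilon> (i, \<rho>))" by (rule realizes[OF x'])
      show "K.realizes \<sigma> (\<theta> (i, \<sigma>)) (\<epsilon> (i, \<sigma>))" using realizes[OF y'] True by simp
      show "E i * z * E i \<in> K.K" using A0_corner_Stab[OF i(1) z] by (simp add: K_eq_KK[OF i(1)])
    qed
    then show ?thesis unfolding eq using True xi yj by simp
  qed
qed

text \<open>For the chosen vertices this is completeness of the irreducible representations. Every
  other e_i is conjugate to one of these by \<kappa> i, and all e_i together sum to the
  unit.\<close>

lemma full: "\<gamma> \<one> \<in> vs.span {z * \<epsilon> x * w | x z w. x \<in> X \<and> z \<in> A0 \<and> w \<in> A0}" (is "_ \<in> vs.span ?J")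
proof -
  have E: "E r \<in> vs.span ?J" if r: "r \<in> R" for r
  proof -
    have rv: "r \<in> verts Q" by (rule R_verts[OF r])
    interpret K: group_algebra sc "HG r" "\<eta>S r" by (rule group_algebra_Stab[OF rv])
    have "K.e0 \<in> vs.span {z * \<epsilon> (r, \<rho>) * w | \<rho> z w. \<rho> \<in> irr (Stab r) \<and> z \<in> K.K \<and> w \<in> K.K}"
      by (rule K.e0_in_span[OF irr_reps[OF r], of "\<lambda>\<rho>. \<theta> (r, \<rho>)"]) (simp add: realizes X_iff r)
    moreover have "{z * \<epsilon> (r, \<rho>) * w | \<rho> z w. \<rho> \<in> irr (Stab r) \<and> z \<in> K.K \<and> w \<in> K.K} \<subseteq> ?J"
      using KK_A0[OF rv] r unfolding K_eq_KK[OF rv] X_iff[symmetric] by (auto simp: X_iff) blast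
    ultimately show ?thesis using subsetD[OF vs.span_mono] unfolding e0_eq_E[OF rv] by blast
  qed
  have conj: "s * z * t \<in> vs.span ?J" if "s \<in> A0" "t \<in> A0" "z \<in> vs.span ?J" for s t z
    using that(3)
  proof (induction rule: vs.span_induct_alt)
    case (step c b z)
    then obtain x u w where b: "b = u * \<epsilon> x * w" "x \<in> X" "u \<in> A0" "w \<in> A0" by blast
    have "s * b * t = (s * u) * \<epsilon> x * (w * t)" by (simp only: b mult.assoc)
    then have "s * b * t \<in> ?J" using b that A0_mult by blast
    then have "s * b * t \<in> vs.span ?J" by (rule vs.span_base)
    moreover have "s * (sc c * b + z) * t = sc c * (s * b * t) + s * z * t"
      by (simp add: distrib_left distrib_right mult_sc mult.assoc)
    ultimately show ?case using step by (simp add: vs.span_add vs.span_scale)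
  qed (simp add: vs.span_zero)
  have "E i \<in> vs.span ?J" if i: "i \<in> verts Q" for i
  proof -
    obtain r where r: "r \<in> R" "\<kappa> i \<in> carrier G" "va (\<kappa> i) r = i" using R_rep[OF i] by blast
    have "\<gamma> (inv (\<kappa> i)) * E r * \<gamma> (\<kappa> i) = \<gamma> (inv (\<kappa> i)) * \<gamma> (\<kappa> i) * E i"
      using E_\<gamma>[OF R_verts[OF r(1)] r(2)] r(3) by (simp add: mult.assoc)
    also have "\<dots> = E i" using r(2) i by (simp add: \<gamma>_inv_\<gamma> \<gamma>1_E)
    finally show ?thesis using conj[OF \<gamma>_A0 \<gamma>_A0 E[OF r(1)], of "inv (\<kappa> i)" "\<kappa> i"] r(2) by simp
  qed
  then show ?thesis unfolding sum_E[symmetric] by (intro vs.span_sum) auto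
qed

lemma finite_X: "finite X"
proof -
  have "finite (irr (Stab r))" if r: "r \<in> R" for r
  proof -
    have rv: "r \<in> verts Q" by (rule R_verts[OF r])
    interpret K: group_algebra sc "HG r" "\<eta>S r" by (rule group_algebra_Stab[OF rv])
    show ?thesis
      by (rule K.S_finite[OF irr_reps[OF r], of "\<lambda>\<rho>. \<theta> (r, \<rho>)" "\<lambda>\<rho>. \<epsilon> (r, \<rho>)"]) (simp add: realizes X_iff r)
  qed
  moreover have "finite R" using R_verts finite_verts by (meson finite_subset subsetI)
  ultimately show ?thesis unfolding assoc_verts_def by (intro finite_SigmaI)
qed

end

section \<open>Coefficients with respect to the arrows\<close>

context equivariant_quiver
begin

text \<open>Since e_i a = 0 unless i is the head of a, a coefficient could be altered by any element
  of AA e_i for another i. Requiring it to be fixed by the idempotent of the head removes this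
  freedom, and \<open>freeness\<close> then gives uniqueness.\<close>

definition has_cf :: "'a \<Rightarrow> ('e \<Rightarrow> 'a) \<Rightarrow> bool" where
  "has_cf p w \<longleftrightarrow> finite {a. w a \<noteq> 0} \<and> {a. w a \<noteq> 0} \<subseteq> arcs Q \<and>
    (\<forall>a. w a \<in> AA) \<and> (\<forall>a \<in> arcs Q. w a * E (head Q a) = w a) \<and> p = (\<Sum>a | w a \<noteq> 0. w a * AR a)"

definition cw :: "'a \<Rightarrow> 'e \<Rightarrow> 'a" where "cw p = (THE w. has_cf p w)"

lemma has_cf_sum: "\<lbrakk>has_cf p w; finite T; {a. w a \<noteq> 0} \<subseteq> T\<rbrakk> \<Longrightarrow> p = (\<Sum>a\<in>T. w a * AR a)"
  unfolding has_cf_def by (auto intro!: sum.mono_neutral_left)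

lemma has_cfI:
  assumes "finite T" "T \<subseteq> arcs Q" "\<And>a. a \<in> T \<Longrightarrow> w a \<in> AA" "\<And>a. a \<in> T \<Longrightarrow> w a * E (head Q a) = w a"
    "\<And>a. a \<notin> T \<Longrightarrow> w a = 0" "p = (\<Sum>a\<in>T. w a * AR a)"
  shows "has_cf p w"
proof -
  have sub: "{a. w a \<noteq> 0} \<subseteq> T" using assms(5) by blast
  have "w a \<in> AA" for a using assms(3)[of a] assms(5)[of a] vs.subspace_0[OF subspace_AA] by (cases "a \<in> T") auto
  moreover have "w a * E (head Q a) = w a" for a using assms(4)[of a] assms(5)[of a] by (cases "a \<in> T") auto
  moreover have "p = (\<Sum>a | w a \<noteq> 0. w a * AR a)"
    unfolding assms(6) using assms(1) sub by (intro sum.mono_neutral_right) auto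
  ultimately show ?thesis unfolding has_cf_def using finite_subset[OF sub assms(1)] sub assms(2) by blast
qed

lemma has_cf_unique: assumes "has_cf p w" "has_cf p w'" shows "w = w'"
proof
  fix a
  let ?T = "{a. w a \<noteq> 0} \<union> {a. w' a \<noteq> 0}"
  have T: "finite ?T" "?T \<subseteq> arcs Q" using assms unfolding has_cf_def by auto
  have p: "p = (\<Sum>a\<in>?T. w a * AR a)" "p = (\<Sum>a\<in>?T. w' a * AR a)"
    using has_cf_sum[OF assms(1) T(1)] has_cf_sum[OF assms(2) T(1)] by auto
  have "(\<Sum>a\<in>?T. (w a - w' a) * AR a) = p - p"
    unfolding left_diff_distrib sum_subtractf using p by simp
  then have sum0: "0 + (\<Sum>a\<in>?T. (w a - w' a) * AR a) = 0" by simp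
  show "w a = w' a"
  proof (cases "a \<in> ?T")
    case True
    have "w a - w' a = 0"
    proof (rule freeness(2)[OF vs.subspace_0[OF subspace_A0] T _ _ sum0 True])
      fix b assume b: "b \<in> ?T"
      show "w b - w' b \<in> AA" using assms vs.subspace_diff[OF subspace_AA] unfolding has_cf_def by blast
      show "(w b - w' b) * E (head Q b) = w b - w' b"
        using assms subsetD[OF T(2) b] unfolding has_cf_def left_diff_distrib by simp
    qed
    then show ?thesis by simp
  qed auto
qed

lemma cw: "has_cf p w \<Longrightarrow> cw p = w"
  unfolding cw_def using has_cf_unique by blast

lemma has_cf_0: "has_cf 0 (\<lambda>_. 0)"
  by (rule has_cfI[of "{}"]) auto

lemma has_cf_add: assumes "has_cf p w" "has_cf p' w'" shows "has_cf (p + p') (\<lambda>a. w a + w' a)"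
proof -
  let ?T = "{a. w a \<noteq> 0} \<union> {a. w' a \<noteq> 0}"
  have T: "finite ?T" "?T \<subseteq> arcs Q" using assms unfolding has_cf_def by auto
  have p: "p = (\<Sum>a\<in>?T. w a * AR a)" "p' = (\<Sum>a\<in>?T. w' a * AR a)"
    using has_cf_sum[OF assms(1) T(1)] has_cf_sum[OF assms(2) T(1)] by auto
  show ?thesis
  proof (rule has_cfI[OF T])
    fix a assume a: "a \<in> ?T"
    show "w a + w' a \<in> AA" using assms vs.subspace_add[OF subspace_AA] unfolding has_cf_def by blast
    show "(w a + w' a) * E (head Q a) = w a + w' a"
      using assms subsetD[OF T(2) a] unfolding has_cf_def distrib_right by simp
  qed (auto simp: distrib_right sum.distrib p[symmetric])
qed

lemma has_cf_left: assumes "has_cf p w" "z \<in> AA" shows "has_cf (z * p) (\<lambda>a. z * w a)"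
proof (rule has_cfI[of "{a. w a \<noteq> 0}"])
  show "finite {a. w a \<noteq> 0}" "{a. w a \<noteq> 0} \<subseteq> arcs Q" using assms(1) unfolding has_cf_def by auto
  fix a assume "a \<in> {a. w a \<noteq> 0}"
  then show "z * w a \<in> AA" "z * w a * E (head Q a) = z * w a"
    using assms AA_mult unfolding has_cf_def by (auto simp: mult.assoc)
next
  show "z * p = (\<Sum>a | w a \<noteq> 0. z * w a * AR a)"
    using assms(1) unfolding has_cf_def by (simp add: sum_distrib_left mult.assoc)
qed auto

lemma has_cf_scale: assumes "has_cf p w" shows "has_cf (sc c * p) (\<lambda>a. sc c * w a)"
proof -
  have A: "\<And>a. w a \<in> AA" and ww: "\<And>a. a \<in> arcs Q \<Longrightarrow> w a * E (head Q a) = w a"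
    and f: "finite {a. w a \<noteq> 0}" "{a. w a \<noteq> 0} \<subseteq> arcs Q" and p: "p = (\<Sum>a | w a \<noteq> 0. w a * AR a)"
    using assms unfolding has_cf_def by blast+
  show ?thesis
  proof (rule has_cfI[OF f])
    show "sc c * p = (\<Sum>a | w a \<noteq> 0. sc c * w a * AR a)"
      unfolding p sum_distrib_left mult.assoc ..
    fix a assume a: "a \<in> {a. w a \<noteq> 0}"
    show "sc c * w a \<in> AA" using A vs.subspace_scale[OF subspace_AA] by blast
    show "sc c * w a * E (head Q a) = sc c * w a" using ww[OF subsetD[OF f(2) a]] by (simp add: mult.assoc)
  qed simp
qed

lemma has_cf_setsum:
  "\<lbrakk>finite S; \<And>s. s \<in> S \<Longrightarrow> has_cf (p s) (w s)\<rbrakk> \<Longrightarrow> has_cf (\<Sum>s\<in>S. p s) (\<lambda>a. \<Sum>s\<in>S. w s a)"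
  by (induction S rule: finite_induct) (simp_all add: has_cf_0 has_cf_add)

text \<open>Pulling g to the left across an arrow a replaces a by a combination of arrows b, so the
  new coefficients are the old ones mixed by the matrix \<open>coef g\<close>.\<close>

lemma has_cf_\<gamma>: assumes p: "has_cf p w" and g: "g \<in> carrier G"
  shows "has_cf (p * \<gamma> g) (\<lambda>b. \<Sum>a | w a \<noteq> 0. sc (coef g a b) * (w a * \<gamma> g))"
proof -
  have A: "\<And>a. w a \<in> AA" and ww: "\<And>a. a \<in> arcs Q \<Longrightarrow> w a * E (head Q a) = w a"
    and f: "finite {a. w a \<noteq> 0}" "{a. w a \<noteq> 0} \<subseteq> arcs Q" and pw: "p = (\<Sum>a | w a \<noteq> 0. w a * AR a)"
    using p unfolding has_cf_def by blast+
  have "has_cf (w a * AR a * \<gamma> g) (\<lambda>b. sc (coef g a b) * (w a * \<gamma> g))" if "w a \<noteq> 0" for a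
  proof -
    have a: "a \<in> arcs Q" using that f by blast
    show ?thesis
    proof (rule has_cfI[of "{b. coef g a b \<noteq> 0}"])
      show "finite {b. coef g a b \<noteq> 0}" by (rule \<phi>_AE(1)[OF g a])
      show "{b. coef g a b \<noteq> 0} \<subseteq> arcs Q" using coef_nonzero(1)[OF g a] by blast
      show "w a * AR a * \<gamma> g = (\<Sum>b | coef g a b \<noteq> 0. sc (coef g a b) * (w a * \<gamma> g) * AR b)"
        unfolding mult.assoc[of "w a"] AR_\<gamma>[OF g a] sum_distrib_left
        by (intro sum.cong refl) (simp add: mult_sc mult.assoc)
      fix b assume "b \<in> {b. coef g a b \<noteq> 0}"
      then have nz: "coef g a b \<noteq> 0" by simp
      show "sc (coef g a b) * (w a * \<gamma> g) \<in> AA"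
        by (intro vs.subspace_scale[OF subspace_AA] AA_mult A \<gamma>_AA g)
      have h: "head Q a \<in> verts Q" using a by simp
      have "w a * \<gamma> g * E (head Q b) = w a * (E (head Q a) * \<gamma> g)"
        using E_\<gamma>[OF h g] coef_nonzero(2)[OF g a nz] by (simp add: mult.assoc)
      also have "\<dots> = w a * \<gamma> g" using ww[OF a] by (simp add: mult.assoc[symmetric])
      finally show "sc (coef g a b) * (w a * \<gamma> g) * E (head Q b) = sc (coef g a b) * (w a * \<gamma> g)"
        by (simp only: mult.assoc)
    qed simp
  qed
  then have "has_cf (\<Sum>a | w a \<noteq> 0. w a * AR a * \<gamma> g) (\<lambda>b. \<Sum>a | w a \<noteq> 0. sc (coef g a b) * (w a * \<gamma> g))"
    using f(1) by (intro has_cf_setsum) auto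
  then show ?thesis unfolding pw sum_distrib_right .
qed

lemma has_cf_restrict: assumes p: "has_cf p w"
  shows "has_cf (\<Sum>a | w a \<noteq> 0 \<and> P a. w a * AR a) (\<lambda>a. if P a then w a else 0)"
proof (rule has_cfI[of "{a. w a \<noteq> 0 \<and> P a}"])
  show "finite {a. w a \<noteq> 0 \<and> P a}" using p unfolding has_cf_def by (auto intro: finite_subset)
  show "{a. w a \<noteq> 0 \<and> P a} \<subseteq> arcs Q" using p unfolding has_cf_def by auto
  show "(\<Sum>a | w a \<noteq> 0 \<and> P a. w a * AR a) = (\<Sum>a | w a \<noteq> 0 \<and> P a. (if P a then w a else 0) * AR a)"
    by (intro sum.cong) auto
qed (use p in \<open>auto simp: has_cf_def\<close>)

lemma has_cf_E: assumes p: "has_cf p w" and i: "i \<in> verts Q"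
  shows "has_cf (p * E i) (\<lambda>a. if tail Q a = i then w a else 0)"
proof -
  have f: "finite {a. w a \<noteq> 0}" "{a. w a \<noteq> 0} \<subseteq> arcs Q" and pw: "p = (\<Sum>a | w a \<noteq> 0. w a * AR a)"
    using p unfolding has_cf_def by blast+
  have "p * E i = (\<Sum>a | w a \<noteq> 0. if tail Q a = i then w a * AR a else 0)"
    unfolding pw sum_distrib_right using f(2) i by (intro sum.cong) (auto simp: mult.assoc AR_E)
  also have "\<dots> = (\<Sum>a | w a \<noteq> 0 \<and> tail Q a = i. w a * AR a)"
    using f(1) by (simp add: sum.inter_filter[symmetric])
  finally show ?thesis using has_cf_restrict[OF p, of "\<lambda>a. tail Q a = i"] by simp
qed

definition A1 :: "'a set" where "A1 = {p. \<exists>w. has_cf p w \<and> (\<forall>a. w a \<in> A0)}"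

lemma A1_cw: assumes "p \<in> A1"
  shows "has_cf p (cw p)" "cw p a \<in> A0" "a \<in> arcs Q \<Longrightarrow> cw p a * E (head Q a) = cw p a"
    "cw p a \<noteq> 0 \<Longrightarrow> a \<in> arcs Q" "finite {a. cw p a \<noteq> 0}" "p = (\<Sum>a | cw p a \<noteq> 0. cw p a * AR a)"
proof -
  obtain w where w: "has_cf p w" "\<forall>a. w a \<in> A0" using assms unfolding A1_def by blast
  show "has_cf p (cw p)" "cw p a \<in> A0" "a \<in> arcs Q \<Longrightarrow> cw p a * E (head Q a) = cw p a"
    "cw p a \<noteq> 0 \<Longrightarrow> a \<in> arcs Q" "finite {a. cw p a \<noteq> 0}" "p = (\<Sum>a | cw p a \<noteq> 0. cw p a * AR a)"
    using w unfolding cw[OF w(1)] has_cf_def by auto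
qed

lemma A1I: "\<lbrakk>has_cf p w; \<And>a. w a \<in> A0\<rbrakk> \<Longrightarrow> p \<in> A1" unfolding A1_def by blast

lemma A1_eqI: "\<lbrakk>p \<in> A1; q \<in> A1; \<And>a. cw p a = cw q a\<rbrakk> \<Longrightarrow> p = q"
proof -
  assume p: "p \<in> A1" and q: "q \<in> A1" and eq: "\<And>a. cw p a = cw q a"
  have "p = (\<Sum>a | cw p a \<noteq> 0. cw p a * AR a)" by (rule A1_cw(6)[OF p])
  also have "\<dots> = q" unfolding eq by (rule A1_cw(6)[OF q, symmetric])
  finally show "p = q" .
qed

lemma A1_0: "0 \<in> A1" and cw_0: "cw 0 a = 0"
proof -
  show "cw 0 a = 0" unfolding cw[OF has_cf_0] ..
  show "0 \<in> A1" by (rule A1I[OF has_cf_0]) (rule vs.subspace_0[OF subspace_A0])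
qed

lemma A1_add: "\<lbrakk>p \<in> A1; q \<in> A1\<rbrakk> \<Longrightarrow> p + q \<in> A1"
  and cw_add: "\<lbrakk>p \<in> A1; q \<in> A1\<rbrakk> \<Longrightarrow> cw (p + q) a = cw p a + cw q a"
proof -
  assume p: "p \<in> A1" and q: "q \<in> A1"
  note c = has_cf_add[OF A1_cw(1)[OF p] A1_cw(1)[OF q]]
  show "cw (p + q) a = cw p a + cw q a" unfolding cw[OF c] ..
  show "p + q \<in> A1" by (rule A1I[OF c]) (intro vs.subspace_add[OF subspace_A0] A1_cw(2) p q)
qed

lemma A1_scale: "p \<in> A1 \<Longrightarrow> sc c * p \<in> A1"
  and cw_scale: "p \<in> A1 \<Longrightarrow> cw (sc c * p) a = sc c * cw p a"
proof -
  assume p: "p \<in> A1"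
  note h = has_cf_scale[OF A1_cw(1)[OF p], of c]
  show "cw (sc c * p) a = sc c * cw p a" unfolding cw[OF h] ..
  show "sc c * p \<in> A1" by (rule A1I[OF h]) (intro vs.subspace_scale[OF subspace_A0] A1_cw(2) p)
qed

lemma subspace_A1: "vs.subspace A1"
  by (intro vs.subspaceI A1_0 A1_add A1_scale)

lemma A1_left: "\<lbrakk>p \<in> A1; z \<in> A0\<rbrakk> \<Longrightarrow> z * p \<in> A1"
  and cw_left: "\<lbrakk>p \<in> A1; z \<in> A0\<rbrakk> \<Longrightarrow> cw (z * p) a = z * cw p a"
proof -
  assume p: "p \<in> A1" and z: "z \<in> A0"
  note c = has_cf_left[OF A1_cw(1)[OF p] A0_AA[OF z]]
  show "cw (z * p) a = z * cw p a" unfolding cw[OF c] ..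
  show "z * p \<in> A1" by (rule A1I[OF c]) (intro A0_mult A1_cw(2) p z)
qed

lemma A1_\<gamma>: "\<lbrakk>p \<in> A1; g \<in> carrier G\<rbrakk> \<Longrightarrow> p * \<gamma> g \<in> A1"
  and cw_\<gamma>: "\<lbrakk>p \<in> A1; g \<in> carrier G\<rbrakk> \<Longrightarrow> cw (p * \<gamma> g) b = (\<Sum>a | cw p a \<noteq> 0. sc (coef g a b) * (cw p a * \<gamma> g))"
proof -
  assume p: "p \<in> A1" and g: "g \<in> carrier G"
  note h = has_cf_\<gamma>[OF A1_cw(1)[OF p] g]
  show "cw (p * \<gamma> g) b = (\<Sum>a | cw p a \<noteq> 0. sc (coef g a b) * (cw p a * \<gamma> g))" unfolding cw[OF h] ..
  show "p * \<gamma> g \<in> A1"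
    by (rule A1I[OF h]) (intro vs.subspace_sum[OF subspace_A0] vs.subspace_scale[OF subspace_A0] A0_mult A1_cw(2) p \<gamma>_A0 g)
qed

lemma A1_E: "\<lbrakk>p \<in> A1; i \<in> verts Q\<rbrakk> \<Longrightarrow> p * E i \<in> A1"
  and cw_E: "\<lbrakk>p \<in> A1; i \<in> verts Q\<rbrakk> \<Longrightarrow> cw (p * E i) a = (if tail Q a = i then cw p a else 0)"
proof -
  assume p: "p \<in> A1" and i: "i \<in> verts Q"
  note h = has_cf_E[OF A1_cw(1)[OF p] i]
  show "cw (p * E i) a = (if tail Q a = i then cw p a else 0)" unfolding cw[OF h] ..
  show "p * E i \<in> A1"
    by (rule A1I[OF h]) (use A1_cw(2)[OF p] vs.subspace_0[OF subspace_A0] in auto)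
qed

lemma A1_right: assumes p: "p \<in> A1" and z: "z \<in> A0" shows "p * z \<in> A1"
  using z unfolding A0_def
proof (induction rule: vs.span_induct_alt)
  case base
  then show ?case by (simp add: A1_0)
next
  case (step c s z)
  then obtain g i where s: "g \<in> carrier G" "i \<in> verts Q" "s = \<gamma> g * E i" by blast
  have "p * s \<in> A1" using A1_E[OF A1_\<gamma>[OF p s(1)] s(2)] by (simp add: s(3) mult.assoc)
  then have "sc c * (p * s) + p * z \<in> A1" using step by (intro A1_add A1_scale)
  moreover have "p * (sc c * s + z) = sc c * (p * s) + p * z" by (simp add: distrib_left mult_sc)
  ultimately show ?case by simp
qed

lemma AR_A1: assumes a: "a \<in> arcs Q" shows "AR a \<in> A1"
proof -
  have h: "head Q a \<in> verts Q" using a by simp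
  have "has_cf (AR a) (\<lambda>b. if b = a then E (head Q a) else 0)"
  proof (rule has_cfI[of "{a}"])
    show "AR a = (\<Sum>b\<in>{a}. (if b = a then E (head Q a) else 0) * AR b)" using a h by (simp add: E_AR)
    show "(if b = a then E (head Q a) else 0) \<in> AA" if "b \<in> {a}" for b
      using that A0_AA[OF E_A0[OF h]] by simp
    show "(if b = a then E (head Q a) else 0) * E (head Q b) = (if b = a then E (head Q a) else 0)" if "b \<in> {a}" for b
      using that E_idem[OF h] by simp
  qed (use a in simp_all)
  moreover have "(if b = a then E (head Q a) else 0) \<in> A0" for b
    using E_A0[OF h] vs.subspace_0[OF subspace_A0] by simp
  ultimately show ?thesis by (rule A1I)
qed

lemma A1_AA: assumes "p \<in> A1" shows "p \<in> AA"
proof -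
  have "(\<Sum>a | cw p a \<noteq> 0. cw p a * AR a) \<in> AA"
  proof (rule vs.subspace_sum[OF subspace_AA])
    fix a assume "a \<in> {a. cw p a \<noteq> 0}"
    then have "cw p a \<noteq> 0" by simp
    from A1_cw(4)[OF assms this] show "cw p a * AR a \<in> AA"
      by (rule AA_mult[OF A0_AA[OF A1_cw(2)[OF assms]] AR_AA])
  qed
  then show ?thesis unfolding A1_cw(6)[OF assms, symmetric] .
qed

text \<open>The part of an element that is carried by the arrows with head \<open>h\<close>.\<close>

definition comp :: "'v \<Rightarrow> 'a \<Rightarrow> 'a" where
  "comp h p = (\<Sum>a | cw p a \<noteq> 0 \<and> head Q a = h. cw p a * AR a)"

lemma comp_A1: "p \<in> A1 \<Longrightarrow> comp h p \<in> A1"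
  and cw_comp: "p \<in> A1 \<Longrightarrow> cw (comp h p) a = (if head Q a = h then cw p a else 0)"
proof -
  assume p: "p \<in> A1"
  note c = has_cf_restrict[OF A1_cw(1)[OF p], of "\<lambda>a. head Q a = h"]
  show "cw (comp h p) a = (if head Q a = h then cw p a else 0)" unfolding comp_def cw[OF c] ..
  show "comp h p \<in> A1" unfolding comp_def
    by (rule A1I[OF c]) (use A1_cw(2)[OF p] vs.subspace_0[OF subspace_A0] in auto)
qed

lemma comp_add: "\<lbrakk>p \<in> A1; q \<in> A1\<rbrakk> \<Longrightarrow> comp h (p + q) = comp h p + comp h q"
  by (rule A1_eqI) (auto simp: comp_A1 A1_add cw_comp cw_add)

lemma comp_scale: "p \<in> A1 \<Longrightarrow> comp h (sc c * p) = sc c * comp h p"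
  by (rule A1_eqI) (auto simp: comp_A1 A1_scale cw_comp cw_scale)

lemma comp_0: "comp h 0 = 0"
  by (rule A1_eqI) (auto simp: comp_A1 A1_0 cw_comp cw_0)

lemma comp_sum: "finite S \<Longrightarrow> (\<And>s. s \<in> S \<Longrightarrow> p s \<in> A1) \<Longrightarrow> comp h (\<Sum>s\<in>S. p s) = (\<Sum>s\<in>S. comp h (p s))"
proof (induction S rule: finite_induct)
  case (insert s S)
  then have "(\<Sum>s\<in>S. p s) \<in> A1" by (intro vs.subspace_sum[OF subspace_A1]) auto
  then show ?case using insert by (simp add: comp_add)
qed (simp add: comp_0)

text \<open>Multiplication from the left changes coefficients but not arrows. Cutting with e_h on
  the left would not commute with it, as \<open>A0\<close> contains group elements that move
  vertices.\<close>

lemma comp_left: "\<lbrakk>p \<in> A1; z \<in> A0\<rbrakk> \<Longrightarrow> comp h (z * p) = z * comp h p"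
  by (rule A1_eqI) (auto simp: comp_A1 A1_left cw_comp cw_left)

text \<open>g turns arrows with head h into combinations of arrows with head h^g, and it is
  injective on vertices, so no other arrow contributes to that component.\<close>

lemma comp_\<gamma>:
  assumes p: "p \<in> A1" and g: "g \<in> carrier G" and h: "h \<in> verts Q"
  shows "comp (va g h) (p * \<gamma> g) = comp h p * \<gamma> g"
proof (rule A1_eqI)
  show "comp (va g h) (p * \<gamma> g) \<in> A1" "comp h p * \<gamma> g \<in> A1" by (intro comp_A1 A1_\<gamma> p g)+
  fix b
  have fin: "finite {a. cw p a \<noteq> 0}" by (rule A1_cw(5)[OF p])
  have "cw (comp h p * \<gamma> g) b = (\<Sum>a | cw (comp h p) a \<noteq> 0. sc (coef g a b) * (cw (comp h p) a * \<gamma> g))"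
    by (rule cw_\<gamma>[OF comp_A1[OF p] g])
  also have "\<dots> = (\<Sum>a | cw p a \<noteq> 0. sc (coef g a b) * (cw (comp h p) a * \<gamma> g))"
    using fin by (intro sum.mono_neutral_left) (auto simp: cw_comp[OF p])
  also have "\<dots> = (\<Sum>a | cw p a \<noteq> 0. if head Q b = va g h then sc (coef g a b) * (cw p a * \<gamma> g) else 0)"
  proof (intro sum.cong refl)
    fix a assume "a \<in> {a. cw p a \<noteq> 0}"
    then have a: "a \<in> arcs Q" using A1_cw(4)[OF p] by blast
    have hd: "head Q a \<in> verts Q" using a by simp
    show "sc (coef g a b) * (cw (comp h p) a * \<gamma> g) = (if head Q b = va g h then sc (coef g a b) * (cw p a * \<gamma> g) else 0)"
    proof (cases "coef g a b = 0")
      case False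
      have "head Q b = va g h \<longleftrightarrow> head Q a = h"
        unfolding coef_nonzero(2)[OF g a False] by (rule va_eq_iff[OF g hd h])
      then show ?thesis unfolding cw_comp[OF p] by (simp only: if_distrib[of "\<lambda>x. sc (coef g a b) * (x * \<gamma> g)"] mult_zero_left mult_zero_right cong: if_cong)
    qed simp
  qed
  also have "\<dots> = cw (comp (va g h) (p * \<gamma> g)) b"
    unfolding cw_comp[OF A1_\<gamma>[OF p g]] cw_\<gamma>[OF p g] by (cases "head Q b = va g h") simp_all
  finally show "cw (comp (va g h) (p * \<gamma> g)) b = cw (comp h p * \<gamma> g) b" by (rule sym)
qed

lemma comp_E: "\<lbrakk>p \<in> A1; i \<in> verts Q\<rbrakk> \<Longrightarrow> comp h (p * E i) = comp h p * E i"
  by (rule A1_eqI) (simp_all add: comp_A1 A1_E cw_comp cw_E)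

end

section \<open>Arrows of the associated quiver and elements of the skew group algebra\<close>

context assoc_quiver_model
begin

definition arrs :: "'v \<Rightarrow> 'v \<Rightarrow> 'e set" where
  "arrs i j = {a \<in> arcs Q. tail Q a = i \<and> head Q a = j}"

definition tens :: "('g, 'k, 'r) rep \<Rightarrow> 'v \<Rightarrow> 'v \<Rightarrow> ('g, 'k, ('v, 'e) path \<Rightarrow> 'r) rep" where
  "tens \<sigma> i j = tensor_rep (twist G \<sigma> (\<kappa> j)) (arrow_rep Q \<phi> i j)"

lemma unit_fun_arrow_rep:
  "unit_fun c \<in> carrier (arrow_rep Q \<phi> i j) \<longleftrightarrow> c \<in> (\<lambda>a. (i, [a], j)) ` arrs i j"
proof -
  have "(\<lambda>a. (tail Q a, [a], head Q a)) ` arrs i j = (\<lambda>a. (i, [a], j)) ` arrs i j"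
    by (intro image_cong) (auto simp: arrs_def)
  moreover have "arrs i j \<subseteq> arcs Q" by (auto simp: arrs_def)
  moreover have "{x. unit_fun c x \<noteq> (0 :: 'k)} = {c}" by (auto simp: unit_fun_def)
  moreover have "carrier (arrow_rep Q \<phi> i j) = arrow_span Q (arrs i j)"
    by (simp add: arrow_rep_def module.defs arrs_def)
  moreover have "(arrow_span Q A :: (('v, 'e) path \<Rightarrow> 'k) set) = {f. finite {x. f x \<noteq> 0} \<and> {x. f x \<noteq> 0} \<subseteq> (\<lambda>a. (tail Q a, [a], head Q a)) ` A}"
    if "A \<subseteq> arcs Q" for A by (rule arrow_span_eq[OF quiver.wf_digraph_axioms that])
  ultimately show ?thesis by simp
qed

lemma twist_simps:
  "carrier (twist G \<sigma> k) = carrier \<sigma>" "zero (twist G \<sigma> k) = zero \<sigma>" "add (twist G \<sigma> k) = add \<sigma>"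
  "smult (twist G \<sigma> k) = smult \<sigma>" "act (twist G \<sigma> k) g = act \<sigma> (k \<otimes> g \<otimes> inv k)"
  "finsum (twist G \<sigma> k) = finsum \<sigma>"
  by (simp_all add: twist_def finsum_def)

lemma tens_simps:
  "carrier (tens \<sigma> i j) = {t. (\<forall>c. t c \<in> carrier \<sigma>) \<and> finite {c. t c \<noteq> \<zero>\<^bsub>\<sigma>\<^esub>} \<and>
      (\<forall>c. t c \<noteq> \<zero>\<^bsub>\<sigma>\<^esub> \<longrightarrow> c \<in> (\<lambda>a. (i, [a], j)) ` arrs i j)}"
  "s \<oplus>\<^bsub>tens \<sigma> i j\<^esub> t = (\<lambda>c. s c \<oplus>\<^bsub>\<sigma>\<^esub> t c)" "r \<odot>\<^bsub>tens \<sigma> i j\<^esub> t = (\<lambda>c. r \<odot>\<^bsub>\<sigma>\<^esub> t c)"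
  "\<zero>\<^bsub>tens \<sigma> i j\<^esub> = (\<lambda>c. \<zero>\<^bsub>\<sigma>\<^esub>)"
  "act (tens \<sigma> i j) g t = (\<lambda>c. \<Oplus>\<^bsub>\<sigma>\<^esub>b \<in> {b. t b \<noteq> \<zero>\<^bsub>\<sigma>\<^esub>}.
      \<phi> g (unit_fun b) c \<odot>\<^bsub>\<sigma>\<^esub> act \<sigma> (\<kappa> j \<otimes> g \<otimes> inv \<kappa> j) (t b))"
  by (simp_all add: tens_def tensor_rep_def twist_simps unit_fun_arrow_rep arrow_rep_def[of Q \<phi> i j])
    (simp_all add: arrow_rep_def module.defs unit_fun_arrow_rep[unfolded arrow_rep_def module.defs, simplified])

lemma tensD: assumes "t \<in> carrier (tens \<sigma> i j)"
  shows "t c \<in> carrier \<sigma>" "finite {c. t c \<noteq> \<zero>\<^bsub>\<sigma>\<^esub>}" "t c \<noteq> \<zero>\<^bsub>\<sigma>\<^esub> \<Longrightarrow> c \<in> (\<lambda>a. (i, [a], j)) ` arrs i j"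
  using assms unfolding tens_simps by blast+

text \<open>Realizes v \<otimes> a as \<theta> v \<gamma> (\<kappa> j) a. The middle factor leads
  from the representative of the orbit, whose idempotent fixes \<theta> v, to the head j of a; it
  also produces the twist of the representation.\<close>

definition \<Theta> :: "'v \<times> ('g, 'k, 'r) rep \<Rightarrow> 'v \<Rightarrow> 'v \<Rightarrow> (('v, 'e) path \<Rightarrow> 'r) \<Rightarrow> 'a" where
  "\<Theta> y i j t = (\<Sum>a | t (i, [a], j) \<noteq> \<zero>\<^bsub>snd y\<^esub>. \<theta> y (t (i, [a], j)) * \<gamma> (\<kappa> j) * AR a)"

text \<open>An intrinsic description of the image of \<Theta>: the part of \<epsilon> y
  \<open>A1\<close> carried by arrows from i to j.\<close>

definition ZZ :: "'v \<times> ('g, 'k, 'r) rep \<Rightarrow> 'v \<Rightarrow> 'v \<Rightarrow> 'a set" where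
  "ZZ y i j = {q \<in> A1. \<epsilon> y * q = q \<and> (\<forall>a. cw q a \<noteq> 0 \<longrightarrow> a \<in> arrs i j)}"

lemma X_rep: assumes "(i, \<rho>) \<in> X"
  shows "representation (HG i) \<rho>" "vectorspace class_ring \<rho>" "abelian_group \<rho>"
    "\<lbrakk>h \<in> Stab i; v \<in> carrier \<rho>\<rbrakk> \<Longrightarrow> act \<rho> h v \<in> carrier \<rho>"
    "\<lbrakk>h \<in> Stab i; v \<in> carrier \<rho>; w \<in> carrier \<rho>\<rbrakk> \<Longrightarrow> act \<rho> h (v \<oplus>\<^bsub>\<rho>\<^esub> w) = act \<rho> h v \<oplus>\<^bsub>\<rho>\<^esub> act \<rho> h w"
    "\<lbrakk>h \<in> Stab i; v \<in> carrier \<rho>\<rbrakk> \<Longrightarrow> act \<rho> h (c \<odot>\<^bsub>\<rho>\<^esub> v) = c \<odot>\<^bsub>\<rho>\<^esub> act \<rho> h v"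
    "\<lbrakk>h \<in> Stab i; g \<in> Stab i; v \<in> carrier \<rho>\<rbrakk> \<Longrightarrow> act \<rho> (h \<otimes> g) v = act \<rho> g (act \<rho> h v)"
    "v \<in> carrier \<rho> \<Longrightarrow> act \<rho> \<one> v = v"
proof -
  show r: "representation (HG i) \<rho>" using X_irr[OF assms] by (simp add: irreducible_rep_def)
  interpret r: representation "HG i" \<rho> by (rule r)
  show "vectorspace class_ring \<rho>" by (rule r.vectorspace_axioms)
  show "abelian_group \<rho>" by (rule r.abelian_group_axioms)
  have lin: "h \<in> Stab i \<Longrightarrow> act \<rho> h \<in> module_hom class_ring \<rho> \<rho>" for h using r.act_linear[of h] by simp
  show "\<lbrakk>h \<in> Stab i; v \<in> carrier \<rho>\<rbrakk> \<Longrightarrow> act \<rho> h v \<in> carrier \<rho>"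
    "\<lbrakk>h \<in> Stab i; v \<in> carrier \<rho>; w \<in> carrier \<rho>\<rbrakk> \<Longrightarrow> act \<rho> h (v \<oplus>\<^bsub>\<rho>\<^esub> w) = act \<rho> h v \<oplus>\<^bsub>\<rho>\<^esub> act \<rho> h w"
    "\<lbrakk>h \<in> Stab i; v \<in> carrier \<rho>\<rbrakk> \<Longrightarrow> act \<rho> h (c \<odot>\<^bsub>\<rho>\<^esub> v) = c \<odot>\<^bsub>\<rho>\<^esub> act \<rho> h v"
    using lin[of h] by (auto simp: module_hom_def)
  show "\<lbrakk>h \<in> Stab i; g \<in> Stab i; v \<in> carrier \<rho>\<rbrakk> \<Longrightarrow> act \<rho> (h \<otimes> g) v = act \<rho> g (act \<rho> h v)"
    using r.act_mult[of h g v] by simp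
  show "v \<in> carrier \<rho> \<Longrightarrow> act \<rho> \<one> v = v" using r.act_one[of v] by simp
qed

lemma \<theta>_0: assumes x: "(i, \<rho>) \<in> X" shows "\<theta> (i, \<rho>) \<zero>\<^bsub>\<rho>\<^esub> = 0"
proof -
  interpret V: abelian_group \<rho> by (rule X_rep(3)[OF x])
  have "\<theta> (i, \<rho>) (\<zero>\<^bsub>\<rho>\<^esub> \<oplus>\<^bsub>\<rho>\<^esub> \<zero>\<^bsub>\<rho>\<^esub>) = \<theta> (i, \<rho>) \<zero>\<^bsub>\<rho>\<^esub> + \<theta> (i, \<rho>) \<zero>\<^bsub>\<rho>\<^esub>"
    by (rule \<theta>_facts(2)[OF x]) simp_all
  then show ?thesis by simp
qed

lemma \<theta>_finsum:
  assumes x: "(i, \<rho>) \<in> X" and "finite S" "\<And>s. s \<in> S \<Longrightarrow> f s \<in> carrier \<rho>"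
  shows "\<theta> (i, \<rho>) (\<Oplus>\<^bsub>\<rho>\<^esub>s\<in>S. f s) = (\<Sum>s\<in>S. \<theta> (i, \<rho>) (f s))"
proof -
  interpret V: abelian_group \<rho> by (rule X_rep(3)[OF x])
  show ?thesis using assms(2,3)
  proof (induction S rule: finite_induct)
    case (insert s S)
    have f: "f \<in> S \<rightarrow> carrier \<rho>" "f s \<in> carrier \<rho>" using insert.prems by auto
    show ?case
      using V.finsum_insert[OF insert.hyps f] \<theta>_facts(2)[OF x f(2) V.finsum_closed[OF f(1)]] insert by simp
  qed (simp add: \<theta>_0[OF x])
qed

lemma \<theta>_A0: "(i, \<rho>) \<in> X \<Longrightarrow> v \<in> carrier \<rho> \<Longrightarrow> \<theta> (i, \<rho>) v \<in> A0"
  using \<theta>_facts(1) subsetD[OF KK_A0[OF X_verts]] by blast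

lemma \<theta>_E: "(i, \<rho>) \<in> X \<Longrightarrow> v \<in> carrier \<rho> \<Longrightarrow> \<theta> (i, \<rho>) v * E i = \<theta> (i, \<rho>) v"
  by (rule \<theta>_facts(12)[OF _ \<theta>_facts(1)])

lemma mult_\<gamma>_one: assumes "z * E i = z" "i \<in> verts Q" shows "z * \<gamma> \<one> = z"
proof -
  have "z * \<gamma> \<one> = z * E i * \<gamma> \<one>" using assms(1) by simp
  also have "\<dots> = z * (E i * \<gamma> \<one>)" by (rule mult.assoc)
  also have "\<dots> = z" using assms by (simp only: \<gamma>1_E)
  finally show ?thesis .
qed

lemma mult_\<gamma>_E: assumes "z * E i = z" "i \<in> verts Q" "k \<in> carrier G" shows "z * \<gamma> k * E (va k i) = z * \<gamma> k"
proof -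
  have "z * \<gamma> k * E (va k i) = z * E i * \<gamma> k" using E_\<gamma>[OF assms(2,3)] by (simp add: mult.assoc)
  then show ?thesis using assms(1) by simp
qed

lemma mult_\<gamma>_inv: assumes "z * E i = z" "i \<in> verts Q" "k \<in> carrier G"
  shows "z * \<gamma> k * \<gamma> (inv k) = z" "z * \<gamma> (inv k) * \<gamma> k = z"
  using mult_\<gamma>_one[OF assms(1,2)] \<gamma>_inv_\<gamma>[OF assms(3)] by (simp_all add: mult.assoc)

section \<open>Tensor products as subspaces of \<open>A1\<close>\<close>

context
  fixes j :: 'v and \<sigma> :: "('g, 'k, 'r) rep" and i' j' :: 'v
  assumes y: "(j, \<sigma>) \<in> X" and k: "\<kappa> j' \<in> carrier G" "va (\<kappa> j') j = j'"
begin

lemma \<Theta>_cf: assumes t: "t \<in> carrier (tens \<sigma> i' j')"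
  shows "\<Theta> (j, \<sigma>) i' j' t \<in> A1"
    "cw (\<Theta> (j, \<sigma>) i' j' t) a = \<theta> (j, \<sigma>) (t (i', [a], j')) * \<gamma> (\<kappa> j')"
proof -
  let ?T = "{a. t (i', [a], j') \<noteq> \<zero>\<^bsub>\<sigma>\<^esub>}" and ?w = "\<lambda>a. \<theta> (j, \<sigma>) (t (i', [a], j')) * \<gamma> (\<kappa> j')"
  have tc: "t c \<in> carrier \<sigma>" and sup: "t c \<noteq> \<zero>\<^bsub>\<sigma>\<^esub> \<Longrightarrow> c \<in> (\<lambda>a. (i', [a], j')) ` arrs i' j'"
    and fin: "finite {c. t c \<noteq> \<zero>\<^bsub>\<sigma>\<^esub>}" for c using tensD[OF t] by auto
  have A0: "?w a \<in> A0" for a by (intro A0_mult \<theta>_A0[OF y] tc \<gamma>_A0 k)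
  have T: "?T \<subseteq> arrs i' j'" using sup by blast
  have c: "has_cf (\<Theta> (j, \<sigma>) i' j' t) ?w"
  proof (rule has_cfI[of ?T])
    have "(\<lambda>a. (i', [a], j')) ` ?T \<subseteq> {c. t c \<noteq> \<zero>\<^bsub>\<sigma>\<^esub>}" by blast
    then have "finite ((\<lambda>a. (i', [a], j')) ` ?T)" using fin finite_subset by blast
    then show "finite ?T" by (rule finite_imageD) (simp add: inj_on_def)
    show "?T \<subseteq> arcs Q" using T by (auto simp: arrs_def)
    show "?w a \<in> AA" if "a \<in> ?T" for a by (rule A0_AA[OF A0])
    show "?w a * E (head Q a) = ?w a" if "a \<in> ?T" for a
    proof -
      have "head Q a = j'" using T that by (auto simp: arrs_def)
      then show ?thesis using mult_\<gamma>_E[OF \<theta>_E[OF y tc] X_verts[OF y] k(1)] k(2) by simp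
    qed
    show "?w a = 0" if "a \<notin> ?T" for a using that \<theta>_0[OF y] by simp
    show "\<Theta> (j, \<sigma>) i' j' t = (\<Sum>a\<in>?T. ?w a * AR a)" by (simp add: \<Theta>_def)
  qed
  show "\<Theta> (j, \<sigma>) i' j' t \<in> A1" by (rule A1I[OF c A0])
  show "cw (\<Theta> (j, \<sigma>) i' j' t) a = ?w a" unfolding cw[OF c] ..
qed

lemma \<Theta>_ZZ: assumes t: "t \<in> carrier (tens \<sigma> i' j')" shows "\<Theta> (j, \<sigma>) i' j' t \<in> ZZ (j, \<sigma>) i' j'"
proof -
  have tc: "t c \<in> carrier \<sigma>" and sup: "t c \<noteq> \<zero>\<^bsub>\<sigma>\<^esub> \<Longrightarrow> c \<in> (\<lambda>a. (i', [a], j')) ` arrs i' j'" for c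
    using tensD[OF t] by auto
  have "\<epsilon> (j, \<sigma>) * \<Theta> (j, \<sigma>) i' j' t = \<Theta> (j, \<sigma>) i' j' t"
    by (rule A1_eqI)
      (simp_all add: A1_left \<Theta>_cf[OF t] \<epsilon>_A0[OF y] cw_left mult.assoc[symmetric] \<theta>_facts(6)[OF y tc])
  moreover have "a \<in> arrs i' j'" if "cw (\<Theta> (j, \<sigma>) i' j' t) a \<noteq> 0" for a
  proof -
    have "t (i', [a], j') \<noteq> \<zero>\<^bsub>\<sigma>\<^esub>" using that \<theta>_0[OF y] unfolding \<Theta>_cf(2)[OF t] by auto
    from sup[OF this] show ?thesis by auto
  qed
  ultimately show ?thesis using \<Theta>_cf(1)[OF t] by (simp add: ZZ_def)
qed

lemma \<Theta>_inj: "inj_on (\<Theta> (j, \<sigma>) i' j') (carrier (tens \<sigma> i' j'))"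
proof (rule inj_onI)
  fix s t assume s: "s \<in> carrier (tens \<sigma> i' j')" and t: "t \<in> carrier (tens \<sigma> i' j')"
    and eq: "\<Theta> (j, \<sigma>) i' j' s = \<Theta> (j, \<sigma>) i' j' t"
  have sc: "s c \<in> carrier \<sigma>" "t c \<in> carrier \<sigma>" for c using tensD[OF s] tensD[OF t] by auto
  have "s (i', [a], j') = t (i', [a], j')" for a
  proof -
    have "\<theta> (j, \<sigma>) (s (i', [a], j')) * \<gamma> (\<kappa> j') = \<theta> (j, \<sigma>) (t (i', [a], j')) * \<gamma> (\<kappa> j')"
      using \<Theta>_cf(2)[OF s, of a] \<Theta>_cf(2)[OF t, of a] eq by simp
    then have "\<theta> (j, \<sigma>) (s (i', [a], j')) * \<gamma> (\<kappa> j') * \<gamma> (inv \<kappa> j') = \<theta> (j, \<sigma>) (t (i', [a], j')) * \<gamma> (\<kappa> j') * \<gamma> (inv \<kappa> j')"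
      by simp
    then have "\<theta> (j, \<sigma>) (s (i', [a], j')) = \<theta> (j, \<sigma>) (t (i', [a], j'))"
      using mult_\<gamma>_inv(1)[OF \<theta>_E[OF y] X_verts[OF y] k(1)] sc by simp
    then show ?thesis using inj_onD[OF \<theta>_facts(4)[OF y]] sc by blast
  qed
  moreover have "s c = t c" if "c \<notin> range (\<lambda>a. (i', [a], j'))" for c
  proof -
    have "c \<notin> (\<lambda>a. (i', [a], j')) ` arrs i' j'" using that by (auto simp: image_iff)
    then have "s c = \<zero>\<^bsub>\<sigma>\<^esub>" "t c = \<zero>\<^bsub>\<sigma>\<^esub>" using tensD(3)[OF s, of c] tensD(3)[OF t, of c] by argo+
    then show ?thesis by simp
  qed
  ultimately have "s c = t c" for c by (cases "c \<in> range (\<lambda>a. (i', [a], j'))") auto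
  then show "s = t" by (rule ext)
qed

text \<open>A coefficient of q lies in \<epsilon> \<open>A0\<close> e_j'. The inverse of \<kappa> j'
  moves it into \<epsilon> \<open>KK j\<close>, which is the image of \<theta>.\<close>

lemma \<Theta>_surj: assumes q: "q \<in> ZZ (j, \<sigma>) i' j'" shows "q \<in> \<Theta> (j, \<sigma>) i' j' ` carrier (tens \<sigma> i' j')"
proof -
  have q1: "q \<in> A1" and \<epsilon>q: "\<epsilon> (j, \<sigma>) * q = q" and sup: "\<And>a. cw q a \<noteq> 0 \<Longrightarrow> a \<in> arrs i' j'"
    using q by (auto simp: ZZ_def)
  have j: "j \<in> verts Q" "j' \<in> verts Q" using X_verts[OF y] va(1)[OF k(1) X_verts[OF y]] k(2) by simp_all
  interpret V: abelian_group \<sigma> by (rule X_rep(3)[OF y])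
  have ex: "\<exists>v\<in>carrier \<sigma>. \<theta> (j, \<sigma>) v * \<gamma> (\<kappa> j') = cw q a" for a
  proof (cases "cw q a = 0")
    case True
    then show ?thesis using \<theta>_0[OF y] by (intro bexI[of _ "\<zero>\<^bsub>\<sigma>\<^esub>"]) auto
  next
    case False
    then have a: "a \<in> arcs Q" "head Q a = j'" using sup by (auto simp: arrs_def)
    have c: "cw q a * E j' = cw q a" using A1_cw(3)[OF q1 a(1)] a(2) by simp
    have "cw q a * \<gamma> (inv \<kappa> j') = cw (\<epsilon> (j, \<sigma>) * q) a * E j' * \<gamma> (inv \<kappa> j')" using \<epsilon>q c by simp
    also have "\<dots> = \<epsilon> (j, \<sigma>) * (E j * cw q a * E j' * \<gamma> (inv \<kappa> j'))"
      using \<epsilon>_E(2)[OF y] by (simp add: cw_left[OF q1 \<epsilon>_A0[OF y]] mult.assoc[symmetric])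
    also have "\<dots> \<in> (\<lambda>z. \<epsilon> (j, \<sigma>) * z) ` KK j"
      by (rule imageI) (rule A0_corner(2)[OF j A1_cw(2)[OF q1] k])
    finally obtain v where v: "v \<in> carrier \<sigma>" "\<theta> (j, \<sigma>) v = cw q a * \<gamma> (inv \<kappa> j')"
      using \<theta>_facts(10)[OF y] by (metis (no_types, lifting) imageE)
    have "\<theta> (j, \<sigma>) v * \<gamma> (\<kappa> j') = cw q a" unfolding v(2) by (rule mult_\<gamma>_inv(2)[OF c j(2) k(1)])
    then show ?thesis using v(1) by blast
  qed
  \<comment> \<open>Vanishing coefficients explicitly get the zero vector, so that the tensor built
    from v has finite support.\<close>
  define v where "v a = (if cw q a = 0 then \<zero>\<^bsub>\<sigma>\<^esub> else SOME v. v \<in> carrier \<sigma> \<and> \<theta> (j, \<sigma>) v * \<gamma> (\<kappa> j') = cw q a)" for a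
  have v: "v a \<in> carrier \<sigma>" "\<theta> (j, \<sigma>) (v a) * \<gamma> (\<kappa> j') = cw q a" for a
    using someI_ex[OF ex[of a, unfolded Bex_def]] \<theta>_0[OF y] unfolding v_def by auto
  have v0: "v a \<noteq> \<zero>\<^bsub>\<sigma>\<^esub> \<Longrightarrow> cw q a \<noteq> 0" for a by (auto simp: v_def)
  \<comment> \<open>The test \<open>l = [hd l]\<close> holds exactly for lists with one
    arrow.\<close>
  define t where "t c = (case c of (u, l, w) \<Rightarrow> if u = i' \<and> w = j' \<and> l = [hd l] then v (hd l) else \<zero>\<^bsub>\<sigma>\<^esub>)" for c
  have t1: "t (i', [a], j') = v a" for a by (simp add: t_def)
  have t2: "c \<in> (\<lambda>a. (i', [a], j')) ` {a. cw q a \<noteq> 0}" if tnz: "t c \<noteq> \<zero>\<^bsub>\<sigma>\<^esub>" for c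
  proof -
    obtain u l w where c: "c = (u, l, w)" by (cases c)
    have "u = i'" "w = j'" "l = [hd l]" "v (hd l) \<noteq> \<zero>\<^bsub>\<sigma>\<^esub>" using tnz by (auto simp: t_def c split: if_splits)
    then show ?thesis unfolding c using v0 by (intro image_eqI[of _ _ "hd l"]) auto
  qed
  have t: "t \<in> carrier (tens \<sigma> i' j')"
    unfolding tens_simps
  proof (intro CollectI conjI allI impI)
    show "t c \<in> carrier \<sigma>" for c using v(1) by (auto simp: t_def split: prod.split)
    show "finite {c. t c \<noteq> \<zero>\<^bsub>\<sigma>\<^esub>}"
      by (rule finite_subset[of _ "(\<lambda>a. (i', [a], j')) ` {a. cw q a \<noteq> 0}"]) (use t2 A1_cw(5)[OF q1] in auto)
    show "c \<in> (\<lambda>a. (i', [a], j')) ` arrs i' j'" if "t c \<noteq> \<zero>\<^bsub>\<sigma>\<^esub>" for c using t2[OF that] sup by blast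
  qed
  have "\<Theta> (j, \<sigma>) i' j' t = q"
    by (rule A1_eqI[OF \<Theta>_cf(1)[OF t] q1]) (simp add: \<Theta>_cf(2)[OF t] t1 v(2))
  then show ?thesis using t by blast
qed

lemma tens_add: assumes s: "s \<in> carrier (tens \<sigma> i' j')" and t: "t \<in> carrier (tens \<sigma> i' j')"
  shows "s \<oplus>\<^bsub>tens \<sigma> i' j'\<^esub> t \<in> carrier (tens \<sigma> i' j')"
    "\<Theta> (j, \<sigma>) i' j' (s \<oplus>\<^bsub>tens \<sigma> i' j'\<^esub> t) = \<Theta> (j, \<sigma>) i' j' s + \<Theta> (j, \<sigma>) i' j' t"
proof -
  interpret V: abelian_group \<sigma> by (rule X_rep(3)[OF y])
  have S: "\<And>c. s c \<in> carrier \<sigma>" "finite {c. s c \<noteq> \<zero>\<^bsub>\<sigma>\<^esub>}" "\<And>c. s c \<noteq> \<zero>\<^bsub>\<sigma>\<^esub> \<Longrightarrow> c \<in> (\<lambda>a. (i', [a], j')) ` arrs i' j'"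
    and T: "\<And>c. t c \<in> carrier \<sigma>" "finite {c. t c \<noteq> \<zero>\<^bsub>\<sigma>\<^esub>}" "\<And>c. t c \<noteq> \<zero>\<^bsub>\<sigma>\<^esub> \<Longrightarrow> c \<in> (\<lambda>a. (i', [a], j')) ` arrs i' j'"
    using tensD[OF s] tensD[OF t] by auto
  have sub: "s c \<noteq> \<zero>\<^bsub>\<sigma>\<^esub> \<or> t c \<noteq> \<zero>\<^bsub>\<sigma>\<^esub>" if "s c \<oplus>\<^bsub>\<sigma>\<^esub> t c \<noteq> \<zero>\<^bsub>\<sigma>\<^esub>" for c using that by auto
  show c: "s \<oplus>\<^bsub>tens \<sigma> i' j'\<^esub> t \<in> carrier (tens \<sigma> i' j')"
    unfolding tens_simps
  proof (intro CollectI conjI allI impI)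
    show "s c \<oplus>\<^bsub>\<sigma>\<^esub> t c \<in> carrier \<sigma>" for c using S T by simp
    show "finite {c. s c \<oplus>\<^bsub>\<sigma>\<^esub> t c \<noteq> \<zero>\<^bsub>\<sigma>\<^esub>}"
      by (rule finite_subset[OF _ finite_UnI[OF S(2) T(2)]]) (use sub in blast)
    show "c \<in> (\<lambda>a. (i', [a], j')) ` arrs i' j'" if "s c \<oplus>\<^bsub>\<sigma>\<^esub> t c \<noteq> \<zero>\<^bsub>\<sigma>\<^esub>" for c
      using sub[OF that] S(3) T(3) by blast
  qed
  show "\<Theta> (j, \<sigma>) i' j' (s \<oplus>\<^bsub>tens \<sigma> i' j'\<^esub> t) = \<Theta> (j, \<sigma>) i' j' s + \<Theta> (j, \<sigma>) i' j' t"
  proof (rule A1_eqI[OF \<Theta>_cf(1)[OF c] A1_add[OF \<Theta>_cf(1)[OF s] \<Theta>_cf(1)[OF t]]])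
    fix a
    show "cw (\<Theta> (j, \<sigma>) i' j' (s \<oplus>\<^bsub>tens \<sigma> i' j'\<^esub> t)) a = cw (\<Theta> (j, \<sigma>) i' j' s + \<Theta> (j, \<sigma>) i' j' t) a"
      unfolding \<Theta>_cf(2)[OF c] cw_add[OF \<Theta>_cf(1)[OF s] \<Theta>_cf(1)[OF t]] \<Theta>_cf(2)[OF s] \<Theta>_cf(2)[OF t]
      by (simp add: tens_simps \<theta>_facts(2)[OF y S(1) T(1)] distrib_right)
  qed
qed

lemma tens_smult: assumes t: "t \<in> carrier (tens \<sigma> i' j')"
  shows "r \<odot>\<^bsub>tens \<sigma> i' j'\<^esub> t \<in> carrier (tens \<sigma> i' j')"
    "\<Theta> (j, \<sigma>) i' j' (r \<odot>\<^bsub>tens \<sigma> i' j'\<^esub> t) = sc r * \<Theta> (j, \<sigma>) i' j' t"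
proof -
  interpret V: vectorspace class_ring \<sigma> by (rule X_rep(2)[OF y])
  have T: "\<And>c. t c \<in> carrier \<sigma>" "finite {c. t c \<noteq> \<zero>\<^bsub>\<sigma>\<^esub>}" "\<And>c. t c \<noteq> \<zero>\<^bsub>\<sigma>\<^esub> \<Longrightarrow> c \<in> (\<lambda>a. (i', [a], j')) ` arrs i' j'"
    using tensD[OF t] by auto
  have sub: "t c \<noteq> \<zero>\<^bsub>\<sigma>\<^esub>" if "r \<odot>\<^bsub>\<sigma>\<^esub> t c \<noteq> \<zero>\<^bsub>\<sigma>\<^esub>" for c using that V.smult_r_null[of r] by auto
  show c: "r \<odot>\<^bsub>tens \<sigma> i' j'\<^esub> t \<in> carrier (tens \<sigma> i' j')"
    unfolding tens_simps
  proof (intro CollectI conjI allI impI)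
    show "r \<odot>\<^bsub>\<sigma>\<^esub> t c \<in> carrier \<sigma>" for c using V.smult_closed[of r] T by simp
    show "finite {c. r \<odot>\<^bsub>\<sigma>\<^esub> t c \<noteq> \<zero>\<^bsub>\<sigma>\<^esub>}"
      by (rule finite_subset[OF _ T(2)]) (use sub in blast)
    show "c \<in> (\<lambda>a. (i', [a], j')) ` arrs i' j'" if "r \<odot>\<^bsub>\<sigma>\<^esub> t c \<noteq> \<zero>\<^bsub>\<sigma>\<^esub>" for c
      using sub[OF that] T(3) by blast
  qed
  show "\<Theta> (j, \<sigma>) i' j' (r \<odot>\<^bsub>tens \<sigma> i' j'\<^esub> t) = sc r * \<Theta> (j, \<sigma>) i' j' t"
  proof (rule A1_eqI[OF \<Theta>_cf(1)[OF c] A1_scale[OF \<Theta>_cf(1)[OF t]]])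
    fix a
    show "cw (\<Theta> (j, \<sigma>) i' j' (r \<odot>\<^bsub>tens \<sigma> i' j'\<^esub> t)) a = cw (sc r * \<Theta> (j, \<sigma>) i' j' t) a"
      unfolding \<Theta>_cf(2)[OF c] cw_scale[OF \<Theta>_cf(1)[OF t]] \<Theta>_cf(2)[OF t]
      by (simp add: tens_simps \<theta>_facts(3)[OF y T(1)] mult.assoc)
  qed
qed

text \<open>The diagonal action applies \<kappa> g \<kappa>^-1 to the vector and g to the arrow.
  Because (\<kappa> g \<kappa>^-1) \<kappa> = \<kappa> g, the group element can be pushed past
  \<gamma> (\<kappa> j'), and then past the arrow by means of the matrix
  \<open>coef g\<close>.\<close>

lemma tens_act:
  assumes t: "t \<in> carrier (tens \<sigma> i' j')" and g: "g \<in> Stab i'" "g \<in> Stab j'" and i': "i' \<in> verts Q"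
  shows "act (tens \<sigma> i' j') g t \<in> carrier (tens \<sigma> i' j')"
    "\<Theta> (j, \<sigma>) i' j' (act (tens \<sigma> i' j') g t) = \<Theta> (j, \<sigma>) i' j' t * \<gamma> g"
proof -
  interpret V: vectorspace class_ring \<sigma> by (rule X_rep(2)[OF y])
  let ?S = "{b. t b \<noteq> \<zero>\<^bsub>\<sigma>\<^esub>}" and ?h = "\<kappa> j' \<otimes> g \<otimes> inv \<kappa> j'"
  have j: "j \<in> verts Q" "j' \<in> verts Q" using X_verts[OF y] va(1)[OF k(1) X_verts[OF y]] k(2) by simp_all
  have gG: "g \<in> carrier G" and gi: "va g i' = i'" "va g j' = j'" using g i' j by (auto simp: Stab_iff)
  have T: "\<And>c. t c \<in> carrier \<sigma>" "finite ?S" "\<And>c. t c \<noteq> \<zero>\<^bsub>\<sigma>\<^esub> \<Longrightarrow> c \<in> (\<lambda>a. (i', [a], j')) ` arrs i' j'"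
    using tensD[OF t] by auto
  have h: "?h \<in> Stab j"
    using k gG gi(2) j va_inv(1)[OF k(1) j(1)] by (simp add: Stab_iff va_mult)
  have ht: "act \<sigma> ?h (t b) \<in> carrier \<sigma>" for b by (rule X_rep(4)[OF y h T(1)])
  have tm: "\<phi> g (unit_fun b) c \<odot>\<^bsub>\<sigma>\<^esub> act \<sigma> ?h (t b) \<in> carrier \<sigma>" for b c
    using V.smult_closed[OF _ ht] by simp
  have unit: "unit_fun (i', [a], j') = AE a" if "a \<in> arrs i' j'" for a
    using that by (simp add: arrs_def arrow_elt_def)
  have nz: "\<exists>b\<in>arrs i' j'. c = (i', [b], j') \<and> coef g a b \<noteq> 0" if a: "a \<in> arrs i' j'" and nz: "\<phi> g (AE a) c \<noteq> 0" for a c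
  proof -
    have aQ: "a \<in> arcs Q" "tail Q a = i'" "head Q a = j'" using a by (auto simp: arrs_def)
    have "(\<Sum>b | coef g a b \<noteq> 0. coef g a b * AE b c) \<noteq> 0" using nz unfolding fun_cong[OF \<phi>_AE(2)[OF gG aQ(1)], of c] .
    then obtain b where "b \<in> {b. coef g a b \<noteq> 0}" "coef g a b * AE b c \<noteq> 0"
      by (rule sum.not_neutral_contains_not_neutral)
    then have b: "coef g a b \<noteq> 0" "AE b c \<noteq> 0" by auto
    note cn = coef_nonzero[OF gG aQ(1) b(1)]
    have "c = (tail Q b, [b], head Q b)" using b(2) by (auto simp: arrow_elt_def unit_fun_def split: if_splits)
    then show ?thesis using cn b(1) aQ gi by (auto simp: arrs_def)
  qed
  let ?t' = "act (tens \<sigma> i' j') g t"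
  have sup: "\<exists>a b. a \<in> arrs i' j' \<and> t (i', [a], j') \<noteq> \<zero>\<^bsub>\<sigma>\<^esub> \<and> b \<in> arrs i' j' \<and> c = (i', [b], j') \<and> coef g a b \<noteq> 0"
    if "?t' c \<noteq> \<zero>\<^bsub>\<sigma>\<^esub>" for c
  proof -
    have "\<exists>b\<in>?S. \<phi> g (unit_fun b) c \<noteq> 0"
    proof (rule ccontr)
      assume "\<not> ?thesis"
      then have z: "\<phi> g (unit_fun b) c = 0" if "b \<in> ?S" for b using that by blast
      have "?t' c = (\<Oplus>\<^bsub>\<sigma>\<^esub>b\<in>?S. \<zero>\<^bsub>\<sigma>\<^esub>)"
        unfolding tens_simps
      proof (rule V.finsum_cong'[OF refl])
        fix b assume "b \<in> ?S"
        from z[OF this] show "\<phi> g (unit_fun b) c \<odot>\<^bsub>\<sigma>\<^esub> act \<sigma> ?h (t b) = \<zero>\<^bsub>\<sigma>\<^esub>"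
          using V.smult_l_null[OF ht[of b]] by simp
      qed simp
      then show False using that by simp
    qed
    then obtain b where b: "t b \<noteq> \<zero>\<^bsub>\<sigma>\<^esub>" "\<phi> g (unit_fun b) c \<noteq> 0" by blast
    then obtain a where a: "a \<in> arrs i' j'" "b = (i', [a], j')" using T(3) by blast
    then show ?thesis using nz[OF a(1), of c] b unit by auto
  qed
  show c: "?t' \<in> carrier (tens \<sigma> i' j')"
    unfolding tens_simps(1)
  proof (intro CollectI conjI allI impI)
    show "?t' c \<in> carrier \<sigma>" for c unfolding tens_simps using tm by (intro V.finsum_closed) auto
    have "{c. ?t' c \<noteq> \<zero>\<^bsub>\<sigma>\<^esub>} \<subseteq> (\<lambda>b. (i', [b], j')) ` (\<Union>a\<in>{a\<in>arrs i' j'. t (i', [a], j') \<noteq> \<zero>\<^bsub>\<sigma>\<^esub>}. {b. coef g a b \<noteq> 0})"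
    proof
      fix c assume "c \<in> {c. ?t' c \<noteq> \<zero>\<^bsub>\<sigma>\<^esub>}"
      then have "?t' c \<noteq> \<zero>\<^bsub>\<sigma>\<^esub>" by (rule CollectD)
      from sup[OF this] obtain a b where "a \<in> arrs i' j'" "t (i', [a], j') \<noteq> \<zero>\<^bsub>\<sigma>\<^esub>" "c = (i', [b], j')" "coef g a b \<noteq> 0" by blast
      then show "c \<in> (\<lambda>b. (i', [b], j')) ` (\<Union>a\<in>{a\<in>arrs i' j'. t (i', [a], j') \<noteq> \<zero>\<^bsub>\<sigma>\<^esub>}. {b. coef g a b \<noteq> 0})"
        by blast
    qed
    moreover have "finite {a\<in>arrs i' j'. t (i', [a], j') \<noteq> \<zero>\<^bsub>\<sigma>\<^esub>}"
    proof (rule finite_imageD[OF finite_subset[OF _ T(2)]])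
      show "(\<lambda>a. (i', [a], j')) ` {a\<in>arrs i' j'. t (i', [a], j') \<noteq> \<zero>\<^bsub>\<sigma>\<^esub>} \<subseteq> ?S" by blast
    qed (simp add: inj_on_def)
    moreover have "finite {b. coef g a b \<noteq> 0}" if "a \<in> arrs i' j'" for a
      using that \<phi>_AE(1)[OF gG] by (simp add: arrs_def)
    ultimately show "finite {c. ?t' c \<noteq> \<zero>\<^bsub>\<sigma>\<^esub>}" by (rule finite_subset[OF _ finite_imageI[OF finite_UN_I]]) auto
    show "c \<in> (\<lambda>a. (i', [a], j')) ` arrs i' j'" if "?t' c \<noteq> \<zero>\<^bsub>\<sigma>\<^esub>" for c using sup[OF that] by blast
  qed
  show "\<Theta> (j, \<sigma>) i' j' ?t' = \<Theta> (j, \<sigma>) i' j' t * \<gamma> g"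
  proof (rule A1_eqI[OF \<Theta>_cf(1)[OF c] A1_\<gamma>[OF \<Theta>_cf(1)[OF t] gG]])
    fix b
    let ?T = "{a. t (i', [a], j') \<noteq> \<zero>\<^bsub>\<sigma>\<^esub>}"
    have TS: "bij_betw (\<lambda>a. (i', [a], j')) ?T ?S"
      unfolding bij_betw_def
    proof (intro conjI equalityI subsetI)
      show "c \<in> (\<lambda>a. (i', [a], j')) ` ?T" if c: "c \<in> ?S" for c
      proof -
        obtain a where "c = (i', [a], j')" using T(3)[of c] c by blast
        then show ?thesis using c by blast
      qed
    qed (auto simp: inj_on_def)
    have Tarr: "a \<in> arrs i' j'" if "a \<in> ?T" for a using T(3)[of "(i', [a], j')"] that by auto
    have finT: "finite ?T" using bij_betw_finite[OF TS] T(2) by simp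
    have conj: "\<theta> (j, \<sigma>) (act \<sigma> ?h v) * \<gamma> (\<kappa> j') = \<theta> (j, \<sigma>) v * \<gamma> (\<kappa> j') * \<gamma> g" if v: "v \<in> carrier \<sigma>" for v
    proof -
      have "?h \<otimes> \<kappa> j' = \<kappa> j' \<otimes> g" using k gG by (simp add: m_assoc)
      then have "\<gamma> ?h * \<gamma> (\<kappa> j') = \<gamma> (\<kappa> j') * \<gamma> g" using k gG by (simp add: \<gamma>_mult[symmetric])
      then show ?thesis using \<theta>_facts(13)[OF y h v] by (simp add: mult.assoc)
    qed
    have 1: "\<theta> (j, \<sigma>) (?t' (i', [b], j')) = (\<Sum>d\<in>?S. sc (\<phi> g (unit_fun d) (i', [b], j')) * \<theta> (j, \<sigma>) (act \<sigma> ?h (t d)))"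
      unfolding tens_simps \<theta>_finsum[OF y T(2) tm] by (intro sum.cong refl \<theta>_facts(3)[OF y] ht)
    have "cw (\<Theta> (j, \<sigma>) i' j' ?t') b = (\<Sum>d\<in>?S. sc (\<phi> g (unit_fun d) (i', [b], j')) * (\<theta> (j, \<sigma>) (t d) * \<gamma> (\<kappa> j') * \<gamma> g))"
      unfolding \<Theta>_cf(2)[OF c] 1 sum_distrib_right by (intro sum.cong refl) (simp add: mult.assoc conj[OF T(1), unfolded mult.assoc])
    also have "\<dots> = (\<Sum>a\<in>?T. sc (\<phi> g (unit_fun (i', [a], j')) (i', [b], j')) * (\<theta> (j, \<sigma>) (t (i', [a], j')) * \<gamma> (\<kappa> j') * \<gamma> g))"
      by (rule sum.reindex_bij_betw[OF TS, symmetric])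
    also have "\<dots> = (\<Sum>a\<in>?T. sc (coef g a b) * (\<theta> (j, \<sigma>) (t (i', [a], j')) * \<gamma> (\<kappa> j') * \<gamma> g))"
    proof (intro sum.cong refl)
      fix a assume "a \<in> ?T"
      then have a: "a \<in> arrs i' j'" by (rule Tarr)
      then have aQ: "a \<in> arcs Q" "tail Q a = i'" "head Q a = j'" by (auto simp: arrs_def)
      \<comment> \<open>The entry \<open>coef g a b\<close> is taken at b with its own end points,
        the left side at the end points i' and j'. As g fixes i' and j', both vanish unless b runs
        from i' to j'.\<close>
      have "\<phi> g (AE a) (i', [b], j') = coef g a b"
      proof (cases "\<phi> g (AE a) (i', [b], j') = 0")
        case True
        have "coef g a b = 0"
        proof (rule ccontr)
          assume n: "coef g a b \<noteq> 0"
          from coef_nonzero[OF gG aQ(1) n] have "tail Q b = i'" "head Q b = j'" using aQ gi by auto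
          then show False using n True by (auto simp: coef_def split: if_splits)
        qed
        then show ?thesis using True by simp
      next
        case False
        from nz[OF a this] have "b \<in> arcs Q" "tail Q b = i'" "head Q b = j'" by (auto simp: arrs_def)
        then show ?thesis by (simp add: coef_def)
      qed
      then show "sc (\<phi> g (unit_fun (i', [a], j')) (i', [b], j')) * (\<theta> (j, \<sigma>) (t (i', [a], j')) * \<gamma> (\<kappa> j') * \<gamma> g) =
          sc (coef g a b) * (\<theta> (j, \<sigma>) (t (i', [a], j')) * \<gamma> (\<kappa> j') * \<gamma> g)"
        by (simp add: unit[OF a])
    qed
    also have "\<dots> = (\<Sum>a | cw (\<Theta> (j, \<sigma>) i' j' t) a \<noteq> 0. sc (coef g a b) * (cw (\<Theta> (j, \<sigma>) i' j' t) a * \<gamma> g))"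
      unfolding \<Theta>_cf(2)[OF t] using finT \<theta>_0[OF y] by (intro sum.mono_neutral_right) auto
    also have "\<dots> = cw (\<Theta> (j, \<sigma>) i' j' t * \<gamma> g) b" by (rule cw_\<gamma>[OF \<Theta>_cf(1)[OF t] gG, symmetric])
    finally show "cw (\<Theta> (j, \<sigma>) i' j' ?t') b = cw (\<Theta> (j, \<sigma>) i' j' t * \<gamma> g) b" .
  qed
qed

end

end

text \<open>\<open>V\<close> is given merely as a record of operations. Its vector space laws are
  carried over from \<open>S\<close> along the bijection first; only then can the meaning of
  \<open>basis\<close> be unfolded and pulled back to \<open>S\<close>.\<close>

lemma (in central_algebra) transported_basis:
  fixes V :: "('k, 'x, 'l) module_scheme"
  assumes S: "vs.subspace S" and bij: "bij_betw \<Xi> S (carrier V)"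
    and add: "\<And>p q. p \<in> S \<Longrightarrow> q \<in> S \<Longrightarrow> \<Xi> (p + q) = \<Xi> p \<oplus>\<^bsub>V\<^esub> \<Xi> q"
    and smult: "\<And>c p. p \<in> S \<Longrightarrow> \<Xi> (sc c * p) = c \<odot>\<^bsub>V\<^esub> \<Xi> p"
    and zero: "\<Xi> 0 = \<zero>\<^bsub>V\<^esub>" and basis: "vectorspace.basis class_ring V B"
  shows "b \<in> B \<Longrightarrow> inv_into S \<Xi> b \<in> S"
    "\<lbrakk>finite T; T \<subseteq> B; (\<Sum>b\<in>T. sc (c b) * inv_into S \<Xi> b) = 0; b \<in> T\<rbrakk> \<Longrightarrow> c b = 0"
    "S \<subseteq> vs.span (inv_into S \<Xi> ` B)"
proof -
  let ?\<alpha> = "inv_into S \<Xi>"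
  have cl: "\<Xi> p \<in> carrier V" if "p \<in> S" for p using bij that by (auto simp: bij_betw_def)
  have ex: "\<exists>p\<in>S. x = \<Xi> p" if "x \<in> carrier V" for x using bij that by (auto simp: bij_betw_def)
  have \<alpha>: "?\<alpha> x \<in> S" "\<Xi> (?\<alpha> x) = x" if "x \<in> carrier V" for x
    using bij_betw_inv_into_right[OF bij that] bij_betw_inv_into[OF bij] that by (auto simp: bij_betw_def)
  note Sadd = vs.subspace_add[OF S] and Sscale = vs.subspace_scale[OF S] and S0 = vs.subspace_0[OF S]
  have ag: "abelian_group V"
  proof (rule abelian_groupI)
    fix x assume "x \<in> carrier V"
    then obtain p where p: "p \<in> S" "x = \<Xi> p" using ex by blast
    show "\<exists>y\<in>carrier V. y \<oplus>\<^bsub>V\<^esub> x = \<zero>\<^bsub>V\<^esub>"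
    proof (rule bexI[of _ "\<Xi> (sc (-1) * p)"])
      show "\<Xi> (sc (-1) * p) \<oplus>\<^bsub>V\<^esub> x = \<zero>\<^bsub>V\<^esub>"
        using add[OF Sscale[OF p(1), of "-1"] p(1)] zero by (simp add: p(2) sc_uminus sc_one)
    qed (rule cl[OF Sscale[OF p(1)]])
    show "\<zero>\<^bsub>V\<^esub> \<oplus>\<^bsub>V\<^esub> x = x" using add[OF S0 p(1)] by (simp add: p(2) zero)
    fix y assume "y \<in> carrier V"
    then obtain q where q: "q \<in> S" "y = \<Xi> q" using ex by blast
    show "x \<oplus>\<^bsub>V\<^esub> y \<in> carrier V" using cl[OF Sadd[OF p(1) q(1)]] add[OF p(1) q(1)] p q by simp
    show "x \<oplus>\<^bsub>V\<^esub> y = y \<oplus>\<^bsub>V\<^esub> x" unfolding p(2) q(2) add[OF p(1) q(1), symmetric] add[OF q(1) p(1), symmetric]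
      by (simp only: add.commute)
    fix z assume "z \<in> carrier V"
    then obtain r where r: "r \<in> S" "z = \<Xi> r" using ex by blast
    show "(x \<oplus>\<^bsub>V\<^esub> y) \<oplus>\<^bsub>V\<^esub> z = x \<oplus>\<^bsub>V\<^esub> (y \<oplus>\<^bsub>V\<^esub> z)"
      unfolding p(2) q(2) r(2) add[OF p(1) q(1), symmetric] add[OF q(1) r(1), symmetric]
        add[OF Sadd[OF p(1) q(1)] r(1), symmetric] add[OF p(1) Sadd[OF q(1) r(1)], symmetric]
      by (simp only: add.assoc)
  next
    show "\<zero>\<^bsub>V\<^esub> \<in> carrier V" using cl[OF S0] zero by simp
  qed
  have "module class_ring V"
  proof (rule moduleI[OF cring_class_ring ag])
    fix a x assume "x \<in> carrier V"
    then obtain p where p: "p \<in> S" "x = \<Xi> p" using ex by blast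
    show "a \<odot>\<^bsub>V\<^esub> x \<in> carrier V" using cl[OF Sscale[OF p(1), of a]] smult[OF p(1), of a] p by simp
    show "\<one>\<^bsub>class_ring\<^esub> \<odot>\<^bsub>V\<^esub> x = x" using smult[OF p(1), of 1] by (simp add: p(2) sc_one)
    fix b
    show "(a \<oplus>\<^bsub>class_ring\<^esub> b) \<odot>\<^bsub>V\<^esub> x = a \<odot>\<^bsub>V\<^esub> x \<oplus>\<^bsub>V\<^esub> b \<odot>\<^bsub>V\<^esub> x"
    proof -
      have "(a \<oplus>\<^bsub>class_ring\<^esub> b) \<odot>\<^bsub>V\<^esub> x = \<Xi> (sc (a + b) * p)" using smult[OF p(1), of "a + b"] by (simp add: p(2))
      also have "\<dots> = a \<odot>\<^bsub>V\<^esub> x \<oplus>\<^bsub>V\<^esub> b \<odot>\<^bsub>V\<^esub> x"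
        unfolding sc_add distrib_right add[OF Sscale[OF p(1)] Sscale[OF p(1)]] smult[OF p(1)] p(2) ..
      finally show ?thesis .
    qed
    show "(a \<otimes>\<^bsub>class_ring\<^esub> b) \<odot>\<^bsub>V\<^esub> x = a \<odot>\<^bsub>V\<^esub> (b \<odot>\<^bsub>V\<^esub> x)"
    proof -
      have "(a \<otimes>\<^bsub>class_ring\<^esub> b) \<odot>\<^bsub>V\<^esub> x = \<Xi> (sc (a * b) * p)" using smult[OF p(1), of "a * b"] by (simp add: p(2))
      also have "\<dots> = a \<odot>\<^bsub>V\<^esub> (b \<odot>\<^bsub>V\<^esub> x)"
        unfolding sc_mult mult.assoc smult[OF Sscale[OF p(1)]] smult[OF p(1)] p(2) ..
      finally show ?thesis .
    qed
    fix y assume "y \<in> carrier V"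
    then obtain q where q: "q \<in> S" "y = \<Xi> q" using ex by blast
    show "a \<odot>\<^bsub>V\<^esub> (x \<oplus>\<^bsub>V\<^esub> y) = a \<odot>\<^bsub>V\<^esub> x \<oplus>\<^bsub>V\<^esub> a \<odot>\<^bsub>V\<^esub> y"
      unfolding p(2) q(2) add[OF p(1) q(1), symmetric] smult[OF p(1), symmetric] smult[OF q(1), symmetric]
        smult[OF Sadd[OF p(1) q(1)], symmetric] add[OF Sscale[OF p(1)] Sscale[OF q(1)], symmetric] distrib_left ..
  qed
  then interpret V: vectorspace "class_ring :: 'k ring" V using field_class_ring by (simp add: vectorspace_def)
  have B: "B \<subseteq> carrier V" "\<not> V.lin_dep B" "V.span B = carrier V"
    using basis by (auto simp: V.basis_def)
  have sumS: "(\<Sum>b\<in>T. sc (a b) * ?\<alpha> b) \<in> S" if "T \<subseteq> carrier V" for T a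
    by (intro vs.subspace_sum[OF S] Sscale \<alpha>(1) subsetD[OF that])
  have lincomb: "V.lincomb a T = \<Xi> (\<Sum>b\<in>T. sc (a b) * ?\<alpha> b)" if "finite T" "T \<subseteq> carrier V" for T a
    using that
  proof (induction T rule: finite_induct)
    case empty
    then show ?case by (simp add: V.lincomb_def zero)
  next
    case (insert b T)
    then have b: "b \<in> carrier V" and T: "T \<subseteq> carrier V" by auto
    have "a c \<odot>\<^bsub>V\<^esub> c \<in> carrier V" if "c \<in> carrier V" for c using V.smult_closed[OF _ that] by simp
    then have "V.lincomb a (insert b T) = a b \<odot>\<^bsub>V\<^esub> b \<oplus>\<^bsub>V\<^esub> V.lincomb a T"
      unfolding V.lincomb_def using insert.hyps b T by (intro V.finsum_insert) auto
    also have "\<dots> = \<Xi> (sc (a b) * ?\<alpha> b + (\<Sum>b\<in>T. sc (a b) * ?\<alpha> b))"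
      unfolding add[OF Sscale[OF \<alpha>(1)[OF b]] sumS[OF T]] smult[OF \<alpha>(1)[OF b]] \<alpha>(2)[OF b]
      using insert.IH[OF T] by simp
    finally show ?case using insert.hyps by simp
  qed
  show "?\<alpha> b \<in> S" if "b \<in> B" for b using \<alpha>(1) that B(1) by blast
  show "c b = 0" if T: "finite T" "T \<subseteq> B" and sum0: "(\<Sum>b\<in>T. sc (c b) * ?\<alpha> b) = 0" and b: "b \<in> T" for T c b
  proof (rule ccontr)
    assume "c b \<noteq> 0"
    moreover have "V.lincomb c T = \<zero>\<^bsub>V\<^esub>"
      using lincomb[OF T(1) subset_trans[OF T(2) B(1)], of c] sum0 zero by simp
    ultimately have "V.lin_dep B"
      unfolding V.lin_dep_def using T b by (intro exI[of _ T] exI[of _ c] exI[of _ b]) auto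
    then show False using B(2) by simp
  qed
  show "S \<subseteq> vs.span (?\<alpha> ` B)"
  proof
    fix p assume p: "p \<in> S"
    then have "\<Xi> p \<in> V.span B" using cl B(3) by simp
    then obtain a T where T: "finite T" "T \<subseteq> B" "\<Xi> p = V.lincomb a T" unfolding V.span_def by blast
    have TV: "T \<subseteq> carrier V" using T(2) B(1) by simp
    have "\<Xi> p = \<Xi> (\<Sum>b\<in>T. sc (a b) * ?\<alpha> b)" using lincomb[OF T(1) TV, of a] T(3) by simp
    then have "p = (\<Sum>b\<in>T. sc (a b) * ?\<alpha> b)"
      using bij p sumS[OF TV, of a] unfolding bij_betw_def by (meson inj_onD)
    also have "\<dots> \<in> vs.span (?\<alpha> ` B)"
      using T(2) by (intro vs.span_sum vs.span_scale vs.span_base) blast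
    finally show "p \<in> vs.span (?\<alpha> ` B)" .
  qed
qed

lemma (in central_algebra) sc_of_nat: "sc (of_nat n) = of_nat n"
  by (induction n) (simp_all add: sc_add sc_one)

section \<open>Mackey decomposition and Frobenius reciprocity\<close>

context assoc_quiver_model
begin

definition Arr :: "'v \<times> ('g, 'k, 'r) rep \<Rightarrow> 'v \<times> ('g, 'k, 'r) rep \<Rightarrow> 'a set" where
  "Arr x y = {p \<in> A1. \<epsilon> y * p = p \<and> p * \<epsilon> x = p}"

definition untens :: "'v \<times> ('g, 'k, 'r) rep \<Rightarrow> 'v \<Rightarrow> 'v \<Rightarrow> 'a \<Rightarrow> ('v, 'e) path \<Rightarrow> 'r" where
  "untens y i j = inv_into (carrier (tens (snd y) i j)) (\<Theta> y i j)"

text \<open>For p in the corner, p \<theta> v \<gamma> (\<kappa> i') is an element of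
  \<open>A1\<close> carried by arrows that start at i'. Its Mackey pieces belong to the heads of
  these arrows; up to the group action it suffices to record the pieces for the pairs in
  \<open>F\<close>.\<close>

definition \<Xi> :: "'v \<times> ('g, 'k, 'r) rep \<Rightarrow> 'v \<times> ('g, 'k, 'r) rep \<Rightarrow> 'a \<Rightarrow> 'v \<times> 'v \<Rightarrow> 'r \<Rightarrow> ('v, 'e) path \<Rightarrow> 'r" where
  "\<Xi> x y p = (\<lambda>P\<in>F (fst x) (fst y). \<lambda>v\<in>carrier (snd x).
     untens y (fst P) (snd P) (comp (snd P) (p * \<theta> x v * \<gamma> (\<kappa> (fst P)))))"

text \<open>The value at v of the map that Frobenius reciprocity attaches to f. Summing over the
  full stabilizer of i' avoids representatives of the cosets of the common stabilizer with j'; the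
  price is the factor in \<open>comp_ind\<close>.\<close>

definition induced :: "'v \<times> ('g, 'k, 'r) rep \<Rightarrow> 'v \<times> ('g, 'k, 'r) rep \<Rightarrow> 'v \<Rightarrow> 'v \<Rightarrow> ('r \<Rightarrow> ('v, 'e) path \<Rightarrow> 'r) \<Rightarrow> 'r \<Rightarrow> 'a" where
  "induced x y i' j' f v = (\<Sum>g\<in>Stab i'.
     \<Theta> y i' j' (f (act (snd x) (\<kappa> i' \<otimes> inv g \<otimes> inv \<kappa> i') v)) * \<gamma> g * \<gamma> (inv \<kappa> i'))"

lemma cancel_inv: "\<lbrakk>a \<in> carrier G; b \<in> carrier G\<rbrakk> \<Longrightarrow> inv a \<otimes> (a \<otimes> b) = b"
  "\<lbrakk>a \<in> carrier G; b \<in> carrier G\<rbrakk> \<Longrightarrow> a \<otimes> (inv a \<otimes> b) = b"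
  by (simp_all add: m_assoc[symmetric])

lemma conj_Stab: assumes "i \<in> verts Q" "k \<in> carrier G" "g \<in> Stab (va k i)"
  shows "k \<otimes> g \<otimes> inv k \<in> Stab i"
  using assms va(1)[OF assms(2,1)] va_inv(1)[OF assms(2,1)] by (simp add: Stab_iff va_mult)

lemmas F_rep = conjunct1[OF conjunct2[OF conjunct2[OF choices[unfolded assoc_quiver_choices_def]]], rule_format]

lemmas bas_basis = conjunct2[OF conjunct2[OF conjunct2[OF conjunct2[OF choices[unfolded assoc_quiver_choices_def]]]], rule_format]

lemma F_orbits: assumes "i \<in> R" "j \<in> R" "(i', j') \<in> F i j"
  shows "i' \<in> verts Q" "j' \<in> verts Q" "\<kappa> i' \<in> carrier G" "va (\<kappa> i') i = i'" "\<kappa> j' \<in> carrier G" "va (\<kappa> j') j = j'"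
proof -
  have "(i', j') \<in> orbit G va i \<times> orbit G va j"
    using F_rep[OF assms(1,2)] assms(3) unfolding orbit_representatives_def by blast
  then obtain g h where g: "g \<in> carrier G" "va g i = i'" and h: "h \<in> carrier G" "va h j = j'"
    by (auto simp: orbit_def)
  show "i' \<in> verts Q" "j' \<in> verts Q" using va(1)[OF g(1) R_verts[OF assms(1)]] va(1)[OF h(1) R_verts[OF assms(2)]] g h by auto
  show "\<kappa> i' \<in> carrier G" "va (\<kappa> i') i = i'" "\<kappa> j' \<in> carrier G" "va (\<kappa> j') j = j'"
    using R_\<kappa>[OF assms(1) g] R_\<kappa>[OF assms(2) h] by auto
qed

lemma F_reps: assumes "i \<in> R" "j \<in> R" "g \<in> carrier G" "h \<in> carrier G"
  shows "\<exists>!P. P \<in> F i j \<and> P \<in> orbit G (\<lambda>g. map_prod (va g) (va g)) (va g i, va h j)"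
proof -
  have "(va g i, va h j) \<in> orbit G va i \<times> orbit G va j" using assms by (auto simp: orbit_def)
  then show ?thesis using F_rep[OF assms(1,2)] unfolding orbit_representatives_def by blast
qed

lemma F_unique: assumes "i \<in> R" "j \<in> R" "(i', j') \<in> F i j" "P \<in> F i j" "m \<in> carrier G" "P = (va m i', va m j')"
  shows "P = (i', j')"
proof -
  note O = F_orbits[OF assms(1-3)]
  have ex1: "\<exists>!P. P \<in> F i j \<and> P \<in> orbit G (\<lambda>g. map_prod (va g) (va g)) (i', j')"
    using F_reps[OF assms(1,2) O(3,5)] O(4,6) by simp
  have "P \<in> orbit G (\<lambda>g. map_prod (va g) (va g)) (i', j')"
    unfolding orbit_def using assms(5,6) by auto
  moreover have "(i', j') \<in> orbit G (\<lambda>g. map_prod (va g) (va g)) (i', j')"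
    unfolding orbit_def using O(1,2) by (intro CollectI exI[of _ \<one>]) (simp add: va_one)
  ultimately show ?thesis using ex1 assms(3,4) by blast
qed

lemma finite_F: assumes "i \<in> R" "j \<in> R" shows "finite (F i j)"
  by (rule finite_subset[of _ "verts Q \<times> verts Q"]) (use F_orbits(1,2)[OF assms] finite_verts in auto)

text \<open>Spells out the direct sum of spaces of equivariant maps; the support condition of the
  direct sum holds because \<open>F i j\<close> is finite.\<close>

lemma arrow_space_carrier:
  assumes "i \<in> R" "j \<in> R"
  shows "f \<in> carrier (arrow_space G Q \<phi> \<kappa> F (i, \<rho>) (j, \<sigma>)) \<longleftrightarrow> f \<in> extensional (F i j) \<and>
    (\<forall>i' j'. (i', j') \<in> F i j \<longrightarrow> f (i', j') \<in> extensional (carrier \<rho>) \<and>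
       (\<forall>v\<in>carrier \<rho>. f (i', j') v \<in> carrier (tens \<sigma> i' j')) \<and>
       (\<forall>v\<in>carrier \<rho>. \<forall>w\<in>carrier \<rho>. f (i', j') (v \<oplus>\<^bsub>\<rho>\<^esub> w) = f (i', j') v \<oplus>\<^bsub>tens \<sigma> i' j'\<^esub> f (i', j') w) \<and>
       (\<forall>c. \<forall>v\<in>carrier \<rho>. f (i', j') (c \<odot>\<^bsub>\<rho>\<^esub> v) = c \<odot>\<^bsub>tens \<sigma> i' j'\<^esub> f (i', j') v) \<and>
       (\<forall>g\<in>Stab i' \<inter> Stab j'. \<forall>v\<in>carrier \<rho>.
          f (i', j') (act \<rho> (\<kappa> i' \<otimes> g \<otimes> inv \<kappa> i') v) = act (tens \<sigma> i' j') g (f (i', j') v)))"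
  unfolding arrow_space_def prod.case direct_sum_family_def tens_def[symmetric] hom_space_def partial_object.simps
    rep_hom_def module_hom_def twist_simps
  using finite_F[OF assms]
  by (auto simp: PiE_iff twist_simps split_paired_all Pi_iff Ball_def)

context
  fixes i :: 'v and \<rho> :: "('g, 'k, 'r) rep" and j :: 'v and \<sigma> :: "('g, 'k, 'r) rep"
  assumes x: "(i, \<rho>) \<in> X" and y: "(j, \<sigma>) \<in> X"
begin

lemma ijR: "i \<in> R" "j \<in> R" using x y by (simp_all add: X_iff)

lemma subspace_Arr: "vs.subspace (Arr (i, \<rho>) (j, \<sigma>))"
proof (rule vs.subspaceI)
  show "0 \<in> Arr (i, \<rho>) (j, \<sigma>)" by (simp add: Arr_def A1_0)
  show "p + q \<in> Arr (i, \<rho>) (j, \<sigma>)" if "p \<in> Arr (i, \<rho>) (j, \<sigma>)" "q \<in> Arr (i, \<rho>) (j, \<sigma>)" for p q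
    using that A1_add by (simp add: Arr_def distrib_left distrib_right)
  show "sc c * p \<in> Arr (i, \<rho>) (j, \<sigma>)" if "p \<in> Arr (i, \<rho>) (j, \<sigma>)" for c p
    using that A1_scale by (simp add: Arr_def mult_sc mult.assoc)
qed

lemma ZZ_E: assumes q: "q \<in> ZZ (j, \<sigma>) i' j'" and i': "i' \<in> verts Q" shows "q * E i' = q"
proof -
  have q1: "q \<in> A1" and sup: "\<And>a. cw q a \<noteq> 0 \<Longrightarrow> a \<in> arrs i' j'" using q by (auto simp: ZZ_def)
  show ?thesis
  proof (rule A1_eqI[OF A1_E[OF q1 i'] q1])
    fix a show "cw (q * E i') a = cw q a"
      unfolding cw_E[OF q1 i'] using sup[of a] by (auto simp: arrs_def)
  qed
qed

lemma subspace_ZZ: "vs.subspace (ZZ (j, \<sigma>) i' j')"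
proof (rule vs.subspaceI)
  show "0 \<in> ZZ (j, \<sigma>) i' j'" by (simp add: ZZ_def A1_0 cw_0)
  show "p + q \<in> ZZ (j, \<sigma>) i' j'" if p: "p \<in> ZZ (j, \<sigma>) i' j'" and q: "q \<in> ZZ (j, \<sigma>) i' j'" for p q
  proof -
    have 1: "p \<in> A1" "q \<in> A1" using p q by (auto simp: ZZ_def)
    have "a \<in> arrs i' j'" if "cw (p + q) a \<noteq> 0" for a
    proof -
      have "cw p a \<noteq> 0 \<or> cw q a \<noteq> 0" using that unfolding cw_add[OF 1] by auto
      then show ?thesis using p q by (auto simp: ZZ_def)
    qed
    then show ?thesis using p q A1_add[OF 1] by (simp add: ZZ_def distrib_left)
  qed
  show "sc c * p \<in> ZZ (j, \<sigma>) i' j'" if p: "p \<in> ZZ (j, \<sigma>) i' j'" for c p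
  proof -
    have 1: "p \<in> A1" using p by (auto simp: ZZ_def)
    have "a \<in> arrs i' j'" if "cw (sc c * p) a \<noteq> 0" for a
    proof -
      have "cw p a \<noteq> 0" using that unfolding cw_scale[OF 1] by auto
      then show ?thesis using p by (auto simp: ZZ_def)
    qed
    then show ?thesis using p A1_scale[OF 1] by (simp add: ZZ_def mult_sc)
  qed
qed

text \<open>All arrows of q have head j', and multiplying by m moves all these heads to j'^m at
  once; so each component is everything or nothing.\<close>

lemma comp_shift:
  assumes q: "q \<in> ZZ (j, \<sigma>) i' j'" and m: "m \<in> carrier G" and j': "j' \<in> verts Q" and h: "h \<in> verts Q"
  shows "comp h (q * \<gamma> m) = (if va m j' = h then q * \<gamma> m else 0)"
proof -
  have q1: "q \<in> A1" and sup: "\<And>a. cw q a \<noteq> 0 \<Longrightarrow> a \<in> arrs i' j'" using q by (auto simp: ZZ_def)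
  have "comp h' q = (if h' = j' then q else 0)" for h'
  proof (rule A1_eqI[OF comp_A1[OF q1]])
    show "(if h' = j' then q else 0) \<in> A1" using q1 A1_0 by simp
    fix a show "cw (comp h' q) a = cw (if h' = j' then q else 0) a"
      unfolding cw_comp[OF q1] using sup[of a] by (auto simp: arrs_def cw_0)
  qed
  moreover have "comp h (q * \<gamma> m) = comp (va (inv m) h) q * \<gamma> m"
    using comp_\<gamma>[OF q1 m va(1)[of "inv m" h]] va_inv(2)[OF m h] m h by simp
  moreover have "va (inv m) h = j' \<longleftrightarrow> va m j' = h"
    using va_inv[OF m h] va_inv[OF m j'] by auto
  ultimately show ?thesis by auto
qed

context
  fixes i' j' :: 'v
  assumes P: "(i', j') \<in> F i j"
begin

lemmas O = F_orbits[OF ijR P]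

lemma untens: assumes q: "q \<in> ZZ (j, \<sigma>) i' j'"
  shows "untens (j, \<sigma>) i' j' q \<in> carrier (tens \<sigma> i' j')" "\<Theta> (j, \<sigma>) i' j' (untens (j, \<sigma>) i' j' q) = q"
  unfolding untens_def snd_conv
  by (rule inv_into_into[OF \<Theta>_surj[OF y O(5,6) q]], rule f_inv_into_f[OF \<Theta>_surj[OF y O(5,6) q]])

lemma untens_\<Theta>: "t \<in> carrier (tens \<sigma> i' j') \<Longrightarrow> untens (j, \<sigma>) i' j' (\<Theta> (j, \<sigma>) i' j' t) = t"
  unfolding untens_def snd_conv by (rule inv_into_f_f[OF \<Theta>_inj[OF y O(5,6)]])

lemma untens_add: assumes "q \<in> ZZ (j, \<sigma>) i' j'" "r \<in> ZZ (j, \<sigma>) i' j'"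
  shows "untens (j, \<sigma>) i' j' (q + r) = untens (j, \<sigma>) i' j' q \<oplus>\<^bsub>tens \<sigma> i' j'\<^esub> untens (j, \<sigma>) i' j' r"
  using untens_\<Theta>[OF tens_add(1)[OF y O(5,6) untens(1)[OF assms(1)] untens(1)[OF assms(2)]]]
  unfolding tens_add(2)[OF y O(5,6) untens(1)[OF assms(1)] untens(1)[OF assms(2)]] untens(2)[OF assms(1)] untens(2)[OF assms(2)] .

lemma untens_smult: assumes "q \<in> ZZ (j, \<sigma>) i' j'"
  shows "untens (j, \<sigma>) i' j' (sc c * q) = c \<odot>\<^bsub>tens \<sigma> i' j'\<^esub> untens (j, \<sigma>) i' j' q"
  using untens_\<Theta>[OF tens_smult(1)[OF y O(5,6) untens(1)[OF assms], of c]]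
  unfolding tens_smult(2)[OF y O(5,6) untens(1)[OF assms]] untens(2)[OF assms] .

lemma untens_act: assumes "q \<in> ZZ (j, \<sigma>) i' j'" "g \<in> Stab i'" "g \<in> Stab j'"
  shows "untens (j, \<sigma>) i' j' (q * \<gamma> g) = act (tens \<sigma> i' j') g (untens (j, \<sigma>) i' j' q)"
  using untens_\<Theta>[OF tens_act(1)[OF y O(5,6) untens(1)[OF assms(1)] assms(2,3) O(1)]]
  unfolding tens_act(2)[OF y O(5,6) untens(1)[OF assms(1)] assms(2,3) O(1)] untens(2)[OF assms(1)] .

lemma piece_A1: assumes "p \<in> A1" "v \<in> carrier \<rho>" shows "p * \<theta> (i, \<rho>) v * \<gamma> (\<kappa> i') \<in> A1"
  using assms by (intro A1_\<gamma> A1_right \<theta>_A0[OF x] O)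

lemma piece_ZZ: assumes p: "p \<in> Arr (i, \<rho>) (j, \<sigma>)" and v: "v \<in> carrier \<rho>"
  shows "comp j' (p * \<theta> (i, \<rho>) v * \<gamma> (\<kappa> i')) \<in> ZZ (j, \<sigma>) i' j'"
proof -
  let ?d = "p * \<theta> (i, \<rho>) v * \<gamma> (\<kappa> i')"
  have p1: "p \<in> A1" "\<epsilon> (j, \<sigma>) * p = p" using p by (auto simp: Arr_def)
  note d = piece_A1[OF p1(1) v]
  have \<epsilon>: "\<epsilon> (j, \<sigma>) * comp j' ?d = comp j' ?d"
    using comp_left[OF d \<epsilon>_A0[OF y], of j'] p1(2) by (simp add: mult.assoc[symmetric])
  have dE: "?d * E i' = ?d"
    using mult_\<gamma>_E[of "p * \<theta> (i, \<rho>) v" i "\<kappa> i'"] \<theta>_E[OF x v] X_verts[OF x] O(3,4) by (simp add: mult.assoc)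
  have "a \<in> arrs i' j'" if nz: "cw (comp j' ?d) a \<noteq> 0" for a
  proof -
    have 1: "head Q a = j'" "cw ?d a \<noteq> 0" using nz unfolding cw_comp[OF d] by (auto split: if_splits)
    have "cw (?d * E i') a \<noteq> 0" using 1(2) unfolding dE .
    then have "tail Q a = i'" unfolding cw_E[OF d O(1)] by (auto split: if_splits)
    then show ?thesis using 1 A1_cw(4)[OF d 1(2)] by (simp add: arrs_def)
  qed
  then show ?thesis using \<epsilon> comp_A1[OF d] by (simp add: ZZ_def)
qed

lemma conj_in_Stab: "g \<in> Stab i' \<Longrightarrow> \<kappa> i' \<otimes> g \<otimes> inv \<kappa> i' \<in> Stab i"
  using conj_Stab[OF X_verts[OF x] O(3)] O(4) by simp

lemma \<theta>_conj: assumes g: "g \<in> Stab i'" and v: "v \<in> carrier \<rho>"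
  shows "\<theta> (i, \<rho>) (act \<rho> (\<kappa> i' \<otimes> g \<otimes> inv \<kappa> i') v) * \<gamma> (\<kappa> i') = \<theta> (i, \<rho>) v * \<gamma> (\<kappa> i') * \<gamma> g"
proof -
  have gG: "g \<in> carrier G" using g O(1) by (simp add: Stab_iff)
  have "\<gamma> (\<kappa> i' \<otimes> g \<otimes> inv \<kappa> i') * \<gamma> (\<kappa> i') = \<gamma> (\<kappa> i') * \<gamma> g"
    using O(3) gG by (simp add: \<gamma>_mult[symmetric] m_assoc)
  then show ?thesis using \<theta>_facts(13)[OF x conj_in_Stab[OF g] v] by (simp add: mult.assoc)
qed

end

lemma \<Xi>_apply: "(i', j') \<in> F i j \<Longrightarrow> v \<in> carrier \<rho> \<Longrightarrow>
    \<Xi> (i, \<rho>) (j, \<sigma>) p (i', j') v = untens (j, \<sigma>) i' j' (comp j' (p * \<theta> (i, \<rho>) v * \<gamma> (\<kappa> i')))"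
  by (simp add: \<Xi>_def)

lemma \<Xi>_closed: assumes p: "p \<in> Arr (i, \<rho>) (j, \<sigma>)"
  shows "\<Xi> (i, \<rho>) (j, \<sigma>) p \<in> carrier (arrow_space G Q \<phi> \<kappa> F (i, \<rho>) (j, \<sigma>))"
proof -
  have p1: "p \<in> A1" using p by (simp add: Arr_def)
  interpret V: vectorspace class_ring \<rho> by (rule X_rep(2)[OF x])
  show ?thesis unfolding arrow_space_carrier[OF ijR]
  proof (intro conjI allI impI ballI)
    show "\<Xi> (i, \<rho>) (j, \<sigma>) p \<in> extensional (F i j)" by (simp add: \<Xi>_def)
    fix i' j' assume P: "(i', j') \<in> F i j"
    note ap = \<Xi>_apply[OF P] and pZ = piece_ZZ[OF P p] and O = F_orbits[OF ijR P]
    show "\<Xi> (i, \<rho>) (j, \<sigma>) p (i', j') \<in> extensional (carrier \<rho>)" using P by (simp add: \<Xi>_def)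
    show "\<Xi> (i, \<rho>) (j, \<sigma>) p (i', j') v \<in> carrier (tens \<sigma> i' j')" if v: "v \<in> carrier \<rho>" for v
      unfolding ap[OF v] by (rule untens(1)[OF P pZ[OF v]])
    show "\<Xi> (i, \<rho>) (j, \<sigma>) p (i', j') (v \<oplus>\<^bsub>\<rho>\<^esub> w) =
      \<Xi> (i, \<rho>) (j, \<sigma>) p (i', j') v \<oplus>\<^bsub>tens \<sigma> i' j'\<^esub> \<Xi> (i, \<rho>) (j, \<sigma>) p (i', j') w"
      if v: "v \<in> carrier \<rho>" and w: "w \<in> carrier \<rho>" for v w
      unfolding ap[OF v] ap[OF w] ap[OF V.a_closed[OF v w]] untens_add[OF P pZ[OF v] pZ[OF w], symmetric]
        \<theta>_facts(2)[OF x v w] distrib_left distrib_right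
        comp_add[OF piece_A1[OF P p1 v] piece_A1[OF P p1 w]] ..
    show "\<Xi> (i, \<rho>) (j, \<sigma>) p (i', j') (c \<odot>\<^bsub>\<rho>\<^esub> v) = c \<odot>\<^bsub>tens \<sigma> i' j'\<^esub> \<Xi> (i, \<rho>) (j, \<sigma>) p (i', j') v"
      if v: "v \<in> carrier \<rho>" for c v
    proof -
      have cv: "c \<odot>\<^bsub>\<rho>\<^esub> v \<in> carrier \<rho>" using V.smult_closed[OF _ v] by simp
      have "p * \<theta> (i, \<rho>) (c \<odot>\<^bsub>\<rho>\<^esub> v) * \<gamma> (\<kappa> i') = sc c * (p * \<theta> (i, \<rho>) v * \<gamma> (\<kappa> i'))"
        unfolding \<theta>_facts(3)[OF x v] mult_sc by (simp only: mult.assoc)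
      then show ?thesis
        unfolding ap[OF v] ap[OF cv] untens_smult[OF P pZ[OF v], symmetric]
        by (simp only: comp_scale[OF piece_A1[OF P p1 v]])
    qed
    show "\<Xi> (i, \<rho>) (j, \<sigma>) p (i', j') (act \<rho> (\<kappa> i' \<otimes> g \<otimes> inv \<kappa> i') v) = act (tens \<sigma> i' j') g (\<Xi> (i, \<rho>) (j, \<sigma>) p (i', j') v)"
      if g: "g \<in> Stab i' \<inter> Stab j'" and v: "v \<in> carrier \<rho>" for g v
    proof -
      have g1: "g \<in> Stab i'" "g \<in> Stab j'" "g \<in> carrier G" "va g j' = j'" using g O(1,2) by (auto simp: Stab_iff)
      have av: "act \<rho> (\<kappa> i' \<otimes> g \<otimes> inv \<kappa> i') v \<in> carrier \<rho>"
        by (rule X_rep(4)[OF x conj_in_Stab[OF P g1(1)] v])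
      have "p * \<theta> (i, \<rho>) (act \<rho> (\<kappa> i' \<otimes> g \<otimes> inv \<kappa> i') v) * \<gamma> (\<kappa> i') = p * \<theta> (i, \<rho>) v * \<gamma> (\<kappa> i') * \<gamma> g"
        using \<theta>_conj[OF P g1(1) v] by (simp add: mult.assoc)
      then have "comp j' (p * \<theta> (i, \<rho>) (act \<rho> (\<kappa> i' \<otimes> g \<otimes> inv \<kappa> i') v) * \<gamma> (\<kappa> i')) = comp j' (p * \<theta> (i, \<rho>) v * \<gamma> (\<kappa> i')) * \<gamma> g"
        using comp_\<gamma>[OF piece_A1[OF P p1 v] g1(3) O(2)] g1(4) by simp
      then show ?thesis
        unfolding ap[OF v] ap[OF av] untens_act[OF P pZ[OF v] g1(1,2), symmetric] by simp
    qed
  qed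
qed

text \<open>The difference d of the two elements has only zero pieces. An arrow a occurring in d
  \<theta> v has its head in the orbit of j, so the pair of i and this head can be moved into
  \<open>F\<close>, where the piece of d vanishes. Hence d \<theta> v = 0 for all v, and \<epsilon>
  is one of the \<theta> v.\<close>

lemma \<Xi>_inj: assumes p: "p \<in> Arr (i, \<rho>) (j, \<sigma>)" and q: "q \<in> Arr (i, \<rho>) (j, \<sigma>)"
  and eq: "\<Xi> (i, \<rho>) (j, \<sigma>) p = \<Xi> (i, \<rho>) (j, \<sigma>) q" shows "p = q"
proof -
  have pq1: "p \<in> A1" "q \<in> A1" using p q by (simp_all add: Arr_def)
  define d where "d = p + sc (-1) * q"
  have dA: "d \<in> Arr (i, \<rho>) (j, \<sigma>)"
    unfolding d_def by (intro vs.subspace_add[OF subspace_Arr] vs.subspace_scale[OF subspace_Arr] p q)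
  then have d1: "d \<in> A1" "\<epsilon> (j, \<sigma>) * d = d" "d * \<epsilon> (i, \<rho>) = d" by (auto simp: Arr_def)
  have i: "i \<in> verts Q" "j \<in> verts Q" using X_verts x y by blast+
  have comp0: "comp j' (d * \<theta> (i, \<rho>) v * \<gamma> (\<kappa> i')) = 0" if P: "(i', j') \<in> F i j" and v: "v \<in> carrier \<rho>" for i' j' v
  proof -
    have "untens (j, \<sigma>) i' j' (comp j' (p * \<theta> (i, \<rho>) v * \<gamma> (\<kappa> i'))) = untens (j, \<sigma>) i' j' (comp j' (q * \<theta> (i, \<rho>) v * \<gamma> (\<kappa> i')))"
      using \<Xi>_apply[OF P v] eq by metis
    then have "comp j' (p * \<theta> (i, \<rho>) v * \<gamma> (\<kappa> i')) = comp j' (q * \<theta> (i, \<rho>) v * \<gamma> (\<kappa> i'))"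
      using untens(2)[OF P piece_ZZ[OF P p v]] untens(2)[OF P piece_ZZ[OF P q v]] by metis
    moreover have "d * \<theta> (i, \<rho>) v * \<gamma> (\<kappa> i') = p * \<theta> (i, \<rho>) v * \<gamma> (\<kappa> i') + sc (-1) * (q * \<theta> (i, \<rho>) v * \<gamma> (\<kappa> i'))"
      unfolding d_def distrib_right by (simp only: mult.assoc)
    ultimately show ?thesis
      using comp_add[OF piece_A1[OF P pq1(1) v] A1_scale[OF piece_A1[OF P pq1(2) v], of "-1"], of j']
        comp_scale[OF piece_A1[OF P pq1(2) v], of j' "-1"] by (simp add: sc_uminus sc_one)
  qed
  have zero: "d * \<theta> (i, \<rho>) v = 0" if v: "v \<in> carrier \<rho>" for v
  proof -
    let ?r = "d * \<theta> (i, \<rho>) v"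
    have r: "?r \<in> A1" by (rule A1_right[OF d1(1) \<theta>_A0[OF x v]])
    have \<epsilon>r: "\<epsilon> (j, \<sigma>) * ?r = ?r" using d1(2) by (simp add: mult.assoc[symmetric])
    have rE: "?r * E i = ?r" using \<theta>_E[OF x v] by (simp add: mult.assoc)
    have "cw ?r a = 0" for a
    proof (rule ccontr)
      assume nz: "cw ?r a \<noteq> 0"
      have a: "a \<in> arcs Q" by (rule A1_cw(4)[OF r nz])
      have hd: "head Q a \<in> verts Q" using a by simp
      \<comment> \<open>e_j fixes the coefficient from the left, through \<epsilon>, and the
        idempotent of the head of a fixes it from the right. So the product is the nonzero
        coefficient itself, and \<open>A0_corner\<close> provides an element that moves j to this
        head.\<close>
      have "E j * cw ?r a * E (head Q a) \<noteq> 0"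
      proof -
        have e: "cw ?r a = \<epsilon> (j, \<sigma>) * cw ?r a" using cw_left[OF r \<epsilon>_A0[OF y], of a] unfolding \<epsilon>r .
        have "E j * cw ?r a = E j * (\<epsilon> (j, \<sigma>) * cw ?r a)" by (rule arg_cong[OF e])
        also have "\<dots> = \<epsilon> (j, \<sigma>) * cw ?r a" unfolding mult.assoc[symmetric] \<epsilon>_E(1)[OF y] ..
        also have "\<dots> = cw ?r a" by (rule e[symmetric])
        finally have "E j * cw ?r a = cw ?r a" .
        then show ?thesis using A1_cw(3)[OF r a] nz by simp
      qed
      then obtain g where g: "g \<in> carrier G" "va g j = head Q a"
        using A0_corner(1)[OF i(2) hd A1_cw(2)[OF r]] by blast
      obtain P where P: "P \<in> F i j" "P \<in> orbit G (\<lambda>g. map_prod (va g) (va g)) (va \<one> i, va g j)"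
        using F_reps[OF ijR one_closed g(1)] by blast
      then obtain m where m: "m \<in> carrier G" "P = (va m i, va m (head Q a))"
        using va_one[OF i(1)] g(2) by (auto simp: orbit_def)
      note PF = P(1)[unfolded m(2)] note O = F_orbits[OF ijR PF]
      \<comment> \<open>m and \<kappa> (va m i) move i to the same vertex, so they differ by an
        element h of the stabilizer of i. It is absorbed into v, which leaves a piece of the kind
        treated in \<open>comp0\<close>.\<close>
      define h where "h = m \<otimes> inv \<kappa> (va m i)"
      have "va h i = va (inv \<kappa> (va m i)) (va (\<kappa> (va m i)) i)"
        unfolding h_def using va_mult[OF m(1) inv_closed[OF O(3)] i(1)] O(4) by simp
      then have "h \<in> Stab i"
        using va_inv(1)[OF O(3) i(1)] O(3) m(1) i(1) by (simp add: Stab_iff) (simp add: h_def)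
      have "m = h \<otimes> \<kappa> (va m i)" using m(1) O(3) by (simp add: h_def m_assoc)
      then have \<gamma>m: "\<gamma> m = \<gamma> h * \<gamma> (\<kappa> (va m i))"
        using \<gamma>_mult[of h "\<kappa> (va m i)"] m(1) O(3) by (simp add: h_def)
      have "comp (head Q a) ?r * \<gamma> m = comp (va m (head Q a)) (?r * \<gamma> m)" by (rule comp_\<gamma>[OF r m(1) hd, symmetric])
      also have "?r * \<gamma> m = d * \<theta> (i, \<rho>) (act \<rho> h v) * \<gamma> (\<kappa> (va m i))"
        unfolding \<gamma>m \<theta>_facts(13)[OF x \<open>h \<in> Stab i\<close> v] by (simp only: mult.assoc)
      also have "comp (va m (head Q a)) \<dots> = 0"
        by (rule comp0[OF PF X_rep(4)[OF x \<open>h \<in> Stab i\<close> v]])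
      finally have 0: "comp (head Q a) ?r * \<gamma> m = 0" .
      have "comp (head Q a) ?r * E i = comp (head Q a) ?r" using comp_E[OF r i(1), of "head Q a"] rE by simp
      from mult_\<gamma>_inv(1)[OF this i(1) m(1)] have "comp (head Q a) ?r = 0" unfolding 0 by simp
      then have "cw (comp (head Q a) ?r) a = 0" by (simp add: cw_0)
      then show False using nz unfolding cw_comp[OF r] by simp
    qed
    then show ?thesis by (intro A1_eqI[OF r A1_0]) (simp add: cw_0)
  qed
  obtain v where "v \<in> carrier \<rho>" "\<epsilon> (i, \<rho>) = \<theta> (i, \<rho>) v" using \<theta>_facts(5)[OF x] by blast
  then have "d = 0" using zero[of v] d1(3) by simp
  then show ?thesis by (simp add: d_def sc_uminus sc_one)
qed

section \<open>From equivariant maps back to elements of the corner\<close>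

context
  fixes i' j' :: 'v and f :: "'r \<Rightarrow> ('v, 'e) path \<Rightarrow> 'r"
  assumes P: "(i', j') \<in> F i j"
    and f: "\<And>v. v \<in> carrier \<rho> \<Longrightarrow> f v \<in> carrier (tens \<sigma> i' j')"
      "\<And>v w. v \<in> carrier \<rho> \<Longrightarrow> w \<in> carrier \<rho> \<Longrightarrow> f (v \<oplus>\<^bsub>\<rho>\<^esub> w) = f v \<oplus>\<^bsub>tens \<sigma> i' j'\<^esub> f w"
      "\<And>c v. v \<in> carrier \<rho> \<Longrightarrow> f (c \<odot>\<^bsub>\<rho>\<^esub> v) = c \<odot>\<^bsub>tens \<sigma> i' j'\<^esub> f v"
      "\<And>g v. g \<in> Stab i' \<inter> Stab j' \<Longrightarrow> v \<in> carrier \<rho> \<Longrightarrow>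
         f (act \<rho> (\<kappa> i' \<otimes> g \<otimes> inv \<kappa> i') v) = act (tens \<sigma> i' j') g (f v)"
begin

abbreviation (input) "ind \<equiv> induced (i, \<rho>) (j, \<sigma>) i' j' f"
abbreviation (input) "val v \<equiv> \<Theta> (j, \<sigma>) i' j' (f v)"
abbreviation (input) "ca g \<equiv> act \<rho> (\<kappa> i' \<otimes> g \<otimes> inv \<kappa> i')"

lemmas OP = F_orbits[OF ijR P]

lemma Stab_G: "g \<in> Stab i' \<Longrightarrow> g \<in> carrier G" "g \<in> Stab i' \<Longrightarrow> inv g \<in> Stab i'"
  using subgroup.subset[OF subgroup_Stab[OF OP(1)]] subgroup.m_inv_closed[OF subgroup_Stab[OF OP(1)]] by blast+

lemma ca: "g \<in> Stab i' \<Longrightarrow> v \<in> carrier \<rho> \<Longrightarrow> ca g v \<in> carrier \<rho>"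
  by (rule X_rep(4)[OF x conj_in_Stab[OF P]])

lemma ind_eq: "ind v = (\<Sum>g\<in>Stab i'. val (ca (inv g) v) * \<gamma> g * \<gamma> (inv \<kappa> i'))"
  by (simp add: induced_def)

lemma val_ZZ: "v \<in> carrier \<rho> \<Longrightarrow> val v \<in> ZZ (j, \<sigma>) i' j'"
  by (rule \<Theta>_ZZ[OF y OP(5,6) f(1)])

lemma val_A1: "v \<in> carrier \<rho> \<Longrightarrow> val v \<in> A1" "v \<in> carrier \<rho> \<Longrightarrow> \<epsilon> (j, \<sigma>) * val v = val v"
  using val_ZZ by (auto simp: ZZ_def)

lemma val_add: "v \<in> carrier \<rho> \<Longrightarrow> w \<in> carrier \<rho> \<Longrightarrow> val (v \<oplus>\<^bsub>\<rho>\<^esub> w) = val v + val w"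
  using tens_add(2)[OF y OP(5,6) f(1) f(1)] f(2) by simp

lemma val_smult: "v \<in> carrier \<rho> \<Longrightarrow> val (c \<odot>\<^bsub>\<rho>\<^esub> v) = sc c * val v"
  using tens_smult(2)[OF y OP(5,6) f(1)] f(3) by simp

lemma val_act: "g \<in> Stab i' \<Longrightarrow> g \<in> Stab j' \<Longrightarrow> v \<in> carrier \<rho> \<Longrightarrow> val (ca g v) = val v * \<gamma> g"
  using tens_act(2)[OF y OP(5,6) f(1) _ _ OP(1)] f(4) by simp

lemma ind_A1: assumes v: "v \<in> carrier \<rho>" shows "ind v \<in> A1" "\<epsilon> (j, \<sigma>) * ind v = ind v"
proof -
  show "ind v \<in> A1" unfolding ind_eq
    by (intro vs.subspace_sum[OF subspace_A1] A1_\<gamma> val_A1(1) ca v inv_closed OP Stab_G)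
  show "\<epsilon> (j, \<sigma>) * ind v = ind v" unfolding ind_eq sum_distrib_left
    using val_A1(2)[OF ca[OF Stab_G(2) v]] by (intro sum.cong) (simp_all add: mult.assoc[symmetric])
qed

lemma ind_add: assumes v: "v \<in> carrier \<rho>" and w: "w \<in> carrier \<rho>" shows "ind (v \<oplus>\<^bsub>\<rho>\<^esub> w) = ind v + ind w"
  unfolding ind_eq sum.distrib[symmetric]
proof (intro sum.cong refl)
  fix g assume "g \<in> Stab i'"
  then have g: "inv g \<in> Stab i'" by (rule Stab_G)
  show "val (ca (inv g) (v \<oplus>\<^bsub>\<rho>\<^esub> w)) * \<gamma> g * \<gamma> (inv \<kappa> i') =
    val (ca (inv g) v) * \<gamma> g * \<gamma> (inv \<kappa> i') + val (ca (inv g) w) * \<gamma> g * \<gamma> (inv \<kappa> i')"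
    unfolding X_rep(5)[OF x conj_in_Stab[OF P g] v w] val_add[OF ca[OF g v] ca[OF g w]] by (simp only: distrib_right)
qed

lemma ind_smult: assumes v: "v \<in> carrier \<rho>" shows "ind (c \<odot>\<^bsub>\<rho>\<^esub> v) = sc c * ind v"
  unfolding ind_eq sum_distrib_left
proof (intro sum.cong refl)
  fix g assume "g \<in> Stab i'"
  then have g: "inv g \<in> Stab i'" by (rule Stab_G)
  show "val (ca (inv g) (c \<odot>\<^bsub>\<rho>\<^esub> v)) * \<gamma> g * \<gamma> (inv \<kappa> i') = sc c * (val (ca (inv g) v) * \<gamma> g * \<gamma> (inv \<kappa> i'))"
    unfolding X_rep(6)[OF x conj_in_Stab[OF P g] v] val_smult[OF ca[OF g v]] by (simp only: mult.assoc)
qed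

text \<open>Replacing g by g (\<kappa>^-1 h \<kappa>) permutes the stabilizer of i' and converts the
  action of h on the argument into right multiplication by h.\<close>

lemma ind_act: assumes h: "h \<in> Stab i" and v: "v \<in> carrier \<rho>" shows "ind (act \<rho> h v) = ind v * \<gamma> h"
proof -
  let ?K = "\<kappa> i'" and ?h = "inv \<kappa> i' \<otimes> h \<otimes> \<kappa> i'"
  have i: "i \<in> verts Q" by (rule X_verts[OF x])
  have hG: "h \<in> carrier G" "va h i = i" using h i by (auto simp: Stab_iff)
  have h': "?h \<in> Stab i'"
    using hG OP i va_inv(1)[OF OP(3) i] by (simp add: Stab_iff va_mult)
  have inv': "inv ?h \<in> Stab i'" by (rule Stab_G(2)[OF h'])
  note G' = Stab_G(1)[OF h'] Stab_G(1)[OF inv']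
  note sub = subgroup_Stab[OF OP(1)]
  have bij: "bij_betw (\<lambda>g. g \<otimes> ?h) (Stab i') (Stab i')"
    by (rule bij_betwI[of _ _ _ "\<lambda>g. g \<otimes> inv ?h"])
      (use subgroup.m_closed[OF sub] h' inv' G' Stab_G(1) in \<open>simp_all add: m_assoc\<close>)
  have "ind (act \<rho> h v) = (\<Sum>g\<in>Stab i'. val (ca (inv (g \<otimes> ?h)) (act \<rho> h v)) * \<gamma> (g \<otimes> ?h) * \<gamma> (inv ?K))"
    unfolding ind_eq by (rule sum.reindex_bij_betw[OF bij, symmetric])
  also have "\<dots> = (\<Sum>g\<in>Stab i'. val (ca (inv g) v) * \<gamma> g * \<gamma> (inv ?K) * \<gamma> h)"
  proof (intro sum.cong refl)
    fix g assume g: "g \<in> Stab i'"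
    note gG = Stab_G(1)[OF g]
    have gh: "inv (g \<otimes> ?h) \<in> Stab i'" using Stab_G(2) subgroup.m_closed[OF sub g h'] by blast
    have 1: "h \<otimes> (?K \<otimes> inv (g \<otimes> ?h) \<otimes> inv ?K) = ?K \<otimes> inv g \<otimes> inv ?K"
      using hG OP(3) gG by (simp add: m_assoc inv_mult_group cancel_inv)
    have 2: "g \<otimes> ?h \<otimes> inv ?K = g \<otimes> inv ?K \<otimes> h" using hG OP(3) gG by (simp add: m_assoc)
    have 3: "\<gamma> (g \<otimes> ?h) * \<gamma> (inv ?K) = \<gamma> g * \<gamma> (inv ?K) * \<gamma> h"
      unfolding \<gamma>_mult[OF m_closed[OF gG G'(1)] inv_closed[OF OP(3)], symmetric] 2
        \<gamma>_mult[OF m_closed[OF gG inv_closed[OF OP(3)]] hG(1)] \<gamma>_mult[OF gG inv_closed[OF OP(3)]] ..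
    have "ca (inv (g \<otimes> ?h)) (act \<rho> h v) = ca (inv g) v"
      unfolding X_rep(7)[OF x h conj_in_Stab[OF P gh] v, symmetric] 1 ..
    then show "val (ca (inv (g \<otimes> ?h)) (act \<rho> h v)) * \<gamma> (g \<otimes> ?h) * \<gamma> (inv ?K) = val (ca (inv g) v) * \<gamma> g * \<gamma> (inv ?K) * \<gamma> h"
      using 3 by (simp add: mult.assoc)
  qed
  also have "\<dots> = ind v * \<gamma> h" unfolding ind_eq sum_distrib_right ..
  finally show ?thesis .
qed

lemma ind_E: assumes v: "v \<in> carrier \<rho>" shows "ind v * E i = ind v"
  unfolding ind_eq sum_distrib_right
proof (intro sum.cong refl)
  fix g assume g: "g \<in> Stab i'"
  have i: "i \<in> verts Q" by (rule X_verts[OF x])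
  have "va g i' = i'" using g OP(1) by (simp add: Stab_iff)
  moreover have "va (inv \<kappa> i') i' = i" using va_inv(1)[OF OP(3) i] OP(4) by simp
  ultimately have e1: "E i' * \<gamma> g * \<gamma> (inv \<kappa> i') = \<gamma> g * \<gamma> (inv \<kappa> i') * E i"
    using E_\<gamma>[OF OP(1) Stab_G(1)[OF g]] E_\<gamma>[OF OP(1) inv_closed[OF OP(3)]] by (simp add: mult.assoc)
  have e2: "val (ca (inv g) v) * E i' = val (ca (inv g) v)"
    by (rule ZZ_E[OF val_ZZ[OF ca[OF Stab_G(2)[OF g] v]] OP(1)])
  have "val (ca (inv g) v) * \<gamma> g * \<gamma> (inv \<kappa> i') * E i = val (ca (inv g) v) * (\<gamma> g * \<gamma> (inv \<kappa> i') * E i)"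
    by (simp only: mult.assoc)
  also have "\<dots> = val (ca (inv g) v) * E i' * \<gamma> g * \<gamma> (inv \<kappa> i')" unfolding e1[symmetric] by (simp only: mult.assoc)
  finally show "val (ca (inv g) v) * \<gamma> g * \<gamma> (inv \<kappa> i') * E i = val (ca (inv g) v) * \<gamma> g * \<gamma> (inv \<kappa> i')"
    unfolding e2 .
qed

text \<open>The linear extension of \<open>ind_act\<close> from group elements to k[G_i] e_i. The
  vector w plays the role of u z, formed inside \<rho>.\<close>

lemma ind_KK: assumes u: "u \<in> carrier \<rho>" and z: "z \<in> KK i"
  shows "\<exists>w\<in>carrier \<rho>. \<theta> (i, \<rho>) w = \<theta> (i, \<rho>) u * z \<and> ind w = ind u * z"
  using z unfolding KK_def
proof (induction rule: vs.span_induct_alt)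
  interpret V: vectorspace class_ring \<rho> by (rule X_rep(2)[OF x])
  case base
  have "ind \<zero>\<^bsub>\<rho>\<^esub> = 0" using ind_add[of "\<zero>\<^bsub>\<rho>\<^esub>" "\<zero>\<^bsub>\<rho>\<^esub>"] by simp
  then show ?case using \<theta>_0[OF x] by (intro bexI[of _ "\<zero>\<^bsub>\<rho>\<^esub>"]) auto
next
  case (step c b z)
  interpret V: vectorspace class_ring \<rho> by (rule X_rep(2)[OF x])
  from step obtain w where w: "w \<in> carrier \<rho>" "\<theta> (i, \<rho>) w = \<theta> (i, \<rho>) u * z" "ind w = ind u * z" by blast
  from step obtain h where h: "h \<in> Stab i" "b = E i * \<gamma> h" by (auto simp: \<eta>S_def)
  note au = X_rep(4)[OF x h(1) u]
  have cu: "c \<odot>\<^bsub>\<rho>\<^esub> act \<rho> h u \<in> carrier \<rho>" using V.smult_closed[OF _ au] by simp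
  have e: "\<theta> (i, \<rho>) u * (E i * \<gamma> h) = \<theta> (i, \<rho>) u * \<gamma> h" "ind u * (E i * \<gamma> h) = ind u * \<gamma> h"
    by (simp_all only: mult.assoc[symmetric] \<theta>_E[OF x u] ind_E[OF u])
  have "\<theta> (i, \<rho>) (c \<odot>\<^bsub>\<rho>\<^esub> act \<rho> h u \<oplus>\<^bsub>\<rho>\<^esub> w) = \<theta> (i, \<rho>) u * (sc c * b + z)"
    unfolding \<theta>_facts(2)[OF x cu w(1)] \<theta>_facts(3)[OF x au] \<theta>_facts(13)[OF x h(1) u] w(2) h(2) distrib_left mult_sc e ..
  moreover have "ind (c \<odot>\<^bsub>\<rho>\<^esub> act \<rho> h u \<oplus>\<^bsub>\<rho>\<^esub> w) = ind u * (sc c * b + z)"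
    unfolding ind_add[OF cu w(1)] ind_smult[OF au] ind_act[OF h(1) u] w(3) h(2) distrib_left mult_sc e ..
  ultimately show ?case using V.a_closed[OF cu w(1)] by blast
qed

text \<open>An equivariant map on \<epsilon> \<open>KK i\<close> is left multiplication by its value
  at \<epsilon>, and v0 is the vector that corresponds to \<epsilon>.\<close>

lemma ind_Arr: assumes v0: "v0 \<in> carrier \<rho>" "\<theta> (i, \<rho>) v0 = \<epsilon> (i, \<rho>)"
  shows "v \<in> carrier \<rho> \<Longrightarrow> ind v0 * \<theta> (i, \<rho>) v = ind v" "ind v0 \<in> Arr (i, \<rho>) (j, \<sigma>)"
proof -
  show *: "ind v0 * \<theta> (i, \<rho>) v = ind v" if v: "v \<in> carrier \<rho>" for v
  proof -
    obtain w where w: "w \<in> carrier \<rho>" "\<theta> (i, \<rho>) w = \<theta> (i, \<rho>) v0 * \<theta> (i, \<rho>) v" "ind w = ind v0 * \<theta> (i, \<rho>) v"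
      using ind_KK[OF v0(1) \<theta>_facts(1)[OF x v]] by blast
    have "\<theta> (i, \<rho>) w = \<theta> (i, \<rho>) v" unfolding w(2) v0(2) by (rule \<theta>_facts(6)[OF x v])
    then have "w = v" using inj_onD[OF \<theta>_facts(4)[OF x]] w(1) v by blast
    then show ?thesis using w(3) by simp
  qed
  show "ind v0 \<in> Arr (i, \<rho>) (j, \<sigma>)"
  proof -
    have "ind v0 * \<epsilon> (i, \<rho>) = ind v0" using *[OF v0(1)] unfolding v0(2) .
    then show ?thesis unfolding Arr_def using ind_A1[OF v0(1)] by blast
  qed
qed

text \<open>The summand of g has all its heads at the image of j' under g \<kappa>^-1 \<kappa>2,
  where \<kappa> and \<kappa>2 belong to i' and i2. If this image is j2, the pairs (i', j') and (i2,
  j2) lie in one orbit, hence coincide in \<open>F\<close>. Then g fixes both vertices, and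
  equivariance makes each such summand equal to \<open>val v\<close>.\<close>

lemma comp_ind:
  assumes v: "v \<in> carrier \<rho>" and P2: "(i2, j2) \<in> F i j"
  shows "comp j2 (ind v * \<gamma> (\<kappa> i2)) =
    (if (i2, j2) = (i', j') then sc (of_nat (card (Stab i' \<inter> Stab j'))) * val v else 0)"
proof -
  note O2 = F_orbits[OF ijR P2]
  have fin: "finite (Stab i')" by (rule finite_subset[OF subgroup.subset[OF subgroup_Stab[OF OP(1)]] finite_G])
  let ?m = "\<lambda>g. g \<otimes> inv \<kappa> i' \<otimes> \<kappa> i2"
  let ?q = "\<lambda>g. val (ca (inv g) v)"
  have m: "?m g \<in> carrier G" "\<gamma> g * \<gamma> (inv \<kappa> i') * \<gamma> (\<kappa> i2) = \<gamma> (?m g)" if "g \<in> Stab i'" for g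
    using Stab_G(1)[OF that] OP(3) O2(3) by (simp_all add: \<gamma>_mult)
  have qZ: "?q g \<in> ZZ (j, \<sigma>) i' j'" if "g \<in> Stab i'" for g by (rule val_ZZ[OF ca[OF Stab_G(2)[OF that] v]])
  have "ind v * \<gamma> (\<kappa> i2) = (\<Sum>g\<in>Stab i'. ?q g * \<gamma> (?m g))"
    unfolding ind_eq sum_distrib_right using m(2) by (intro sum.cong) (simp_all add: mult.assoc)
  then have "comp j2 (ind v * \<gamma> (\<kappa> i2)) = (\<Sum>g\<in>Stab i'. comp j2 (?q g * \<gamma> (?m g)))"
    using comp_sum[OF fin, of "\<lambda>g. ?q g * \<gamma> (?m g)" j2] A1_\<gamma>[OF _ m(1)] qZ by (simp add: ZZ_def)
  also have "\<dots> = (\<Sum>g\<in>Stab i'. if va (?m g) j' = j2 then ?q g * \<gamma> (?m g) else 0)"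
    by (intro sum.cong refl) (rule comp_shift[OF qZ m(1) OP(2) O2(2)])
  finally have c: "comp j2 (ind v * \<gamma> (\<kappa> i2)) = (\<Sum>g\<in>Stab i'. if va (?m g) j' = j2 then ?q g * \<gamma> (?m g) else 0)" .
  have i: "i \<in> verts Q" by (rule X_verts[OF x])
  show ?thesis
  proof (cases "(i2, j2) = (i', j')")
    case False
    have "va (?m g) j' \<noteq> j2" if g: "g \<in> Stab i'" for g
    proof
      assume eq: "va (?m g) j' = j2"
      have gi: "va g i' = i'" "g \<in> carrier G" using g OP(1) by (auto simp: Stab_iff)
      have "va (inv \<kappa> i') i' = i" using va_inv(1)[OF OP(3) i] OP(4) by simp
      then have "va (?m g) i' = i2"
        using gi OP O2 by (simp add: va_mult)
      then have "(i2, j2) = (i', j')" using F_unique[OF ijR P P2 m(1)[OF g]] eq by simp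
      then show False using False by blast
    qed
    then have "(\<Sum>g\<in>Stab i'. if va (?m g) j' = j2 then ?q g * \<gamma> (?m g) else 0) = 0" by (intro sum.neutral) simp
    then show ?thesis unfolding c using False by (simp only: if_False)
  next
    case True
    then have eqs: "i2 = i'" "j2 = j'" by auto
    have "(\<Sum>g\<in>Stab i'. if va (?m g) j' = j2 then ?q g * \<gamma> (?m g) else 0) = (\<Sum>g\<in>Stab i'. if g \<in> Stab j' then val v else 0)"
    proof (intro sum.cong refl)
      fix g assume g: "g \<in> Stab i'"
      have mg: "?m g = g" using Stab_G(1)[OF g] OP(3) by (simp add: eqs m_assoc)
      show "(if va (?m g) j' = j2 then ?q g * \<gamma> (?m g) else 0) = (if g \<in> Stab j' then val v else 0)"
      proof (cases "g \<in> Stab j'")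
        case True
        have "inv g \<in> Stab j'" by (rule subgroup.m_inv_closed[OF subgroup_Stab[OF OP(2)] True])
        then have "?q g * \<gamma> g = val v * \<gamma> (inv g) * \<gamma> g" using val_act[OF Stab_G(2)[OF g] _ v] by simp
        also have "\<dots> = val v" by (rule mult_\<gamma>_inv(2)[OF ZZ_E[OF val_ZZ[OF v] OP(1)] OP(1) Stab_G(1)[OF g]])
        finally show ?thesis unfolding mg using True OP(2) by (simp add: Stab_iff eqs)
      next
        case False
        then show ?thesis unfolding mg using Stab_G(1)[OF g] OP(2) by (simp add: Stab_iff eqs)
      qed
    qed
    also have "\<dots> = of_nat (card (Stab i' \<inter> Stab j')) * val v"
      using fin by (simp add: sum.If_cases)
    finally show ?thesis unfolding c using True by (simp add: sc_of_nat)
  qed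
qed

end

text \<open>By \<open>comp_ind\<close> an induced element has a nonzero piece at most at its own
  pair, with the order of a common stabilizer as a factor. So the sum of the induced elements, each
  divided by that order, is a preimage.\<close>

lemma \<Xi>_surj: assumes f: "f \<in> carrier (arrow_space G Q \<phi> \<kappa> F (i, \<rho>) (j, \<sigma>))"
  shows "f \<in> \<Xi> (i, \<rho>) (j, \<sigma>) ` Arr (i, \<rho>) (j, \<sigma>)"
proof -
  note fA = f[unfolded arrow_space_carrier[OF ijR]]
  obtain v0 where v0: "v0 \<in> carrier \<rho>" "\<theta> (i, \<rho>) v0 = \<epsilon> (i, \<rho>)" using \<theta>_facts(5)[OF x] by auto
  let ?c = "\<lambda>P. 1 / of_nat (card (Stab (fst P) \<inter> Stab (snd P))) :: 'k"
  let ?I = "\<lambda>P v. induced (i, \<rho>) (j, \<sigma>) (fst P) (snd P) (f P) v"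
  define p where "p = (\<Sum>P\<in>F i j. sc (?c P) * ?I P v0)"
  have hyp: "f (i', j') v \<in> carrier (tens \<sigma> i' j')"
    "f (i', j') (v \<oplus>\<^bsub>\<rho>\<^esub> w) = f (i', j') v \<oplus>\<^bsub>tens \<sigma> i' j'\<^esub> f (i', j') w"
    "f (i', j') (c \<odot>\<^bsub>\<rho>\<^esub> v) = c \<odot>\<^bsub>tens \<sigma> i' j'\<^esub> f (i', j') v"
    "g \<in> Stab i' \<inter> Stab j' \<Longrightarrow> f (i', j') (act \<rho> (\<kappa> i' \<otimes> g \<otimes> inv \<kappa> i') v) = act (tens \<sigma> i' j') g (f (i', j') v)"
    if "(i', j') \<in> F i j" "v \<in> carrier \<rho>" "w \<in> carrier \<rho>" for i' j' v w c g
    using fA that by blast+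
  have I: "?I P v0 \<in> Arr (i, \<rho>) (j, \<sigma>)" "v \<in> carrier \<rho> \<Longrightarrow> ?I P v0 * \<theta> (i, \<rho>) v = ?I P v"
    "v \<in> carrier \<rho> \<Longrightarrow> ?I P v \<in> A1"
    "\<lbrakk>v \<in> carrier \<rho>; (i2, j2) \<in> F i j\<rbrakk> \<Longrightarrow> comp j2 (?I P v * \<gamma> (\<kappa> i2)) =
      (if (i2, j2) = P then sc (of_nat (card (Stab (fst P) \<inter> Stab (snd P)))) * \<Theta> (j, \<sigma>) (fst P) (snd P) (f P v) else 0)"
    if P: "P \<in> F i j" for P v i2 j2
  proof -
    obtain i' j' where ij: "P = (i', j')" by (cases P)
    note P' = P[unfolded ij]
    note h = hyp(1)[OF P' _ v0(1)] hyp(2)[OF P'] hyp(3)[OF P' _ v0(1)] hyp(4)[OF P' _ v0(1)]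
    show "?I P v0 \<in> Arr (i, \<rho>) (j, \<sigma>)" unfolding ij fst_conv snd_conv by (rule ind_Arr(2)[OF P' h v0])
    show "?I P v0 * \<theta> (i, \<rho>) v = ?I P v" if "v \<in> carrier \<rho>"
      unfolding ij fst_conv snd_conv by (rule ind_Arr(1)[OF P' h v0 that])
    show "?I P v \<in> A1" if "v \<in> carrier \<rho>" unfolding ij fst_conv snd_conv by (rule ind_A1(1)[OF P' h that])
    show "comp j2 (?I P v * \<gamma> (\<kappa> i2)) =
      (if (i2, j2) = P then sc (of_nat (card (Stab (fst P) \<inter> Stab (snd P)))) * \<Theta> (j, \<sigma>) (fst P) (snd P) (f P v) else 0)"
      if "v \<in> carrier \<rho>" "(i2, j2) \<in> F i j"
      unfolding ij fst_conv snd_conv by (rule comp_ind[OF P' h that])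
  qed
  have fin: "finite (F i j)" by (rule finite_F[OF ijR])
  have pA: "p \<in> Arr (i, \<rho>) (j, \<sigma>)"
    unfolding p_def by (intro vs.subspace_sum[OF subspace_Arr] vs.subspace_scale[OF subspace_Arr] I(1))
  have "\<Xi> (i, \<rho>) (j, \<sigma>) p = f"
  proof (rule extensionalityI[of _ "F i j"])
    show "\<Xi> (i, \<rho>) (j, \<sigma>) p \<in> extensional (F i j)" "f \<in> extensional (F i j)" using fA by (simp_all add: \<Xi>_def)
    fix P assume PF: "P \<in> F i j"
    obtain i2 j2 where ij: "P = (i2, j2)" by (cases P)
    note P = PF[unfolded ij] and O = F_orbits[OF ijR PF[unfolded ij]]
    show "\<Xi> (i, \<rho>) (j, \<sigma>) p P = f P"
    proof (rule extensionalityI[of _ "carrier \<rho>"])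
      show "\<Xi> (i, \<rho>) (j, \<sigma>) p P \<in> extensional (carrier \<rho>)" using PF by (simp add: \<Xi>_def)
      show "f P \<in> extensional (carrier \<rho>)" using fA P unfolding ij by blast
      fix v assume v: "v \<in> carrier \<rho>"
      have IA: "?I P v * \<gamma> (\<kappa> i2) \<in> A1" if "P \<in> F i j" for P by (rule A1_\<gamma>[OF I(3)[OF that v] O(3)])
      have "p * \<theta> (i, \<rho>) v * \<gamma> (\<kappa> i2) = (\<Sum>P\<in>F i j. sc (?c P) * (?I P v * \<gamma> (\<kappa> i2)))"
        unfolding p_def sum_distrib_right
      proof (intro sum.cong refl)
        fix P assume "P \<in> F i j"
        from I(2)[OF this v] show "sc (?c P) * ?I P v0 * \<theta> (i, \<rho>) v * \<gamma> (\<kappa> i2) = sc (?c P) * (?I P v * \<gamma> (\<kappa> i2))"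
          by (simp add: mult.assoc)
      qed
      then have "comp j2 (p * \<theta> (i, \<rho>) v * \<gamma> (\<kappa> i2)) = (\<Sum>P\<in>F i j. sc (?c P) * comp j2 (?I P v * \<gamma> (\<kappa> i2)))"
        using comp_sum[OF fin, of "\<lambda>P. sc (?c P) * (?I P v * \<gamma> (\<kappa> i2))" j2] A1_scale[OF IA] comp_scale[OF IA] by simp
      also have "\<dots> = (\<Sum>P'\<in>F i j. if P' = P then \<Theta> (j, \<sigma>) i2 j2 (f (i2, j2) v) else 0)"
      proof (intro sum.cong refl)
        fix P' assume P': "P' \<in> F i j"
        show "sc (?c P') * comp j2 (?I P' v * \<gamma> (\<kappa> i2)) = (if P' = P then \<Theta> (j, \<sigma>) i2 j2 (f (i2, j2) v) else 0)"
        proof (cases "P' = P")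
          case True
          have "of_nat (card (Stab i2 \<inter> Stab j2)) \<noteq> (0 :: 'k)"
            by (rule card_subgroup[OF subgroups_Inter_pair[OF subgroup_Stab[OF O(1)] subgroup_Stab[OF O(2)]]])
          then have "sc (?c P') * sc (of_nat (card (Stab i2 \<inter> Stab j2))) = 1"
            unfolding True ij sc_mult[symmetric] by (simp add: sc_one)
          then show ?thesis unfolding I(4)[OF P' v P] using True ij by (simp add: mult.assoc[symmetric])
        next
          case False
          then show ?thesis unfolding I(4)[OF P' v P] using ij by simp
        qed
      qed
      also have "\<dots> = \<Theta> (j, \<sigma>) i2 j2 (f (i2, j2) v)" using fin PF by simp
      finally have c: "comp j2 (p * \<theta> (i, \<rho>) v * \<gamma> (\<kappa> i2)) = \<Theta> (j, \<sigma>) i2 j2 (f (i2, j2) v)" .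
      show "\<Xi> (i, \<rho>) (j, \<sigma>) p P v = f P v"
        unfolding ij \<Xi>_apply[OF P v] c by (rule untens_\<Theta>[OF P hyp(1)[OF P v v]])
    qed
  qed
  then show ?thesis using pA by blast
qed

lemma \<Xi>_bij: "bij_betw (\<Xi> (i, \<rho>) (j, \<sigma>)) (Arr (i, \<rho>) (j, \<sigma>)) (carrier (arrow_space G Q \<phi> \<kappa> F (i, \<rho>) (j, \<sigma>)))"
  unfolding bij_betw_def using \<Xi>_closed \<Xi>_surj by (auto intro!: inj_onI \<Xi>_inj)

lemma arrow_space_ops:
  "f \<oplus>\<^bsub>arrow_space G Q \<phi> \<kappa> F (i, \<rho>) (j, \<sigma>)\<^esub> g = (\<lambda>P\<in>F i j. \<lambda>v\<in>carrier \<rho>. f P v \<oplus>\<^bsub>tens \<sigma> (fst P) (snd P)\<^esub> g P v)"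
  "c \<odot>\<^bsub>arrow_space G Q \<phi> \<kappa> F (i, \<rho>) (j, \<sigma>)\<^esub> f = (\<lambda>P\<in>F i j. \<lambda>v\<in>carrier \<rho>. c \<odot>\<^bsub>tens \<sigma> (fst P) (snd P)\<^esub> f P v)"
  "\<zero>\<^bsub>arrow_space G Q \<phi> \<kappa> F (i, \<rho>) (j, \<sigma>)\<^esub> = (\<lambda>P\<in>F i j. \<lambda>v\<in>carrier \<rho>. \<zero>\<^bsub>tens \<sigma> (fst P) (snd P)\<^esub>)"
  by (simp_all add: arrow_space_def direct_sum_family_def tens_def[symmetric] hom_space_def twist_simps case_prod_unfold)

lemma \<Xi>_add: assumes p: "p \<in> Arr (i, \<rho>) (j, \<sigma>)" and q: "q \<in> Arr (i, \<rho>) (j, \<sigma>)"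
  shows "\<Xi> (i, \<rho>) (j, \<sigma>) (p + q) = \<Xi> (i, \<rho>) (j, \<sigma>) p \<oplus>\<^bsub>arrow_space G Q \<phi> \<kappa> F (i, \<rho>) (j, \<sigma>)\<^esub> \<Xi> (i, \<rho>) (j, \<sigma>) q"
  unfolding arrow_space_ops \<Xi>_def fst_conv snd_conv
proof (intro restrict_ext)
  fix P v assume PF: "P \<in> F i j" and v: "v \<in> carrier \<rho>"
  have PF': "(fst P, snd P) \<in> F i j" using PF by simp
  have pq: "p \<in> A1" "q \<in> A1" using p q by (simp_all add: Arr_def)
  show "untens (j, \<sigma>) (fst P) (snd P) (comp (snd P) ((p + q) * \<theta> (i, \<rho>) v * \<gamma> (\<kappa> (fst P)))) =
    (\<lambda>P\<in>F i j. \<lambda>v\<in>carrier \<rho>. untens (j, \<sigma>) (fst P) (snd P) (comp (snd P) (p * \<theta> (i, \<rho>) v * \<gamma> (\<kappa> (fst P))))) P v \<oplus>\<^bsub>tens \<sigma> (fst P) (snd P)\<^esub>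
    (\<lambda>P\<in>F i j. \<lambda>v\<in>carrier \<rho>. untens (j, \<sigma>) (fst P) (snd P) (comp (snd P) (q * \<theta> (i, \<rho>) v * \<gamma> (\<kappa> (fst P))))) P v"
    unfolding restrict_apply'[OF PF] restrict_apply'[OF v] distrib_right comp_add[OF piece_A1[OF PF' pq(1) v] piece_A1[OF PF' pq(2) v]]
    by (rule untens_add[OF PF' piece_ZZ[OF PF' p v] piece_ZZ[OF PF' q v]])
qed

lemma \<Xi>_smult: assumes p: "p \<in> Arr (i, \<rho>) (j, \<sigma>)"
  shows "\<Xi> (i, \<rho>) (j, \<sigma>) (sc c * p) = c \<odot>\<^bsub>arrow_space G Q \<phi> \<kappa> F (i, \<rho>) (j, \<sigma>)\<^esub> \<Xi> (i, \<rho>) (j, \<sigma>) p"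
  unfolding arrow_space_ops \<Xi>_def fst_conv snd_conv
proof (intro restrict_ext)
  fix P v assume PF: "P \<in> F i j" and v: "v \<in> carrier \<rho>"
  have PF': "(fst P, snd P) \<in> F i j" using PF by simp
  have p1: "p \<in> A1" using p by (simp add: Arr_def)
  have "sc c * p * \<theta> (i, \<rho>) v * \<gamma> (\<kappa> (fst P)) = sc c * (p * \<theta> (i, \<rho>) v * \<gamma> (\<kappa> (fst P)))" by (simp only: mult.assoc)
  then show "untens (j, \<sigma>) (fst P) (snd P) (comp (snd P) (sc c * p * \<theta> (i, \<rho>) v * \<gamma> (\<kappa> (fst P)))) =
    c \<odot>\<^bsub>tens \<sigma> (fst P) (snd P)\<^esub> (\<lambda>P\<in>F i j. \<lambda>v\<in>carrier \<rho>. untens (j, \<sigma>) (fst P) (snd P) (comp (snd P) (p * \<theta> (i, \<rho>) v * \<gamma> (\<kappa> (fst P))))) P v"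
    unfolding restrict_apply'[OF PF] restrict_apply'[OF v]
    by (simp only: comp_scale[OF piece_A1[OF PF' p1 v]] untens_smult[OF PF' piece_ZZ[OF PF' p v]])
qed

lemma \<Xi>_0: "\<Xi> (i, \<rho>) (j, \<sigma>) 0 = \<zero>\<^bsub>arrow_space G Q \<phi> \<kappa> F (i, \<rho>) (j, \<sigma>)\<^esub>"
  unfolding arrow_space_ops \<Xi>_def fst_conv snd_conv
proof (intro restrict_ext)
  fix P v assume PF: "P \<in> F i j" and v: "v \<in> carrier \<rho>"
  have PF': "(fst P, snd P) \<in> F i j" using PF by simp
  interpret V: vectorspace class_ring \<sigma> by (rule X_rep(2)[OF y])
  have z: "\<zero>\<^bsub>tens \<sigma> (fst P) (snd P)\<^esub> \<in> carrier (tens \<sigma> (fst P) (snd P))" by (simp add: tens_simps)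
  have "\<Theta> (j, \<sigma>) (fst P) (snd P) \<zero>\<^bsub>tens \<sigma> (fst P) (snd P)\<^esub> = 0" by (simp add: \<Theta>_def tens_simps)
  then show "untens (j, \<sigma>) (fst P) (snd P) (comp (snd P) (0 * \<theta> (i, \<rho>) v * \<gamma> (\<kappa> (fst P)))) = \<zero>\<^bsub>tens \<sigma> (fst P) (snd P)\<^esub>"
    using untens_\<Theta>[OF PF' z] by (simp add: comp_0)
qed

end

definition \<alpha> :: "('v \<times> ('g, 'k, 'r) rep) \<times> ('v \<times> 'v \<Rightarrow> 'r \<Rightarrow> ('v, 'e) path \<Rightarrow> 'r) \<times> ('v \<times> ('g, 'k, 'r) rep) \<Rightarrow> 'a" where
  "\<alpha> = (\<lambda>(x, b, y). inv_into (Arr x y) (\<Xi> x y) b)"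

lemma arrow_basis:
  assumes x: "x \<in> X" and y: "y \<in> X"
  shows "b \<in> bas x y \<Longrightarrow> \<alpha> (x, b, y) \<in> Arr x y"
    "\<lbrakk>finite T; T \<subseteq> bas x y; (\<Sum>b\<in>T. sc (c b) * \<alpha> (x, b, y)) = 0; b \<in> T\<rbrakk> \<Longrightarrow> c b = 0"
    "Arr x y \<subseteq> vs.span ((\<lambda>b. \<alpha> (x, b, y)) ` bas x y)"
proof -
  obtain i \<rho> j \<sigma> where xy: "x = (i, \<rho>)" "y = (j, \<sigma>)" by (cases x, cases y)
  note x' = x[unfolded xy] and y' = y[unfolded xy]
  have bas: "vectorspace.basis class_ring (arrow_space G Q \<phi> \<kappa> F x y) (bas x y)"
    by (rule bas_basis[OF x y])
  note tb = transported_basis[OF subspace_Arr[OF x' y'] \<Xi>_bij[OF x' y'] \<Xi>_add[OF x' y'] \<Xi>_smult[OF x' y']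
      \<Xi>_0[OF x' y'] bas[unfolded xy]]
  show "b \<in> bas x y \<Longrightarrow> \<alpha> (x, b, y) \<in> Arr x y"
    unfolding xy \<alpha>_def prod.case by (rule tb(1))
  show "\<lbrakk>finite T; T \<subseteq> bas x y; (\<Sum>b\<in>T. sc (c b) * \<alpha> (x, b, y)) = 0; b \<in> T\<rbrakk> \<Longrightarrow> c b = 0"
    unfolding xy \<alpha>_def prod.case by (rule tb(2))
  show "Arr x y \<subseteq> vs.span ((\<lambda>b. \<alpha> (x, b, y)) ` bas x y)"
    unfolding xy \<alpha>_def prod.case by (rule tb(3))
qed

end

section \<open>The path algebra of the associated quiver as a corner\<close>

context assoc_quiver_model
begin

lemma \<gamma>1_AA: assumes z: "z \<in> AA" shows "\<gamma> \<one> * z = z" "z * \<gamma> \<one> = z"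
proof -
  obtain a where "a \<in> carrier SA" "z = embed a" using z unfolding AA_eq_embed by blast
  then show "\<gamma> \<one> * z = z" "z * \<gamma> \<one> = z" using embed_unit by blast+
qed

text \<open>An indexed form of fullness, in which scalars are absorbed into z. It allows the unit to
  be inserted between two factors, and it later provides the witnesses of
  \<open>full_idempotent\<close>.\<close>

lemma full_sum: "\<exists>(n::nat) x z w. (\<forall>t<n. x t \<in> X \<and> z t \<in> A0 \<and> w t \<in> A0) \<and> \<gamma> \<one> = (\<Sum>t<n. z t * \<epsilon> (x t) * w t)"
  using full
proof (induction rule: vs.span_induct_alt)
  case base
  show ?case by (intro exI[of _ "0 :: nat"]) simp
next
  case (step c b v)
  then obtain n x z w where IH: "\<forall>t<n. x t \<in> X \<and> z t \<in> A0 \<and> w t \<in> A0" "v = (\<Sum>t<(n::nat). z t * \<epsilon> (x t) * w t)" by blast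
  from step obtain x0 z0 w0 where b: "b = z0 * \<epsilon> x0 * w0" "x0 \<in> X" "z0 \<in> A0" "w0 \<in> A0" by blast
  let ?x = "x(n := x0)" and ?z = "z(n := sc c * z0)" and ?w = "w(n := w0)"
  have "(\<Sum>t<n. ?z t * \<epsilon> (?x t) * ?w t) = v" unfolding IH(2) by (intro sum.cong) auto
  then have "sc c * b + v = (\<Sum>t<Suc n. ?z t * \<epsilon> (?x t) * ?w t)" by (simp add: b(1) mult.assoc add.commute)
  moreover have "\<forall>t<Suc n. ?x t \<in> X \<and> ?z t \<in> A0 \<and> ?w t \<in> A0"
    using IH(1) b vs.subspace_scale[OF subspace_A0 b(3)] by (auto simp: less_Suc_eq)
  ultimately show ?case by blast
qed

text \<open>Multiplying the decomposition of the unit by \<epsilon> y kills all terms whose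
  idempotent is another one. Setting the z of those terms to 0 keeps the index range and leaves
  \<epsilon> y in every term.\<close>

lemma partition:
  assumes y: "y \<in> X"
  obtains n :: nat and z w where "\<And>t. t < n \<Longrightarrow> z t \<in> A0" "\<And>t. t < n \<Longrightarrow> w t \<in> A0"
    "\<And>a. a \<in> A0 \<Longrightarrow> (\<Sum>t<n. z t * \<epsilon> y * w t * a * \<epsilon> y) = a * \<epsilon> y"
    "\<And>a. a \<in> A0 \<Longrightarrow> (\<Sum>t<n. \<epsilon> y * a * z t * \<epsilon> y * w t) = \<epsilon> y * a"
proof -
  obtain n x z w where full: "\<forall>t<(n::nat). x t \<in> X \<and> z t \<in> A0 \<and> w t \<in> A0" "\<gamma> \<one> = (\<Sum>t<n. z t * \<epsilon> (x t) * w t)"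
    using full_sum by blast
  let ?z = "\<lambda>t. if x t = y then z t else 0"
  note \<epsilon>A = \<epsilon>_A0[OF y]
  show ?thesis
  proof (rule that[of n ?z w])
    show "?z t \<in> A0" if "t < n" for t using full that vs.subspace_0[OF subspace_A0] by simp
    show "w t \<in> A0" if "t < n" for t using full that by blast
    fix a assume a: "a \<in> A0"
    have "(\<Sum>t<n. ?z t * \<epsilon> y * w t * a * \<epsilon> y) = (\<Sum>t<n. z t * \<epsilon> (x t) * w t * a * \<epsilon> y)"
    proof (intro sum.cong refl)
      fix t assume "t \<in> {..<n}"
      then have t: "x t \<in> X" "w t \<in> A0" using full by auto
      have 0: "\<epsilon> (x t) * (w t * a) * \<epsilon> y = 0" if "x t \<noteq> y"
        by (rule orthogonal[OF y t(1) that[symmetric] A0_mult[OF t(2) a]])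
      show "?z t * \<epsilon> y * w t * a * \<epsilon> y = z t * \<epsilon> (x t) * w t * a * \<epsilon> y"
        using 0 by (cases "x t = y") (simp_all add: mult.assoc)
    qed
    also have "\<dots> = \<gamma> \<one> * (a * \<epsilon> y)" unfolding full(2) sum_distrib_right by (simp only: mult.assoc)
    also have "\<dots> = a * \<epsilon> y" by (rule \<gamma>1_AA(1)[OF A0_AA[OF A0_mult[OF a \<epsilon>A]]])
    finally show "(\<Sum>t<n. ?z t * \<epsilon> y * w t * a * \<epsilon> y) = a * \<epsilon> y" .
    have "(\<Sum>t<n. \<epsilon> y * a * ?z t * \<epsilon> y * w t) = (\<Sum>t<n. \<epsilon> y * a * z t * \<epsilon> (x t) * w t)"
    proof (intro sum.cong refl)
      fix t assume "t \<in> {..<n}"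
      then have t: "x t \<in> X" "z t \<in> A0" using full by auto
      have 0: "\<epsilon> y * (a * z t) * \<epsilon> (x t) = 0" if "x t \<noteq> y"
        by (rule orthogonal[OF t(1) y that A0_mult[OF a t(2)]])
      show "\<epsilon> y * a * ?z t * \<epsilon> y * w t = \<epsilon> y * a * z t * \<epsilon> (x t) * w t"
        using 0 by (cases "x t = y") (simp_all add: mult.assoc[symmetric])
    qed
    also have "\<dots> = \<epsilon> y * a * \<gamma> \<one>" unfolding full(2) sum_distrib_left by (simp only: mult.assoc)
    also have "\<dots> = \<epsilon> y * a" by (rule \<gamma>1_AA(2)[OF A0_AA[OF A0_mult[OF \<epsilon>A a]]])
    finally show "(\<Sum>t<n. \<epsilon> y * a * ?z t * \<epsilon> y * w t) = \<epsilon> y * a" .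
  qed
qed

abbreviation "QG \<equiv> assoc_quiver X bas"

lemma QG_simps: "verts QG = X" "tail QG (x, b, y) = x" "head QG (x, b, y) = y"
  "(x, b, y) \<in> arcs QG \<longleftrightarrow> x \<in> X \<and> y \<in> X \<and> b \<in> bas x y"
  by (auto simp: assoc_quiver_def)

lemma wf_QG: "wf_digraph QG"
  by unfold_locales (auto simp: assoc_quiver_def)

sublocale QG: wf_digraph QG by (rule wf_QG)

lemma \<alpha>_facts: assumes b: "b \<in> arcs QG"
  shows "tail QG b \<in> X" "head QG b \<in> X" "\<alpha> b \<in> A1" "\<epsilon> (head QG b) * \<alpha> b = \<alpha> b" "\<alpha> b * \<epsilon> (tail QG b) = \<alpha> b"
proof -
  obtain x b' y where 1: "b = (x, b', y)" by (cases b)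
  have 2: "x \<in> X" "y \<in> X" "b' \<in> bas x y" using b unfolding 1 QG_simps by auto
  show "tail QG b \<in> X" "head QG b \<in> X" using 2 by (simp_all add: 1 QG_simps)
  show "\<alpha> b \<in> A1" "\<epsilon> (head QG b) * \<alpha> b = \<alpha> b" "\<alpha> b * \<epsilon> (tail QG b) = \<alpha> b"
    using arrow_basis(1)[OF 2] by (simp_all add: 1 QG_simps Arr_def)
qed

lemma \<epsilon>_\<epsilon>: "x \<in> X \<Longrightarrow> y \<in> X \<Longrightarrow> \<epsilon> y * \<epsilon> x = (if x = y then \<epsilon> x else 0)"
  using orthogonal[of x y "\<epsilon> x"] \<epsilon>_A0[of x] \<epsilon>_idem[of x] by (auto simp: mult.assoc)

text \<open>The arrows with the end points of b give a linearly independent family, so the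
  coordinate dual to b extends to a functional on the whole ring. Nothing is claimed about arrows
  with other end points.\<close>

lemma dual_functional:
  assumes b: "b \<in> arcs QG"
  obtains lam :: "'a \<Rightarrow> 'k" where "\<And>u v. lam (u + v) = lam u + lam v" "\<And>c u. lam (sc c * u) = c * lam u"
    "\<And>d. \<lbrakk>d \<in> arcs QG; tail QG d = tail QG b; head QG d = head QG b\<rbrakk> \<Longrightarrow> lam (\<alpha> d) = (if d = b then 1 else 0)"
proof -
  obtain x b' y where 1: "b = (x, b', y)" by (cases b)
  have x: "x \<in> X" "y \<in> X" and b': "b' \<in> bas x y" using b unfolding 1 QG_simps by auto
  let ?A = "\<lambda>c. \<alpha> (x, c, y)"
  have inj: "inj_on ?A (bas x y)"
  proof (rule inj_onI, rule ccontr)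
    fix c d assume c: "c \<in> bas x y" and d: "d \<in> bas x y" and eq: "?A c = ?A d" and ne: "c \<noteq> d"
    have "(\<Sum>e\<in>{c, d}. sc (if e = c then 1 else - 1) * ?A e) = 0"
      using ne eq by (simp add: sc_uminus sc_one)
    from arrow_basis(2)[OF x _ _ this, of c] c d show False by simp
  qed
  have ind: "vs.independent (?A ` bas x y)"
    unfolding vs.independent_explicit_module
  proof (intro allI impI)
    fix T u v assume T: "finite T" "T \<subseteq> ?A ` bas x y" and s: "(\<Sum>v\<in>T. sc (u v) * v) = 0" and v: "v \<in> T"
    obtain S where S: "S \<subseteq> bas x y" "T = ?A ` S" using T(2) by (meson subset_imageE)
    have iS: "inj_on ?A S" by (rule inj_on_subset[OF inj S(1)])
    have fS: "finite S" using T(1) finite_imageD[OF _ iS] S(2) by simp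
    obtain c where c: "c \<in> S" "v = ?A c" using v S(2) by blast
    have "(\<Sum>e\<in>S. sc (u (?A e)) * ?A e) = 0" using s unfolding S(2) sum.reindex[OF iS] by simp
    from arrow_basis(2)[OF x fS S(1) this c(1)] show "u v = 0" using c(2) by simp
  qed
  interpret L: vector_space_pair "\<lambda>c x. sc c * x" "(*) :: 'k \<Rightarrow> 'k \<Rightarrow> 'k"
    by unfold_locales (simp_all add: algebra_simps)
  from L.linear_independent_extend[OF ind, of "\<lambda>v. if v = ?A b' then 1 else 0"]
  obtain lam where l: "Vector_Spaces.linear (\<lambda>c x. sc c * x) ((*) :: 'k \<Rightarrow> 'k \<Rightarrow> 'k) lam"
    "\<forall>v\<in>?A ` bas x y. lam v = (if v = ?A b' then 1 else 0)" by blast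
  interpret l: Vector_Spaces.linear "\<lambda>c x. sc c * x" "(*) :: 'k \<Rightarrow> 'k \<Rightarrow> 'k" lam by (rule l(1))
  show ?thesis
  proof (rule that[of lam])
    show "lam (u + v) = lam u + lam v" for u v by (rule l.add)
    show "lam (sc c * u) = c * lam u" for c u by (rule l.scale)
    fix d assume d: "d \<in> arcs QG" "tail QG d = tail QG b" "head QG d = head QG b"
    obtain d' where d': "d = (x, d', y)" "d' \<in> bas x y" using d 1 by (cases d) (auto simp: QG_simps)
    show "lam (\<alpha> d) = (if d = b then 1 else 0)"
      using l(2) d' b' inj_onD[OF inj, of d' b'] by (auto simp: 1)
  qed
qed

text \<open>
  Reads off the coefficient of one arrow by a map that is linear over the semisimple part \<open>A0\<close>;
  it is obtained by averaging a dual functional over the partition of unity.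
\<close>

lemma dual_A0_linear:
  assumes b: "b \<in> arcs QG"
  obtains D :: "'a \<Rightarrow> 'a" where "\<And>p q. D (p + q) = D p + D q" "\<And>p. p \<in> A1 \<Longrightarrow> D p \<in> AA"
    "\<And>a p. \<lbrakk>a \<in> A0; p \<in> A1\<rbrakk> \<Longrightarrow> D (a * p) = a * D p"
    "\<And>d. d \<in> arcs QG \<Longrightarrow> D (\<alpha> d) = (if d = b then \<epsilon> (head QG b) else 0)"
proof -
  let ?x = "tail QG b" and ?y = "head QG b"
  note x = \<alpha>_facts(1)[OF b] and y = \<alpha>_facts(2)[OF b]
  obtain lam :: "'a \<Rightarrow> 'k" where l: "\<And>u v. lam (u + v) = lam u + lam v" "\<And>c u. lam (sc c * u) = c * lam u"
    "\<And>d. \<lbrakk>d \<in> arcs QG; tail QG d = tail QG b; head QG d = head QG b\<rbrakk> \<Longrightarrow> lam (\<alpha> d) = (if d = b then 1 else 0)"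
    using dual_functional[OF b] by blast
  have l0: "lam 0 = 0" using l(2)[of 0 0] by simp
  have lsum: "lam (sum f S) = (\<Sum>s\<in>S. lam (f s))" if "finite S" for f :: "nat \<Rightarrow> 'a" and S
    using that by (induction S rule: finite_induct) (simp_all add: l0 l(1))
  obtain n z w where part: "\<And>t. t < n \<Longrightarrow> z t \<in> A0" "\<And>t. t < n \<Longrightarrow> w t \<in> A0"
    "\<And>a. a \<in> A0 \<Longrightarrow> (\<Sum>t<(n::nat). z t * \<epsilon> ?y * w t * a * \<epsilon> ?y) = a * \<epsilon> ?y"
    "\<And>a. a \<in> A0 \<Longrightarrow> (\<Sum>t<n. \<epsilon> ?y * a * z t * \<epsilon> ?y * w t) = \<epsilon> ?y * a"
    using partition[OF y] by blast
  define D where "D p = (\<Sum>t<n. sc (lam (\<epsilon> ?y * w t * p * \<epsilon> ?x)) * (z t * \<epsilon> ?y))" for p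
  note \<epsilon>y = \<epsilon>_A0[OF y]
  show ?thesis
  proof (rule that[of D])
    show "D (p + q) = D p + D q" for p q
      unfolding D_def distrib_left distrib_right l(1) sc_add sum.distrib ..
    show "D p \<in> AA" if "p \<in> A1" for p
      unfolding D_def
    proof (rule vs.subspace_sum[OF subspace_AA])
      fix t assume "t \<in> {..<n}"
      then have "z t \<in> A0" using part(1) by simp
      then show "sc (lam (\<epsilon> ?y * w t * p * \<epsilon> ?x)) * (z t * \<epsilon> ?y) \<in> AA"
        by (intro vs.subspace_scale[OF subspace_AA] A0_AA A0_mult \<epsilon>y)
    qed
    show "D (a * p) = a * D p" if a: "a \<in> A0" and p: "p \<in> A1" for a p
    proof -
      \<comment> \<open>This is the source of linearity over \<open>A0\<close>. By Schur the
        elements \<epsilon> y w_t a z_s \<epsilon> y are multiples c t s of \<epsilon> y. One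
        partition formula, applied to \<epsilon> y w_t a, brings these scalars out of
        \<open>lam\<close>; the other sums them against the z_t to a z_s \<epsilon> y.\<close>
      have "\<forall>t s. \<exists>c. t < n \<longrightarrow> s < n \<longrightarrow> \<epsilon> ?y * (w t * a * z s) * \<epsilon> ?y = sc c * \<epsilon> ?y"
        using schur[OF y A0_mult[OF A0_mult[OF part(2) a] part(1)]] by blast
      then obtain c where c: "\<And>t s. t < n \<Longrightarrow> s < n \<Longrightarrow> \<epsilon> ?y * (w t * a * z s) * \<epsilon> ?y = sc (c t s) * \<epsilon> ?y"
        by metis
      have lt: "lam (\<epsilon> ?y * w t * (a * p) * \<epsilon> ?x) = (\<Sum>s<n. c t s * lam (\<epsilon> ?y * w s * p * \<epsilon> ?x))" if t: "t < n" for t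
      proof -
        have "\<epsilon> ?y * w t * (a * p) * \<epsilon> ?x = (\<epsilon> ?y * (w t * a)) * p * \<epsilon> ?x" by (simp only: mult.assoc)
        also have "\<dots> = (\<Sum>s<n. \<epsilon> ?y * (w t * a) * z s * \<epsilon> ?y * w s) * p * \<epsilon> ?x"
          unfolding part(4)[OF A0_mult[OF part(2)[OF t] a]] ..
        also have "\<dots> = (\<Sum>s<n. sc (c t s) * (\<epsilon> ?y * w s * p * \<epsilon> ?x))"
          unfolding sum_distrib_right
        proof (intro sum.cong refl)
          fix s assume "s \<in> {..<n}"
          then have s: "s < n" by simp
          have e: "\<epsilon> ?y * w s = \<epsilon> ?y * (\<epsilon> ?y * w s)" using \<epsilon>_idem[OF y] by (simp add: mult.assoc[symmetric])
          have "\<epsilon> ?y * (w t * a) * z s * \<epsilon> ?y * w s * p * \<epsilon> ?x = (\<epsilon> ?y * (w t * a * z s) * \<epsilon> ?y) * (w s * p * \<epsilon> ?x)"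
            by (simp only: mult.assoc)
          also have "\<dots> = sc (c t s) * (\<epsilon> ?y * w s * p * \<epsilon> ?x)" unfolding c[OF t s] by (simp only: mult.assoc)
          finally show "\<epsilon> ?y * (w t * a) * z s * \<epsilon> ?y * w s * p * \<epsilon> ?x = sc (c t s) * (\<epsilon> ?y * w s * p * \<epsilon> ?x)" .
        qed
        finally show ?thesis by (simp only: lsum[OF finite_lessThan] l(2))
      qed
      have "D (a * p) = (\<Sum>t<n. \<Sum>s<n. sc (lam (\<epsilon> ?y * w s * p * \<epsilon> ?x)) * (z t * (\<epsilon> ?y * (w t * a * z s) * \<epsilon> ?y)))"
        unfolding D_def
      proof (intro sum.cong refl)
        fix t assume "t \<in> {..<n}"
        then have t: "t < n" by simp
        show "sc (lam (\<epsilon> ?y * w t * (a * p) * \<epsilon> ?x)) * (z t * \<epsilon> ?y) =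
          (\<Sum>s<n. sc (lam (\<epsilon> ?y * w s * p * \<epsilon> ?x)) * (z t * (\<epsilon> ?y * (w t * a * z s) * \<epsilon> ?y)))"
          unfolding lt[OF t] sc_sum sum_distrib_right
        proof (intro sum.cong refl)
          fix s assume "s \<in> {..<n}"
          then have s: "s < n" by simp
          show "sc (c t s * lam (\<epsilon> ?y * w s * p * \<epsilon> ?x)) * (z t * \<epsilon> ?y) =
            sc (lam (\<epsilon> ?y * w s * p * \<epsilon> ?x)) * (z t * (\<epsilon> ?y * (w t * a * z s) * \<epsilon> ?y))"
          proof -
            have "sc (c t s * lam (\<epsilon> ?y * w s * p * \<epsilon> ?x)) = sc (lam (\<epsilon> ?y * w s * p * \<epsilon> ?x)) * sc (c t s)"
              unfolding sc_mult[symmetric] by (simp only: mult.commute)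
            moreover have "z t * (\<epsilon> ?y * (w t * a * z s) * \<epsilon> ?y) = sc (c t s) * (z t * \<epsilon> ?y)"
              unfolding c[OF t s] by (rule mult_sc)
            ultimately show ?thesis by (simp only: mult.assoc)
          qed
        qed
      qed
      also have "\<dots> = (\<Sum>s<n. \<Sum>t<n. sc (lam (\<epsilon> ?y * w s * p * \<epsilon> ?x)) * (z t * (\<epsilon> ?y * (w t * a * z s) * \<epsilon> ?y)))"
        by (rule sum.swap)
      also have "\<dots> = (\<Sum>s<n. sc (lam (\<epsilon> ?y * w s * p * \<epsilon> ?x)) * (a * (z s * \<epsilon> ?y)))"
      proof (intro sum.cong refl)
        fix s assume "s \<in> {..<n}"
        then have s: "s < n" by simp
        have "(\<Sum>t<n. z t * (\<epsilon> ?y * (w t * a * z s) * \<epsilon> ?y)) = (\<Sum>t<n. z t * \<epsilon> ?y * w t * (a * z s) * \<epsilon> ?y)"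
          by (simp only: mult.assoc)
        also have "\<dots> = a * (z s * \<epsilon> ?y)" unfolding part(3)[OF A0_mult[OF a part(1)[OF s]]] by (rule mult.assoc)
        finally show "(\<Sum>t<n. sc (lam (\<epsilon> ?y * w s * p * \<epsilon> ?x)) * (z t * (\<epsilon> ?y * (w t * a * z s) * \<epsilon> ?y))) =
            sc (lam (\<epsilon> ?y * w s * p * \<epsilon> ?x)) * (a * (z s * \<epsilon> ?y))"
          unfolding sum_distrib_left[symmetric] by simp
      qed
      also have "\<dots> = a * D p" unfolding D_def sum_distrib_left mult_sc ..
      finally show ?thesis .
    qed
    show "D (\<alpha> d) = (if d = b then \<epsilon> ?y else 0)" if d: "d \<in> arcs QG" for d
    proof (cases "tail QG d = ?x \<and> head QG d = ?y")
      case False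
      note df = \<alpha>_facts[OF d]
      \<comment> \<open>Arrows with another source or target are killed by orthogonality before
        \<open>lam\<close> is applied.\<close>
      have "\<epsilon> ?y * w t * \<alpha> d * \<epsilon> ?x = 0" if t: "t < n" for t
      proof (cases "tail QG d = ?x")
        case True
        then have "head QG d \<noteq> ?y" using False by simp
        then have "\<epsilon> ?y * w t * \<epsilon> (head QG d) = 0" by (rule orthogonal[OF df(2) y _ part(2)[OF t]])
        moreover have "\<epsilon> ?y * w t * \<alpha> d = \<epsilon> ?y * w t * \<epsilon> (head QG d) * \<alpha> d" using df(4) by (simp add: mult.assoc)
        ultimately show ?thesis by simp
      next
        case False
        have "\<alpha> d * \<epsilon> ?x = \<alpha> d * (\<epsilon> (tail QG d) * \<epsilon> ?x)" using df(5) by (simp add: mult.assoc[symmetric])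
        then have "\<alpha> d * \<epsilon> ?x = 0" unfolding \<epsilon>_\<epsilon>[OF x df(1)] using False by auto
        then show ?thesis by (simp add: mult.assoc)
      qed
      then show ?thesis unfolding D_def using False by (auto simp: l0)
    next
      case True
      note df = \<alpha>_facts[OF d]
      have "\<forall>t. \<exists>c. t < n \<longrightarrow> \<epsilon> ?y * w t * \<epsilon> ?y = sc c * \<epsilon> ?y" using schur[OF y part(2)] by blast
      then obtain c where c: "\<And>t. t < n \<Longrightarrow> \<epsilon> ?y * w t * \<epsilon> ?y = sc (c t) * \<epsilon> ?y" by metis
      have "D (\<alpha> d) = (\<Sum>t<n. sc (lam (\<alpha> d)) * (z t * \<epsilon> ?y * w t * \<epsilon> ?y * \<epsilon> ?y))"
        unfolding D_def
      proof (intro sum.cong refl)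
        fix t assume "t \<in> {..<n}"
        then have t: "t < n" by simp
        have "\<epsilon> ?y * w t * \<alpha> d * \<epsilon> ?x = \<epsilon> ?y * w t * \<epsilon> ?y * \<alpha> d" using df(4,5) True by (simp add: mult.assoc)
        also have "\<dots> = sc (c t) * \<alpha> d" unfolding c[OF t] using df(4) True by (simp add: mult.assoc)
        finally have 1: "lam (\<epsilon> ?y * w t * \<alpha> d * \<epsilon> ?x) = c t * lam (\<alpha> d)" by (simp only: l(2))
        have "z t * \<epsilon> ?y * w t * \<epsilon> ?y * \<epsilon> ?y = z t * (\<epsilon> ?y * w t * \<epsilon> ?y)" using \<epsilon>_idem[OF y] by (simp add: mult.assoc)
        also have "\<dots> = sc (c t) * (z t * \<epsilon> ?y)" unfolding c[OF t] by (rule mult_sc)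
        finally have 2: "z t * \<epsilon> ?y * w t * \<epsilon> ?y * \<epsilon> ?y = sc (c t) * (z t * \<epsilon> ?y)" .
        show "sc (lam (\<epsilon> ?y * w t * \<alpha> d * \<epsilon> ?x)) * (z t * \<epsilon> ?y) = sc (lam (\<alpha> d)) * (z t * \<epsilon> ?y * w t * \<epsilon> ?y * \<epsilon> ?y)"
        proof -
          have "sc (c t * lam (\<alpha> d)) = sc (lam (\<alpha> d)) * sc (c t)" unfolding sc_mult[symmetric] by (simp only: mult.commute)
          then show ?thesis unfolding 1 2 by (simp only: mult.assoc)
        qed
      qed
      also have "\<dots> = sc (lam (\<alpha> d)) * (\<epsilon> ?y * \<epsilon> ?y)"
        unfolding sum_distrib_left[symmetric] part(3)[OF \<epsilon>y] ..
      also have "\<dots> = (if d = b then \<epsilon> ?y else 0)"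
        using l(3)[OF d] True \<epsilon>_idem[OF y] by (simp add: sc_one)
      finally show ?thesis .
    qed
  qed
qed

text \<open>Expand every \<alpha> b over the arrows of \<open>Q\<close>. By \<open>freeness\<close>
  the collected coefficients s vanish, and the \<open>A0\<close>-linear map dual to a single new
  arrow c translates this into \<open>w c\<close> = 0.\<close>

lemma arrows_free:
  assumes u: "u \<in> A0" and T: "finite T" "T \<subseteq> arcs QG"
    and w: "\<And>b. b \<in> T \<Longrightarrow> w b \<in> AA" "\<And>b. b \<in> T \<Longrightarrow> w b * \<epsilon> (head QG b) = w b"
    and sum0: "u + (\<Sum>b\<in>T. w b * \<alpha> b) = 0"
  shows "u = 0" "\<And>b. b \<in> T \<Longrightarrow> w b = 0"
proof -
  let ?S = "\<Union>b\<in>T. {a. cw (\<alpha> b) a \<noteq> 0}"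
  have A1: "\<alpha> b \<in> A1" if "b \<in> T" for b using \<alpha>_facts(3) subsetD[OF T(2) that] by blast
  have S: "finite ?S" "?S \<subseteq> arcs Q" using T(1) A1_cw(4,5)[OF A1] by auto
  have \<alpha>S: "\<alpha> b = (\<Sum>a\<in>?S. cw (\<alpha> b) a * AR a)" if b: "b \<in> T" for b
  proof -
    have "\<alpha> b = (\<Sum>a | cw (\<alpha> b) a \<noteq> 0. cw (\<alpha> b) a * AR a)" by (rule A1_cw(6)[OF A1[OF b]])
    also have "\<dots> = (\<Sum>a\<in>?S. cw (\<alpha> b) a * AR a)" using S(1) b by (intro sum.mono_neutral_left) auto
    finally show ?thesis .
  qed
  define s where "s a = (\<Sum>b\<in>T. w b * cw (\<alpha> b) a)" for a
  have "(\<Sum>b\<in>T. w b * \<alpha> b) = (\<Sum>b\<in>T. \<Sum>a\<in>?S. w b * cw (\<alpha> b) a * AR a)"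
  proof (intro sum.cong refl)
    fix b assume b: "b \<in> T"
    have "w b * \<alpha> b = w b * (\<Sum>a\<in>?S. cw (\<alpha> b) a * AR a)" by (rule arg_cong[OF \<alpha>S[OF b]])
    then show "w b * \<alpha> b = (\<Sum>a\<in>?S. w b * cw (\<alpha> b) a * AR a)" unfolding sum_distrib_left mult.assoc .
  qed
  also have "\<dots> = (\<Sum>a\<in>?S. s a * AR a)" unfolding s_def sum_distrib_right by (rule sum.swap)
  finally have s0: "u + (\<Sum>a\<in>?S. s a * AR a) = 0" using sum0 by simp
  have sA: "s a \<in> AA" for a unfolding s_def
    by (intro vs.subspace_sum[OF subspace_AA] AA_mult w(1) A0_AA A1_cw(2)[OF A1])
  have sE: "s a * E (head Q a) = s a" if a: "a \<in> ?S" for a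
    unfolding s_def sum_distrib_right
    using A1_cw(3)[OF A1 subsetD[OF S(2) a]] by (intro sum.cong refl) (simp add: mult.assoc)
  show "u = 0" by (rule freeness(1)[OF u S sA sE s0])
  have sz: "s a = 0" if "a \<in> ?S" for a by (rule freeness(2)[OF u S sA sE s0 that])
  show "w c = 0" if c: "c \<in> T" for c
  proof -
    note cQ = subsetD[OF T(2) c]
    obtain D where D: "\<And>p q. D (p + q) = D p + D q" "\<And>p. p \<in> A1 \<Longrightarrow> D p \<in> AA"
      "\<And>a p. \<lbrakk>a \<in> A0; p \<in> A1\<rbrakk> \<Longrightarrow> D (a * p) = a * D p"
      "\<And>d. d \<in> arcs QG \<Longrightarrow> D (\<alpha> d) = (if d = c then \<epsilon> (head QG c) else 0)"
      using dual_A0_linear[OF cQ] by blast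
    have "D 0 + D 0 = D 0 + 0" using D(1)[of 0 0] by simp
    then have D0: "D 0 = 0" by (rule add_left_imp_eq)
    have Dsum: "D (sum f S') = (\<Sum>s\<in>S'. D (f s))" if "finite S'" for f :: "'e \<Rightarrow> 'a" and S'
      using that by (induction S' rule: finite_induct) (simp_all add: D0 D(1))
    have Da: "D (\<alpha> b) = (\<Sum>a\<in>?S. cw (\<alpha> b) a * D (AR a))" if b: "b \<in> T" for b
    proof -
      have "D (\<alpha> b) = D (\<Sum>a\<in>?S. cw (\<alpha> b) a * AR a)" by (rule arg_cong[OF \<alpha>S[OF b]])
      also have "\<dots> = (\<Sum>a\<in>?S. cw (\<alpha> b) a * D (AR a))"
        unfolding Dsum[OF S(1)]
        by (intro sum.cong refl D(3) A1_cw(2)[OF A1[OF b]] AR_A1 subsetD[OF S(2)])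
      finally show ?thesis .
    qed
    \<comment> \<open>D is applied only to the \<alpha> b, whose coefficients lie in
      \<open>A0\<close>; the factors \<open>w b\<close> from \<open>AA\<close> stay outside.
      Exchanging the sums makes the coefficients s reappear.\<close>
    have "w c = (\<Sum>b\<in>T. if b = c then w b * \<epsilon> (head QG c) else 0)" using T(1) c w(2)[OF c] by simp
    also have "\<dots> = (\<Sum>b\<in>T. w b * D (\<alpha> b))"
      using D(4) T(2) by (intro sum.cong refl) (auto simp: subset_iff)
    also have "\<dots> = (\<Sum>b\<in>T. \<Sum>a\<in>?S. w b * cw (\<alpha> b) a * D (AR a))"
      by (intro sum.cong refl) (simp only: Da sum_distrib_left mult.assoc)
    also have "\<dots> = (\<Sum>a\<in>?S. s a * D (AR a))" unfolding s_def sum_distrib_right by (rule sum.swap)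
    also have "\<dots> = 0" by (intro sum.neutral ballI) (simp only: sz mult_zero_left)
    finally show ?thesis .
  qed
qed

end

section \<open>The homomorphism from the path algebra of the associated quiver\<close>

context assoc_quiver_model
begin

text \<open>The first arrow traversed becomes the rightmost factor. The vertex u matters only for
  the empty walk, whose value is the idempotent of u.\<close>

primrec walk_elt where
  "walk_elt [] u = \<epsilon> u"
| "walk_elt (b # l) u = walk_elt l (head QG b) * \<alpha> b"

definition path_elt where "path_elt p = walk_elt (fst (snd p)) (fst p)"

abbreviation "PQ \<equiv> path_algebra QG :: ('k, _ \<Rightarrow> 'k) module"

definition \<Psi> where "\<Psi> f = (\<Sum>p | f p \<noteq> 0. sc (f p) * path_elt p)"

definition e :: 'a where "e = (\<Sum>x\<in>X. \<epsilon> x)"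

lemma QG_path_Nil: "(u, [], v) \<in> paths QG \<longleftrightarrow> u = v \<and> u \<in> X"
  by (auto simp: paths_def QG.awalk_Nil_iff QG_simps)

lemma QG_path_Cons: "(u, b # l, v) \<in> paths QG \<longleftrightarrow> b \<in> arcs QG \<and> u = tail QG b \<and> (head QG b, l, v) \<in> paths QG"
  by (auto simp: paths_def QG.awalk_Cons_iff)

lemma QG_trivial_path: assumes "p \<in> paths QG" "fst (snd p) = []" shows "p = (fst p, [], fst p) \<and> fst p \<in> X"
proof -
  obtain u l v where p: "p = (u, l, v)" by (cases p)
  have l: "l = []" using assms(2) by (simp add: p)
  have "u = v" "u \<in> X" using assms(1) unfolding p l QG_path_Nil by blast+
  then show ?thesis unfolding p l fst_conv by blast
qed

lemma walk_elt:
  assumes "(u, l, v) \<in> paths QG"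
  shows "u \<in> X" "walk_elt l u \<in> AA" "walk_elt l u * \<epsilon> u = walk_elt l u"
proof -
  have "u \<in> X \<and> walk_elt l u \<in> AA \<and> walk_elt l u * \<epsilon> u = walk_elt l u"
    using assms
  proof (induction l arbitrary: u)
    case Nil
    then have "u \<in> X" unfolding QG_path_Nil by blast
    then show ?case using \<epsilon>_idem A0_AA[OF \<epsilon>_A0] unfolding walk_elt.simps by blast
  next
    case (Cons b l)
    then have b: "b \<in> arcs QG" "u = tail QG b" "(head QG b, l, v) \<in> paths QG" by (simp_all add: QG_path_Cons)
    note bf = \<alpha>_facts[OF b(1)]
    have "walk_elt l (head QG b) * \<alpha> b \<in> AA" using Cons.IH[OF b(3)] A1_AA[OF bf(3)] AA_mult by blast
    then show ?case using bf by (simp add: b(2) mult.assoc)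
  qed
  then show "u \<in> X" "walk_elt l u \<in> AA" "walk_elt l u * \<epsilon> u = walk_elt l u" by auto
qed

lemma walk_elt_left: "(u, l, v) \<in> paths QG \<Longrightarrow> v \<in> X \<and> \<epsilon> v * walk_elt l u = walk_elt l u"
proof (induction l arbitrary: u)
  case Nil
  then have "u = v" "u \<in> X" unfolding QG_path_Nil by blast+
  then show ?case using \<epsilon>_idem unfolding walk_elt.simps by blast
next
  case (Cons b l)
  then have "v \<in> X \<and> \<epsilon> v * walk_elt l (head QG b) = walk_elt l (head QG b)" unfolding QG_path_Cons by blast
  then show ?case unfolding walk_elt.simps mult.assoc[symmetric] by simp
qed

lemma walk_elt_append: "\<lbrakk>(u, l, v) \<in> paths QG; (v, m, w) \<in> paths QG\<rbrakk> \<Longrightarrow> walk_elt (l @ m) u = walk_elt m v * walk_elt l u"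
proof (induction l arbitrary: u)
  case Nil
  then show ?case using walk_elt(3)[of v m w] by (simp add: QG_path_Nil)
next
  case (Cons b l)
  then show ?case by (simp add: QG_path_Cons mult.assoc)
qed

lemma \<Psi>_sum: "\<lbrakk>finite T; {p. f p \<noteq> 0} \<subseteq> T\<rbrakk> \<Longrightarrow> \<Psi> f = (\<Sum>p\<in>T. sc (f p) * path_elt p)"
  unfolding \<Psi>_def by (intro sum.mono_neutral_left) auto

lemma \<Psi>_add: assumes f: "f \<in> carrier PQ" and g: "g \<in> carrier PQ" shows "\<Psi> (\<lambda>p. f p + g p) = \<Psi> f + \<Psi> g"
proof -
  let ?T = "{p. f p \<noteq> 0} \<union> {p. g p \<noteq> 0}"
  have T: "finite ?T" using f g by (simp add: carrier_path_algebra)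
  have sub: "{p. f p + g p \<noteq> 0} \<subseteq> ?T" by auto
  show ?thesis
    unfolding \<Psi>_sum[OF T sub] \<Psi>_sum[OF T Un_upper1] \<Psi>_sum[OF T Un_upper2] sc_add distrib_right sum.distrib ..
qed

lemma \<Psi>_scale: assumes f: "f \<in> carrier PQ" shows "\<Psi> (\<lambda>p. c * f p) = sc c * \<Psi> f"
proof -
  have T: "finite {p. f p \<noteq> 0}" using f by (simp add: carrier_path_algebra)
  have sub: "{p. c * f p \<noteq> 0} \<subseteq> {p. f p \<noteq> 0}" by auto
  show ?thesis unfolding \<Psi>_sum[OF T sub] unfolding \<Psi>_def sum_distrib_left sc_mult mult.assoc ..
qed

lemma \<Psi>_0: "\<Psi> (\<lambda>_. 0) = 0" by (simp add: \<Psi>_def)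

lemma \<Psi>_unit: "\<Psi> (unit_fun p) = path_elt p"
proof -
  have "{q. unit_fun p q \<noteq> (0 :: 'k)} = {p}" by (auto simp: unit_fun_def)
  then show ?thesis by (simp add: \<Psi>_def unit_fun_def sc_one)
qed

lemma \<Psi>_mult: assumes f: "f \<in> carrier PQ" and g: "g \<in> carrier PQ" shows "\<Psi> (f \<otimes>\<^bsub>PQ\<^esub> g) = \<Psi> f * \<Psi> g"
  using f
proof (induction rule: path_algebra_induct)
  case zero
  then show ?case by (simp add: path_algebra_mult_linear \<Psi>_0)
next
  case (step c p f)
  note pc = path_algebra_closed(4)[OF step(1)] and mc = QG.path_algebra_mult_closed
  have unit: "\<Psi> (unit_fun p \<otimes>\<^bsub>PQ\<^esub> g) = path_elt p * \<Psi> g"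
    using g
  proof (induction rule: path_algebra_induct)
    case zero
    then show ?case by (simp add: path_algebra_mult_linear \<Psi>_0)
  next
    case (step d q g)
    note qc = path_algebra_closed(4)[OF step(1)]
    have pq: "\<Psi> (unit_fun p \<otimes>\<^bsub>PQ\<^esub> unit_fun q) = path_elt p * path_elt q"
    proof -
      obtain u l v where q: "q = (u, l, v)" by (cases q)
      obtain v' m w where p: "p = (v', m, w)" by (cases p)
      note P = \<open>p \<in> paths QG\<close>[unfolded p] and Q = step(1)[unfolded q]
      show ?thesis
      proof (cases "v = v'")
        case True
        have eq: "unit_fun p \<otimes>\<^bsub>PQ\<^esub> unit_fun q = unit_fun (u, l @ m, w)"
          unfolding p q QG.unit_mult_unit[OF P Q] using True by simp
        show ?thesis unfolding eq \<Psi>_unit path_elt_def unfolding p q fst_conv snd_conv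
          using walk_elt_append[OF Q, of m w] P True by simp
      next
        case False
        have "walk_elt m v' * walk_elt l u = walk_elt m v' * \<epsilon> v' * (\<epsilon> v * walk_elt l u)"
          using walk_elt(3)[OF P] walk_elt_left[OF Q] by simp
        also have "\<dots> = walk_elt m v' * (\<epsilon> v' * \<epsilon> v) * walk_elt l u" by (simp only: mult.assoc)
        also have "\<dots> = 0" using \<epsilon>_\<epsilon>[of v v'] walk_elt(1)[OF P] walk_elt_left[OF Q] False by simp
        finally have "path_elt p * path_elt q = 0" unfolding path_elt_def p q fst_conv snd_conv .
        moreover have "unit_fun p \<otimes>\<^bsub>PQ\<^esub> unit_fun q = (\<lambda>_. 0)"
          unfolding p q QG.unit_mult_unit[OF P Q] using False by simp
        ultimately show ?thesis by (simp only: \<Psi>_0)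
      qed
    qed
    have "\<Psi> (unit_fun p \<otimes>\<^bsub>PQ\<^esub> (\<lambda>x. d * unit_fun q x + g x)) = sc d * \<Psi> (unit_fun p \<otimes>\<^bsub>PQ\<^esub> unit_fun q) + \<Psi> (unit_fun p \<otimes>\<^bsub>PQ\<^esub> g)"
      using \<Psi>_add[OF path_algebra_closed(3)[OF mc[OF pc qc], of d] mc[OF pc step(2)]] \<Psi>_scale[OF mc[OF pc qc], of d]
      by (simp only: path_algebra_mult_linear)
    also have "\<dots> = path_elt p * (sc d * path_elt q + \<Psi> g)"
      unfolding pq step(3) distrib_left using mult_sc[of "path_elt p" d "path_elt q"] by simp
    also have "\<dots> = path_elt p * \<Psi> (\<lambda>x. d * unit_fun q x + g x)"
      unfolding \<Psi>_add[OF path_algebra_closed(3)[OF qc] step(2)] \<Psi>_scale[OF qc] \<Psi>_unit ..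
    finally show ?case .
  qed
  have "\<Psi> ((\<lambda>x. c * unit_fun p x + f x) \<otimes>\<^bsub>PQ\<^esub> g) = sc c * \<Psi> (unit_fun p \<otimes>\<^bsub>PQ\<^esub> g) + \<Psi> (f \<otimes>\<^bsub>PQ\<^esub> g)"
    using \<Psi>_add[OF path_algebra_closed(3)[OF mc[OF pc g], of c] mc[OF step(2) g]] \<Psi>_scale[OF mc[OF pc g], of c]
    by (simp only: path_algebra_mult_linear)
  also have "\<dots> = (sc c * path_elt p + \<Psi> f) * \<Psi> g"
    unfolding unit step(3) distrib_right by (simp only: mult.assoc)
  also have "\<dots> = \<Psi> (\<lambda>x. c * unit_fun p x + f x) * \<Psi> g"
    unfolding \<Psi>_add[OF path_algebra_closed(3)[OF pc] step(2)] \<Psi>_scale[OF pc] \<Psi>_unit ..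
  finally show ?case .
qed

lemma \<Psi>_one: "\<Psi> \<one>\<^bsub>PQ\<^esub> = e"
proof -
  have sub: "{p. \<one>\<^bsub>PQ\<^esub> p \<noteq> 0} \<subseteq> (\<lambda>u. (u, [], u)) ` X"
    by (auto simp: path_algebra_def QG_simps split: if_splits)
  have inj: "inj_on (\<lambda>u. (u, [], u)) X" by (simp add: inj_on_def)
  have "\<Psi> \<one>\<^bsub>PQ\<^esub> = (\<Sum>u\<in>X. sc (\<one>\<^bsub>PQ\<^esub> (u, [], u)) * path_elt (u, [], u))"
    unfolding \<Psi>_sum[OF finite_imageI[OF finite_X] sub] sum.reindex[OF inj] o_def ..
  also have "\<dots> = e"
    unfolding e_def by (intro sum.cong) (simp_all add: path_algebra_def QG_simps sc_one path_elt_def)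
  finally show ?thesis .
qed

lemma path_elt_AA: "p \<in> paths QG \<Longrightarrow> path_elt p \<in> AA"
  using walk_elt(2) by (cases p) (auto simp: path_elt_def)

text \<open>Group the nontrivial paths by their first arrow b: the relation takes the form u +
  \<Sum> w b \<alpha> b = 0 with u in \<open>A0\<close>. By \<open>arrows_free\<close> each
  \<open>w b\<close> vanishes, and this is a relation among shorter paths.\<close>

lemma paths_independent:
  assumes "finite T" "T \<subseteq> paths QG" "\<And>p. p \<in> T \<Longrightarrow> length (fst (snd p)) < n"
    "(\<Sum>p\<in>T. sc (c p) * path_elt p) = 0" "p \<in> T"
  shows "c p = 0"
  using assms
proof (induction n arbitrary: T c p)
  case 0
  then show ?case by blast
next
  case (Suc n)
  let ?T0 = "{p \<in> T. fst (snd p) = []}"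
  let ?T1 = "T - ?T0"
  let ?B = "(\<lambda>p. hd (fst (snd p))) ` ?T1"
  \<comment> \<open>\<open>?S b\<close> consists of the remainders of paths in \<open>T\<close>
    after deleting a first arrow b; \<open>?h\<close> puts that arrow back.\<close>
  let ?S = "\<lambda>b. {q. fst q = head QG b \<and> (tail QG b, b # fst (snd q), snd (snd q)) \<in> T}"
  let ?h = "\<lambda>x. (tail QG (fst x), fst x # fst (snd (snd x)), snd (snd (snd x)))"
  let ?g = "\<lambda>p. sc (c p) * path_elt p"
  define w where "w b = (\<Sum>q\<in>?S b. sc (c (?h (b, q))) * path_elt q)" for b
  have form: "\<exists>b l. b \<in> arcs QG \<and> p = (tail QG b, b # l, snd (snd p)) \<and> (head QG b, l, snd (snd p)) \<in> paths QG" if pT: "p \<in> ?T1" for p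
  proof -
    obtain u l v where p: "p = (u, l, v)" by (cases p)
    have "l \<noteq> []" using pT by (simp add: p)
    then obtain b l' where l: "l = b # l'" by (cases l) simp_all
    have "(u, b # l', v) \<in> paths QG" using pT Suc.prems(2) unfolding p l by blast
    then show ?thesis unfolding QG_path_Cons p l by (intro exI[of _ b] exI[of _ l']) simp
  qed
  have bij: "bij_betw ?h (Sigma ?B ?S) ?T1"
  proof (rule bij_betwI[of _ _ _ "\<lambda>p. (hd (fst (snd p)), (head QG (hd (fst (snd p))), tl (fst (snd p)), snd (snd p)))"])
    show "?h \<in> Sigma ?B ?S \<rightarrow> ?T1" by auto
    show "(\<lambda>p. (hd (fst (snd p)), (head QG (hd (fst (snd p))), tl (fst (snd p)), snd (snd p)))) \<in> ?T1 \<rightarrow> Sigma ?B ?S"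
    proof (rule funcsetI)
      fix p assume p: "p \<in> ?T1"
      from form[OF this] obtain b l where b: "p = (tail QG b, b # l, snd (snd p))" by blast
      have "hd (fst (snd p)) = b" "tl (fst (snd p)) = l" using arg_cong[OF b, of "\<lambda>p. fst (snd p)"] by simp_all
      then show "(hd (fst (snd p)), (head QG (hd (fst (snd p))), tl (fst (snd p)), snd (snd p))) \<in> Sigma ?B ?S"
        using p b by auto
    qed
    show "?h (hd (fst (snd p)), (head QG (hd (fst (snd p))), tl (fst (snd p)), snd (snd p))) = p" if "p \<in> ?T1" for p
    proof -
      from form[OF that] obtain b l where b: "p = (tail QG b, b # l, snd (snd p))" by blast
      have "hd (fst (snd p)) = b" "tl (fst (snd p)) = l" using arg_cong[OF b, of "\<lambda>p. fst (snd p)"] by simp_all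
      then show ?thesis using b by simp
    qed
  qed auto
  have finT1: "finite ?T1" using Suc.prems(1) by simp
  have finS: "finite (?S b)" for b
  proof (rule finite_imageD)
    show "finite ((\<lambda>q. ?h (b, q)) ` ?S b)" by (rule finite_subset[OF _ Suc.prems(1)]) auto
    show "inj_on (\<lambda>q. ?h (b, q)) (?S b)" by (auto simp: inj_on_def prod_eq_iff)
  qed
  have BQ: "?B \<subseteq> arcs QG"
  proof
    fix b assume "b \<in> ?B"
    then obtain p where p: "p \<in> ?T1" "b = hd (fst (snd p))" by blast
    from form[OF p(1)] obtain b' l where b: "b' \<in> arcs QG" "p = (tail QG b', b' # l, snd (snd p))" by blast
    have "hd (fst (snd p)) = b'" using arg_cong[OF b(2), of "\<lambda>p. fst (snd p)"] by simp
    then show "b \<in> arcs QG" using b(1) p(2) by simp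
  qed
  have Spath: "q \<in> paths QG" if "q \<in> ?S b" for q b
  proof -
    obtain u l v where q: "q = (u, l, v)" by (cases q)
    have "(tail QG b, b # l, v) \<in> paths QG" "u = head QG b" using that Suc.prems(2) by (auto simp: q)
    then show ?thesis by (simp add: QG_path_Cons q)
  qed
  have "(\<Sum>p\<in>?T1. ?g p) = (\<Sum>x\<in>Sigma ?B ?S. ?g (?h x))" by (rule sum.reindex_bij_betw[OF bij, symmetric])
  also have "\<dots> = (\<Sum>b\<in>?B. \<Sum>q\<in>?S b. ?g (?h (b, q)))"
    using finT1 finS by (subst sum.Sigma) (simp_all add: case_prod_unfold)
  also have "\<dots> = (\<Sum>b\<in>?B. w b * \<alpha> b)"
    unfolding w_def sum_distrib_right
    by (intro sum.cong refl) (auto simp: path_elt_def mult.assoc)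
  finally have T1: "(\<Sum>p\<in>?T1. ?g p) = (\<Sum>b\<in>?B. w b * \<alpha> b)" .
  have "(\<Sum>p\<in>?T0. ?g p) + (\<Sum>b\<in>?B. w b * \<alpha> b) = 0"
    using sum.subset_diff[of ?T0 T ?g] Suc.prems(1,4) unfolding T1 by (simp add: add.commute)
  moreover have "(\<Sum>p\<in>?T0. ?g p) \<in> A0"
  proof (rule vs.subspace_sum[OF subspace_A0], rule vs.subspace_scale[OF subspace_A0])
    fix p assume p: "p \<in> ?T0"
    then have "fst p \<in> X" using Suc.prems(2) QG_trivial_path[of p] by blast
    then show "path_elt p \<in> A0" using p \<epsilon>_A0 by (simp add: path_elt_def)
  qed
  moreover have "w b \<in> AA" for b
    unfolding w_def by (intro vs.subspace_sum[OF subspace_AA] vs.subspace_scale[OF subspace_AA] path_elt_AA Spath)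
  moreover have "w b * \<epsilon> (head QG b) = w b" for b
    unfolding w_def sum_distrib_right
  proof (intro sum.cong refl)
    fix q assume q: "q \<in> ?S b"
    have "path_elt q * \<epsilon> (head QG b) = path_elt q"
      using walk_elt(3)[of "fst q" "fst (snd q)" "snd (snd q)"] Spath[OF q] q by (simp add: path_elt_def)
    then show "sc (c (?h (b, q))) * path_elt q * \<epsilon> (head QG b) = sc (c (?h (b, q))) * path_elt q"
      by (simp only: mult.assoc)
  qed
  ultimately have u0: "(\<Sum>p\<in>?T0. ?g p) = 0" and w0: "\<And>b. b \<in> ?B \<Longrightarrow> w b = 0"
    using arrows_free[of "\<Sum>p\<in>?T0. ?g p" ?B w, OF _ finite_imageI[OF finT1] BQ] by blast+
  show ?case
  proof (cases "p \<in> ?T0")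
    case True
    obtain x where x: "p = (x, [], x)" "x \<in> X"
      using QG_trivial_path[of p] True Suc.prems(2) by blast
    \<comment> \<open>Only trivial paths are left in this sum, and right multiplication by
      \<epsilon> x isolates the one at x.\<close>
    have "(\<Sum>q\<in>?T0. ?g q) * \<epsilon> x = (\<Sum>q\<in>?T0. if q = p then sc (c p) * \<epsilon> x else 0)"
      unfolding sum_distrib_right
    proof (intro sum.cong refl)
      fix q assume q: "q \<in> ?T0"
      obtain y where y: "q = (y, [], y)" "y \<in> X"
        using QG_trivial_path[of q] q Suc.prems(2) by blast
      show "?g q * \<epsilon> x = (if q = p then sc (c p) * \<epsilon> x else 0)"
        using \<epsilon>_\<epsilon>[OF x(2) y(2)] by (auto simp: x(1) y(1) path_elt_def mult.assoc)
    qed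
    also have "\<dots> = sc (c p) * \<epsilon> x" using True Suc.prems(1) by simp
    finally have "sc (c p) * \<epsilon> x = 0" unfolding u0 by simp
    then show ?thesis using \<epsilon>_nonzero[OF x(2)] vs.scale_eq_0_iff[of "c p" "\<epsilon> x"] by simp
  next
    case False
    then have p: "p \<in> ?T1" using Suc.prems(5) by blast
    have "p \<in> ?h ` Sigma ?B ?S" using p bij unfolding bij_betw_def by simp
    then obtain s where s: "p = ?h s" "s \<in> Sigma ?B ?S" by blast
    obtain b q where bq: "s = (b, q)" by (cases s)
    have q: "p = ?h (b, q)" "b \<in> ?B" "q \<in> ?S b" using s unfolding bq by (simp, blast, blast)
    show ?thesis unfolding q(1)
    proof (rule Suc.IH[of "?S b" "\<lambda>q. c (?h (b, q))" q])
      show "finite (?S b)" by (rule finS)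
      show "?S b \<subseteq> paths QG" using Spath by blast
      show "length (fst (snd q)) < n" if "q \<in> ?S b" for q using that Suc.prems(3)[of "(tail QG b, b # fst (snd q), snd (snd q))"] by simp
      show "(\<Sum>q\<in>?S b. sc (c (?h (b, q))) * path_elt q) = 0" using w0[OF q(2)] unfolding w_def .
    qed (rule q(3))
  qed
qed

lemma \<Psi>_inj: "inj_on \<Psi> (carrier PQ)"
proof (rule inj_onI)
  fix f g assume f: "f \<in> carrier PQ" and g: "g \<in> carrier PQ" and eq: "\<Psi> f = \<Psi> g"
  let ?d = "\<lambda>p. f p + (- 1) * g p"
  let ?T = "{p. ?d p \<noteq> 0}"
  have mg: "(\<lambda>p. (- 1) * g p) \<in> carrier PQ" by (rule path_algebra_closed(3)[OF g])
  have d: "?d \<in> carrier PQ" by (rule path_algebra_closed(2)[OF f mg])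
  have "\<Psi> ?d = 0" unfolding \<Psi>_add[OF f mg] \<Psi>_scale[OF g] eq by (simp add: sc_uminus sc_one)
  then have s0: "(\<Sum>p\<in>?T. sc (?d p) * path_elt p) = 0" unfolding \<Psi>_def .
  have T: "finite ?T" "?T \<subseteq> paths QG" using d unfolding carrier_path_algebra by blast+
  have len: "length (fst (snd p)) < Suc (Max ((\<lambda>p. length (fst (snd p))) ` ?T))" if "p \<in> ?T" for p
    using Max_ge[OF finite_imageI[OF T(1)] imageI[OF that], of "\<lambda>p. length (fst (snd p))"] by simp
  have d0: "?d p = 0" for p
  proof (rule ccontr)
    assume "?d p \<noteq> 0"
    then have "p \<in> ?T" by blast
    from paths_independent[OF T len s0 this] \<open>?d p \<noteq> 0\<close> show False by blast
  qed
  show "f = g" using d0 by (auto simp: fun_eq_iff)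
qed

abbreviation (input) "Img \<equiv> \<Psi> ` carrier PQ"

lemma Img_add: assumes "u \<in> Img" "v \<in> Img" shows "u + v \<in> Img"
proof -
  obtain f g where f: "f \<in> carrier PQ" "u = \<Psi> f" and g: "g \<in> carrier PQ" "v = \<Psi> g" using assms by blast
  show ?thesis unfolding f(2) g(2) \<Psi>_add[OF f(1) g(1), symmetric] by (rule imageI[OF path_algebra_closed(2)[OF f(1) g(1)]])
qed

lemma Img_scale: assumes "u \<in> Img" shows "sc c * u \<in> Img"
proof -
  obtain f where f: "f \<in> carrier PQ" "u = \<Psi> f" using assms by blast
  show ?thesis unfolding f(2) \<Psi>_scale[OF f(1), symmetric] by (rule imageI[OF path_algebra_closed(3)[OF f(1)]])
qed

lemma Img_mult: assumes "u \<in> Img" "v \<in> Img" shows "u * v \<in> Img"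
proof -
  obtain f g where f: "f \<in> carrier PQ" "u = \<Psi> f" and g: "g \<in> carrier PQ" "v = \<Psi> g" using assms by blast
  show ?thesis unfolding f(2) g(2) \<Psi>_mult[OF f(1) g(1), symmetric] by (rule imageI[OF QG.path_algebra_mult_closed[OF f(1) g(1)]])
qed

lemma Img_subspace: "vs.subspace Img"
proof (rule vs.subspaceI)
  show "0 \<in> Img" using imageI[OF path_algebra_closed(1), of \<Psi>] unfolding \<Psi>_0 .
qed (rule Img_add, assumption+, rule Img_scale)

lemma Img_path: "p \<in> paths QG \<Longrightarrow> path_elt p \<in> Img"
  using imageI[OF path_algebra_closed(4), of p QG \<Psi>] unfolding \<Psi>_unit .

lemma Arr_Img: assumes x: "x \<in> X" and y: "y \<in> X" and p: "p \<in> Arr x y" shows "p \<in> Img"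
proof -
  have "(\<lambda>b. \<alpha> (x, b, y)) ` bas x y \<subseteq> Img"
  proof (rule image_subsetI)
    fix b assume "b \<in> bas x y"
    then have b: "(x, b, y) \<in> arcs QG" using x y by (simp add: QG_simps)
    have "path_elt (x, [(x, b, y)], y) = \<alpha> (x, b, y)"
      using \<alpha>_facts(4)[OF b] by (simp add: path_elt_def)
    moreover have "(x, [(x, b, y)], y) \<in> paths QG" using QG.arrow_path[OF b] by (simp add: QG_simps)
    ultimately show "\<alpha> (x, b, y) \<in> Img" using Img_path[of "(x, [(x, b, y)], y)"] by simp
  qed
  from vs.span_minimal[OF this Img_subspace] show ?thesis
    using arrow_basis(3)[OF x y] p by blast
qed

text \<open>Products of arrows of \<open>Q\<close> do not pass through the idempotents \<epsilon>,
  so the unit, as a sum of terms z \<epsilon> w, is inserted before the rightmost arrow. The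
  induction hypothesis is then needed with that z as t and with the vertex of that \<epsilon> as x,
  which is why both vary.\<close>

lemma corner_Img:
  assumes z: "z \<in> AA" and x: "x \<in> X" and y: "y \<in> X" and "s \<in> A0" "t \<in> A0"
  shows "\<epsilon> y * s * z * t * \<epsilon> x \<in> Img"
  using z x \<open>t \<in> A0\<close>
proof (induction arbitrary: x t rule: AA_induct)
  case (base z)
  have szt: "s * z * t \<in> A0" by (intro A0_mult base \<open>s \<in> A0\<close>)
  have "\<epsilon> y * s * z * t * \<epsilon> x = \<epsilon> y * (s * z * t) * \<epsilon> x" by (simp only: mult.assoc)
  moreover have "\<epsilon> y * (s * z * t) * \<epsilon> x \<in> Img"
  proof (cases "x = y")
    case True
    obtain c where c: "\<epsilon> y * (s * z * t) * \<epsilon> y = sc c * \<epsilon> y" using schur[OF y szt] by blast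
    have "path_elt (y, [], y) \<in> Img" by (rule Img_path) (simp add: QG_path_Nil y)
    then have "sc c * \<epsilon> y \<in> Img" using Img_scale by (simp add: path_elt_def)
    then show ?thesis using c True by simp
  next
    case False
    show ?thesis unfolding orthogonal[OF base(2) y False szt] by (rule vs.subspace_0[OF Img_subspace])
  qed
  ultimately show ?case by simp
next
  case (arrow z a)
  obtain n x' z' w' where full: "\<forall>i<(n::nat). x' i \<in> X \<and> z' i \<in> A0 \<and> w' i \<in> A0" "\<gamma> \<one> = (\<Sum>i<n. z' i * \<epsilon> (x' i) * w' i)"
    using full_sum by blast
  have "z * AR a = z * \<gamma> \<one> * AR a" using \<gamma>1_AA(2)[OF arrow(1)] by simp
  then have "\<epsilon> y * s * (z * AR a) * t * \<epsilon> x = \<epsilon> y * s * (z * \<gamma> \<one> * AR a) * t * \<epsilon> x" by simp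
  \<comment> \<open>The inserted idempotent is doubled: one copy closes the left factor, which the
    induction hypothesis covers, the other opens the right factor, which lies in
    \<open>Arr\<close>.\<close>
  also have "\<dots> = (\<Sum>i<n. (\<epsilon> y * s * z * z' i * \<epsilon> (x' i)) * (\<epsilon> (x' i) * w' i * AR a * t * \<epsilon> x))"
    unfolding full(2) sum_distrib_left sum_distrib_right
  proof (intro sum.cong refl)
    fix i assume "i \<in> {..<n}"
    then have "\<epsilon> (x' i) * \<epsilon> (x' i) = \<epsilon> (x' i)" using full(1) \<epsilon>_idem by blast
    then have "\<epsilon> (x' i) * (\<epsilon> (x' i) * (w' i * (AR a * (t * \<epsilon> x)))) = \<epsilon> (x' i) * (w' i * (AR a * (t * \<epsilon> x)))"
      unfolding mult.assoc[symmetric] by simp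
    then show "\<epsilon> y * s * (z * (z' i * \<epsilon> (x' i) * w' i) * AR a) * t * \<epsilon> x =
      (\<epsilon> y * s * z * z' i * \<epsilon> (x' i)) * (\<epsilon> (x' i) * w' i * AR a * t * \<epsilon> x)"
      by (simp only: mult.assoc)
  qed
  also have "\<dots> \<in> Img"
  proof (rule vs.subspace_sum[OF Img_subspace], rule Img_mult)
    fix i assume "i \<in> {..<n}"
    then have i: "x' i \<in> X" "z' i \<in> A0" "w' i \<in> A0" using full(1) by auto
    show "\<epsilon> y * s * z * z' i * \<epsilon> (x' i) \<in> Img" by (rule arrow.IH[OF i(1,2)])
    have "\<epsilon> (x' i) * w' i * AR a * t * \<epsilon> x \<in> A1"
      by (intro A1_right A1_left AR_A1 arrow(2) \<epsilon>_A0 arrow.prems A0_mult i)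
    moreover have "\<epsilon> (x' i) * (\<epsilon> (x' i) * w' i * AR a * t * \<epsilon> x) = \<epsilon> (x' i) * w' i * AR a * t * \<epsilon> x"
      using \<epsilon>_idem[OF i(1)] by (simp add: mult.assoc[symmetric])
    moreover have "\<epsilon> (x' i) * w' i * AR a * t * \<epsilon> x * \<epsilon> x = \<epsilon> (x' i) * w' i * AR a * t * \<epsilon> x"
      using \<epsilon>_idem[OF arrow.prems(1)] by (simp add: mult.assoc)
    ultimately have "\<epsilon> (x' i) * w' i * AR a * t * \<epsilon> x \<in> Arr x (x' i)" by (simp add: Arr_def)
    then show "\<epsilon> (x' i) * w' i * AR a * t * \<epsilon> x \<in> Img" by (rule Arr_Img[OF arrow.prems(1) i(1)])
  qed
  finally show ?case .
next
  case (zero u v)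
  have "\<epsilon> y * s * (u + v) * t * \<epsilon> x = \<epsilon> y * s * u * t * \<epsilon> x + \<epsilon> y * s * v * t * \<epsilon> x"
    by (simp only: distrib_left distrib_right)
  then show ?case using Img_add[OF zero(3)[OF zero.prems] zero(4)[OF zero.prems]] by simp
next
  case (step c z)
  have "\<epsilon> y * s * (sc c * z) * t * \<epsilon> x = sc c * (\<epsilon> y * s * z * t * \<epsilon> x)"
    unfolding mult_sc[of "\<epsilon> y * s" c z] by (simp only: mult.assoc)
  then show ?case using Img_scale[OF step(2)[OF step.prems]] by simp
qed

lemma e_A0: "e \<in> A0" unfolding e_def by (intro vs.subspace_sum[OF subspace_A0] \<epsilon>_A0)

lemma \<Psi>_AA: assumes "f \<in> carrier PQ" shows "\<Psi> f \<in> AA"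
  unfolding \<Psi>_def
proof (rule vs.subspace_sum[OF subspace_AA], rule vs.subspace_scale[OF subspace_AA])
  fix p assume "p \<in> {p. f p \<noteq> 0}"
  then have "p \<in> paths QG" using assms unfolding carrier_path_algebra by blast
  then show "path_elt p \<in> AA" by (rule path_elt_AA)
qed

lemma \<Psi>_bij: "bij_betw \<Psi> (carrier PQ) {z \<in> AA. e * z = z \<and> z * e = z}"
  unfolding bij_betw_def
proof (intro conjI \<Psi>_inj equalityI subsetI)
  have fin: "finite (verts QG)" using finite_X by (simp add: QG_simps)
  interpret PQ: ring PQ by (rule QG.ring_path_algebra[OF fin])
  fix z assume "z \<in> Img"
  then obtain f where f: "f \<in> carrier PQ" "z = \<Psi> f" by blast
  have "e * z = z" using \<Psi>_mult[OF PQ.one_closed f(1)] PQ.l_one[OF f(1)] unfolding f(2) \<Psi>_one by simp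
  moreover have "z * e = z" using \<Psi>_mult[OF f(1) PQ.one_closed] PQ.r_one[OF f(1)] unfolding f(2) \<Psi>_one by simp
  ultimately show "z \<in> {z \<in> AA. e * z = z \<and> z * e = z}" using \<Psi>_AA[OF f(1)] f(2) by simp
next
  fix z assume "z \<in> {z \<in> AA. e * z = z \<and> z * e = z}"
  then have z: "z \<in> AA" "e * z = z" "z * e = z" by auto
  have g1: "\<gamma> \<one> \<in> A0" by (rule \<gamma>_A0) simp
  have "e * z * e = (\<Sum>y\<in>X. \<Sum>x\<in>X. \<epsilon> y * z * \<epsilon> x)"
    unfolding e_def sum_distrib_right sum_distrib_left by (rule sum.swap)
  also have "\<dots> \<in> Img"
  proof (intro vs.subspace_sum[OF Img_subspace])
    fix x y assume xy: "y \<in> X" "x \<in> X"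
    have "\<epsilon> y * \<gamma> \<one> * z * \<gamma> \<one> * \<epsilon> x = \<epsilon> y * z * \<epsilon> x"
      using \<gamma>1_AA(2)[OF A0_AA[OF \<epsilon>_A0[OF xy(1)]]] \<gamma>1_AA(2)[OF z(1)] by (simp add: mult.assoc)
    then show "\<epsilon> y * z * \<epsilon> x \<in> Img" using corner_Img[OF z(1) xy(2,1) g1 g1] by simp
  qed
  finally show "z \<in> Img" unfolding z(2,3) .
qed

end

section \<open>The equivalence\<close>

text \<open>Over a finite field the product of all X - a vanishes everywhere; adding 1 gives a
  nonconstant polynomial without roots.\<close>

lemma infinite_alg_closed: "infinite (UNIV :: 'k::alg_closed_field set)"
proof
  assume fin: "finite (UNIV :: 'k set)"
  let ?q = "\<Prod>a\<in>UNIV. [:- a, 1 :: 'k:]"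
  have "degree ?q = (\<Sum>a\<in>(UNIV :: 'k set). degree [:- a, 1 :: 'k:])" by (rule degree_prod_eq_sum_degree) simp
  also have "\<dots> = card (UNIV :: 'k set)" by simp
  finally have "degree ?q > 0" using fin by (simp add: finite_UNIV_card_ge_0)
  then have "degree (?q + 1) > 0" by (simp add: degree_add_eq_left)
  then obtain z where "poly (?q + 1) z = 0" using alg_closed_imp_poly_has_root by blast
  moreover have "poly ?q z = 0" using fin by (auto simp: poly_prod intro!: prod_zero bexI[of _ z])
  ultimately show False by simp
qed

text \<open>In a finite module, infinitely many scalars cannot all act differently on a given v. If
  c v = d v with c and d distinct, then c - d is invertible and kills v.\<close>

lemma (in wf_digraph) finite_path_module_trivial:
  fixes N :: "(('a, 'b) path \<Rightarrow> 'k::alg_closed_field, 'm) module"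
  assumes fin: "finite (verts G)" and N: "left_module (path_algebra G) N" and finN: "finite (carrier N)"
  shows "carrier N = {\<zero>\<^bsub>N\<^esub>}"
proof -
  let ?P = "path_algebra G :: ('k, ('a, 'b) path \<Rightarrow> 'k) module"
  interpret N: left_module ?P N by (rule N)
  let ?s = "\<lambda>c x. c * \<one>\<^bsub>?P\<^esub> x"
  have s: "?s c \<in> carrier ?P" for c by (rule path_algebra_closed(3)[OF N.R.one_closed])
  have s_mult: "?s c \<otimes>\<^bsub>?P\<^esub> ?s d = ?s (c * d)" for c d
    unfolding path_algebra_mult_linear N.R.l_one[OF N.R.one_closed] by (simp add: mult.assoc)
  have "v = \<zero>\<^bsub>N\<^esub>" if v: "v \<in> carrier N" for v
  proof -
    have "\<not> inj (\<lambda>c. ?s c \<odot>\<^bsub>N\<^esub> v)"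
    proof
      assume inj: "inj (\<lambda>c. ?s c \<odot>\<^bsub>N\<^esub> v)"
      have "range (\<lambda>c. ?s c \<odot>\<^bsub>N\<^esub> v) \<subseteq> carrier N" using N.smult_closed[OF s v] by blast
      then have "finite (range (\<lambda>c. ?s c \<odot>\<^bsub>N\<^esub> v))" by (rule finite_subset[OF _ finN])
      then show False using finite_imageD[OF _ inj] infinite_alg_closed by blast
    qed
    then obtain c d where cd: "?s c \<odot>\<^bsub>N\<^esub> v = ?s d \<odot>\<^bsub>N\<^esub> v" "c \<noteq> d" unfolding inj_def by blast
    note vc = N.smult_closed[OF s v]
    have "?s c = ?s (c - d) \<oplus>\<^bsub>?P\<^esub> ?s d" by (auto simp: fun_eq_iff algebra_simps)
    then have "?s c \<odot>\<^bsub>N\<^esub> v = ?s (c - d) \<odot>\<^bsub>N\<^esub> v \<oplus>\<^bsub>N\<^esub> ?s d \<odot>\<^bsub>N\<^esub> v"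
      using N.smult_l_distr[OF s s v, of "c - d" d] by simp
    then have "?s (c - d) \<odot>\<^bsub>N\<^esub> v \<oplus>\<^bsub>N\<^esub> ?s d \<odot>\<^bsub>N\<^esub> v = \<zero>\<^bsub>N\<^esub> \<oplus>\<^bsub>N\<^esub> ?s d \<odot>\<^bsub>N\<^esub> v"
      unfolding cd(1) N.M.l_zero[OF vc] by (rule sym)
    then have 0: "?s (c - d) \<odot>\<^bsub>N\<^esub> v = \<zero>\<^bsub>N\<^esub>" using N.M.add.right_cancel[OF vc vc N.M.zero_closed] by blast
    let ?i = "inverse (c - d)"
    have "?s ?i \<odot>\<^bsub>N\<^esub> \<zero>\<^bsub>N\<^esub> \<oplus>\<^bsub>N\<^esub> ?s ?i \<odot>\<^bsub>N\<^esub> \<zero>\<^bsub>N\<^esub> = \<zero>\<^bsub>N\<^esub> \<oplus>\<^bsub>N\<^esub> ?s ?i \<odot>\<^bsub>N\<^esub> \<zero>\<^bsub>N\<^esub>"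
      using N.smult_r_distr[OF s N.M.zero_closed N.M.zero_closed, of ?i] N.smult_closed[OF s N.M.zero_closed, of ?i] by simp
    then have i0: "?s ?i \<odot>\<^bsub>N\<^esub> \<zero>\<^bsub>N\<^esub> = \<zero>\<^bsub>N\<^esub>"
      using N.M.add.right_cancel[OF N.smult_closed[OF s N.M.zero_closed] N.smult_closed[OF s N.M.zero_closed] N.M.zero_closed] by blast
    have "?s 1 = \<one>\<^bsub>?P\<^esub>" by simp
    then have "v = ?s (?i * (c - d)) \<odot>\<^bsub>N\<^esub> v" using N.smult_one[OF v] cd(2) by simp
    also have "\<dots> = ?s ?i \<odot>\<^bsub>N\<^esub> (?s (c - d) \<odot>\<^bsub>N\<^esub> v)"
      unfolding s_mult[symmetric] by (rule N.smult_assoc[OF s s v])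
    also have "\<dots> = \<zero>\<^bsub>N\<^esub>" unfolding 0 i0 ..
    finally show ?thesis .
  qed
  then show ?thesis using N.M.zero_closed by blast
qed

context assoc_quiver_model
begin

definition unembed :: "'a \<Rightarrow> 'g \<Rightarrow> ('v, 'e) path \<Rightarrow> 'k" where "unembed = inv_into (carrier SA) embed"

lemma unembed: assumes "z \<in> AA" shows "unembed z \<in> carrier SA" "embed (unembed z) = z"
  using assms unfolding unembed_def AA_eq_embed by (rule inv_into_into, rule f_inv_into_f)

lemma SA_eqI: "\<lbrakk>a \<in> carrier SA; b \<in> carrier SA; embed a = embed b\<rbrakk> \<Longrightarrow> a = b"
  by (rule inj_onD[OF embed_inj])

lemma equivalence:
  "equivalent_categories (module_category PQ :: (_, 'm \<Rightarrow> 'm) category) (module_category SA :: (_, 'm \<Rightarrow> 'm) category)"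
proof -
  have fin: "finite (verts QG)" using finite_X by (simp only: QG_simps)
  interpret A: ring SA by (rule ring_SA)
  interpret B: ring PQ by (rule QG.ring_path_algebra[OF fin])
  note Am = A.m_closed and Aa = A.add.m_closed
  obtain n x z w where full: "\<forall>t<(n::nat). x t \<in> X \<and> z t \<in> A0 \<and> w t \<in> A0" "\<gamma> \<one> = (\<Sum>t<n. z t * \<epsilon> (x t) * w t)"
    using full_sum by blast
  have x: "x t \<in> X" and zA: "z t \<in> A0" and wA: "w t \<in> A0" if "t < n" for t using full that by auto
  \<comment> \<open>The terms z \<epsilon> w of the unit are split at the idempotent \<epsilon>,
    which is absorbed by e on both sides; z \<epsilon> and \<epsilon> w witness that e is
    full.\<close>
  let ?p = "\<lambda>t. unembed (z t * \<epsilon> (x t))" and ?q = "\<lambda>t. unembed (\<epsilon> (x t) * w t)"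
  have eAA: "e \<in> AA" by (rule A0_AA[OF e_A0])
  note e = unembed[OF eAA]
  have \<epsilon>e: "\<epsilon> y * e = \<epsilon> y" "e * \<epsilon> y = \<epsilon> y" if y: "y \<in> X" for y
  proof -
    have "\<epsilon> y * e = (\<Sum>x\<in>X. if x = y then \<epsilon> y else 0)"
      unfolding e_def sum_distrib_left by (intro sum.cong refl) (simp only: \<epsilon>_\<epsilon>[OF _ y] cong: if_cong)
    then show "\<epsilon> y * e = \<epsilon> y" using finite_X y by (simp only: sum.delta if_True)
    have "e * \<epsilon> y = (\<Sum>x\<in>X. if x = y then \<epsilon> y else 0)"
      unfolding e_def sum_distrib_right
    proof (intro sum.cong refl)
      fix x assume "x \<in> X"
      from \<epsilon>_\<epsilon>[OF y this] show "\<epsilon> x * \<epsilon> y = (if x = y then \<epsilon> y else 0)" unfolding eq_commute[of x y] .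
    qed
    then show "e * \<epsilon> y = \<epsilon> y" using finite_X y by (simp only: sum.delta if_True)
  qed
  have "e * e = e * (\<Sum>x\<in>X. \<epsilon> x)" by (rule arg_cong[OF e_def])
  also have "\<dots> = (\<Sum>x\<in>X. \<epsilon> x)" unfolding sum_distrib_left by (intro sum.cong refl \<epsilon>e(2))
  also have "\<dots> = e" by (rule e_def[symmetric])
  finally have ee: "e * e = e" .
  have p: "?p t \<in> carrier SA" "embed (?p t) = z t * \<epsilon> (x t)" and q: "?q t \<in> carrier SA" "embed (?q t) = \<epsilon> (x t) * w t"
    if t: "t < n" for t
    by (rule unembed[OF A0_AA[OF A0_mult[OF zA[OF t] \<epsilon>_A0[OF x[OF t]]]]]
      unembed[OF A0_AA[OF A0_mult[OF \<epsilon>_A0[OF x[OF t]] wA[OF t]]]])+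
  have \<Psi>u: "unembed (\<Psi> b) \<in> carrier SA" "embed (unembed (\<Psi> b)) = \<Psi> b" if "b \<in> carrier PQ" for b
    by (rule unembed[OF \<Psi>_AA[OF that]])+
  interpret full_idempotent SA PQ "unembed e" "\<lambda>b. unembed (\<Psi> b)" n ?p ?q
  proof
    show "unembed e \<in> carrier SA" by (rule e(1))
    show "unembed e \<otimes>\<^bsub>SA\<^esub> unembed e = unembed e"
    proof (rule SA_eqI[OF Am[OF e(1) e(1)] e(1)])
      show "embed (unembed e \<otimes>\<^bsub>SA\<^esub> unembed e) = embed (unembed e)"
        unfolding embed_mult[OF e(1) e(1)] e(2) by (rule ee)
    qed
    show "bij_betw (\<lambda>b. unembed (\<Psi> b)) (carrier PQ)
      {a \<in> carrier SA. unembed e \<otimes>\<^bsub>SA\<^esub> a = a \<and> a \<otimes>\<^bsub>SA\<^esub> unembed e = a}"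
      unfolding bij_betw_def
    proof (intro conjI inj_onI equalityI subsetI)
      fix b c assume b: "b \<in> carrier PQ" and c: "c \<in> carrier PQ" and eq: "unembed (\<Psi> b) = unembed (\<Psi> c)"
      have "\<Psi> b = embed (unembed (\<Psi> b))" by (rule \<Psi>u(2)[OF b, symmetric])
      also have "\<dots> = \<Psi> c" unfolding eq by (rule \<Psi>u(2)[OF c])
      finally have "\<Psi> b = \<Psi> c" .
      then show "b = c" by (rule inj_onD[OF \<Psi>_inj _ b c])
    next
      fix a assume "a \<in> (\<lambda>b. unembed (\<Psi> b)) ` carrier PQ"
      then obtain b where b: "b \<in> carrier PQ" "a = unembed (\<Psi> b)" by blast
      note a = \<Psi>u[OF b(1), folded b(2)]
      have "\<Psi> b \<in> {z \<in> AA. e * z = z \<and> z * e = z}" using bij_betwE[OF \<Psi>_bij] b(1) by (rule bspec)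
      then have eb: "e * \<Psi> b = \<Psi> b" "\<Psi> b * e = \<Psi> b" by simp_all
      have "unembed e \<otimes>\<^bsub>SA\<^esub> a = a"
      proof (rule SA_eqI[OF Am[OF e(1) a(1)] a(1)])
        show "embed (unembed e \<otimes>\<^bsub>SA\<^esub> a) = embed a" unfolding embed_mult[OF e(1) a(1)] e(2) a(2) by (rule eb)
      qed
      moreover have "a \<otimes>\<^bsub>SA\<^esub> unembed e = a"
      proof (rule SA_eqI[OF Am[OF a(1) e(1)] a(1)])
        show "embed (a \<otimes>\<^bsub>SA\<^esub> unembed e) = embed a" unfolding embed_mult[OF a(1) e(1)] e(2) a(2) by (rule eb)
      qed
      ultimately show "a \<in> {a \<in> carrier SA. unembed e \<otimes>\<^bsub>SA\<^esub> a = a \<and> a \<otimes>\<^bsub>SA\<^esub> unembed e = a}" using a(1) by blast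
    next
      fix a assume "a \<in> {a \<in> carrier SA. unembed e \<otimes>\<^bsub>SA\<^esub> a = a \<and> a \<otimes>\<^bsub>SA\<^esub> unembed e = a}"
      then have a: "a \<in> carrier SA" "unembed e \<otimes>\<^bsub>SA\<^esub> a = a" "a \<otimes>\<^bsub>SA\<^esub> unembed e = a" by blast+
      have "e * embed a = embed a" using embed_mult[OF e(1) a(1)] unfolding a(2) e(2) by (rule sym)
      moreover have "embed a * e = embed a" using embed_mult[OF a(1) e(1)] unfolding a(3) e(2) by (rule sym)
      moreover have "embed a \<in> AA" unfolding AA_eq_embed using a(1) by (rule imageI)
      ultimately have "embed a \<in> {z \<in> AA. e * z = z \<and> z * e = z}" by simp
      then have "embed a \<in> \<Psi> ` carrier PQ" unfolding bij_betw_imp_surj_on[OF \<Psi>_bij] .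
      then obtain b where b: "embed a = \<Psi> b" "b \<in> carrier PQ" by (rule imageE)
      have "a = unembed (\<Psi> b)"
      proof (rule SA_eqI[OF a(1) \<Psi>u(1)[OF b(2)]])
        show "embed a = embed (unembed (\<Psi> b))" unfolding \<Psi>u(2)[OF b(2)] by (rule b(1))
      qed
      then show "a \<in> (\<lambda>b. unembed (\<Psi> b)) ` carrier PQ" using b(2) by (rule image_eqI)
    qed
    show "unembed (\<Psi> (b \<oplus>\<^bsub>PQ\<^esub> c)) = unembed (\<Psi> b) \<oplus>\<^bsub>SA\<^esub> unembed (\<Psi> c)"
      if b: "b \<in> carrier PQ" and c: "c \<in> carrier PQ" for b c
    proof (rule SA_eqI[OF \<Psi>u(1)[OF B.add.m_closed[OF b c]] Aa[OF \<Psi>u(1)[OF b] \<Psi>u(1)[OF c]]])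
      show "embed (unembed (\<Psi> (b \<oplus>\<^bsub>PQ\<^esub> c))) = embed (unembed (\<Psi> b) \<oplus>\<^bsub>SA\<^esub> unembed (\<Psi> c))"
        unfolding embed_add[OF \<Psi>u(1)[OF b] \<Psi>u(1)[OF c]] \<Psi>u(2)[OF b] \<Psi>u(2)[OF c] \<Psi>u(2)[OF B.add.m_closed[OF b c]]
        unfolding path_algebra_simps by (rule \<Psi>_add[OF b c])
    qed
    show "unembed (\<Psi> (b \<otimes>\<^bsub>PQ\<^esub> c)) = unembed (\<Psi> b) \<otimes>\<^bsub>SA\<^esub> unembed (\<Psi> c)"
      if b: "b \<in> carrier PQ" and c: "c \<in> carrier PQ" for b c
    proof (rule SA_eqI[OF \<Psi>u(1)[OF B.m_closed[OF b c]] Am[OF \<Psi>u(1)[OF b] \<Psi>u(1)[OF c]]])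
      show "embed (unembed (\<Psi> (b \<otimes>\<^bsub>PQ\<^esub> c))) = embed (unembed (\<Psi> b) \<otimes>\<^bsub>SA\<^esub> unembed (\<Psi> c))"
        unfolding embed_mult[OF \<Psi>u(1)[OF b] \<Psi>u(1)[OF c]] \<Psi>u(2)[OF b] \<Psi>u(2)[OF c] \<Psi>u(2)[OF B.m_closed[OF b c]]
        by (rule \<Psi>_mult[OF b c])
    qed
    show "unembed (\<Psi> \<one>\<^bsub>PQ\<^esub>) = unembed e" unfolding \<Psi>_one ..
    show "?p \<in> {..<n} \<rightarrow> carrier SA" by (rule funcsetI, rule p(1), rule lessThan_iff[THEN iffD1])
    show "?q \<in> {..<n} \<rightarrow> carrier SA" by (rule funcsetI, rule q(1), rule lessThan_iff[THEN iffD1])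
    show "?p t \<otimes>\<^bsub>SA\<^esub> unembed e = ?p t" if t: "t < n" for t
    proof (rule SA_eqI[OF Am[OF p(1)[OF t] e(1)] p(1)[OF t]])
      show "embed (?p t \<otimes>\<^bsub>SA\<^esub> unembed e) = embed (?p t)"
        unfolding embed_mult[OF p(1)[OF t] e(1)] p(2)[OF t] e(2) by (simp only: mult.assoc \<epsilon>e(1)[OF x[OF t]])
    qed
    show "unembed e \<otimes>\<^bsub>SA\<^esub> ?q t = ?q t" if t: "t < n" for t
    proof (rule SA_eqI[OF Am[OF e(1) q(1)[OF t]] q(1)[OF t]])
      show "embed (unembed e \<otimes>\<^bsub>SA\<^esub> ?q t) = embed (?q t)"
        unfolding embed_mult[OF e(1) q(1)[OF t]] q(2)[OF t] e(2) by (simp only: mult.assoc[symmetric] \<epsilon>e(2)[OF x[OF t]])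
    qed
    \<comment> \<open>Sums in the record are compared with sums in \<open>'a\<close> over initial
      segments. Membership is proved along with it, because \<open>embed\<close> is additive only on
      the carrier.\<close>
    have emb: "embed (finsum SA (\<lambda>t. ?p t \<otimes>\<^bsub>SA\<^esub> ?q t) {..<m}) = (\<Sum>t<m. z t * \<epsilon> (x t) * w t) \<and>
        finsum SA (\<lambda>t. ?p t \<otimes>\<^bsub>SA\<^esub> ?q t) {..<m} \<in> carrier SA" if "m \<le> n" for m
      using that
    proof (induction m)
      case 0
      have "embed \<zero>\<^bsub>SA\<^esub> + embed \<zero>\<^bsub>SA\<^esub> = embed \<zero>\<^bsub>SA\<^esub> + 0"
        using embed_add[OF A.zero_closed A.zero_closed] A.r_zero[OF A.zero_closed] by (simp only: add_0_right)
      then have "embed \<zero>\<^bsub>SA\<^esub> = 0" by (rule add_left_imp_eq)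
      then show ?case unfolding lessThan_0 A.finsum_empty sum.empty by (rule conjI[OF _ A.zero_closed])
    next
      case (Suc m)
      then have m: "m < n" by simp
      let ?f = "\<lambda>t. ?p t \<otimes>\<^bsub>SA\<^esub> ?q t"
      have f: "?f \<in> {..<m} \<rightarrow> carrier SA"
      proof (rule funcsetI)
        fix t assume "t \<in> {..<m}"
        then have "t < n" using m by simp
        then show "?f t \<in> carrier SA" by (intro Am p(1) q(1))
      qed
      have fm: "?f m \<in> carrier SA" by (rule Am[OF p(1)[OF m] q(1)[OF m]])
      note IH = Suc.IH[OF less_imp_le[OF m]]
      have "embed (?f m) = z m * (\<epsilon> (x m) * \<epsilon> (x m)) * w m"
        unfolding embed_mult[OF p(1)[OF m] q(1)[OF m]] p(2)[OF m] q(2)[OF m] by (simp only: mult.assoc)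
      then have fm': "embed (?f m) = z m * \<epsilon> (x m) * w m" unfolding \<epsilon>_idem[OF x[OF m]] .
      have ins: "finsum SA ?f {..<Suc m} = ?f m \<oplus>\<^bsub>SA\<^esub> finsum SA ?f {..<m}"
        unfolding lessThan_Suc by (rule A.finsum_insert[OF finite_lessThan _ f fm]) simp
      show ?case
        unfolding ins embed_add[OF fm conjunct2[OF IH]] fm' conjunct1[OF IH] sum.lessThan_Suc
        by (rule conjI[OF add.commute Aa[OF fm conjunct2[OF IH]]])
    qed
    show "finsum SA (\<lambda>t. ?p t \<otimes>\<^bsub>SA\<^esub> ?q t) {..<n} = \<one>\<^bsub>SA\<^esub>"
    proof (rule SA_eqI[OF _ A.one_closed])
      show "finsum SA (\<lambda>t. ?p t \<otimes>\<^bsub>SA\<^esub> ?q t) {..<n} \<in> carrier SA" by (rule conjunct2[OF emb[OF le_refl]])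
      show "embed (finsum SA (\<lambda>t. ?p t \<otimes>\<^bsub>SA\<^esub> ?q t) {..<n}) = embed \<one>\<^bsub>SA\<^esub>"
        unfolding embed_one full(2) by (rule conjunct1[OF emb[OF le_refl]])
    qed
  qed
  show ?thesis
  proof (rule morita_equivalence)
    fix N :: "(_ \<Rightarrow> 'k, 'm) module"
    assume "left_module PQ N" "finite (carrier N)"
    then show "carrier N = {\<zero>\<^bsub>N\<^esub>}" by (rule QG.finite_path_module_trivial[OF fin])
  qed
qed

end

theorem theorem1:
  fixes G :: "('g, 'n) monoid_scheme"
    and Q :: "('v, 'e) pre_digraph"
    and \<phi> :: "'g \<Rightarrow> (('v, 'e) path \<Rightarrow> 'k::alg_closed_field) \<Rightarrow> ('v, 'e) path \<Rightarrow> 'k"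
    and R :: "'v set"
    and \<kappa> :: "'v \<Rightarrow> 'g"
    and F :: "'v \<Rightarrow> 'v \<Rightarrow> ('v \<times> 'v) set"
    and irr :: "'g set \<Rightarrow> ('g, 'k, 'r) rep set"
    and bas :: "'v \<times> ('g, 'k, 'r) rep \<Rightarrow> 'v \<times> ('g, 'k, 'r) rep
                \<Rightarrow> ('v \<times> 'v \<Rightarrow> 'r \<Rightarrow> ('v, 'e) path \<Rightarrow> 'r) set"
  assumes "group G" and "finite (carrier G)" and "\<not> CHAR('k) dvd Coset.order G"
    and "wf_digraph Q" and "finite (verts Q)"
    and "right_algebra_action G (path_algebra Q) \<phi>"
    and "\<And>g. g \<in> carrier G \<Longrightarrow> \<phi> g ` vertex_idem ` verts Q = vertex_idem ` verts Q"
    and "\<And>g. g \<in> carrier G \<Longrightarrow> \<phi> g ` arrow_span Q (arcs Q) \<subseteq> arrow_span Q (arcs Q)"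
    and "assoc_quiver_choices G Q \<phi> R \<kappa> F irr bas"
  shows "equivalent_categories
    (module_category (path_algebra (assoc_quiver (assoc_verts G \<phi> R irr) bas)
        :: ('k, ('v \<times> ('g, 'k, 'r) rep, _) path \<Rightarrow> 'k) module)
      :: (_, 'm \<Rightarrow> 'm) category)
    (module_category (skew_group_algebra G (path_algebra Q) \<phi>) :: (_, 'm \<Rightarrow> 'm) category)"
proof -
  obtain \<iota> \<gamma> where m: "skew_model (lscale :: 'k \<Rightarrow> ('g \<times> ('v, 'e) path, 'k) linend) G Q \<phi> \<iota> \<gamma>"
    using skew_model_exists[OF assms(6,4,2,5)] by blast
  have "of_nat (card (carrier G)) \<noteq> (0 :: 'k)"
    using assms(3) unfolding of_nat_eq_0_iff_char_dvd Coset.order_def .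
  then have "equivariant_quiver lscale G Q \<phi> \<iota> \<gamma>"
    using m assms(7,8) by (intro equivariant_quiver.intro equivariant_quiver_axioms.intro)
  then have "assoc_quiver_model lscale G Q \<phi> \<iota> \<gamma> R \<kappa> F irr bas"
    using assms(9) by (intro assoc_quiver_model.intro assoc_quiver_model_axioms.intro)
  then show ?thesis by (rule assoc_quiver_model.equivalence)
qed


end
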